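(* Let $\Omega=(-1,1)\times(-1,1)$, $T>0$, $\mathscr{D}=\Omega\times(0,T)$, and $\rho_0(x)=+1$ for $x_2>0$, $\rho_0(x)=-1$ for $x_2<0$. Let $(\overline\rho,\overline v,\overline m)$ be an admissible subsolution with mixing zone $\mathscr{U}\subset\mathscr{D}$, and let $X$ be the associated complete metric space of triples $(\rho,v,m)$ (all as defined in the context). Then there exists a residual subset of $X$ such that, for every element $(\rho,v,m)$ of this subset, the pair $(\rho,v)$ is a weak solution of the incompressible porous media equation in $\Omega\times(0,T)$ with initial condition $\rho_0$ and satisfies $|\rho(x,t)|=1$ for a.e. $(x,t)\in\Omega\times(0,T)$.
   Context: Notation: $\nabla^\perp=(-\partial_2,\partial_1)$, and $(0,s)$ denotes the vector in $\mathbb{R}^2$ with components $0$ and $s$. Weak solution: a pair $(\rho,v)$ with $\rho\in L^\infty(\Omega\times(0,T))$, $v\in L^\infty(0,T;L^2(\Omega))$ is a weak solution of the incompressible porous media equation ($\partial_t\rho+\operatorname{div}(\rho v)=0$, $\operatorname{div}v=0$, $v+\nabla p=-(0,\rho)$, with $v\cdot\nu=0$ on $\partial\Omega$) with initial condition $\rho_0\in L^\infty(\Omega)$ if for all $\phi\in C_c^\infty(\mathbb{R}^2\times(-\infty,T))$ $$\int_0^T\!\!\int_\Omega\rho(\partial_t\phi+v\cdot\nabla\phi)\,dx\,dt+\int_\Omega\rho_0(x)\phi(x,0)\,dx=0,\qquad \int_0^T\!\!\int_\Omega v\cdot\nabla\phi\,dx\,dt=0,$$ and, for a.e. $t\in(0,T)$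 and all $\psi\in C_c^\infty(\Omega)$, $\int_\Omega(v+(0,\rho))\cdot\nabla^\perp\psi\,dx=0$. Admissible subsolution: a triple $(\rho,v,m)\in L^\infty(\mathscr{D};\mathbb{R}\times\mathbb{R}^2\times\mathbb{R}^2)$ such that (i) for all $\phi\in C_c^\infty(\overline\Omega\times[0,T))$: $\int_0^T\!\int_\Omega(\rho\,\partial_t\phi+m\cdot\nabla\phi)\,dx\,dt+\int_\Omega\phi(x,0)\rho_0(x)\,dx=0$; (ii) for a.e. $t\in(0,T)$: $\int_\Omega v\cdot\nabla\psi\,dx=0$ for all $\psi\in C^\infty(\overline\Omega)$; (iii) for a.e. $t\in(0,T)$: $\int_\Omega(v+(0,\rho))\cdot\nabla^\perp\psi\,dx=0$ for all $\psi\in C_c^\infty(\Omega)$; (iv) $|m-\rho v+\tfrac12(0,1-\rho^2)|\le\tfrac12(1-\rho^2)$ a.e. in $\mathscr{D}$; and there exists an open subset $\mathscr{U}\subset\mathscr{D}$ (called the mixing zone) such that (v) $|\rho|=1$ a.e. in $\mathscr{D}\setminus\mathscr{U}$; (vi) $(\rho,v,m)$ is continuous in $\mathscr{U}$; (vii) $|m-\rho v+\tfrac12(0,1-\rho^2)|<\tfrac12(1-\rho^2)$ in $\mathscr{U}$. The space $X$: given an admissible subsolution $(\overline\rho,\overline v,\overline m)$ with mixing zone $\mathscr{U}$, let $X_0$ be the set of all $(\rho,v,m)\in L^\infty(\mathscr{D})$ satisfying (i)-(iii), with $(\rho,v,m)=(\overline\rho,\overline v,\overline m)$ a.e. in $\mathscr{D}\setminus\mathscr{U}$,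 and satisfying (vi)-(vii) in $\mathscr{U}$. The set $X_0$ is bounded in $L^2(\mathscr{D})$, so the weak $L^2(\mathscr{D})$ topology is metrizable on bounded sets containing it; $X$ is the closure of $X_0$ with respect to weak $L^2(\mathscr{D})$ convergence, equipped with such a metric (a complete metric space). A subset of $X$ is residual if it contains a countable intersection of dense open sets. *)

theory Defs
  imports "HOL-Analysis.Analysis"
begin

subsection \<open>Test functions and differential operators\<close>

primrec C_k :: "nat \<Rightarrow> ('a::euclidean_space \<Rightarrow> real) \<Rightarrow> bool" where
  "C_k 0 f \<longleftrightarrow> continuous_on UNIV f"
| "C_k (Suc n) f \<longleftrightarrow>
     (\<forall>x. f differentiable (at x)) \<and> (\<forall>h. C_k n (\<lambda>x. frechet_derivative f (at x) h))"

definition smooth :: "('a::euclidean_space \<Rightarrow> real) \<Rightarrow> bool" where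
  "smooth f \<longleftrightarrow> (\<forall>k. C_k k f)"

text \<open>\<open>C\<^sub>c\<^sup>\<infinity>(G)\<close> for open \<open>G\<close>; functions are extended by zero to the whole space.\<close>

definition test_functions :: "'a::euclidean_space set \<Rightarrow> ('a \<Rightarrow> real) set" where
  "test_functions G =
     {\<phi>. smooth \<phi> \<and> compact (closure {z. \<phi> z \<noteq> 0}) \<and> closure {z. \<phi> z \<noteq> 0} \<subseteq> G}"

text \<open>\<open>C\<^sub>c\<^sup>\<infinity>(K)\<close> for \<open>K\<close> not open, such as \<open>closure \<Omega> \<times> [0,T)\<close>: functions on \<open>K\<close> whose
  support relative to \<open>K\<close> is a compact subset of \<open>K\<close>, so they need not vanish on the part of
  the boundary that belongs to \<open>K\<close>. Smoothness up to the boundary means being the restriction of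
  a smooth function on the whole space; such an extension represents the function, and its values
  outside \<open>K\<close> are irrelevant. In particular \<open>C\<^sup>\<infinity>(closure \<Omega>)\<close> is represented by \<open>smooth\<close>.\<close>

definition test_functions_rel :: "'a::euclidean_space set \<Rightarrow> ('a \<Rightarrow> real) set" where
  "test_functions_rel K =
     {\<phi>. smooth \<phi> \<and> compact (closure {z\<in>K. \<phi> z \<noteq> 0}) \<and> closure {z\<in>K. \<phi> z \<noteq> 0} \<subseteq> K}"

definition gradient :: "(real^2 \<Rightarrow> real) \<Rightarrow> real^2 \<Rightarrow> real^2" where
  "gradient \<psi> x = (\<chi> i. frechet_derivative \<psi> (at x) (axis i 1))"

definition perp_gradient :: "(real^2 \<Rightarrow> real) \<Rightarrow> real^2 \<Rightarrow> real^2" where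
  "perp_gradient \<psi> x = vector [- (gradient \<psi> x $ 2), gradient \<psi> x $ 1]"

text \<open>Space-time points are pairs \<open>(x, t)\<close>.\<close>

definition time_deriv :: "((real^2) \<times> real \<Rightarrow> real) \<Rightarrow> (real^2) \<times> real \<Rightarrow> real" where
  "time_deriv \<phi> z = deriv (\<lambda>s. \<phi> (fst z, s)) (snd z)"

definition space_gradient :: "((real^2) \<times> real \<Rightarrow> real) \<Rightarrow> (real^2) \<times> real \<Rightarrow> real^2" where
  "space_gradient \<phi> z = gradient (\<lambda>x. \<phi> (x, snd z)) (fst z)"

subsection \<open>Lebesgue spaces\<close>

text \<open>Representatives of elements of \<open>L\<^sup>\<infinity>(S)\<close> and \<open>L\<^sup>2(S)\<close>; values outside \<open>S\<close> are irrelevant.\<close>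

definition ess_bounded :: "'a::euclidean_space set \<Rightarrow> ('a \<Rightarrow> 'b::euclidean_space) \<Rightarrow> bool" where
  "ess_bounded S f \<longleftrightarrow> f \<in> borel_measurable (lebesgue_on S) \<and>
     (\<exists>C. AE z in lebesgue_on S. norm (f z) \<le> C)"

definition square_integrable :: "'a::euclidean_space set \<Rightarrow> ('a \<Rightarrow> 'b::euclidean_space) \<Rightarrow> bool" where
  "square_integrable S f \<longleftrightarrow> f \<in> borel_measurable (lebesgue_on S) \<and>
     integrable (lebesgue_on S) (\<lambda>z. (norm (f z))\<^sup>2)"

text \<open>\<open>L\<^sup>\<infinity>(0,T; L\<^sup>2(\<Omega>))\<close>\<close>

definition Linf_L2 :: "(real^2) set \<Rightarrow> real \<Rightarrow> ((real^2) \<times> real \<Rightarrow> real^2) \<Rightarrow> bool" where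
  "Linf_L2 \<Omega> T v \<longleftrightarrow> v \<in> borel_measurable (lebesgue_on (\<Omega> \<times> {0<..<T})) \<and>
     (\<exists>C. AE t in lebesgue_on {0<..<T}. square_integrable \<Omega> (\<lambda>x. v (x, t)) \<and>
        (LINT x|lebesgue_on \<Omega>. (norm (v (x, t)))\<^sup>2) \<le> C)"

definition L2_eq :: "'a::euclidean_space set \<Rightarrow> (('a \<Rightarrow> 'b::euclidean_space) \<times> ('a \<Rightarrow> 'b)) set" where
  "L2_eq S = {(f, g). square_integrable S f \<and> square_integrable S g \<and>
     (AE z in lebesgue_on S. f z = g z)}"

definition L2_class :: "'a::euclidean_space set \<Rightarrow> ('a \<Rightarrow> 'b::euclidean_space) \<Rightarrow> ('a \<Rightarrow> 'b) set" where
  "L2_class S f = L2_eq S `` {f}"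

text \<open>The weak topology on \<open>L\<^sup>2(S)\<close> (the set of classes of square integrable functions): the
  coarsest topology for which \<open>f \<mapsto> \<integral>\<^sub>S f \<bullet> g\<close> is continuous for every \<open>g \<in> L\<^sup>2(S)\<close>.\<close>

definition weak_L2 :: "'a::euclidean_space set \<Rightarrow> ('a \<Rightarrow> 'b::euclidean_space) set topology" where
  "weak_L2 S = topology_generated_by
     {L2_class S ` {f. square_integrable S f \<and> (LINT z|lebesgue_on S. f z \<bullet> g z) \<in> W} | g W.
        square_integrable S g \<and> open W}"

definition residual_in :: "'a topology \<Rightarrow> 'a set \<Rightarrow> bool" where
  "residual_in X R \<longleftrightarrow> R \<subseteq> topspace X \<and>
     (\<exists>\<G>. countable \<G> \<and> (\<forall>G\<in>\<G>. openin X G \<and> X closure_of G = topspace X) \<and>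
        topspace X \<inter> \<Inter>\<G> \<subseteq> R)"

subsection \<open>Weak solutions and admissible subsolutions\<close>

definition weak_solution ::
  "(real^2) set \<Rightarrow> real \<Rightarrow> (real^2 \<Rightarrow> real) \<Rightarrow>
   ((real^2) \<times> real \<Rightarrow> real) \<Rightarrow> ((real^2) \<times> real \<Rightarrow> real^2) \<Rightarrow> bool" where
  "weak_solution \<Omega> T \<rho>\<^sub>0 \<rho> v \<longleftrightarrow>
     ess_bounded (\<Omega> \<times> {0<..<T}) \<rho> \<and> Linf_L2 \<Omega> T v \<and>
     (\<forall>\<phi>\<in>test_functions (UNIV \<times> {..<T}).
        (LINT z|lebesgue_on (\<Omega> \<times> {0<..<T}).
           \<rho> z * (time_deriv \<phi> z + v z \<bullet> space_gradient \<phi> z))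
        + (LINT x|lebesgue_on \<Omega>. \<rho>\<^sub>0 x * \<phi> (x, 0)) = 0 \<and>
        (LINT z|lebesgue_on (\<Omega> \<times> {0<..<T}). v z \<bullet> space_gradient \<phi> z) = 0) \<and>
     (AE t in lebesgue_on {0<..<T}. \<forall>\<psi>\<in>test_functions \<Omega>.
        (LINT x|lebesgue_on \<Omega>. (v (x, t) + vector [0, \<rho> (x, t)]) \<bullet> perp_gradient \<psi> x) = 0)"

text \<open>The linear system relating density, velocity and flux, i.e. conditions (i)--(iii) in the
  definition of a subsolution.\<close>

definition linear_system ::
  "(real^2) set \<Rightarrow> real \<Rightarrow> (real^2 \<Rightarrow> real) \<Rightarrow>
   ((real^2) \<times> real \<Rightarrow> real) \<Rightarrow> ((real^2) \<times> real \<Rightarrow> real^2) \<Rightarrow> ((real^2) \<times> real \<Rightarrow> real^2) \<Rightarrow> bool" where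
  "linear_system \<Omega> T \<rho>\<^sub>0 \<rho> v m \<longleftrightarrow>
     (\<forall>\<phi>\<in>test_functions_rel (closure \<Omega> \<times> {0..<T}).
        (LINT z|lebesgue_on (\<Omega> \<times> {0<..<T}). \<rho> z * time_deriv \<phi> z + m z \<bullet> space_gradient \<phi> z)
        + (LINT x|lebesgue_on \<Omega>. \<phi> (x, 0) * \<rho>\<^sub>0 x) = 0) \<and>
     (AE t in lebesgue_on {0<..<T}. \<forall>\<psi>. smooth \<psi> \<longrightarrow>
        (LINT x|lebesgue_on \<Omega>. v (x, t) \<bullet> gradient \<psi> x) = 0) \<and>
     (AE t in lebesgue_on {0<..<T}. \<forall>\<psi>\<in>test_functions \<Omega>.
        (LINT x|lebesgue_on \<Omega>. (v (x, t) + vector [0, \<rho> (x, t)]) \<bullet> perp_gradient \<psi> x) = 0)"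

text \<open>Left-hand side of the relaxed (convex hull) inequality
  \<open>|m - \<rho>v + (0, 1 - \<rho>\<^sup>2)/2| \<le> (1 - \<rho>\<^sup>2)/2\<close>.\<close>

definition hull_gap :: "real \<Rightarrow> real^2 \<Rightarrow> real^2 \<Rightarrow> real" where
  "hull_gap r a b = norm (b - r *\<^sub>R a + (1/2) *\<^sub>R vector [0, 1 - r\<^sup>2])"

text \<open>Continuity and the strict inequality on \<open>U\<close>, i.e. conditions (vi) and (vii).\<close>

definition strict_on ::
  "((real^2) \<times> real) set \<Rightarrow>
   ((real^2) \<times> real \<Rightarrow> real) \<Rightarrow> ((real^2) \<times> real \<Rightarrow> real^2) \<Rightarrow> ((real^2) \<times> real \<Rightarrow> real^2) \<Rightarrow> bool" where
  "strict_on U \<rho> v m \<longleftrightarrow>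
     continuous_on U (\<lambda>z. (\<rho> z, v z, m z)) \<and>
     (\<forall>z\<in>U. hull_gap (\<rho> z) (v z) (m z) < (1 - (\<rho> z)\<^sup>2) / 2)"

definition mixing_zone ::
  "(real^2) set \<Rightarrow> real \<Rightarrow>
   ((real^2) \<times> real \<Rightarrow> real) \<Rightarrow> ((real^2) \<times> real \<Rightarrow> real^2) \<Rightarrow> ((real^2) \<times> real \<Rightarrow> real^2) \<Rightarrow>
   ((real^2) \<times> real) set \<Rightarrow> bool" where
  "mixing_zone \<Omega> T \<rho> v m U \<longleftrightarrow>
     open U \<and> U \<subseteq> \<Omega> \<times> {0<..<T} \<and>
     (AE z in lebesgue_on (\<Omega> \<times> {0<..<T} - U). \<bar>\<rho> z\<bar> = 1) \<and>
     strict_on U \<rho> v m"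

definition admissible_subsolution ::
  "(real^2) set \<Rightarrow> real \<Rightarrow> (real^2 \<Rightarrow> real) \<Rightarrow>
   ((real^2) \<times> real \<Rightarrow> real) \<Rightarrow> ((real^2) \<times> real \<Rightarrow> real^2) \<Rightarrow> ((real^2) \<times> real \<Rightarrow> real^2) \<Rightarrow> bool" where
  "admissible_subsolution \<Omega> T \<rho>\<^sub>0 \<rho> v m \<longleftrightarrow>
     ess_bounded (\<Omega> \<times> {0<..<T}) (\<lambda>z. (\<rho> z, v z, m z)) \<and>
     linear_system \<Omega> T \<rho>\<^sub>0 \<rho> v m \<and>
     (AE z in lebesgue_on (\<Omega> \<times> {0<..<T}).
        hull_gap (\<rho> z) (v z) (m z) \<le> (1 - (\<rho> z)\<^sup>2) / 2) \<and>
     (\<exists>U. mixing_zone \<Omega> T \<rho> v m U)"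

subsection \<open>The space of subsolutions\<close>

text \<open>\<open>X\<^sub>0\<close> is the image in \<open>L\<^sup>2\<close> of the set of functions below: a class belongs to it iff it has a
  representative that is continuous and satisfies the strict inequality everywhere on \<open>U\<close>.\<close>

definition subsolution_space_0 ::
  "(real^2) set \<Rightarrow> real \<Rightarrow> (real^2 \<Rightarrow> real) \<Rightarrow>
   ((real^2) \<times> real \<Rightarrow> real) \<Rightarrow> ((real^2) \<times> real \<Rightarrow> real^2) \<Rightarrow> ((real^2) \<times> real \<Rightarrow> real^2) \<Rightarrow>
   ((real^2) \<times> real) set \<Rightarrow> ((real^2) \<times> real \<Rightarrow> real \<times> (real^2) \<times> (real^2)) set set" where
  "subsolution_space_0 \<Omega> T \<rho>\<^sub>0 \<rho>' v' m' U =
     {L2_class (\<Omega> \<times> {0<..<T}) (\<lambda>z. (\<rho> z, v z, m z)) | \<rho> v m.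
        ess_bounded (\<Omega> \<times> {0<..<T}) (\<lambda>z. (\<rho> z, v z, m z)) \<and>
        linear_system \<Omega> T \<rho>\<^sub>0 \<rho> v m \<and>
        (AE z in lebesgue_on (\<Omega> \<times> {0<..<T} - U). (\<rho> z, v z, m z) = (\<rho>' z, v' z, m' z)) \<and>
        strict_on U \<rho> v m}"

text \<open>The space \<open>X\<close>, as a topological space with the weak topology. Since \<open>X\<^sub>0\<close> is bounded in
  \<open>L\<^sup>2\<close>, this topology is completely metrizable; residuality depends only on the topology, so no
  particular metric is fixed.\<close>

definition subsolution_space ::
  "(real^2) set \<Rightarrow> real \<Rightarrow> (real^2 \<Rightarrow> real) \<Rightarrow>
   ((real^2) \<times> real \<Rightarrow> real) \<Rightarrow> ((real^2) \<times> real \<Rightarrow> real^2) \<Rightarrow> ((real^2) \<times> real \<Rightarrow> real^2) \<Rightarrow>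
   ((real^2) \<times> real) set \<Rightarrow> ((real^2) \<times> real \<Rightarrow> real \<times> (real^2) \<times> (real^2)) set topology" where
  "subsolution_space \<Omega> T \<rho>\<^sub>0 \<rho>' v' m' U =
     subtopology (weak_L2 (\<Omega> \<times> {0<..<T}))
       (weak_L2 (\<Omega> \<times> {0<..<T}) closure_of subsolution_space_0 \<Omega> T \<rho>\<^sub>0 \<rho>' v' m' U)"

end

theory Submission imports Defs begin

text \<open>
The residual set consists of the classes with \<open>\<integral> \<rho>\<^sup>2 \<ge> |D|\<close>. It is a \<open>G\<^sub>\<delta>\<close> set because
\<open>\<rho> \<mapsto> \<integral> \<rho>\<^sup>2\<close> is weakly lower semicontinuous. Density is a Baire-category form of convex integration: around
almost every point of the mixing zone a strict subsolution is nearly constant, and adding a localized plane wave of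
high frequency, in a direction in which the constraint (iv) leaves room, is a weakly small change that lowers
\<open>\<integral> (1 - \<rho>\<^sup>2)\<close>. By Vitali covering this gain is bounded below as long as the deficit is not small, and finitely
many repetitions make the deficit arbitrarily small.

In the residual set the weak limits have \<open>|\<rho>| = 1\<close>, hence the approximating densities converge strongly in \<open>L\<^sup>2\<close>.
At almost every time the \<open>L\<^sup>2\<close> norm of a velocity with (ii) and (iii) is at most that of the density, since on the
square such a velocity is a rotated gradient of a stream function vanishing on the boundary. With (iv), which gives
\<open>|m - \<rho>v| \<le> 1 - \<rho>\<^sup>2\<close>, the identity \<open>m = \<rho>v\<close> survives in the limit.
\<close>

section \<open>Fubini and density on Lebesgue-measurable sets\<close>

text \<open>Why there is always room: in the variables u = 2v + (0,\<rho>) and m' = 2m + (0,1)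
  constraint (iv) becomes |m' - \<rho> u| \<le> 1 - \<rho>^2, and a plane wave of the linear system
  with spatial frequency (sin(t/2), cos(t/2)) and unit density changes u by the unit vector (sin t,
  cos t). So u can be moved in every direction, while the time frequency and a stream function make
  the flux increment arbitrary. The obstacle in the limit is that v and m carry no pointwise bound
  uniform over \<open>X\<^sub>0\<close>, and that products such as \<rho> v and conditions at almost
  every time are not weakly continuous. All information is therefore passed to the limit through
  finitely many L2 pairings, with test fields made from the limit itself or from indicators of sets
  of times; the uncountably many spatial test functions at a fixed time are handled by a countable
  uniformly dense family. No metric on X occurs: weak neighbourhoods are described by finite lists
  of test fields.\<close>

lemma AE_lebesgue_on_iff:
  assumes "S \<in> sets lebesgue"
  shows "(AE z in lebesgue_on S. P z) \<longleftrightarrow> (AE z in lborel. z \<in> S \<longrightarrow> P z)"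
proof -
  have "(AE z in lebesgue_on S. P z) \<longleftrightarrow> (AE z in lebesgue. z \<in> S \<longrightarrow> P z)"
    using assms by (intro AE_restrict_space_iff) auto
  then show ?thesis unfolding AE_completion_iff .
qed

lemma sets_lebesgue_Times:
  "A \<in> sets borel \<Longrightarrow> B \<in> sets borel \<Longrightarrow> A \<times> B \<in> sets (lebesgue :: ('a::euclidean_space \<times> 'b::euclidean_space) measure)"
  by (metis borel_Times sets_completionI_sets sets_lborel)

lemma AE_lebesgue_on_slice:
  fixes A :: "'a::euclidean_space set" and B :: "'b::euclidean_space set"
  assumes AE: "AE z in lebesgue_on (A \<times> B). P z" and A: "A \<in> sets borel" and B: "B \<in> sets borel"
  shows "AE t in lebesgue_on B. AE x in lebesgue_on A. P (x, t)"
proof -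
  have AB: "A \<times> B \<in> sets lebesgue"
    using A B by (rule sets_lebesgue_Times)
  have "AE z in lborel. z \<in> A \<times> B \<longrightarrow> P z"
    using AE unfolding AE_lebesgue_on_iff[OF AB] .
  then have 1: "AE z in lborel \<Otimes>\<^sub>M (lborel :: 'b measure). z \<in> A \<times> B \<longrightarrow> P z"
    unfolding lborel_prod .
  \<comment> \<open>\<open>AE_pair\<close> freezes the first coordinate, whereas time is the second
    one; hence the factors are swapped first.\<close>
  have "lborel \<Otimes>\<^sub>M lborel = distr (lborel \<Otimes>\<^sub>M lborel) (lborel \<Otimes>\<^sub>M lborel) (\<lambda>(x::'b, y::'a). (y, x))"
    by (rule lborel_pair.distr_pair_swap)
  from this[symmetric] have "AE z in distr (lborel \<Otimes>\<^sub>M lborel) (lborel \<Otimes>\<^sub>M lborel) (\<lambda>(x::'b, y::'a). (y, x)). z \<in> A \<times> B \<longrightarrow> P z"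
    using 1 by (rule ssubst)
  then have "AE w in (lborel :: 'b measure) \<Otimes>\<^sub>M (lborel :: 'a measure). (snd w, fst w) \<in> A \<times> B \<longrightarrow> P (snd w, fst w)"
    by (auto dest!: AE_distrD[rotated] simp: case_prod_beta)
  from lborel_pair.AE_pair[OF this]
  have "AE t in lborel. AE x in lborel. x \<in> A \<and> t \<in> B \<longrightarrow> P (x, t)"
    by simp
  then have "AE t in lborel. t \<in> B \<longrightarrow> (AE x in lborel. x \<in> A \<longrightarrow> P (x, t))"
    by eventually_elim auto
  moreover have Al: "A \<in> sets lebesgue" and Bl: "B \<in> sets lebesgue" using A B by auto
  ultimately show ?thesis unfolding AE_lebesgue_on_iff[OF Al] AE_lebesgue_on_iff[OF Bl] by simp
qed

text \<open>Lebesgue measure on a product is not the product of the Lebesgue measures; only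
  \<open>lborel\<close> factorises. Fubini arguments therefore run on a Borel representative of the
  extension of f by zero.\<close>

lemma lebesgue_on_ex_borel:
  fixes f :: "'a::euclidean_space \<Rightarrow> real"
  assumes f: "f \<in> borel_measurable (lebesgue_on S)" and S: "S \<in> sets lebesgue"
  obtains g where "g \<in> borel_measurable borel" "AE z in lborel. indicator S z *\<^sub>R f z = g z"
proof -
  have "(\<lambda>x. if x \<in> S then f x else 0) \<in> borel_measurable lebesgue"
    using f S by (rule borel_measurable_if_I)
  then obtain g where "g \<in> borel_measurable lborel" "AE z in lborel. (if z \<in> S then f z else 0) = g z"
    using completion_ex_borel_measurable_real by blast
  moreover from this(2) have "AE z in lborel. indicator S z *\<^sub>R f z = g z"
    by eventually_elim (auto simp: indicator_def)
  ultimately show ?thesis using that by auto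
qed

text \<open>Almost every slice is the best possible: a null set of the product may meet a single
  slice in a nonmeasurable set. All slices of the Borel representative are measurable, and almost
  every slice of f agrees with it almost everywhere.\<close>

lemma measurable_lebesgue_on_slice:
  fixes f :: "'a::euclidean_space \<times> 'b::euclidean_space \<Rightarrow> real"
  assumes f: "f \<in> borel_measurable (lebesgue_on (A \<times> B))" and A: "A \<in> sets borel" and B: "B \<in> sets borel"
  shows "AE t in lebesgue_on B. (\<lambda>x. f (x, t)) \<in> borel_measurable (lebesgue_on A)"
proof -
  have AB: "A \<times> B \<in> sets lebesgue"
    using A B by (rule sets_lebesgue_Times)
  obtain g where g: "g \<in> borel_measurable borel" "AE z in lborel. indicator (A \<times> B) z *\<^sub>R f z = g z"
    using lebesgue_on_ex_borel[OF f AB] .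
  have "AE z in lebesgue_on (A \<times> B). f z = g z"
  proof -
    have "AE z in lborel. z \<in> A \<times> B \<longrightarrow> f z = g z"
      using g(2) by eventually_elim (auto simp: indicator_def)
    then show ?thesis unfolding AE_lebesgue_on_iff[OF AB] .
  qed
  from AE_lebesgue_on_slice[OF this A B] show ?thesis
  proof eventually_elim
    case (elim t)
    have "(\<lambda>x. g (x, t)) \<in> borel_measurable borel"
      using g(1) by (intro measurable_compose[OF _ g(1)]) (auto intro!: borel_measurable_Pair)
    then have m: "(\<lambda>x. g (x, t)) \<in> borel_measurable lebesgue" by (simp add: measurable_completion)
    have Al: "A \<in> sets lebesgue" using A by auto
    have "AE x in lborel. x \<in> A \<longrightarrow> f (x, t) = g (x, t)" using elim unfolding AE_lebesgue_on_iff[OF Al] .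
    then have "AE x in lebesgue. (if x \<in> A then g (x, t) else 0) = (if x \<in> A then f (x, t) else 0)"
      unfolding AE_completion_iff by eventually_elim auto
    moreover have "(\<lambda>x. if x \<in> A then g (x, t) else 0) \<in> borel_measurable lebesgue"
      using m A by (intro borel_measurable_if_I measurable_restrict_space1) auto
    ultimately have "(\<lambda>x. if x \<in> A then f (x, t) else 0) \<in> borel_measurable lebesgue"
      by (rule borel_measurable_AE[rotated])
    then show ?case by (rule borel_measurable_if_D)
  qed
qed

lemma fubini_lebesgue_on:
  fixes f :: "'a::euclidean_space \<times> 'b::euclidean_space \<Rightarrow> real"
  assumes f: "integrable (lebesgue_on (A \<times> B)) f" and A: "A \<in> sets borel" and B: "B \<in> sets borel"
  shows "AE t in lebesgue_on B. integrable (lebesgue_on A) (\<lambda>x. f (x, t))"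
    and "integrable (lebesgue_on B) (\<lambda>t. LINT x|lebesgue_on A. f (x, t))"
    and "(LINT t|lebesgue_on B. LINT x|lebesgue_on A. f (x, t)) = (LINT z|lebesgue_on (A \<times> B). f z)"
proof -
  have AB: "A \<times> B \<in> sets lebesgue"
    using A B by (rule sets_lebesgue_Times)
  have m: "f \<in> borel_measurable (lebesgue_on (A \<times> B))" using f by auto
  obtain g where g: "g \<in> borel_measurable borel" "AE z in lborel. indicator (A \<times> B) z *\<^sub>R f z = g z"
    using lebesgue_on_ex_borel[OF m AB] .
  have If: "integrable lebesgue (\<lambda>z. indicator (A \<times> B) z *\<^sub>R f z)"
    using f AB by (simp add: integrable_restrict_space)
  have gl: "g \<in> borel_measurable lebesgue" using g(1) by (simp add: measurable_completion)
  have ae: "AE z in lebesgue. indicator (A \<times> B) z *\<^sub>R f z = g z" using g(2) by (simp add: AE_completion_iff)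
  have "integrable lebesgue g"
    using If gl ae by (rule integrable_cong_AE_imp) 
  then have Ig: "integrable lborel g" using g(1) by (simp add: integrable_completion)
  have Ig': "integrable (lborel \<Otimes>\<^sub>M lborel) (case_prod (\<lambda>x t. g (x, t)))" using Ig by (simp add: lborel_prod)
  have eqI: "(LINT z|lebesgue_on (A \<times> B). f z) = integral\<^sup>L lborel g"
  proof -
    have "(LINT z|lebesgue_on (A \<times> B). f z) = (LINT z|lebesgue. indicator (A \<times> B) z *\<^sub>R f z)"
      using AB by (intro integral_restrict_space) auto
    also have "\<dots> = integral\<^sup>L lebesgue g"
      using If gl ae by (intro integral_cong_AE) auto
    also have "\<dots> = integral\<^sup>L lborel g" using g(1) by (intro integral_completion) auto
    finally show ?thesis .
  qed
  have sl: "AE t in lborel. AE x in lborel. indicator (A \<times> B) (x, t) *\<^sub>R f (x, t) = g (x, t)"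
  proof -
    have "AE z in lebesgue_on (UNIV \<times> UNIV). indicator (A \<times> B) z *\<^sub>R f z = g z"
      using g(2) by (subst AE_lebesgue_on_iff) (simp_all del: real_scaleR_def)
    from AE_lebesgue_on_slice[OF this] show ?thesis
      unfolding lebesgue_on_UNIV_eq AE_completion_iff by simp
  qed
  have gm: "(\<lambda>x. g (x, t)) \<in> borel_measurable borel" for t
    using g(1) by (intro measurable_compose[OF _ g(1)]) (auto intro!: borel_measurable_Pair)
  \<comment> \<open>At such t both the integrability and the value of the slice integral are
    inherited from the Borel representative, which Fubini on \<open>lborel\<close> controls.\<close>
  have key: "AE t in lborel. integrable lebesgue (\<lambda>x. indicator (A \<times> B) (x, t) *\<^sub>R f (x, t)) \<and>
      (LINT x|lebesgue. indicator (A \<times> B) (x, t) *\<^sub>R f (x, t)) = (LINT x|lborel. g (x, t))"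
    using sl lborel_pair.AE_integrable_snd[OF Ig']
  proof eventually_elim
    case (elim t)
    have ae: "AE x in lebesgue. g (x, t) = indicator (A \<times> B) (x, t) *\<^sub>R f (x, t)"
      using elim(1) by (auto simp: AE_completion_iff elim: eventually_mono)
    have I: "integrable lebesgue (\<lambda>x. g (x, t))"
      using elim(2) gm by (simp add: integrable_completion)
    have ms: "(\<lambda>x. indicator (A \<times> B) (x, t) *\<^sub>R f (x, t)) \<in> borel_measurable lebesgue"
      using borel_measurable_AE[OF _ ae] I by blast
    have "integrable lebesgue (\<lambda>x. indicator (A \<times> B) (x, t) *\<^sub>R f (x, t))"
      using I ms ae by (rule integrable_cong_AE_imp)
    moreover have "(LINT x|lebesgue. indicator (A \<times> B) (x, t) *\<^sub>R f (x, t)) = (LINT x|lebesgue. g (x, t))"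
      using ms I ae by (intro integral_cong_AE) (auto elim: eventually_mono)
    ultimately show ?case using gm by (simp add: integral_completion)
  qed
  have sp: "indicat_real (A \<times> B) (x, t) * f (x, t) = indicat_real B t * (indicat_real A x * f (x, t))" for x t
    by (auto simp: indicator_def)
  have "AE t in lborel. t \<in> B \<longrightarrow> integrable (lebesgue_on A) (\<lambda>x. f (x, t))"
    using key by eventually_elim (use A in \<open>auto simp: sp integrable_restrict_space\<close>)
  then show "AE t in lebesgue_on B. integrable (lebesgue_on A) (\<lambda>x. f (x, t))"
    using AE_lebesgue_on_iff[of B "\<lambda>t. integrable (lebesgue_on A) (\<lambda>x. f (x, t))"] B by simp
  have key3: "AE t in lebesgue. (LINT x|lborel. g (x, t)) = indicator B t *\<^sub>R (LINT x|lebesgue_on A. f (x, t))"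
    using key unfolding AE_completion_iff
  proof eventually_elim
    case (elim t)
    then show ?case
      using A by (simp add: sp integral_restrict_space)
  qed
  have I: "integrable lborel (\<lambda>t. LINT x|lborel. g (x, t))"
    using lborel_pair.integrable_snd[OF Ig'] .
  then have I2: "integrable lebesgue (\<lambda>t. LINT x|lborel. g (x, t))"
    using borel_measurable_integrable by (subst integrable_completion) auto
  have ms: "(\<lambda>t. indicator B t *\<^sub>R (LINT x|lebesgue_on A. f (x, t))) \<in> borel_measurable lebesgue"
    using borel_measurable_AE[OF _ key3] I2 by blast
  have "integrable lebesgue (\<lambda>t. indicator B t *\<^sub>R (LINT x|lebesgue_on A. f (x, t)))"
    using I2 ms key3 by (rule integrable_cong_AE_imp)
  then show "integrable (lebesgue_on B) (\<lambda>t. LINT x|lebesgue_on A. f (x, t))"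
    using B by (simp add: integrable_restrict_space)
  have "(LINT t|lebesgue_on B. LINT x|lebesgue_on A. f (x, t)) = (LINT t|lebesgue. LINT x|lborel. g (x, t))"
    using B ms I2 key3 by (subst integral_restrict_space) (auto intro!: integral_cong_AE elim: eventually_mono)
  also have "\<dots> = (LINT t|lborel. LINT x|lborel. g (x, t))"
    using I by (intro integral_completion) auto
  also have "\<dots> = integral\<^sup>L lborel g"
    using lborel_pair.integral_snd[OF Ig'] by (simp add: lborel_prod)
  finally show "(LINT t|lebesgue_on B. LINT x|lebesgue_on A. f (x, t)) = (LINT z|lebesgue_on (A \<times> B). f z)"
    by (simp add: eqI)
qed

lemma integrable_bounded_lebesgue_on:
  fixes f :: "'a::euclidean_space \<Rightarrow> 'b::euclidean_space"
  assumes "f \<in> borel_measurable (lebesgue_on S)" "S \<in> lmeasurable" "AE z in lebesgue_on S. norm (f z) \<le> C"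
  shows "integrable (lebesgue_on S) f"
proof -
  interpret finite_measure "lebesgue_on S"
    by (rule finite_measure_lebesgue_on[OF assms(2)])
  show ?thesis using assms by (intro integrable_const_bound) auto
qed

section \<open>Square integrable and essentially bounded functions\<close>

lemma square_integrable_inner:
  assumes "square_integrable S f" "square_integrable S g"
  shows "integrable (lebesgue_on S) (\<lambda>z. f z \<bullet> g z)"
proof (rule Bochner_Integration.integrable_bound)
  show "integrable (lebesgue_on S) (\<lambda>z. (norm (f z))\<^sup>2 + (norm (g z))\<^sup>2)"
    using assms by (auto simp: square_integrable_def)
  show "(\<lambda>z. f z \<bullet> g z) \<in> borel_measurable (lebesgue_on S)"
    using assms by (auto simp: square_integrable_def)
  show "AE z in lebesgue_on S. norm (f z \<bullet> g z) \<le> norm ((norm (f z))\<^sup>2 + (norm (g z))\<^sup>2)"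
  proof (intro AE_I2)
    fix z
    have "\<bar>f z \<bullet> g z\<bar> \<le> norm (f z) * norm (g z)" by (rule Cauchy_Schwarz_ineq2)
    also have "\<dots> \<le> (norm (f z))\<^sup>2 + (norm (g z))\<^sup>2"
      using sum_squares_bound[of "norm (f z)" "norm (g z)"] mult_nonneg_nonneg[OF norm_ge_zero[of "f z"] norm_ge_zero[of "g z"]]
      by linarith
    finally show "norm (f z \<bullet> g z) \<le> norm ((norm (f z))\<^sup>2 + (norm (g z))\<^sup>2)" by simp
  qed
qed

lemma square_integrable_bounded:
  assumes "f \<in> borel_measurable (lebesgue_on S)" "S \<in> lmeasurable" "AE z in lebesgue_on S. norm (f z) \<le> C"
  shows "square_integrable S f"
proof -
  have "integrable (lebesgue_on S) (\<lambda>z. (norm (f z))\<^sup>2)"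
  proof (rule integrable_bounded_lebesgue_on)
    show "AE z in lebesgue_on S. norm ((norm (f z))\<^sup>2) \<le> C\<^sup>2"
      using assms(3) by eventually_elim (simp add: power_mono)
  qed (use assms in auto)
  then show ?thesis using assms by (simp add: square_integrable_def)
qed

lemma ess_bounded_imp_square_integrable:
  "ess_bounded S f \<Longrightarrow> S \<in> lmeasurable \<Longrightarrow> square_integrable S f"
  using square_integrable_bounded by (auto simp: ess_bounded_def)

lemma square_integrable_imp_integrable:
  assumes "square_integrable S f" "S \<in> lmeasurable"
  shows "integrable (lebesgue_on S) f"
proof (rule Bochner_Integration.integrable_bound)
  interpret finite_measure "lebesgue_on S"
    by (rule finite_measure_lebesgue_on[OF assms(2)])
  show "integrable (lebesgue_on S) (\<lambda>z. 1 + (norm (f z))\<^sup>2)"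
    using assms by (auto simp: square_integrable_def)
  show "f \<in> borel_measurable (lebesgue_on S)"
    using assms by (auto simp: square_integrable_def)
  show "AE z in lebesgue_on S. norm (f z) \<le> norm (1 + (norm (f z))\<^sup>2)"
  proof (intro AE_I2)
    fix z
    show "norm (f z) \<le> norm (1 + (norm (f z))\<^sup>2)"
      using sum_squares_bound[of 1 "norm (f z)"] norm_ge_zero[of "f z"] by (simp del: norm_ge_zero)
  qed
qed

text \<open>Truncating f at a large height costs little in L1. The truncated function is an almost
  everywhere limit of continuous functions; truncating these as well gives a uniform bound, so on a
  set of finite measure they converge in L1. The approximant is bounded but need not have compact
  support.\<close>

lemma integrable_approx_continuous:
  fixes f :: "'a::euclidean_space \<Rightarrow> real"
  assumes f: "integrable (lebesgue_on S) f" and S: "S \<in> lmeasurable" and e: "e > 0"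
  obtains g C where "continuous_on UNIV g" "\<And>x. \<bar>g x\<bar> \<le> C" "integrable (lebesgue_on S) (\<lambda>x. f x - g x)"
    "(LINT x|lebesgue_on S. \<bar>f x - g x\<bar>) < e"
proof -
  interpret F: finite_measure "lebesgue_on S"
    by (rule finite_measure_lebesgue_on[OF S])
  have Sl: "S \<in> sets lebesgue" using S by auto
  define tr where "tr = (\<lambda>(M::nat) (y::real). max (- real M) (min (real M) y))"
  have trb: "\<bar>tr M y\<bar> \<le> real M" for M y by (auto simp: tr_def)
  have trl: "\<bar>tr M y\<bar> \<le> \<bar>y\<bar>" for M y by (auto simp: tr_def)
  have trc: "continuous_on UNIV (tr M)" for M
    unfolding tr_def by (intro continuous_intros)
  have trm: "tr M \<in> borel_measurable borel" for M using trc by (rule borel_measurable_continuous_onI)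
  have fm: "f \<in> borel_measurable (lebesgue_on S)" using f by auto
  have "(\<lambda>M. LINT x|lebesgue_on S. \<bar>f x - tr M (f x)\<bar>) \<longlonglongrightarrow> (LINT x|lebesgue_on S. 0)"
  proof (rule integral_dominated_convergence[where w="\<lambda>x. 2 * \<bar>f x\<bar>"])
    show "AE x in lebesgue_on S. (\<lambda>M. \<bar>f x - tr M (f x)\<bar>) \<longlonglongrightarrow> 0"
    proof (intro AE_I2)
      fix x
      obtain M0 :: nat where "\<bar>f x\<bar> \<le> real M0" using real_arch_simple by blast
      then have "eventually (\<lambda>M. \<bar>f x - tr M (f x)\<bar> = 0) sequentially"
        unfolding eventually_sequentially by (intro exI[of _ M0]) (auto simp: tr_def)
      then show "(\<lambda>M. \<bar>f x - tr M (f x)\<bar>) \<longlonglongrightarrow> 0" by (rule tendsto_eventually)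
    qed
    show "AE x in lebesgue_on S. norm \<bar>f x - tr M (f x)\<bar> \<le> 2 * \<bar>f x\<bar>" for M
    proof (intro AE_I2)
      fix x show "norm \<bar>f x - tr M (f x)\<bar> \<le> 2 * \<bar>f x\<bar>" using trl[of M "f x"] by simp
    qed
    show "(\<lambda>x. \<bar>f x - tr M (f x)\<bar>) \<in> borel_measurable (lebesgue_on S)" for M
      using fm measurable_compose[OF fm trm[of M]] by auto
  qed (use f in auto)
  then have "eventually (\<lambda>M. (LINT x|lebesgue_on S. \<bar>f x - tr M (f x)\<bar>) < e / 2) sequentially"
    using e by (intro order_tendstoD(2)[where y=0]) auto
  then obtain M where M: "(LINT x|lebesgue_on S. \<bar>f x - tr M (f x)\<bar>) < e / 2"
    by (meson eventually_sequentially order_refl)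
  have tm: "(\<lambda>x. tr M (f x)) \<in> borel_measurable (lebesgue_on S)"
    using measurable_compose[OF fm trm[of M]] .
  then have "(\<lambda>x. tr M (f x)) measurable_on S"
    using Sl measurable_on_iff_borel_measurable by blast
  then obtain N g where N: "negligible N" and g: "\<And>n. continuous_on UNIV (g n)"
    and gl: "\<And>x. x \<notin> N \<Longrightarrow> (\<lambda>n. g n x) \<longlonglongrightarrow> (if x \<in> S then tr M (f x) else 0)"
    unfolding measurable_on_def by auto
  \<comment> \<open>The functions \<open>g n\<close> come without a uniform bound. Cutting them at
    the same height does not disturb the limit, because \<open>tr M\<close> is continuous and
    idempotent.\<close>
  define h where "h n x = tr M (g n x)" for n :: nat and x
  have hc: "continuous_on UNIV (h n)" for n
    unfolding h_def using continuous_on_compose2[OF trc g] by auto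
  have hm: "h n \<in> borel_measurable (lebesgue_on S)" for n
    by (intro measurable_restrict_space1 measurable_completion) (simp add: hc borel_measurable_continuous_onI)
  have "(\<lambda>n. LINT x|lebesgue_on S. \<bar>tr M (f x) - h n x\<bar>) \<longlonglongrightarrow> (LINT x|lebesgue_on S. 0)"
  proof (rule integral_dominated_convergence[where w="\<lambda>x. 2 * real M"])
    have "AE x in lebesgue. x \<notin> N"
      using N by (simp add: AE_not_in negligible_iff_null_sets)
    then have "AE x in lebesgue. x \<in> S \<longrightarrow> (\<lambda>n. \<bar>tr M (f x) - h n x\<bar>) \<longlonglongrightarrow> 0"
    proof eventually_elim
      case (elim x)
      show ?case
      proof
        assume xS: "x \<in> S"
        then have "(\<lambda>n. g n x) \<longlonglongrightarrow> tr M (f x)" using gl[OF elim] by simp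
        then have "(\<lambda>n. h n x) \<longlonglongrightarrow> tr M (tr M (f x))"
          unfolding h_def using trc continuous_on_tendsto_compose[of UNIV "tr M"] by auto
        moreover have "tr M (tr M (f x)) = tr M (f x)" by (auto simp: tr_def)
        ultimately have "(\<lambda>n. h n x) \<longlonglongrightarrow> tr M (f x)" by simp
        then show "(\<lambda>n. \<bar>tr M (f x) - h n x\<bar>) \<longlonglongrightarrow> 0"
          using tendsto_rabs[OF tendsto_diff[OF tendsto_const[of "tr M (f x)"]], of "\<lambda>n. h n x" "tr M (f x)"] by simp
      qed
    qed
    then show "AE x in lebesgue_on S. (\<lambda>n. \<bar>tr M (f x) - h n x\<bar>) \<longlonglongrightarrow> 0"
      using Sl by (simp add: AE_restrict_space_iff)
    show "AE x in lebesgue_on S. norm \<bar>tr M (f x) - h n x\<bar> \<le> 2 * real M" for n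
    proof (intro AE_I2)
      fix x show "norm \<bar>tr M (f x) - h n x\<bar> \<le> 2 * real M"
        using trb[of M "f x"] trb[of M "g n x"] by (simp add: h_def)
    qed
    show "(\<lambda>x. \<bar>tr M (f x) - h n x\<bar>) \<in> borel_measurable (lebesgue_on S)" for n
      using tm hm by auto
  qed auto
  then have "eventually (\<lambda>n. (LINT x|lebesgue_on S. \<bar>tr M (f x) - h n x\<bar>) < e / 2) sequentially"
    using e by (intro order_tendstoD(2)[where y=0]) auto
  then obtain n where n: "(LINT x|lebesgue_on S. \<bar>tr M (f x) - h n x\<bar>) < e / 2"
    by (meson eventually_sequentially order_refl)
  have hb: "\<bar>h n x\<bar> \<le> real M" for x by (simp add: h_def trb)
  have It: "integrable (lebesgue_on S) (\<lambda>x. tr M (f x))"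
    using tm S by (rule integrable_bounded_lebesgue_on[where C=M]) (simp add: trb)
  have Ih: "integrable (lebesgue_on S) (h n)"
    using hm S by (rule integrable_bounded_lebesgue_on[where C=M]) (simp add: hb)
  have "(LINT x|lebesgue_on S. \<bar>f x - h n x\<bar>) \<le> (LINT x|lebesgue_on S. \<bar>f x - tr M (f x)\<bar> + \<bar>tr M (f x) - h n x\<bar>)"
    using f It Ih by (intro integral_mono) auto
  also have "\<dots> = (LINT x|lebesgue_on S. \<bar>f x - tr M (f x)\<bar>) + (LINT x|lebesgue_on S. \<bar>tr M (f x) - h n x\<bar>)"
    using f It Ih by (intro Bochner_Integration.integral_add) auto
  also have "\<dots> < e" using M n by simp
  finally have lt: "(LINT x|lebesgue_on S. \<bar>f x - h n x\<bar>) < e" .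
  have "integrable (lebesgue_on S) (\<lambda>x. f x - h n x)" using f Ih by (rule Bochner_Integration.integrable_diff)
  from that[OF hc hb this lt] show ?thesis .
qed

section \<open>Smooth functions\<close>

lemma C_k_imp_continuous: "C_k n f \<Longrightarrow> continuous_on UNIV f"
  by (cases n) (auto intro!: continuous_at_imp_continuous_on differentiable_imp_continuous_within)

lemma C_k_Suc_imp: "C_k (Suc n) f \<Longrightarrow> C_k n f"
proof (induction n arbitrary: f)
  case 0
  then show ?case using C_k_imp_continuous[OF 0] by simp
next
  case (Suc n)
  then show ?case by (metis C_k.simps(2))
qed

lemma smooth_continuous: "smooth f \<Longrightarrow> continuous_on UNIV f"
  by (rule C_k_imp_continuous[of 0]) (simp only: smooth_def)

lemma smooth_differentiable: "smooth f \<Longrightarrow> f differentiable (at x)"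
  by (metis C_k.simps(2) smooth_def)

lemma smooth_has_derivative: "smooth f \<Longrightarrow> (f has_derivative frechet_derivative f (at x)) (at x)"
  using smooth_differentiable frechet_derivative_works by blast

lemma smooth_frechet_derivative: "smooth f \<Longrightarrow> smooth (\<lambda>x. frechet_derivative f (at x) h)"
  unfolding smooth_def by (metis C_k.simps(2))

text \<open>A class of differentiable functions that is stable under all directional derivatives can
  be differentiated any number of times. Families given by a formula are thus smooth without
  computing higher derivatives.\<close>

lemma smooth_coinduct:
  assumes "P f"
    and "\<And>f. P f \<Longrightarrow> \<exists>f'. (\<forall>x. (f has_derivative f' x) (at x)) \<and> (\<forall>h. P (\<lambda>x. f' x h))"
  shows "smooth f"
proof -
  have "\<forall>f. P f \<longrightarrow> C_k n f" for n
  proof (induction n)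
    case 0
    show ?case
    proof (intro allI impI)
      fix f assume "P f"
      from assms(2)[OF this] have "\<forall>x. f differentiable (at x)" by (auto simp: differentiable_def)
      then show "C_k 0 f"
        by (auto intro!: continuous_at_imp_continuous_on differentiable_imp_continuous_within)
    qed
  next
    case (Suc n)
    show ?case
    proof (intro allI impI)
      fix f assume "P f"
      from assms(2)[OF this] obtain f' where f': "\<And>x. (f has_derivative f' x) (at x)" "\<And>h. P (\<lambda>x. f' x h)"
        by auto
      have "frechet_derivative f (at x) = f' x" for x
        using f'(1) frechet_derivative_at by (metis)
      then show "C_k (Suc n) f" using f' Suc by (auto simp: differentiable_def)
    qed
  qed
  then show ?thesis using assms(1) by (auto simp: smooth_def)
qed

lemma C_k_const: "C_k n (\<lambda>x. c)"
proof (induction n arbitrary: c)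
  case (Suc n)
  have "frechet_derivative (\<lambda>x::'a. c) (at x) = (\<lambda>h. 0)" for x
    by (rule frechet_derivative_at[symmetric]) (rule has_derivative_const)
  with Suc show ?case by simp
qed simp

lemma smooth_const: "smooth (\<lambda>x. c)"
  by (simp add: smooth_def C_k_const)

lemma C_k_add: "C_k n f \<Longrightarrow> C_k n g \<Longrightarrow> C_k n (\<lambda>x. f x + g x)"
proof (induction n arbitrary: f g)
  case 0 then show ?case by (auto intro: continuous_intros)
next
  case (Suc n)
  have d: "((\<lambda>x. f x + g x) has_derivative (\<lambda>h. frechet_derivative f (at x) h + frechet_derivative g (at x) h)) (at x)" for x
    using Suc.prems by (intro has_derivative_add) (auto simp: frechet_derivative_works[symmetric])
  have "frechet_derivative (\<lambda>x. f x + g x) (at x) = (\<lambda>h. frechet_derivative f (at x) h + frechet_derivative g (at x) h)" for x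
    using frechet_derivative_at[OF d] by simp
  with Suc d show ?case by (auto simp: differentiable_def)
qed

lemma C_k_mult: "C_k n f \<Longrightarrow> C_k n g \<Longrightarrow> C_k n (\<lambda>x. f x * g x)"
proof (induction n arbitrary: f g)
  case 0 then show ?case by (auto intro: continuous_intros)
next
  case (Suc n)
  have d: "((\<lambda>x. f x * g x) has_derivative (\<lambda>h. f x * frechet_derivative g (at x) h + frechet_derivative f (at x) h * g x)) (at x)" for x
    using Suc.prems by (intro has_derivative_mult) (auto simp: frechet_derivative_works[symmetric])
  have e: "frechet_derivative (\<lambda>x. f x * g x) (at x) = (\<lambda>h. f x * frechet_derivative g (at x) h + frechet_derivative f (at x) h * g x)" for x
    using frechet_derivative_at[OF d] by simp
  have "C_k n (\<lambda>x. f x * frechet_derivative g (at x) h + frechet_derivative f (at x) h * g x)" for h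
    using Suc.prems C_k_Suc_imp by (intro C_k_add Suc.IH) auto
  with d e show ?case by (auto simp: differentiable_def)
qed

lemma smooth_add: "smooth f \<Longrightarrow> smooth g \<Longrightarrow> smooth (\<lambda>x. f x + g x)"
  by (simp add: smooth_def C_k_add)

lemma smooth_mult: "smooth f \<Longrightarrow> smooth g \<Longrightarrow> smooth (\<lambda>x. f x * g x)"
  by (simp add: smooth_def C_k_mult)

lemma smooth_compose_affine:
  assumes "smooth (f :: real \<Rightarrow> real)"
  shows "smooth (\<lambda>x::'a::euclidean_space. f (a + u \<bullet> x))"
\<comment> \<open>The constant c belongs to the class because differentiating in direction h
  produces the factor \<open>u \<bullet> h\<close>.\<close>
proof (rule smooth_coinduct[where P="\<lambda>F. \<exists>c f. smooth f \<and> F = (\<lambda>x. c * f (a + u \<bullet> x))"])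
  show "\<exists>c g. smooth g \<and> (\<lambda>x. f (a + u \<bullet> x)) = (\<lambda>x. c * g (a + u \<bullet> x))"
    using assms by (intro exI[of _ 1] exI[of _ f]) auto
next
  fix F :: "'a \<Rightarrow> real" assume "\<exists>c f. smooth f \<and> F = (\<lambda>x. c * f (a + u \<bullet> x))"
  then obtain c f where f: "smooth f" and F: "F = (\<lambda>x. c * f (a + u \<bullet> x))" by auto
  have lin: "frechet_derivative f (at t) h = h * frechet_derivative f (at t) 1" for t h :: real
    using linear_frechet_derivative[OF smooth_differentiable[OF f, of t]] linear_scale[of "frechet_derivative f (at t)" h 1] by simp
  show "\<exists>F'. (\<forall>x. (F has_derivative F' x) (at x)) \<and>
       (\<forall>h. \<exists>c f. smooth f \<and> (\<lambda>x. F' x h) = (\<lambda>x. c * f (a + u \<bullet> x)))"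
  proof (intro exI conjI allI)
    fix x
    have "((\<lambda>x. a + u \<bullet> x) has_derivative (\<lambda>h. u \<bullet> h)) (at x)"
      by (auto intro!: derivative_eq_intros)
    from has_derivative_mult_right[OF diff_chain_at[OF this smooth_has_derivative[OF f]], of c]
    show "(F has_derivative (\<lambda>h. c * frechet_derivative f (at (a + u \<bullet> x)) (u \<bullet> h))) (at x)"
      by (simp add: F o_def)
  next
    fix h
    show "smooth (\<lambda>t. frechet_derivative f (at t) 1)" by (rule smooth_frechet_derivative[OF f])
    show "(\<lambda>x. c * frechet_derivative f (at (a + u \<bullet> x)) (u \<bullet> h)) =
        (\<lambda>x. (c * (u \<bullet> h)) * frechet_derivative f (at (a + u \<bullet> x)) 1)"
      by (subst lin) (simp add: mult_ac)
  qed
qed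

section \<open>Slices and derivatives in space and time\<close>

lemma has_derivative_slice_fst:
  assumes "(\<phi> has_derivative \<phi>') (at (x, t))"
  shows "((\<lambda>x. \<phi> (x, t)) has_derivative (\<lambda>h. \<phi>' (h, 0))) (at x)"
proof (rule has_derivative_compose[where f="\<lambda>x. (x, t)" and f'="\<lambda>h. (h, 0)" and g=\<phi> and g'=\<phi>'])
  show "((\<lambda>x. (x, t)) has_derivative (\<lambda>h. (h, 0))) (at x)"
    by (auto intro!: derivative_eq_intros)
qed (use assms in simp)

lemma has_derivative_slice_snd:
  assumes "(\<phi> has_derivative \<phi>') (at (x, t))"
  shows "((\<lambda>t. \<phi> (x, t)) has_derivative (\<lambda>h. \<phi>' (0, h))) (at t)"
proof (rule has_derivative_compose[where f="\<lambda>t. (x, t)" and f'="\<lambda>h. (0, h)" and g=\<phi> and g'=\<phi>'])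
  show "((\<lambda>t. (x, t)) has_derivative (\<lambda>h. (0, h))) (at t)"
    by (auto intro!: derivative_eq_intros)
qed (use assms in simp)

lemma time_deriv_eq:
  assumes "smooth \<phi>"
  shows "time_deriv \<phi> z = frechet_derivative \<phi> (at z) (0, 1)"
proof -
  have "((\<lambda>s. \<phi> (fst z, s)) has_derivative (\<lambda>h. frechet_derivative \<phi> (at z) (0, h))) (at (snd z))"
    by (rule has_derivative_slice_snd) (simp add: smooth_has_derivative[OF assms])
  moreover have "frechet_derivative \<phi> (at z) (0, h) = frechet_derivative \<phi> (at z) (0, 1) * h" for h
    using linear_frechet_derivative[OF smooth_differentiable[OF assms, of z]]
      linear_scale[of "frechet_derivative \<phi> (at z)" h "(0, 1)"] by simp
  then have "(\<lambda>h. frechet_derivative \<phi> (at z) (0, h)) = (*) (frechet_derivative \<phi> (at z) (0, 1))" by (rule ext)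
  ultimately show ?thesis
    unfolding time_deriv_def by (intro DERIV_imp_deriv) (simp add: has_field_derivative_def)
qed

lemma space_slice_has_derivative:
  assumes "smooth \<phi>"
  shows "((\<lambda>x. \<phi> (x, t)) has_derivative (\<lambda>h. frechet_derivative \<phi> (at (x, t)) (h, 0))) (at x)"
  by (rule has_derivative_slice_fst[OF smooth_has_derivative[OF assms]])

lemma space_gradient_eq:
  assumes "smooth \<phi>"
  shows "space_gradient \<phi> z = (\<chi> i. frechet_derivative \<phi> (at z) (axis i 1, 0))"
  using frechet_derivative_at[OF space_slice_has_derivative[OF assms, of "snd z" "fst z"], symmetric]
  by (simp add: space_gradient_def gradient_def)

lemma smooth_slice:
  assumes "smooth (\<phi> :: 'a::euclidean_space \<times> 'b::euclidean_space \<Rightarrow> real)"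
  shows "smooth (\<lambda>x. \<phi> (x, t))"
proof (rule smooth_coinduct[where P="\<lambda>F. \<exists>\<phi>. smooth \<phi> \<and> F = (\<lambda>x. \<phi> (x, t))"])
  show "\<exists>\<psi>. smooth \<psi> \<and> (\<lambda>x. \<phi> (x, t)) = (\<lambda>x. \<psi> (x, t))" using assms by auto
next
  fix F :: "'a \<Rightarrow> real" assume "\<exists>\<phi>. smooth \<phi> \<and> F = (\<lambda>x. \<phi> (x, t))"
  then obtain \<phi> where f: "smooth \<phi>" and F: "F = (\<lambda>x. \<phi> (x, t))" by auto
  have "((\<lambda>x. \<phi> (x, t)) has_derivative (\<lambda>h. frechet_derivative \<phi> (at (x, t)) (h, 0))) (at x)" for x
    by (rule has_derivative_slice_fst[OF smooth_has_derivative[OF f]])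
  then show "\<exists>F'. (\<forall>x. (F has_derivative F' x) (at x)) \<and> (\<forall>h. \<exists>\<phi>. smooth \<phi> \<and> (\<lambda>x. F' x h) = (\<lambda>x. \<phi> (x, t)))"
    using smooth_frechet_derivative[OF f] unfolding F by (intro exI[of _ "\<lambda>x h. frechet_derivative \<phi> (at (x, t)) (h, 0)"]) blast
qed

lemma inner_real2: "(a::real^2) \<bullet> b = a $ 1 * b $ 1 + a $ 2 * b $ 2"
  by (simp add: inner_vec_def sum_2)

lemma norm_real2_sq: "(norm (a::real^2))\<^sup>2 = (a $ 1)\<^sup>2 + (a $ 2)\<^sup>2"
  unfolding power2_norm_eq_inner inner_real2 by (simp add: power2_eq_square)

lemma vector_sel [simp]: "(vector [a, b] :: real^2) $ 1 = a" "(vector [a, b] :: real^2) $ 2 = b"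
  by (simp_all add: vector_2)

section \<open>Translations, difference quotients and integration by parts\<close>

lemma lborel_integral_translation:
  fixes f :: "'a::euclidean_space \<Rightarrow> real"
  assumes "f \<in> borel_measurable borel"
  shows "(LINT x|lborel. f (x + c)) = (LINT x|lborel. f x)"
  using assms integral_distr[of "(+) c" lborel borel f] by (simp add: lborel_distr_plus add.commute)

lemma lborel_integrable_translation:
  fixes f :: "'a::euclidean_space \<Rightarrow> real"
  assumes "f \<in> borel_measurable borel"
  shows "integrable lborel (\<lambda>x. f (x + c)) \<longleftrightarrow> integrable lborel f"
  using assms integrable_distr_eq[of "(+) c" lborel borel f] by (simp add: lborel_distr_plus add.commute)

lemma integrable_lborel_compact_support:
  fixes f :: "'a::euclidean_space \<Rightarrow> real"
  assumes "f \<in> borel_measurable borel" "compact K" "\<And>x. x \<notin> K \<Longrightarrow> f x = 0" "\<And>x. \<bar>f x\<bar> \<le> C"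
  shows "integrable lborel f"
proof (rule Bochner_Integration.integrable_bound)
  show "integrable lborel (\<lambda>x. C * indicator K x :: real)"
    using emeasure_compact_finite[OF assms(2)] compact_imp_closed[OF assms(2)] by auto
  show "AE x in lborel. norm (f x) \<le> norm (C * indicator K x :: real)"
  proof (intro AE_I2)
    fix x show "norm (f x) \<le> norm (C * indicator K x :: real)"
      using assms(3)[of x] assms(4)[of x] by (cases "x \<in> K") auto
  qed
qed (use assms in simp)

lemma continuous_compact_support_bounded:
  fixes f :: "'a::euclidean_space \<Rightarrow> real"
  assumes "continuous_on UNIV f" "compact K" "\<And>x. x \<notin> K \<Longrightarrow> f x = 0"
  obtains C where "C \<ge> 0" "\<And>x. \<bar>f x\<bar> \<le> C"
proof -
  have "bounded (f ` K)"
    using assms(1,2) by (intro compact_imp_bounded compact_continuous_image) (auto intro: continuous_on_subset)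
  then obtain C where C: "\<And>x. x \<in> K \<Longrightarrow> norm (f x) \<le> C" by (auto simp: bounded_iff)
  have "\<bar>f x\<bar> \<le> max C 0" for x using C[of x] assms(3)[of x] by (cases "x \<in> K") auto
  then show ?thesis using that[of "max C 0"] by auto
qed

lemma integrable_lborel_continuous_compact_support:
  fixes f :: "'a::euclidean_space \<Rightarrow> real"
  assumes "continuous_on UNIV f" "compact K" "\<And>x. x \<notin> K \<Longrightarrow> f x = 0"
  shows "integrable lborel f"
proof -
  obtain C where "\<And>x. \<bar>f x\<bar> \<le> C" using continuous_compact_support_bounded[OF assms] by metis
  then show ?thesis
    using assms by (intro integrable_lborel_compact_support[of f K C] borel_measurable_continuous_onI) auto
qed

lemma difference_quotient_integral_tendsto:
  fixes \<phi> \<psi> :: "'a::euclidean_space \<Rightarrow> real"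
  assumes \<psi>: "\<psi> \<in> borel_measurable borel" "compact K" "\<And>x. x \<notin> K \<Longrightarrow> \<psi> x = 0" "\<And>x. \<bar>\<psi> x\<bar> \<le> C"
    and \<phi>: "\<And>x. (\<phi> has_derivative \<phi>' x) (at x)" "continuous_on UNIV (\<lambda>x. \<phi>' x a)"
    and h: "h \<longlonglongrightarrow> 0" "\<And>n. h n \<noteq> 0" "\<And>n. \<bar>h n\<bar> \<le> 1"
  shows "(\<lambda>n. LINT x|lborel. \<psi> x * ((\<phi> (x + h n *\<^sub>R a) - \<phi> x) / h n)) \<longlonglongrightarrow> (LINT x|lborel. \<psi> x * \<phi>' x a)"
proof -
  \<comment> \<open>All points reached from K by a move of size at most 1 along a; the intermediate
    points of the mean value theorem lie here.\<close>
  define K' where "K' = (\<lambda>p. fst p + snd p *\<^sub>R a) ` (K \<times> {-1..1::real})"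
  have "compact K'"
    unfolding K'_def using \<psi>(2) by (intro compact_continuous_image compact_Times) (auto intro!: continuous_intros)
  then have "bounded ((\<lambda>x. \<phi>' x a) ` K')"
    using \<phi>(2) by (intro compact_imp_bounded compact_continuous_image) (auto intro: continuous_on_subset)
  then obtain M0 where M0: "\<And>x. x \<in> K' \<Longrightarrow> norm (\<phi>' x a) \<le> M0" by (auto simp: bounded_iff)
  define M where "M = max M0 0"
  have M: "\<And>x. x \<in> K' \<Longrightarrow> \<bar>\<phi>' x a\<bar> \<le> M" using M0 by (force simp: M_def)
  have cph: "continuous_on UNIV \<phi>"
    using \<phi>(1) by (auto intro!: continuous_at_imp_continuous_on has_derivative_continuous)
  have dr: "((\<lambda>s. \<phi> (x + s *\<^sub>R a)) has_real_derivative \<phi>' (x + s *\<^sub>R a) a) (at s)" for x s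
  proof -
    have "((\<lambda>s. x + s *\<^sub>R a) has_derivative (\<lambda>s. s *\<^sub>R a)) (at s)"
      by (auto intro!: derivative_eq_intros)
    from diff_chain_at[OF this \<phi>(1)]
    have "((\<lambda>s. \<phi> (x + s *\<^sub>R a)) has_derivative (\<lambda>s'. \<phi>' (x + s *\<^sub>R a) (s' *\<^sub>R a))) (at s)"
      by (simp add: o_def)
    moreover have "linear (\<phi>' (x + s *\<^sub>R a))" using \<phi>(1) has_derivative_linear by blast
    ultimately show ?thesis by (simp add: has_field_derivative_def linear_scale mult_commute_abs)
  qed
  have dqb: "\<bar>(\<phi> (x + s *\<^sub>R a) - \<phi> x) / s\<bar> \<le> M" if "x \<in> K" "s \<noteq> 0" "\<bar>s\<bar> \<le> 1" for x s
  proof -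
    have inK: "x + u *\<^sub>R a \<in> K'" if "\<bar>u\<bar> \<le> 1" for u
      unfolding K'_def using \<open>x \<in> K\<close> that by (intro image_eqI[of _ _ "(x, u)"]) auto
    have "norm (\<phi> (x + s *\<^sub>R a) - \<phi> (x + 0 *\<^sub>R a)) \<le> M * norm (s - 0)"
    proof (rule field_differentiable_bound[of "{-1..1}" "\<lambda>s. \<phi> (x + s *\<^sub>R a)" "\<lambda>s. \<phi>' (x + s *\<^sub>R a) a"])
      show "norm (\<phi>' (x + u *\<^sub>R a) a) \<le> M" if "u \<in> {-1..1}" for u
        using M[OF inK[of u]] that by auto
    qed (use that dr in \<open>auto intro: has_field_derivative_at_within\<close>)
    then show ?thesis using that by (simp add: divide_le_eq abs_mult)
  qed
  show ?thesis
  proof (rule integral_dominated_convergence[where w="\<lambda>x. C * M * indicator K x"])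
    show "(\<lambda>x. \<psi> x * \<phi>' x a) \<in> borel_measurable lborel"
      using \<psi>(1) borel_measurable_continuous_onI[OF \<phi>(2)] by auto
    show "(\<lambda>x. \<psi> x * ((\<phi> (x + h n *\<^sub>R a) - \<phi> x) / h n)) \<in> borel_measurable lborel" for n
    proof -
      have "continuous_on UNIV (\<lambda>x. (\<phi> (x + h n *\<^sub>R a) - \<phi> x) / h n)"
        using h(2) by (intro continuous_intros continuous_on_compose2[OF cph]) auto
      from borel_measurable_times[OF \<psi>(1) borel_measurable_continuous_onI[OF this]] show ?thesis by simp
    qed
    show "integrable lborel (\<lambda>x. C * M * indicator K x)"
      using emeasure_compact_finite[OF \<psi>(2)] compact_imp_closed[OF \<psi>(2)] by auto
    show "AE x in lborel. (\<lambda>n. \<psi> x * ((\<phi> (x + h n *\<^sub>R a) - \<phi> x) / h n)) \<longlonglongrightarrow> \<psi> x * \<phi>' x a"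
    proof (intro AE_I2 tendsto_mult tendsto_const)
      fix x
      have "((\<lambda>s. (\<phi> (x + s *\<^sub>R a) - \<phi> x) / s) \<longlongrightarrow> \<phi>' x a) (at 0)"
        using dr[of x 0] by (simp add: DERIV_def)
      then show "(\<lambda>n. (\<phi> (x + h n *\<^sub>R a) - \<phi> x) / h n) \<longlonglongrightarrow> \<phi>' x a"
        using h(1,2) by (auto simp: tendsto_at_iff_sequentially o_def)
    qed
    show "AE x in lborel. norm (\<psi> x * ((\<phi> (x + h n *\<^sub>R a) - \<phi> x) / h n)) \<le> C * M * indicator K x" for n
    proof (intro AE_I2)
      fix x
      show "norm (\<psi> x * ((\<phi> (x + h n *\<^sub>R a) - \<phi> x) / h n)) \<le> C * M * indicator K x"
      proof (cases "x \<in> K")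
        case True
        have "\<bar>\<psi> x\<bar> * \<bar>(\<phi> (x + h n *\<^sub>R a) - \<phi> x) / h n\<bar> \<le> C * M"
          using \<psi>(4)[of x] dqb[OF True h(2,3)] by (intro mult_mono) auto
        then show ?thesis using True by (simp add: abs_mult)
      qed (use \<psi>(3) in simp)
    qed
  qed
qed

lemma derivative_outside_support:
  fixes G :: "'a::euclidean_space \<Rightarrow> real"
  assumes "(G has_derivative G') (at x)" "closed K" "\<And>x. x \<notin> K \<Longrightarrow> G x = 0" "x \<notin> K"
  shows "G' h = 0"
proof -
  have "((\<lambda>_. 0) has_derivative G') (at x)"
    using assms by (intro has_derivative_transform_within_open[OF assms(1), of "- K"]) auto
  then have "G' = (\<lambda>_. 0)" using has_derivative_unique has_derivative_const by blast
  then show ?thesis by simp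
qed

text \<open>By translation invariance every difference quotient of G has integral zero, and these
  integrals converge to that of the derivative.\<close>

lemma integral_derivative_compact_support:
  fixes G :: "'a::euclidean_space \<Rightarrow> real"
  assumes G: "\<And>x. (G has_derivative G' x) (at x)" "continuous_on UNIV (\<lambda>x. G' x b)"
    and K: "compact K" "\<And>x. x \<notin> K \<Longrightarrow> G x = 0"
  shows "(LINT x|lborel. G' x b) = 0"
proof -
  define K' where "K' = (\<lambda>p. fst p + snd p *\<^sub>R b) ` (K \<times> {-1..1::real})"
  have K': "compact K'"
    unfolding K'_def using K(1) by (intro compact_continuous_image compact_Times) (auto intro!: continuous_intros)
  have inK': "x \<in> K'" if "x + s *\<^sub>R b \<in> K" "\<bar>s\<bar> \<le> 1" for x s
    unfolding K'_def using that by (intro image_eqI[of _ _ "(x + s *\<^sub>R b, -s)"]) auto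
  have Gc: "continuous_on UNIV G"
    using G(1) by (auto intro!: continuous_at_imp_continuous_on has_derivative_continuous)
  have G'0: "G' x b = 0" if "x \<notin> K" for x
    using derivative_outside_support[OF G(1) compact_imp_closed[OF K(1)] K(2) that] .
  define h where "h n = 1 / real (Suc n)" for n
  have h: "h \<longlonglongrightarrow> 0" "\<And>n. h n \<noteq> 0" "\<And>n. \<bar>h n\<bar> \<le> 1"
    unfolding h_def using LIMSEQ_inverse_real_of_nat by (auto simp: field_simps)
  \<comment> \<open>The indicator of \<open>K'\<close> plays the part of the bounded factor; it
    equals 1 wherever G or one of the translates in question is nonzero.\<close>
  have "(\<lambda>n. LINT x|lborel. indicator K' x * ((G (x + h n *\<^sub>R b) - G x) / h n)) \<longlonglongrightarrow> (LINT x|lborel. indicator K' x * G' x b)"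
    by (rule difference_quotient_integral_tendsto[where K=K' and C=1])
       (use K' G h borel_measurable_indicator[of K' borel] compact_imp_closed[OF K'] in \<open>auto simp: indicator_eq_0_iff abs_indicator indicator_le_1\<close>)
  moreover have "(LINT x|lborel. indicator K' x * ((G (x + h n *\<^sub>R b) - G x) / h n)) = 0" for n
  proof -
    have IG: "integrable lborel G" by (rule integrable_lborel_continuous_compact_support[OF Gc K])
    have "indicator K' x * ((G (x + h n *\<^sub>R b) - G x) / h n) = (G (x + h n *\<^sub>R b) - G x) / h n" for x
    proof (cases "x \<in> K'")
      case False
      then have "x + h n *\<^sub>R b \<notin> K" "x + 0 *\<^sub>R b \<notin> K" using inK'[of x "h n"] inK'[of x 0] h(3) by auto
      then show ?thesis using K(2) by auto
    qed simp
    then have "(LINT x|lborel. indicator K' x * ((G (x + h n *\<^sub>R b) - G x) / h n)) = (LINT x|lborel. (G (x + h n *\<^sub>R b) - G x) / h n)"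
      by (simp only:)
    also have "\<dots> = ((LINT x|lborel. G (x + h n *\<^sub>R b)) - (LINT x|lborel. G x)) / h n"
      using IG lborel_integrable_translation[of G "h n *\<^sub>R b"] Gc
      by (subst Bochner_Integration.integral_diff[symmetric]) (auto intro: borel_measurable_continuous_onI)
    also have "\<dots> = 0"
      using lborel_integral_translation[of G] Gc by (auto intro: borel_measurable_continuous_onI)
    finally show ?thesis .
  qed
  ultimately have "(\<lambda>n::nat. 0) \<longlonglongrightarrow> (LINT x|lborel. indicator K' x * G' x b)"
    by (simp only:)
  then have "(LINT x|lborel. indicator K' x * G' x b) = 0"
    by (rule LIMSEQ_unique) (rule tendsto_const)
  moreover have "indicator K' x * G' x b = G' x b" for x
    using G'0[of x] inK'[of x 0] by (auto simp: indicator_def)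
  ultimately show ?thesis by (simp only:)
qed

text \<open>Difference quotients commute, so no second derivatives are needed.\<close>

lemma integral_swap_derivatives:
  fixes g \<phi> :: "'a::euclidean_space \<Rightarrow> real"
  assumes g: "\<And>x. (g has_derivative g' x) (at x)" "\<And>h. continuous_on UNIV (\<lambda>x. g' x h)"
    and K: "compact K" "\<And>x. x \<notin> K \<Longrightarrow> g x = 0"
    and \<phi>: "\<And>x. (\<phi> has_derivative \<phi>' x) (at x)" "\<And>h. continuous_on UNIV (\<lambda>x. \<phi>' x h)"
  shows "(LINT x|lborel. g' x a * \<phi>' x b) = (LINT x|lborel. g' x b * \<phi>' x a)"
proof -
  define K' where "K' = (\<lambda>p. fst p + snd p *\<^sub>R a) ` (K \<times> {-1..1::real})"
  have K': "compact K'"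
    unfolding K'_def using K(1) by (intro compact_continuous_image compact_Times) (auto intro!: continuous_intros)
  have inK': "x \<in> K'" if "x + s *\<^sub>R a \<in> K" "\<bar>s\<bar> \<le> 1" for x s
    unfolding K'_def using that by (intro image_eqI[of _ _ "(x + s *\<^sub>R a, -s)"]) auto
  have gc: "continuous_on UNIV g"
    using g(1) by (auto intro!: continuous_at_imp_continuous_on has_derivative_continuous)
  have pc: "continuous_on UNIV \<phi>"
    using \<phi>(1) by (auto intro!: continuous_at_imp_continuous_on has_derivative_continuous)
  have g'0: "g' x h = 0" if "x \<notin> K" for x h
    using derivative_outside_support[OF g(1) compact_imp_closed[OF K(1)] K(2) that] .
  define h where "h n = 1 / real (Suc n)" for n
  have h: "h \<longlonglongrightarrow> 0" "\<And>n. h n \<noteq> 0" "\<And>n. \<bar>h n\<bar> \<le> 1"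
    unfolding h_def using LIMSEQ_inverse_real_of_nat by (auto simp: field_simps)
  have "bounded ((\<lambda>x. \<phi>' x b) ` K')"
    using \<phi>(2) K' by (intro compact_imp_bounded compact_continuous_image) (auto intro: continuous_on_subset)
  then obtain C where C: "\<And>x. x \<in> K' \<Longrightarrow> \<bar>\<phi>' x b\<bar> \<le> C" by (auto simp: bounded_iff)
  obtain B where B: "\<And>x. \<bar>g' x b\<bar> \<le> B"
    using continuous_compact_support_bounded[OF g(2) K(1) g'0] by metis
  \<comment> \<open>The derivative of g along a is replaced by a quotient with step
    \<open>h n\<close>, that of \<phi> below by one with step \<open>- h n\<close>: translating the
    integral moves the shift from g to \<phi>.\<close>
  have L1: "(\<lambda>n. LINT x|lborel. (indicator K' x * \<phi>' x b) * ((g (x + h n *\<^sub>R a) - g x) / h n))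
      \<longlonglongrightarrow> (LINT x|lborel. (indicator K' x * \<phi>' x b) * g' x a)"
  proof (rule difference_quotient_integral_tendsto[where K=K' and C="max C 0"])
    show "(\<lambda>x. indicator K' x * \<phi>' x b) \<in> borel_measurable borel"
      using compact_imp_closed[OF K'] borel_measurable_continuous_onI[OF \<phi>(2)[of b]] by simp
    show "\<bar>indicator K' x * \<phi>' x b\<bar> \<le> max C 0" for x using C[of x] by (auto simp: indicator_def)
  qed (use K' g h in auto)
  have L2: "(\<lambda>n. LINT x|lborel. g' x b * ((\<phi> (x + (- h n) *\<^sub>R a) - \<phi> x) / (- h n)))
      \<longlonglongrightarrow> (LINT x|lborel. g' x b * \<phi>' x a)"
  proof (rule difference_quotient_integral_tendsto[where K=K and C=B])
    show "(\<lambda>x. g' x b) \<in> borel_measurable borel" by (rule borel_measurable_continuous_onI[OF g(2)])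
    show "(\<lambda>n. - h n) \<longlonglongrightarrow> 0" using tendsto_minus[OF h(1)] by simp
  qed (use K g'0 B \<phi> h in auto)
  have eq: "(LINT x|lborel. (indicator K' x * \<phi>' x b) * ((g (x + h n *\<^sub>R a) - g x) / h n)) =
      (LINT x|lborel. g' x b * ((\<phi> (x + (- h n) *\<^sub>R a) - \<phi> x) / (- h n)))" for n
  proof -
    define c where "c = h n *\<^sub>R a"
    have c0: "continuous_on UNIV (\<lambda>x. \<phi>' (x - c) b)"
      by (intro continuous_on_compose2[OF \<phi>(2)[of b]] continuous_intros) auto
    have A: "(indicator K' x * \<phi>' x b) * ((g (x + h n *\<^sub>R a) - g x) / h n) =
        (\<phi>' ((x + c) - c) b * g (x + c) - \<phi>' x b * g x) / h n" for x
    proof (cases "x \<in> K'")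
      case False
      then have "x + h n *\<^sub>R a \<notin> K" "x + 0 *\<^sub>R a \<notin> K" using inK'[of x "h n"] inK'[of x 0] h(3) by auto
      then show ?thesis using K(2) by (auto simp: c_def)
    qed (auto simp: c_def algebra_simps)
    have m1: "(\<lambda>x. \<phi>' (x - c) b * g x) \<in> borel_measurable borel"
      using c0 gc by (intro borel_measurable_continuous_onI continuous_intros)
    have i1: "integrable lborel (\<lambda>x. \<phi>' (x - c) b * g x)"
      using c0 gc K by (intro integrable_lborel_continuous_compact_support[where K=K] continuous_intros) auto
    have i2: "integrable lborel (\<lambda>x. \<phi>' x b * g x)"
      using \<phi>(2) gc K by (intro integrable_lborel_continuous_compact_support[where K=K] continuous_intros) auto
    have "(LINT x|lborel. (indicator K' x * \<phi>' x b) * ((g (x + h n *\<^sub>R a) - g x) / h n)) =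
       (LINT x|lborel. (\<phi>' ((x + c) - c) b * g (x + c) - \<phi>' x b * g x) / h n)"
      unfolding A ..
    also have "\<dots> = ((LINT x|lborel. \<phi>' ((x + c) - c) b * g (x + c)) - (LINT x|lborel. \<phi>' x b * g x)) / h n"
      using i1 i2 lborel_integrable_translation[OF m1, of c]
      by (subst Bochner_Integration.integral_diff[symmetric]) auto
    also have "(LINT x|lborel. \<phi>' ((x + c) - c) b * g (x + c)) = (LINT x|lborel. \<phi>' (x - c) b * g x)"
      by (rule lborel_integral_translation[OF m1])
    finally have E1: "(LINT x|lborel. (indicator K' x * \<phi>' x b) * ((g (x + h n *\<^sub>R a) - g x) / h n)) =
        ((LINT x|lborel. \<phi>' (x - c) b * g x) - (LINT x|lborel. \<phi>' x b * g x)) / h n" .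
    have dG: "((\<lambda>x. g x * (\<phi> (x - c) - \<phi> x)) has_derivative
        (\<lambda>k. g x * (\<phi>' (x - c) k - \<phi>' x k) + g' x k * (\<phi> (x - c) - \<phi> x))) (at x)" for x
    proof -
      have "((\<lambda>x. x - c) has_derivative (\<lambda>k. k)) (at x)" by (auto intro!: derivative_eq_intros)
      from diff_chain_at[OF this \<phi>(1)] have "((\<lambda>x. \<phi> (x - c)) has_derivative \<phi>' (x - c)) (at x)"
        by (simp add: o_def)
      then show ?thesis
        by (intro has_derivative_mult[OF g(1)] has_derivative_diff \<phi>(1))
    qed
    have c1: "continuous_on UNIV (\<lambda>x. \<phi> (x - c))"
      by (intro continuous_on_compose2[OF pc] continuous_intros) auto
    \<comment> \<open>The integrand is the derivative along b of g(x) (\<phi>(x - c) - \<phi>(x)),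
      which has compact support. So the derivative along b moves from \<phi> to g while the one
      along a is still a finite difference.\<close>
    have "(LINT x|lborel. g x * (\<phi>' (x - c) b - \<phi>' x b) + g' x b * (\<phi> (x - c) - \<phi> x)) = 0"
      using dG gc c0 c1 pc g(2) \<phi>(2) K
      by (intro integral_derivative_compact_support[where K=K and
          G="\<lambda>x. g x * (\<phi> (x - c) - \<phi> x)" and G'="\<lambda>x k. g x * (\<phi>' (x - c) k - \<phi>' x k) + g' x k * (\<phi> (x - c) - \<phi> x)"]
          continuous_intros) auto
    moreover have i3: "integrable lborel (\<lambda>x. g' x b * (\<phi> (x - c) - \<phi> x))"
      using c1 pc g(2) K g'0 by (intro integrable_lborel_continuous_compact_support[where K=K] continuous_intros) auto
    moreover have "(LINT x|lborel. g x * (\<phi>' (x - c) b - \<phi>' x b) + g' x b * (\<phi> (x - c) - \<phi> x)) =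
       ((LINT x|lborel. \<phi>' (x - c) b * g x) - (LINT x|lborel. \<phi>' x b * g x)) + (LINT x|lborel. g' x b * (\<phi> (x - c) - \<phi> x))"
      using i1 i2 i3 by (simp add: right_diff_distrib mult.commute)
    ultimately have E2: "(LINT x|lborel. \<phi>' (x - c) b * g x) - (LINT x|lborel. \<phi>' x b * g x) = - (LINT x|lborel. g' x b * (\<phi> (x - c) - \<phi> x))"
      by linarith
    have "(LINT x|lborel. g' x b * ((\<phi> (x + (- h n) *\<^sub>R a) - \<phi> x) / (- h n))) = (LINT x|lborel. g' x b * (\<phi> (x - c) - \<phi> x)) / (- h n)"
      by (simp add: c_def)
    then show ?thesis using E1 E2 h(2)[of n] by simp
  qed
  have "(LINT x|lborel. (indicator K' x * \<phi>' x b) * g' x a) = (LINT x|lborel. g' x b * \<phi>' x a)"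
    using LIMSEQ_unique[OF L1] L2 unfolding eq by blast
  moreover have "(indicator K' x * \<phi>' x b) * g' x a = g' x a * \<phi>' x b" for x
    using g'0[of x a] inK'[of x 0] by (auto simp: indicator_def)
  ultimately show ?thesis by (simp only:)
qed

section \<open>Bump functions and convolution\<close>

text \<open>With a polynomial in 1/t as prefactor the family is closed under differentiation up to
  constants, which is what coinduction needs; \<open>flat_fun 1\<close> is the classical
  exp(-1/t).\<close>

definition flat_fun :: "real poly \<Rightarrow> real \<Rightarrow> real" where
  "flat_fun p t = (if t > 0 then poly p (1 / t) * exp (- (1 / t)) else 0)"

lemma poly_mult_exp_tendsto_0: "((\<lambda>y::real. poly p y * exp (- y)) \<longlongrightarrow> 0) at_top"
proof -
  have "((\<lambda>y::real. \<Sum>i\<le>degree p. coeff p i * (y ^ i / exp y)) \<longlongrightarrow> (\<Sum>i\<le>degree p. coeff p i * 0)) at_top"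
    by (intro tendsto_sum tendsto_mult tendsto_const tendsto_power_div_exp_0)
  moreover have "(\<Sum>i\<le>degree p. coeff p i * (y ^ i / exp y)) = poly p y * exp (- y)" for y
    unfolding poly_altdef sum_distrib_right by (rule sum.cong) (simp_all add: exp_minus divide_inverse)
  ultimately show ?thesis by simp
qed

text \<open>In the variable y = 1/t one has d/dt = -y^2 d/dy, and p(y) exp(-y) has the derivative
  (p' - p) exp(-y). At t = 0 the right difference quotient is y p(y) exp(-y) with y tending to
  infinity, hence tends to 0.\<close>

lemma flat_fun_has_real_derivative:
  "(flat_fun p has_real_derivative flat_fun ([:0, 0, 1:] * (p - pderiv p)) t) (at t)"
proof -
  consider "t > 0" | "t < 0" | "t = 0" by linarith
  then show ?thesis
  proof cases
    case 1
    have "((\<lambda>t. poly p (1 / t) * exp (- (1 / t))) has_real_derivative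
        (poly (pderiv p) (1 / t) * (- 1 / t\<^sup>2) * exp (- (1 / t)) + exp (- (1 / t)) * (1 / t\<^sup>2) * poly p (1 / t))) (at t)"
    proof -
      have a: "((\<lambda>t. 1 / t) has_real_derivative (- 1 / t\<^sup>2)) (at t)"
        using 1 by (auto intro!: derivative_eq_intros simp: power2_eq_square field_simps)
      have b: "((\<lambda>t. poly p (1 / t)) has_real_derivative (poly (pderiv p) (1 / t) * (- 1 / t\<^sup>2))) (at t)"
        using DERIV_chain2[OF poly_DERIV a] .
      have c: "((\<lambda>t. exp (- (1 / t))) has_real_derivative (exp (- (1 / t)) * (1 / t\<^sup>2))) (at t)"
        using DERIV_chain2[OF DERIV_exp DERIV_minus[OF a]] by simp
      show ?thesis using DERIV_mult[OF b c] by (simp add: add_ac)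
    qed
    moreover have "poly (pderiv p) (1 / t) * (- 1 / t\<^sup>2) * exp (- (1 / t)) + exp (- (1 / t)) * (1 / t\<^sup>2) * poly p (1 / t)
        = flat_fun ([:0, 0, 1:] * (p - pderiv p)) t"
      using 1 by (simp add: flat_fun_def power2_eq_square field_simps)
    ultimately have d: "((\<lambda>t. poly p (1 / t) * exp (- (1 / t))) has_real_derivative flat_fun ([:0, 0, 1:] * (p - pderiv p)) t) (at t)"
      by simp
    have "((\<lambda>t. poly p (1 / t) * exp (- (1 / t))) has_derivative (*) (flat_fun ([:0, 0, 1:] * (p - pderiv p)) t)) (at t)"
      using d by (simp only: has_field_derivative_def)
    then have "(flat_fun p has_derivative (*) (flat_fun ([:0, 0, 1:] * (p - pderiv p)) t)) (at t)"
      by (rule has_derivative_transform_within_open[of _ _ _ _ "{0<..}"]) (use 1 in \<open>auto simp: flat_fun_def\<close>)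
    then show ?thesis by (simp only: has_field_derivative_def)
  next
    case 2
    have "((\<lambda>t. 0 :: real) has_derivative (\<lambda>h. 0)) (at t)" by (rule has_derivative_const)
    then have "(flat_fun p has_derivative (\<lambda>h. 0)) (at t)"
      by (rule has_derivative_transform_within_open[of _ _ _ _ "{..<0}"]) (use 2 in \<open>auto simp: flat_fun_def\<close>)
    moreover have "(*) (flat_fun ([:0, 0, 1:] * (p - pderiv p)) t) = (\<lambda>h. 0)" using 2 by (auto simp: flat_fun_def)
    ultimately show ?thesis by (simp only: has_field_derivative_def)
  next
    case 3
    have "((\<lambda>y. poly ([:0, 1:] * p) y * exp (- y)) \<longlongrightarrow> 0) at_top" by (rule poly_mult_exp_tendsto_0)
    from filterlim_compose[OF this filterlim_inverse_at_top_right]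
    have "((\<lambda>s. poly ([:0, 1:] * p) (inverse s) * exp (- inverse s)) \<longlongrightarrow> 0) (at_right 0)" .
    then have r: "((\<lambda>s. flat_fun p s / s) \<longlongrightarrow> 0) (at_right 0)"
      by (rule Lim_transform_eventually)
         (auto simp: eventually_at_filter flat_fun_def field_simps)
    have l: "((\<lambda>s. flat_fun p s / s) \<longlongrightarrow> 0) (at_left 0)"
      by (rule tendsto_eventually) (auto simp: eventually_at_filter flat_fun_def)
    have "((\<lambda>s. flat_fun p s / s) \<longlongrightarrow> 0) (at 0)" using filterlim_split_at[OF l r] .
    then show ?thesis using 3 by (simp add: DERIV_def flat_fun_def)
  qed
qed

lemma smooth_realI:
  fixes f :: "real \<Rightarrow> real"
  assumes "P f" "\<And>f. P f \<Longrightarrow> \<exists>f'. (\<forall>t. (f has_real_derivative f' t) (at t)) \<and> (\<forall>c. P (\<lambda>t. f' t * c))"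
  shows "smooth f"
proof (rule smooth_coinduct[where P=P])
  fix f assume "P f"
  from assms(2)[OF this] obtain f' where f': "\<And>t. (f has_real_derivative f' t) (at t)" "\<And>c. P (\<lambda>t. f' t * c)"
    by blast
  then show "\<exists>f'. (\<forall>x. (f has_derivative f' x) (at x)) \<and> (\<forall>h. P (\<lambda>x. f' x h))"
    by (intro exI[of _ "\<lambda>t c. f' t * c"]) (simp add: has_field_derivative_def)
qed (rule assms(1))

lemma smooth_flat_fun: "smooth (flat_fun p)"
proof (rule smooth_realI[where P="\<lambda>f. \<exists>c p. f = (\<lambda>t. c * flat_fun p t)"])
  show "\<exists>c q. flat_fun p = (\<lambda>t. c * flat_fun q t)" by (intro exI[of _ 1] exI[of _ p]) auto
next
  fix f assume "\<exists>c p. f = (\<lambda>t. c * flat_fun p t)"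
  then obtain c p where f: "f = (\<lambda>t. c * flat_fun p t)" by blast
  show "\<exists>f'. (\<forall>t. (f has_real_derivative f' t) (at t)) \<and> (\<forall>d. \<exists>c p. (\<lambda>t. f' t * d) = (\<lambda>t. c * flat_fun p t))"
  proof (intro exI conjI allI)
    fix t show "(f has_real_derivative c * flat_fun ([:0, 0, 1:] * (p - pderiv p)) t) (at t)"
      unfolding f by (rule DERIV_cmult[OF flat_fun_has_real_derivative])
    fix d show "(\<lambda>t. c * flat_fun ([:0, 0, 1:] * (p - pderiv p)) t * d) =
      (\<lambda>t. (c * d) * flat_fun ([:0, 0, 1:] * (p - pderiv p)) t)" by (simp add: mult_ac)
  qed
qed

lemma smooth_antiderivative:
  assumes f: "smooth (f :: real \<Rightarrow> real)"
  obtains F where "smooth F" "\<And>t. (F has_real_derivative f t) (at t)"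
proof -
  have "\<exists>F. \<forall>x. -\<infinity> < ereal x \<longrightarrow> ereal x < \<infinity> \<longrightarrow> (F has_vector_derivative f x) (at x)"
    by (rule einterval_antiderivative)
       (use smooth_continuous[OF f] in \<open>auto simp: continuous_on_eq_continuous_at\<close>)
  then obtain F where F: "\<And>t. (F has_real_derivative f t) (at t)"
    by (auto simp: has_real_derivative_iff_has_vector_derivative)
  have "smooth F"
  proof (rule smooth_realI[where P="\<lambda>g. g = F \<or> smooth g"])
    fix g assume "g = F \<or> smooth g"
    then show "\<exists>g'. (\<forall>t. (g has_real_derivative g' t) (at t)) \<and> (\<forall>c. (\<lambda>t. g' t * c) = F \<or> smooth (\<lambda>t. g' t * c))"
    proof
      assume "g = F"
      then show ?thesis using F f smooth_mult[OF f smooth_const] by blast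
    next
      assume g: "smooth g"
      have "(g has_real_derivative frechet_derivative g (at t) 1) (at t)" for t
      proof -
        have "frechet_derivative g (at t) h = frechet_derivative g (at t) 1 * h" for h
          using linear_frechet_derivative[OF smooth_differentiable[OF g, of t]]
            linear_scale[of "frechet_derivative g (at t)" h 1] by simp
        then have "frechet_derivative g (at t) = (*) (frechet_derivative g (at t) 1)" by (rule ext)
        with smooth_has_derivative[OF g, of t] show ?thesis by (simp only: has_field_derivative_def)
      qed
      then show ?thesis using smooth_mult[OF smooth_frechet_derivative[OF g] smooth_const]
        by (intro exI[of _ "\<lambda>t. frechet_derivative g (at t) 1"]) auto
    qed
  qed simp
  with F show ?thesis using that by blast
qed

text \<open>The primitive B climbs from 0 to the mass k of the bump and is constant on either side.
  Products B(z1) b(z2) later serve as kernels whose first partial derivative is a mollifier; from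
  them a stream function is built.\<close>

lemma smooth_bump_exists:
  obtains b B :: "real \<Rightarrow> real" and k where "smooth b" "smooth B" "\<And>t. b t \<ge> 0" "\<And>t. \<bar>t\<bar> \<ge> 1 \<Longrightarrow> b t = 0" "b 0 > 0"
    "\<And>t. (B has_real_derivative b t) (at t)" "\<And>t. t \<le> -1 \<Longrightarrow> B t = 0" "\<And>t. t \<ge> 1 \<Longrightarrow> B t = k"
proof -
  define b where "b t = flat_fun 1 (1 + 1 \<bullet> t) * flat_fun 1 (1 + (-1) \<bullet> t)" for t :: real
  have b: "smooth b" unfolding b_def by (intro smooth_mult smooth_compose_affine smooth_flat_fun)
  have b0: "b t \<ge> 0" for t by (auto simp: b_def flat_fun_def)
  have b1: "b t = 0" if "\<bar>t\<bar> \<ge> 1" for t using that by (auto simp: b_def flat_fun_def)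
  have b2: "b 0 > 0" by (auto simp: b_def flat_fun_def)
  obtain F where F: "smooth F" "\<And>t. (F has_real_derivative b t) (at t)" using smooth_antiderivative[OF b] by blast
  define B where "B t = F t + (- F (-1))" for t
  have B: "smooth B" unfolding B_def by (intro smooth_add F smooth_const)
  have dB: "(B has_real_derivative b t) (at t)" for t unfolding B_def using F(2) by (auto intro!: derivative_eq_intros)
  have cB: "continuous_on S B" for S using smooth_continuous[OF B] continuous_on_subset by blast
  have dz: "(B has_real_derivative 0) (at t)" if "\<bar>t\<bar> \<ge> 1" for t
    using dB[of t] b1[OF that] by simp
  have Bl: "B t = B (-1)" if "t \<le> -1" for t
  proof (cases "t = -1")
    case False
    then have "t < -1" using that by simp
    then show ?thesis
      by (intro DERIV_isconst_end[of t "-1" B, symmetric] cB) (use dz in auto)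
  qed simp
  have Br: "B t = B 1" if "t \<ge> 1" for t
  proof (cases "t = 1")
    case False
    then have "1 < t" using that by simp
    then show ?thesis
      by (intro DERIV_isconst_end[of 1 t B] cB) (use dz in auto)
  qed simp
  have "B (-1) = 0" by (simp add: B_def)
  then have "B t = 0" if "t \<le> -1" for t using Bl[OF that] by simp
  from that[OF b B b0 b1 b2 dB this Br] show ?thesis .
qed

section \<open>Convolution with an integrable function of bounded support\<close>

lemma frechet_derivative_Basis_sum:
  fixes k :: "'a::euclidean_space \<Rightarrow> real"
  assumes "k differentiable (at x)"
  shows "frechet_derivative k (at x) h = (\<Sum>i\<in>Basis. (h \<bullet> i) * frechet_derivative k (at x) i)"
proof -
  have lin: "linear (frechet_derivative k (at x))" using linear_frechet_derivative[OF assms] .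
  have "frechet_derivative k (at x) h = frechet_derivative k (at x) (\<Sum>i\<in>Basis. (h \<bullet> i) *\<^sub>R i)"
    by (simp add: euclidean_representation)
  also have "\<dots> = (\<Sum>i\<in>Basis. (h \<bullet> i) * frechet_derivative k (at x) i)"
    by (simp add: linear_sum[OF lin] linear_scale[OF lin])
  finally show ?thesis .
qed

lemma integrable_mult_continuous:
  fixes w k :: "'a::euclidean_space \<Rightarrow> real"
  assumes w: "integrable lborel w" "\<And>y. norm y > R \<Longrightarrow> w y = 0" and k: "continuous_on UNIV k"
  shows "integrable lborel (\<lambda>y. w y * k y)"
proof -
  have "bounded (k ` cball 0 R)"
    using k by (intro compact_imp_bounded compact_continuous_image) (auto intro: continuous_on_subset)
  then obtain C where "\<forall>y\<in>cball 0 R. \<bar>k y\<bar> \<le> C" by (auto simp: bounded_iff)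
  then have C: "\<bar>k y\<bar> \<le> C" if "norm y \<le> R" for y using that by auto
  show ?thesis
  proof (rule Bochner_Integration.integrable_bound)
    show "integrable lborel (\<lambda>y. \<bar>C\<bar> * \<bar>w y\<bar>)" using w by auto
    show "(\<lambda>y. w y * k y) \<in> borel_measurable lborel"
      using borel_measurable_integrable[OF w(1)] borel_measurable_continuous_onI[OF k] by auto
    show "AE y in lborel. norm (w y * k y) \<le> norm (\<bar>C\<bar> * \<bar>w y\<bar>)"
    proof (intro AE_I2)
      fix y show "norm (w y * k y) \<le> norm (\<bar>C\<bar> * \<bar>w y\<bar>)"
      proof (cases "norm y > R")
        case False
        then have "\<bar>k y\<bar> \<le> \<bar>C\<bar>" using C[of y] by linarith
        then show ?thesis by (simp add: abs_mult mult.commute mult_right_mono)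
      qed (simp add: w(2))
    qed
  qed
qed

text \<open>As w is merely integrable, the derivative has to fall on k. The derivative of k is
  uniformly continuous on the bounded set of arguments that occur, so the linearisation error is
  small uniformly in y and survives integration against |w|.\<close>

lemma convolution_has_derivative:
  fixes w k :: "'a::euclidean_space \<Rightarrow> real"
  assumes w: "integrable lborel w" "\<And>y. norm y > R \<Longrightarrow> w y = 0" and k: "smooth k"
  shows "((\<lambda>x. LINT y|lborel. w y * k (x - l *\<^sub>R y)) has_derivative
     (\<lambda>h. LINT y|lborel. w y * frechet_derivative k (at (x - l *\<^sub>R y)) h)) (at x)"
proof -
  have kc: "continuous_on UNIV (\<lambda>y. g (x - l *\<^sub>R y))" if "smooth g" for g :: "'a \<Rightarrow> real" and x
    by (intro continuous_on_compose2[OF smooth_continuous[OF that]] continuous_intros) auto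
  have I: "integrable lborel (\<lambda>y. w y * g (x - l *\<^sub>R y))" if "smooth g" for g :: "'a \<Rightarrow> real" and x
    using integrable_mult_continuous[OF w kc[OF that]] .
  define D where "D z h = frechet_derivative k (at z) h" for z h
  have Ds: "smooth (\<lambda>z. D z h)" for h unfolding D_def by (rule smooth_frechet_derivative[OF k])
  have Dlin: "linear (D z)" for z
    unfolding D_def using linear_frechet_derivative[OF smooth_differentiable[OF k]] .
  have Dd: "(k has_derivative D z) (at z)" for z
    unfolding D_def using smooth_has_derivative[OF k, of z] by simp
  define M where "M = (LINT y|lborel. \<bar>w y\<bar>)"
  have M: "M \<ge> 0" unfolding M_def by simp
  \<comment> \<open>Every argument of k that occurs for increments of length at most 1 lies in the
    ball of this radius.\<close>
  define R' where "R' = norm x + 1 + \<bar>l\<bar> * \<bar>R\<bar>"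
  show ?thesis
    unfolding has_derivative_at_alt D_def[symmetric]
  proof (intro conjI allI impI)
    have "linear (\<lambda>h. LINT y|lborel. w y * D (x - l *\<^sub>R y) h)"
    proof (rule linearI)
      fix a b and c :: real
      show "(LINT y|lborel. w y * D (x - l *\<^sub>R y) (a + b)) = (LINT y|lborel. w y * D (x - l *\<^sub>R y) a) + (LINT y|lborel. w y * D (x - l *\<^sub>R y) b)"
        using I[OF Ds] by (subst Bochner_Integration.integral_add[symmetric]) (auto simp: linear_add[OF Dlin] distrib_left)
      show "(LINT y|lborel. w y * D (x - l *\<^sub>R y) (c *\<^sub>R a)) = c *\<^sub>R (LINT y|lborel. w y * D (x - l *\<^sub>R y) a)"
        by (simp add: linear_scale[OF Dlin] mult.left_commute)
    qed
    then show "bounded_linear (\<lambda>h. LINT y|lborel. w y * D (x - l *\<^sub>R y) h)"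
      by (simp add: linear_conv_bounded_linear)
  next
    fix e :: real assume e: "e > 0"
    \<comment> \<open>\<open>DIM('a)\<close> pays for passing from basis directions to all
      directions, \<open>M + 1\<close> for integrating against |w|; the 1 keeps the denominator
      positive when w vanishes.\<close>
    define e' where "e' = e / (real DIM('a) * (M + 1))"
    have e': "e' > 0" using e M by (simp add: e'_def)
    have "\<exists>d>0. \<forall>z\<in>cball 0 R'. \<forall>z'\<in>cball 0 R'. dist z' z < d \<longrightarrow> \<bar>D z' i - D z i\<bar> < e'" for i
    proof -
      have "uniformly_continuous_on (cball 0 R') (\<lambda>z. D z i)"
        using smooth_continuous[OF Ds] by (intro compact_uniformly_continuous) (auto intro: continuous_on_subset)
      then show ?thesis using e' unfolding uniformly_continuous_on_def by (auto simp: dist_real_def)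
    qed
    then obtain d where d: "\<And>i. d i > 0" "\<And>i z z'. z \<in> cball 0 R' \<Longrightarrow> z' \<in> cball 0 R' \<Longrightarrow> dist z' z < d i \<Longrightarrow> \<bar>D z' i - D z i\<bar> < e'"
      by metis
    define \<delta> where "\<delta> = min 1 (Min (d ` Basis))"
    have \<delta>: "\<delta> > 0" "\<delta> \<le> 1" "\<And>i. i \<in> Basis \<Longrightarrow> \<delta> \<le> d i"
      unfolding \<delta>_def using d(1) by (auto simp: min_le_iff_disj)
    show "\<exists>\<delta>>0. \<forall>x'. norm (x' - x) < \<delta> \<longrightarrow>
        norm ((LINT y|lborel. w y * k (x' - l *\<^sub>R y)) - (LINT y|lborel. w y * k (x - l *\<^sub>R y)) -
          (LINT y|lborel. w y * D (x - l *\<^sub>R y) (x' - x))) \<le> e * norm (x' - x)"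
    proof (intro exI conjI allI impI)
      fix x' assume x': "norm (x' - x) < \<delta>"
      have pt: "\<bar>k (x' - l *\<^sub>R y) - k (x - l *\<^sub>R y) - D (x - l *\<^sub>R y) (x' - x)\<bar> \<le> norm (x' - x) * (real DIM('a) * e')"
        if y: "norm y \<le> R" for y
      proof -
        define z where "z = x - l *\<^sub>R y"
        have ly: "norm (l *\<^sub>R y) \<le> \<bar>l\<bar> * \<bar>R\<bar>" using y by (auto intro!: mult_left_mono)
        have zz: "\<xi> \<in> cball 0 R'" if "norm (\<xi> - z) < \<delta>" for \<xi>
        proof -
          have "norm \<xi> \<le> norm (\<xi> - z) + norm x + norm (l *\<^sub>R y)"
            unfolding z_def using norm_triangle_ineq[of "\<xi> - (x - l *\<^sub>R y)" "x - l *\<^sub>R y"] norm_triangle_ineq4[of x "l *\<^sub>R y"] by simp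
          then show ?thesis using that \<delta>(2) ly by (simp add: R'_def)
        qed
        have "norm (k (x' - l *\<^sub>R y) - k z - D z ((x' - l *\<^sub>R y) - z)) \<le> norm ((x' - l *\<^sub>R y) - z) * (real DIM('a) * e')"
        proof (rule differentiable_bound_linearization[where S="ball z \<delta>" and f'=D])
          show "z + t *\<^sub>R (x' - l *\<^sub>R y - z) \<in> ball z \<delta>" if "t \<in> {0..1}" for t
          proof -
            have "\<bar>t\<bar> * norm (x' - x) \<le> 1 * norm (x' - x)" using that by (intro mult_right_mono) auto
            then show ?thesis using x' by (simp add: z_def dist_norm)
          qed
          show "(k has_derivative D \<xi>) (at \<xi> within ball z \<delta>)" for \<xi>
            using Dd by (rule has_derivative_at_withinI)
          show "z \<in> ball z \<delta>" using \<delta> by simp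
          fix \<xi> assume xi: "\<xi> \<in> ball z \<delta>"
          show "onorm (D \<xi> - D z) \<le> real DIM('a) * e'"
            unfolding fun_diff_def
          proof (rule onorm_le)
            fix v
            have "norm (D \<xi> v - D z v) = \<bar>\<Sum>i\<in>Basis. (v \<bullet> i) * (D \<xi> i - D z i)\<bar>"
              unfolding D_def using smooth_differentiable[OF k]
              by (subst (1 2) frechet_derivative_Basis_sum) (auto simp: sum_subtractf right_diff_distrib)
            also have "\<dots> \<le> (\<Sum>i\<in>(Basis :: 'a set). norm v * e')"
            proof (rule order_trans[OF sum_abs], rule sum_mono)
              fix i :: 'a assume i: "i \<in> Basis"
              have "\<bar>D \<xi> i - D z i\<bar> < e'"
                using xi zz[of \<xi>] zz[of z] \<delta>(1) \<delta>(3)[OF i] by (intro d(2)) (auto simp: dist_norm norm_minus_commute)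
              moreover have "\<bar>v \<bullet> i\<bar> \<le> norm v" using i by (rule Basis_le_norm)
              ultimately show "\<bar>(v \<bullet> i) * (D \<xi> i - D z i)\<bar> \<le> norm v * e'"
                unfolding abs_mult by (intro mult_mono) auto
            qed
            finally show "norm (D \<xi> v - D z v) \<le> real DIM('a) * e' * norm v" by (simp add: mult_ac)
          qed
        qed
        then show ?thesis by (simp add: z_def)
      qed
      have "(LINT y|lborel. w y * k (x' - l *\<^sub>R y)) - (LINT y|lborel. w y * k (x - l *\<^sub>R y)) - (LINT y|lborel. w y * D (x - l *\<^sub>R y) (x' - x))
         = (LINT y|lborel. w y * (k (x' - l *\<^sub>R y) - k (x - l *\<^sub>R y) - D (x - l *\<^sub>R y) (x' - x)))"
        using I[OF k] I[OF Ds] by (simp add: right_diff_distrib)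
      also have "norm \<dots> \<le> (LINT y|lborel. \<bar>w y\<bar> * (norm (x' - x) * (real DIM('a) * e')))"
      proof (rule order_trans[OF integral_norm_bound], rule integral_mono)
        show "integrable lborel (\<lambda>y. norm (w y * (k (x' - l *\<^sub>R y) - k (x - l *\<^sub>R y) - D (x - l *\<^sub>R y) (x' - x))))"
          using I[OF k] I[OF Ds] by (intro integrable_norm) (simp add: right_diff_distrib)
        show "integrable lborel (\<lambda>y. \<bar>w y\<bar> * (norm (x' - x) * (real DIM('a) * e')))" using w by auto
        fix y
        show "norm (w y * (k (x' - l *\<^sub>R y) - k (x - l *\<^sub>R y) - D (x - l *\<^sub>R y) (x' - x)))
            \<le> \<bar>w y\<bar> * (norm (x' - x) * (real DIM('a) * e'))"
        proof (cases "norm y \<le> R")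
          case True
          then show ?thesis using pt[OF True] by (simp add: abs_mult mult_left_mono)
        next
          case False
          then have "w y = 0" using w(2)[of y] by simp
          then show ?thesis by simp
        qed
      qed
      also have "\<dots> = M * (norm (x' - x) * (real DIM('a) * e'))" by (simp add: M_def)
      also have "\<dots> = norm (x' - x) * e * (M / (M + 1))" using M by (simp add: e'_def)
      also have "\<dots> \<le> norm (x' - x) * e * 1" using M e by (intro mult_left_mono) auto
      finally show "norm ((LINT y|lborel. w y * k (x' - l *\<^sub>R y)) - (LINT y|lborel. w y * k (x - l *\<^sub>R y)) -
          (LINT y|lborel. w y * D (x - l *\<^sub>R y) (x' - x))) \<le> e * norm (x' - x)" by (simp add: mult.commute)
    qed (rule \<delta>(1))
  qed
qed

lemma smooth_convolution:
  fixes w k :: "'a::euclidean_space \<Rightarrow> real"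
  assumes w: "integrable lborel w" "\<And>y. norm y > R \<Longrightarrow> w y = 0" and k: "smooth k"
  shows "smooth (\<lambda>x. LINT y|lborel. w y * k (x - l *\<^sub>R y))"
proof (rule smooth_coinduct[where P="\<lambda>f. \<exists>k. smooth k \<and> f = (\<lambda>x. LINT y|lborel. w y * k (x - l *\<^sub>R y))"])
  fix f assume "\<exists>k. smooth k \<and> f = (\<lambda>x. LINT y|lborel. w y * k (x - l *\<^sub>R y))"
  then obtain k where k: "smooth k" and f: "f = (\<lambda>x. LINT y|lborel. w y * k (x - l *\<^sub>R y))" by auto
  show "\<exists>f'. (\<forall>x. (f has_derivative f' x) (at x)) \<and>
    (\<forall>h. \<exists>k. smooth k \<and> (\<lambda>x. f' x h) = (\<lambda>x. LINT y|lborel. w y * k (x - l *\<^sub>R y)))"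
    unfolding f
    using convolution_has_derivative[OF w k] smooth_frechet_derivative[OF k]
    by (intro exI[of _ "\<lambda>x h. LINT y|lborel. w y * frechet_derivative k (at (x - l *\<^sub>R y)) h"]) blast
qed (use k in auto)

section \<open>Contracting mollification\<close>

text \<open>Clipping at C and cutting off outside S turns almost everywhere bounds into pointwise
  ones, so that later estimates have no exceptional sets.\<close>

lemma bounded_borel_representative:
  fixes f :: "'a::euclidean_space \<Rightarrow> real"
  assumes f: "f \<in> borel_measurable (lebesgue_on S)" and S: "S \<in> sets borel"
    and b: "AE x in lebesgue_on S. \<bar>f x\<bar> \<le> C" and C: "C \<ge> 0"
  obtains g where "g \<in> borel_measurable borel" "\<And>x. \<bar>g x\<bar> \<le> C" "\<And>x. x \<notin> S \<Longrightarrow> g x = 0"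
    "AE x in lebesgue_on S. f x = g x"
    "\<And>h. h \<in> borel_measurable borel \<Longrightarrow> (LINT x|lebesgue_on S. f x * h x) = (LINT x|lborel. g x * h x)"
proof -
  have Sl: "S \<in> sets lebesgue" using S by auto
  obtain g0 where g0: "g0 \<in> borel_measurable borel" "AE z in lborel. indicator S z *\<^sub>R f z = g0 z"
    using lebesgue_on_ex_borel[OF f Sl] by blast
  define g where "g x = indicator S x * max (- C) (min C (g0 x))" for x
  have gm: "g \<in> borel_measurable borel" unfolding g_def using g0(1) S by measurable
  have "AE x in lborel. x \<in> S \<longrightarrow> \<bar>f x\<bar> \<le> C" using b unfolding AE_lebesgue_on_iff[OF Sl] .
  then have "AE x in lborel. indicator S x *\<^sub>R f x = g x"
    using g0(2) by eventually_elim (auto simp: g_def indicator_def)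
  then have "AE x in lborel. x \<in> S \<longrightarrow> f x = g x"
    by eventually_elim (auto simp: indicator_def)
  then have ae': "AE x in lebesgue_on S. f x = g x" unfolding AE_lebesgue_on_iff[OF Sl] .
  have g0S: "g x = 0" if "x \<notin> S" for x using that by (simp add: g_def)
  have "(LINT x|lebesgue_on S. f x * h x) = (LINT x|lborel. g x * h x)" if h: "h \<in> borel_measurable borel" for h
  proof -
    have hm: "(\<lambda>x. g x * h x) \<in> borel_measurable borel" using gm h by auto
    have "(LINT x|lebesgue_on S. f x * h x) = (LINT x|lebesgue_on S. g x * h x)"
    proof (rule integral_cong_AE)
      show "(\<lambda>x. f x * h x) \<in> borel_measurable (lebesgue_on S)"
        using f h by (intro borel_measurable_times) (auto intro!: measurable_restrict_space1 measurable_completion)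
      show "(\<lambda>x. g x * h x) \<in> borel_measurable (lebesgue_on S)"
        using hm by (auto intro!: measurable_restrict_space1 measurable_completion)
      show "AE x in lebesgue_on S. f x * h x = g x * h x" using ae' by eventually_elim simp
    qed
    also have "\<dots> = (LINT x|lebesgue. indicator S x *\<^sub>R (g x * h x))"
      using Sl by (intro integral_restrict_space) auto
    also have "\<dots> = (LINT x|lebesgue. g x * h x)"
      by (intro Bochner_Integration.integral_cong) (auto simp: indicator_def g0S)
    also have "\<dots> = (LINT x|lborel. g x * h x)" using hm by (intro integral_completion) auto
    finally show ?thesis .
  qed
  moreover have "\<bar>g x\<bar> \<le> C" for x using C by (auto simp: g_def indicator_def)
  ultimately show ?thesis using that[of g] gm g0S ae' by blast
qed

lemma lborel_integral_affine:
  fixes f :: "'a::euclidean_space \<Rightarrow> real"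
  assumes f: "f \<in> borel_measurable borel" and c: "c \<noteq> 0"
  shows "(LINT x|lborel. f x) = \<bar>c\<bar> ^ DIM('a) * (LINT x|lborel. f (t + c *\<^sub>R x))"
proof -
  have "(LINT x|lborel. f x) = (LINT x|density (distr lborel borel (\<lambda>x. t + c *\<^sub>R x)) (\<lambda>_. \<bar>c\<bar> ^ DIM('a)). f x)"
    using lborel_affine[OF c, of t] by simp
  also have "\<dots> = (LINT x|distr lborel borel (\<lambda>x. t + c *\<^sub>R x). \<bar>c\<bar> ^ DIM('a) *\<^sub>R f x)"
    using f by (intro integral_density) auto
  also have "\<dots> = (LINT x|lborel. \<bar>c\<bar> ^ DIM('a) *\<^sub>R f (t + c *\<^sub>R x))"
    using f by (intro integral_distr) auto
  finally show ?thesis by simp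
qed

lemma lborel_integrable_affine:
  fixes f :: "'a::euclidean_space \<Rightarrow> real"
  assumes f: "integrable lborel f" and c: "c \<noteq> 0"
  shows "integrable lborel (\<lambda>x. f (t + c *\<^sub>R x))"
proof -
  have fm: "f \<in> borel_measurable borel" using borel_measurable_integrable[OF f] by simp
  have "integrable (density (distr lborel borel (\<lambda>x. t + c *\<^sub>R x)) (\<lambda>_. \<bar>c\<bar> ^ DIM('a))) f"
    using lborel_affine[OF c, of t] f by simp
  then have "integrable (distr lborel borel (\<lambda>x. t + c *\<^sub>R x)) (\<lambda>x. \<bar>c\<bar> ^ DIM('a) *\<^sub>R f x)"
    using fm by (subst (asm) integrable_density) auto
  then have "integrable lborel (\<lambda>x. \<bar>c\<bar> ^ DIM('a) *\<^sub>R f (t + c *\<^sub>R x))"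
    using fm by (subst (asm) integrable_distr_eq) auto
  then show ?thesis using c by simp
qed

text \<open>A mollification that at the same time contracts the domain by the factor \<open>1 - 2\<epsilon>\<close>, so that
  the mollified field is supported inside the original domain.\<close>

lemma contracted_mollifier_weak_limit:
  fixes G w \<eta> :: "'a::euclidean_space \<Rightarrow> real" and \<epsilon> :: "nat \<Rightarrow> real"
  assumes G: "G \<in> borel_measurable borel" "\<And>x. \<bar>G x\<bar> \<le> C" "\<And>x. x \<notin> S \<Longrightarrow> G x = 0"
    and w: "w \<in> borel_measurable borel" "\<And>x. \<bar>w x\<bar> \<le> C" "\<And>x. x \<notin> S \<Longrightarrow> w x = 0"
    and S: "bounded S" "open S"
    and \<eta>: "continuous_on UNIV \<eta>" "\<And>x. \<eta> x \<ge> 0" "compact K" "\<And>x. x \<notin> K \<Longrightarrow> \<eta> x = 0"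
    and \<epsilon>: "\<epsilon> \<longlonglongrightarrow> 0" "\<And>n. \<epsilon> n > 0" "\<And>n. \<epsilon> n \<le> 1 / 3"
    and inS: "\<And>n s y. y \<in> S \<Longrightarrow> s \<in> K \<Longrightarrow> (1 - 2 * \<epsilon> n) *\<^sub>R y + \<epsilon> n *\<^sub>R s \<in> S"
  shows "(\<lambda>n. (LINT x|lborel. G x * (LINT y|lborel. w y * \<eta> ((1 / \<epsilon> n) *\<^sub>R (x - (1 - 2 * \<epsilon> n) *\<^sub>R y)))) / \<epsilon> n ^ DIM('a))
    \<longlonglongrightarrow> (LINT s|lborel. \<eta> s) * (LINT y|lborel. G y * w y)"
proof -
  \<comment> \<open>The bound \<epsilon> \<le> 1/3 keeps this contraction factor at least 1/3; that
    is the origin of \<open>3 ^ DIM('a)\<close> in the estimates below.\<close>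
  define l where "l n = 1 - 2 * \<epsilon> n" for n
  have l: "l n \<ge> 1 / 3" "l n \<le> 1" for n using \<epsilon>(2,3)[of n] by (auto simp: l_def)
  define E where "E n = \<epsilon> n ^ DIM('a)" for n
  have E: "E n > 0" for n using \<epsilon>(2) by (simp add: E_def)
  define H where "H n x y = \<eta> ((1 / \<epsilon> n) *\<^sub>R (x - l n *\<^sub>R y))" for n x y
  define c where "c = (LINT s|lborel. \<eta> s)"
  have \<eta>i: "integrable lborel \<eta>" by (rule integrable_lborel_continuous_compact_support[OF \<eta>(1,3,4)])
  have \<eta>m: "\<eta> \<in> borel_measurable borel" by (rule borel_measurable_continuous_onI[OF \<eta>(1)])
  have c: "c \<ge> 0" unfolding c_def using \<eta>(2) by simp
  obtain D where D: "D \<ge> 0" "\<And>x. \<bar>\<eta> x\<bar> \<le> D"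
    using continuous_compact_support_bounded[OF \<eta>(1,3,4)] by metis
  have C: "C \<ge> 0" using G(2)[of undefined] by linarith
  have Sm: "emeasure lborel S < \<infinity>" "S \<in> sets borel"
    using emeasure_bounded_finite[OF S(1)] S(2) by auto
  have iS: "integrable lborel (indicator S :: 'a \<Rightarrow> real)" using Sm by auto
  have bS: "integrable lborel f" if "f \<in> borel_measurable borel" "\<And>x. \<bar>f x\<bar> \<le> B" "\<And>x. x \<notin> S \<Longrightarrow> f x = 0" for f :: "'a \<Rightarrow> real" and B
  proof (rule Bochner_Integration.integrable_bound)
    show "integrable lborel (\<lambda>x. B * indicator S x)" using iS by auto
    show "AE x in lborel. norm (f x) \<le> norm (B * indicator S x)"
    proof (intro AE_I2)
      fix x show "norm (f x) \<le> norm (B * indicator S x)" using that(2)[of x] that(3)[of x] by (cases "x \<in> S") auto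
    qed
  qed (use that in simp)
  have Gi: "integrable lborel G" using bS[OF G] .
  have wi: "integrable lborel w" using bS[OF w] .
  have Hc: "continuous_on UNIV (\<lambda>p. H n (fst p) (snd p))" for n
    unfolding H_def by (intro continuous_on_compose2[OF \<eta>(1)] continuous_intros) auto
  have Hm: "(\<lambda>p. H n (fst p) (snd p)) \<in> borel_measurable (lborel \<Otimes>\<^sub>M lborel)" for n
    using borel_measurable_continuous_onI[OF Hc] by (simp add: lborel_prod)
  have Hmx: "(\<lambda>x. H n x y) \<in> borel_measurable borel" for n y
    unfolding H_def by (intro borel_measurable_continuous_onI continuous_on_compose2[OF \<eta>(1)] continuous_intros) auto
  have Hmy: "(\<lambda>y. H n x y) \<in> borel_measurable borel" for n x
    unfolding H_def by (intro borel_measurable_continuous_onI continuous_on_compose2[OF \<eta>(1)] continuous_intros) auto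
  have H0: "H n x y \<ge> 0" "\<bar>H n x y\<bar> \<le> D" for n x y unfolding H_def using \<eta>(2) D by auto
  \<comment> \<open>Substitution x = l y + \<epsilon> s: for fixed y the kernel becomes
    \<eta>(s).\<close>
  have IHx: "(LINT x|lborel. f x * H n x y) = E n * (LINT s|lborel. f (l n *\<^sub>R y + \<epsilon> n *\<^sub>R s) * \<eta> s)"
    if "f \<in> borel_measurable borel" for f n y
  proof -
    have "(LINT x|lborel. f x * H n x y) = \<bar>\<epsilon> n\<bar> ^ DIM('a) * (LINT s|lborel. f (l n *\<^sub>R y + \<epsilon> n *\<^sub>R s) * H n (l n *\<^sub>R y + \<epsilon> n *\<^sub>R s) y)"
      using that Hmx[of n y] \<epsilon>(2)[of n] by (intro lborel_integral_affine) auto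
    moreover have "H n (l n *\<^sub>R y + \<epsilon> n *\<^sub>R s) y = \<eta> s" for s
      using \<epsilon>(2)[of n] by (simp add: H_def)
    ultimately show ?thesis using \<epsilon>(2)[of n] by (simp add: E_def)
  qed
  \<comment> \<open>Integrated in the contracted variable y, the kernel picks up the Jacobian
    (\<epsilon>/l)^d, which is at most (3 \<epsilon>)^d.\<close>
  have IHy: "integrable lborel (\<lambda>y. H n x y)" "(LINT y|lborel. H n x y) \<le> E n * (3 ^ DIM('a) * c)" for n x
  proof -
    have k: "\<epsilon> n / l n > 0" "- \<epsilon> n / l n \<noteq> 0" using \<epsilon>(2)[of n] l(1)[of n] by (auto intro!: divide_pos_pos)
    have eq: "H n x ((1 / l n) *\<^sub>R x + (- \<epsilon> n / l n) *\<^sub>R s) = \<eta> s" for s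
      using \<epsilon>(2)[of n] l(1)[of n] by (simp add: H_def algebra_simps)
    have eq2: "H n x y = \<eta> ((1 / \<epsilon> n) *\<^sub>R x + (- l n / \<epsilon> n) *\<^sub>R y)" for y
      by (simp add: H_def algebra_simps)
    show "integrable lborel (\<lambda>y. H n x y)"
      unfolding eq2 using \<epsilon>(2)[of n] l(1)[of n] by (intro lborel_integrable_affine[OF \<eta>i]) auto
    have "(LINT y|lborel. H n x y) = \<bar>- \<epsilon> n / l n\<bar> ^ DIM('a) * c"
      using lborel_integral_affine[OF Hmy k(2), of n x "(1 / l n) *\<^sub>R x"] unfolding eq c_def .
    also have "\<dots> \<le> (3 * \<epsilon> n) ^ DIM('a) * c"
    proof (intro mult_right_mono power_mono c)
      have "\<epsilon> n * 1 \<le> \<epsilon> n * (3 * l n)" using \<epsilon>(2)[of n] l(1)[of n] by (intro mult_left_mono) auto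
      then show "\<bar>- \<epsilon> n / l n\<bar> \<le> 3 * \<epsilon> n" using \<epsilon>(2)[of n] l(1)[of n] by (simp add: divide_le_eq mult_ac)
    qed simp
    finally show "(LINT y|lborel. H n x y) \<le> E n * (3 ^ DIM('a) * c)" by (simp add: E_def power_mult_distrib mult_ac)
  qed
  define A where "A f n = (LINT x|lborel. f x * (LINT y|lborel. w y * H n x y)) / E n" for f n
  have inner: "\<bar>LINT y|lborel. w y * H n x y\<bar> \<le> E n * (C * (3 ^ DIM('a) * c))" for n x
  proof -
    have "\<bar>LINT y|lborel. w y * H n x y\<bar> \<le> (LINT y|lborel. C * H n x y)"
      using IHy(1)[of n x] w(2) H0(1) C
      by (intro order_trans[OF integral_abs_bound integral_mono']) (auto simp: abs_mult intro!: mult_right_mono)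
    also have "\<dots> = C * (LINT y|lborel. H n x y)" by simp
    also have "\<dots> \<le> C * (E n * (3 ^ DIM('a) * c))" using IHy(2)[of n x] C by (intro mult_left_mono) auto
    finally show ?thesis by (simp add: mult_ac)
  qed
  have innerm: "(\<lambda>x. LINT y|lborel. w y * H n x y) \<in> borel_measurable borel" for n
  proof -
    have "(\<lambda>(x, y). w y * H n x y) \<in> borel_measurable (lborel \<Otimes>\<^sub>M lborel)"
      using Hm[of n] measurable_compose[OF measurable_snd, of w lborel borel lborel] w(1)
      by (auto simp: case_prod_beta)
    from lborel.borel_measurable_lebesgue_integral[OF this] show ?thesis by simp
  qed
  \<comment> \<open>A bound by the L1 norm of f, uniform in n. It reduces the convergence to
    functions f that are continuous inside S.\<close>
  have A1: "\<bar>A f n\<bar> \<le> (C * (3 ^ DIM('a) * c)) * (LINT x|lborel. \<bar>f x\<bar>)" if f: "integrable lborel f" for f n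
  proof -
    have "\<bar>LINT x|lborel. f x * (LINT y|lborel. w y * H n x y)\<bar> \<le> (LINT x|lborel. \<bar>f x\<bar> * (E n * (C * (3 ^ DIM('a) * c))))"
    proof (rule order_trans[OF integral_abs_bound])
      show "(LINT x|lborel. \<bar>f x * (LINT y|lborel. w y * H n x y)\<bar>) \<le> (LINT x|lborel. \<bar>f x\<bar> * (E n * (C * (3 ^ DIM('a) * c))))"
      proof (rule integral_mono')
        show "integrable lborel (\<lambda>x. \<bar>f x\<bar> * (E n * (C * (3 ^ DIM('a) * c))))" using f by auto
        show "\<bar>f x * (LINT y|lborel. w y * H n x y)\<bar> \<le> \<bar>f x\<bar> * (E n * (C * (3 ^ DIM('a) * c)))" for x
          unfolding abs_mult using inner[of n x] by (intro mult_left_mono) auto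
      qed (simp add: less_imp_le[OF E] C c)
    qed
    also have "\<dots> = E n * ((C * (3 ^ DIM('a) * c)) * (LINT x|lborel. \<bar>f x\<bar>))" by simp
    finally show ?thesis using E[of n] unfolding A_def by (simp add: divide_le_eq mult_ac)
  qed
  have Ai: "integrable lborel (\<lambda>x. f x * (LINT y|lborel. w y * H n x y))" if f: "integrable lborel f" for f n
  proof (rule Bochner_Integration.integrable_bound)
    show "integrable lborel (\<lambda>x. \<bar>f x\<bar> * (E n * (C * (3 ^ DIM('a) * c))))" using f by auto
    show "(\<lambda>x. f x * (LINT y|lborel. w y * H n x y)) \<in> borel_measurable lborel"
      using borel_measurable_integrable[OF f] innerm by auto
    show "AE x in lborel. norm (f x * (LINT y|lborel. w y * H n x y)) \<le> norm (\<bar>f x\<bar> * (E n * (C * (3 ^ DIM('a) * c))))"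
    proof (intro AE_I2)
      fix x
      have "\<bar>f x\<bar> * \<bar>LINT y|lborel. w y * H n x y\<bar> \<le> \<bar>f x\<bar> * (E n * (C * (3 ^ DIM('a) * c)))"
        using inner[of n x] by (intro mult_left_mono) auto
      also have "\<dots> \<le> \<bar>\<bar>f x\<bar> * (E n * (C * (3 ^ DIM('a) * c)))\<bar>" by (rule abs_ge_self)
      finally show "norm (f x * (LINT y|lborel. w y * H n x y)) \<le> norm (\<bar>f x\<bar> * (E n * (C * (3 ^ DIM('a) * c))))"
        by (simp only: real_norm_def abs_mult)
    qed
  qed
  have main: "(\<lambda>n. A (\<lambda>x. indicator S x * g x) n) \<longlonglongrightarrow> c * (LINT y|lborel. (indicator S y * g y) * w y)"
    if g: "continuous_on UNIV g" "\<And>x. \<bar>g x\<bar> \<le> B" for g B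
  proof -
    define f where "f x = indicator S x * g x" for x
    have gm: "g \<in> borel_measurable borel" by (rule borel_measurable_continuous_onI[OF g(1)])
    have fm: "f \<in> borel_measurable borel" unfolding f_def using Sm(2) gm by auto
    have fb: "\<bar>f x\<bar> \<le> B" for x using g(2)[of x] by (auto simp: f_def indicator_def)
    have B: "B \<ge> 0" using fb[of undefined] by linarith
    have fi: "integrable lborel f" by (rule bS[OF fm fb]) (simp add: f_def)
    have Aeq: "A f n = (LINT y|lborel. w y * (LINT s|lborel. f (l n *\<^sub>R y + \<epsilon> n *\<^sub>R s) * \<eta> s))" for n
    proof -
      have fw: "integrable (lborel \<Otimes>\<^sub>M lborel) (case_prod (\<lambda>x y. f x * w y))"
      proof (rule lborel_pair.Fubini_integrable)
        show "(\<lambda>(x, y). f x * w y) \<in> borel_measurable (lborel \<Otimes>\<^sub>M lborel)" using fm w(1) by measurable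
        show "integrable lborel (\<lambda>x. LINT y|lborel. norm (case (x, y) of (x, y) \<Rightarrow> f x * w y))"
          using fi by (simp add: abs_mult)
        show "AE x in lborel. integrable lborel (\<lambda>y. case (x, y) of (x, y) \<Rightarrow> f x * w y)" using wi by simp
      qed
      have "integrable (lborel \<Otimes>\<^sub>M lborel) (case_prod (\<lambda>x y. f x * (w y * H n x y)))"
      proof (rule Bochner_Integration.integrable_bound)
        show "integrable (lborel \<Otimes>\<^sub>M lborel) (\<lambda>p. D * (case p of (x, y) \<Rightarrow> f x * w y))" using fw by simp
        have "(\<lambda>p. f (fst p) * (w (snd p) * H n (fst p) (snd p))) \<in> borel_measurable (lborel \<Otimes>\<^sub>M lborel)"
          using fm w(1) Hm[of n] by measurable
        then show "(\<lambda>(x, y). f x * (w y * H n x y)) \<in> borel_measurable (lborel \<Otimes>\<^sub>M lborel)"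
          by (simp add: case_prod_beta)
        show "AE p in lborel \<Otimes>\<^sub>M lborel. norm (case p of (x, y) \<Rightarrow> f x * (w y * H n x y)) \<le> norm (D * (case p of (x, y) \<Rightarrow> f x * w y))"
        proof (intro AE_I2)
          fix p :: "'a \<times> 'a"
          have "\<bar>f (fst p) * w (snd p)\<bar> * \<bar>H n (fst p) (snd p)\<bar> \<le> \<bar>f (fst p) * w (snd p)\<bar> * D"
            using H0 by (intro mult_left_mono) auto
          then show "norm (case p of (x, y) \<Rightarrow> f x * (w y * H n x y)) \<le> norm (D * (case p of (x, y) \<Rightarrow> f x * w y))"
            using D(1) by (simp add: case_prod_beta abs_mult mult_ac)
        qed
      qed
      from lborel_pair.Fubini_integral[OF this]
      have "(LINT x|lborel. f x * (LINT y|lborel. w y * H n x y)) = (LINT y|lborel. LINT x|lborel. f x * (w y * H n x y))"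
        by simp
      also have "\<dots> = (LINT y|lborel. w y * (LINT x|lborel. f x * H n x y))"
        unfolding integral_mult_right_zero[symmetric] by (simp only: mult.left_commute)
      also have "\<dots> = E n * (LINT y|lborel. w y * (LINT s|lborel. f (l n *\<^sub>R y + \<epsilon> n *\<^sub>R s) * \<eta> s))"
        unfolding IHx[OF fm] mult.left_commute[where a="E n"] integral_mult_right_zero ..
      finally show ?thesis using E[of n] by (simp add: A_def)
    qed
    have gy: "(\<lambda>n. LINT s|lborel. g (l n *\<^sub>R y + \<epsilon> n *\<^sub>R s) * \<eta> s) \<longlonglongrightarrow> (LINT s|lborel. g y * \<eta> s)" for y
    proof (rule integral_dominated_convergence[where w="\<lambda>s. B * \<eta> s"])
      have ls: "(\<lambda>n. l n *\<^sub>R y + \<epsilon> n *\<^sub>R s) \<longlonglongrightarrow> y" for s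
      proof -
        have "(\<lambda>n. l n *\<^sub>R y + \<epsilon> n *\<^sub>R s) \<longlonglongrightarrow> (1 - 2 * 0) *\<^sub>R y + 0 *\<^sub>R s"
          unfolding l_def by (intro tendsto_intros \<epsilon>(1))
        then show ?thesis by simp
      qed
      show "AE s in lborel. (\<lambda>n. g (l n *\<^sub>R y + \<epsilon> n *\<^sub>R s) * \<eta> s) \<longlonglongrightarrow> g y * \<eta> s"
        using continuous_on_tendsto_compose[OF g(1) ls] by (intro AE_I2 tendsto_mult tendsto_const) auto
      show "(\<lambda>s. g (l n *\<^sub>R y + \<epsilon> n *\<^sub>R s) * \<eta> s) \<in> borel_measurable lborel" for n
      proof -
        have "continuous_on UNIV (\<lambda>s. g (l n *\<^sub>R y + \<epsilon> n *\<^sub>R s) * \<eta> s)"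
          by (intro continuous_intros \<eta>(1) continuous_on_compose2[OF g(1)]) auto
        then show ?thesis by (simp add: borel_measurable_continuous_onI)
      qed
      show "AE s in lborel. norm (g (l n *\<^sub>R y + \<epsilon> n *\<^sub>R s) * \<eta> s) \<le> B * \<eta> s" for n
        using g(2) \<eta>(2) by (intro AE_I2) (auto simp: abs_mult intro!: mult_right_mono)
    qed (use \<eta>i \<eta>m in auto)
    have "(\<lambda>n. LINT y|lborel. w y * (LINT s|lborel. f (l n *\<^sub>R y + \<epsilon> n *\<^sub>R s) * \<eta> s)) \<longlonglongrightarrow> (LINT y|lborel. w y * (f y * c))"
    proof (rule integral_dominated_convergence[where w="\<lambda>y. \<bar>w y\<bar> * (B * c)"])
      show "AE y in lborel. (\<lambda>n. w y * (LINT s|lborel. f (l n *\<^sub>R y + \<epsilon> n *\<^sub>R s) * \<eta> s)) \<longlonglongrightarrow> w y * (f y * c)"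
      proof (intro AE_I2)
        fix y
        show "(\<lambda>n. w y * (LINT s|lborel. f (l n *\<^sub>R y + \<epsilon> n *\<^sub>R s) * \<eta> s)) \<longlonglongrightarrow> w y * (f y * c)"
        proof (cases "y \<in> S")
          case True
          \<comment> \<open>Here the contraction is used: starting from y in S the point stays in S,
            so the jump of f across the boundary of S is never seen.\<close>
          have "f (l n *\<^sub>R y + \<epsilon> n *\<^sub>R s) * \<eta> s = g (l n *\<^sub>R y + \<epsilon> n *\<^sub>R s) * \<eta> s" for n s
            using inS[OF True, of s n] \<eta>(4)[of s] by (cases "s \<in> K") (auto simp: f_def l_def)
          then have eqf: "(LINT s|lborel. f (l n *\<^sub>R y + \<epsilon> n *\<^sub>R s) * \<eta> s) = (LINT s|lborel. g (l n *\<^sub>R y + \<epsilon> n *\<^sub>R s) * \<eta> s)" for n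
            by (simp only:)
          have "(LINT s|lborel. g y * \<eta> s) = f y * c" using True by (simp add: f_def c_def)
          with gy[of y] have "(\<lambda>n. LINT s|lborel. f (l n *\<^sub>R y + \<epsilon> n *\<^sub>R s) * \<eta> s) \<longlonglongrightarrow> f y * c"
            unfolding eqf by (simp only:)
          then show ?thesis by (intro tendsto_mult tendsto_const)
        qed (simp add: w(3))
      qed
      show mm: "(\<lambda>y. w y * (LINT s|lborel. f (l n *\<^sub>R y + \<epsilon> n *\<^sub>R s) * \<eta> s)) \<in> borel_measurable lborel" for n
      proof -
        have "(\<lambda>p. f (l n *\<^sub>R fst p + \<epsilon> n *\<^sub>R snd p)) \<in> borel_measurable (borel \<Otimes>\<^sub>M borel)"
          using fm by measurable
        then have "(\<lambda>(y, s). f (l n *\<^sub>R y + \<epsilon> n *\<^sub>R s) * \<eta> s) \<in> borel_measurable (lborel \<Otimes>\<^sub>M lborel)"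
          using \<eta>m fm by measurable
        from lborel.borel_measurable_lebesgue_integral[OF this] show ?thesis using w(1) by auto
      qed
      show "AE y in lborel. norm (w y * (LINT s|lborel. f (l n *\<^sub>R y + \<epsilon> n *\<^sub>R s) * \<eta> s)) \<le> \<bar>w y\<bar> * (B * c)" for n
      proof (intro AE_I2)
        fix y
        have "\<bar>LINT s|lborel. f (l n *\<^sub>R y + \<epsilon> n *\<^sub>R s) * \<eta> s\<bar> \<le> (LINT s|lborel. B * \<eta> s)"
          using fb \<eta>(2) \<eta>i B by (intro order_trans[OF integral_abs_bound integral_mono']) (auto simp: abs_mult intro!: mult_right_mono)
        then have "\<bar>LINT s|lborel. f (l n *\<^sub>R y + \<epsilon> n *\<^sub>R s) * \<eta> s\<bar> \<le> B * c" by (simp add: c_def)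
        then show "norm (w y * (LINT s|lborel. f (l n *\<^sub>R y + \<epsilon> n *\<^sub>R s) * \<eta> s)) \<le> \<bar>w y\<bar> * (B * c)"
          unfolding real_norm_def abs_mult by (intro mult_left_mono) auto
      qed
      show "(\<lambda>y. w y * (f y * c)) \<in> borel_measurable lborel" using w(1) fm by auto
      show "integrable lborel (\<lambda>y. \<bar>w y\<bar> * (B * c))" using wi by auto
    qed
    moreover have "(LINT y|lborel. w y * (f y * c)) = c * (LINT y|lborel. f y * w y)" by (simp add: mult_ac)
    ultimately have "(\<lambda>n. A f n) \<longlonglongrightarrow> c * (LINT y|lborel. f y * w y)" unfolding Aeq by simp
    then show ?thesis unfolding f_def .
  qed
  have "(\<lambda>n. A G n) \<longlonglongrightarrow> c * (LINT y|lborel. G y * w y)"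
  proof (rule LIMSEQ_I)
    fix r :: real assume r: "r > 0"
    \<comment> \<open>The sum of the two error constants of the density argument, the operator bound
      \<open>A1\<close> and the bound for the limit functional; the summand 1 makes M
      positive.\<close>
    define M where "M = C * (3 ^ DIM('a) * c) + c * C + 1"
    have M: "M > 0" unfolding M_def using C c by (intro add_nonneg_pos add_nonneg_nonneg mult_nonneg_nonneg) auto
    have SL: "S \<in> lmeasurable" using S by (rule lmeasurable_open)
    have rM: "r / (2 * M) > 0" using r M by simp
    have "integrable (lebesgue_on S) G"
      using G SL by (intro integrable_bounded_lebesgue_on[where C=C]) (auto intro!: measurable_restrict_space1 measurable_completion)
    then obtain g B where g: "continuous_on UNIV g" "\<And>x. \<bar>g x\<bar> \<le> B" and
      gr: "(LINT x|lebesgue_on S. \<bar>G x - g x\<bar>) < r / (2 * M)"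
      using integrable_approx_continuous[OF _ SL rM, of G] by metis
    define f where "f x = indicator S x * g x" for x
    have gm: "g \<in> borel_measurable borel" by (rule borel_measurable_continuous_onI[OF g(1)])
    have fm: "f \<in> borel_measurable borel" unfolding f_def using Sm(2) gm by auto
    have fb: "\<bar>f x\<bar> \<le> B" for x using g(2)[of x] by (auto simp: f_def indicator_def)
    have fi: "integrable lborel f" by (rule bS[OF fm fb]) (simp add: f_def)
    have d: "integrable lborel (\<lambda>x. G x - f x)" using Gi fi by auto
    have "(LINT x|lebesgue_on S. \<bar>G x - g x\<bar>) = (LINT x|lebesgue. indicator S x *\<^sub>R \<bar>G x - g x\<bar>)"
      using Sm by (intro integral_restrict_space) auto
    also have "\<dots> = (LINT x|lebesgue. \<bar>G x - f x\<bar>)"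
      by (intro Bochner_Integration.integral_cong) (auto simp: f_def indicator_def G(3))
    also have "\<dots> = (LINT x|lborel. \<bar>G x - f x\<bar>)" using G(1) fm by (intro integral_completion) auto
    finally have small: "(LINT x|lborel. \<bar>G x - f x\<bar>) < r / (2 * M)" using gr by simp
    have i1: "integrable lborel (\<lambda>y. G y * w y)" "integrable lborel (\<lambda>y. f y * w y)"
    proof -
      show "integrable lborel (\<lambda>y. G y * w y)"
        using G w C by (intro bS[where B="C * C"]) (auto simp: abs_mult intro!: mult_mono)
      have "B \<ge> 0" using fb[of undefined] by linarith
      then show "integrable lborel (\<lambda>y. f y * w y)"
        using fm fb w C by (intro bS[where B="B * C"]) (auto simp: abs_mult intro!: mult_mono)
    qed
    have b2: "\<bar>c * (LINT y|lborel. f y * w y) - c * (LINT y|lborel. G y * w y)\<bar> \<le> c * C * (LINT x|lborel. \<bar>G x - f x\<bar>)"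
    proof -
      have "c * (LINT y|lborel. f y * w y) - c * (LINT y|lborel. G y * w y) = c * (LINT y|lborel. (f y - G y) * w y)"
        using i1 by (simp add: left_diff_distrib right_diff_distrib)
      also have "\<bar>\<dots>\<bar> \<le> c * (LINT y|lborel. \<bar>G y - f y\<bar> * C)"
        unfolding abs_mult using c d w(2) C
        by (intro mult_mono order_trans[OF integral_abs_bound integral_mono'])
           (auto simp: abs_mult abs_minus_commute intro!: mult_mono)
      finally show ?thesis by (simp add: mult_ac)
    qed
    obtain N where N: "\<And>n. n \<ge> N \<Longrightarrow> norm (A f n - c * (LINT y|lborel. f y * w y)) < r / 2"
      using LIMSEQ_D[OF main[OF g], of "r / 2"] r unfolding f_def by auto
    show "\<exists>N. \<forall>n\<ge>N. norm (A G n - c * (LINT y|lborel. G y * w y)) < r"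
    proof (intro exI[of _ N] allI impI)
      fix n assume n: "n \<ge> N"
      have "A G n - A f n = A (\<lambda>x. G x - f x) n"
        unfolding A_def using Ai[OF Gi] Ai[OF fi] by (simp add: left_diff_distrib diff_divide_distrib)
      with A1[OF d, of n] have b1: "\<bar>A G n - A f n\<bar> \<le> (C * (3 ^ DIM('a) * c)) * (LINT x|lborel. \<bar>G x - f x\<bar>)" by simp
      have "(C * (3 ^ DIM('a) * c)) * (LINT x|lborel. \<bar>G x - f x\<bar>) + c * C * (LINT x|lborel. \<bar>G x - f x\<bar>)
          = (M - 1) * (LINT x|lborel. \<bar>G x - f x\<bar>)" by (simp add: M_def distrib_right)
      also have "\<dots> \<le> M * (LINT x|lborel. \<bar>G x - f x\<bar>)" by (intro mult_right_mono) auto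
      also have "\<dots> \<le> M * (r / (2 * M))" using small M by (intro mult_left_mono) auto
      also have "\<dots> = r / 2" using M by simp
      finally have "\<bar>A G n - A f n\<bar> + \<bar>c * (LINT y|lborel. f y * w y) - c * (LINT y|lborel. G y * w y)\<bar> \<le> r / 2"
        using b1 b2 by linarith
      with N[OF n] show "norm (A G n - c * (LINT y|lborel. G y * w y)) < r"
        unfolding real_norm_def by linarith
    qed
  qed
  then show ?thesis unfolding A_def H_def E_def c_def l_def .
qed

section \<open>The velocity bound on the square\<close>

lemma borel_measurable_lebesgue_on_borel:
  "f \<in> borel_measurable borel \<Longrightarrow> f \<in> borel_measurable (lebesgue_on S)"
  by (intro measurable_restrict_space1 measurable_completion) simp

lemma integrable_lebesgue_on_mult_continuous:
  fixes f h :: "'a::euclidean_space \<Rightarrow> real"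
  assumes f: "integrable (lebesgue_on S) f" and S: "bounded S" and h: "continuous_on UNIV h"
  shows "integrable (lebesgue_on S) (\<lambda>x. f x * h x)"
proof -
  have "bounded (h ` closure S)"
    using S h by (intro compact_imp_bounded compact_continuous_image) (auto intro: continuous_on_subset)
  then obtain M where M: "\<forall>y\<in>closure S. \<bar>h y\<bar> \<le> M" by (auto simp: bounded_iff)
  have hm: "h \<in> borel_measurable (lebesgue_on S)"
    by (intro measurable_restrict_space1 measurable_completion) (simp add: h borel_measurable_continuous_onI)
  show ?thesis
  proof (rule Bochner_Integration.integrable_bound)
    show "integrable (lebesgue_on S) (\<lambda>x. M * f x)" using f by auto
    show "(\<lambda>x. f x * h x) \<in> borel_measurable (lebesgue_on S)" using f hm by auto
    show "AE x in lebesgue_on S. norm (f x * h x) \<le> norm (M * f x)"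
    proof (intro AE_I2)
      fix x assume "x \<in> space (lebesgue_on S)"
      then have "x \<in> closure S" using closure_subset by (auto simp: space_restrict_space)
      then have "\<bar>h x\<bar> \<le> \<bar>M\<bar>" using M by force
      then show "norm (f x * h x) \<le> norm (M * f x)"
        using mult_left_mono[of "\<bar>h x\<bar>" "\<bar>M\<bar>" "\<bar>f x\<bar>"] by (simp add: abs_mult mult.commute)
    qed
  qed
qed

text \<open>Were the integral zero, f would vanish almost everywhere, although it is positive on a
  nonempty open set.\<close>

lemma integral_continuous_nonneg_pos:
  fixes f :: "'a::euclidean_space \<Rightarrow> real"
  assumes "continuous_on UNIV f" "integrable lborel f" "\<And>x. f x \<ge> 0" "f a > 0"
  shows "(LINT x|lborel. f x) > 0"
proof (rule ccontr)
  assume "\<not> ?thesis"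
  then have "(LINT x|lborel. f x) = 0" using Bochner_Integration.integral_nonneg[of lborel f] assms(3) by (simp add: order_antisym)
  then have "AE x in lborel. f x = 0"
    using assms by (subst (asm) integral_nonneg_eq_0_iff_AE) auto
  then have "AE x in lebesgue. f x = 0" by (simp add: AE_completion_iff)
  then have "negligible {x. f x \<noteq> 0}"
    by (subst (asm) completion.AE_iff_null_sets) (simp add: negligible_iff_null_sets)
  then have "negligible {x. f x > 0}" by (rule negligible_subset) auto
  moreover have "open {x. f x > 0}" using assms(1) by (intro open_Collect_less continuous_intros) auto
  ultimately show False using open_not_negligible[of "{x. f x > 0}"] assms(4) by auto
qed

definition unit_square :: "(real^2) set" where
  "unit_square = {x. -1 < x $ 1 \<and> x $ 1 < 1 \<and> -1 < x $ 2 \<and> x $ 2 < 1}"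

lemma unit_square_eq_box: "unit_square = box (vector [-1, -1]) (vector [1, 1])"
  by (auto simp: unit_square_def mem_box_cart forall_2)

lemma open_unit_square: "open unit_square" and bounded_unit_square: "bounded unit_square"
  by (simp_all add: unit_square_eq_box open_box bounded_box)

lemma axis_inner_real2: "axis i (1::real) \<bullet> (x::real^2) = x $ i"
  by (simp add: inner_axis')

text \<open>A smooth field w would be (-d2 \<Psi>, d1 \<Psi>) with a stream function \<Psi>
  vanishing on the boundary, and the curl equation tested with \<Psi> would be the claim. For
  bounded w the stream function of the contracted mollification is used, whose support lies in the
  open square; afterwards the mollification is removed. Testing the divergence with all smooth
  functions, not only compactly supported ones, encodes zero normal flux and is what makes \<Psi>
  vanish near the boundary.\<close>

lemma stream_function_identity:
  fixes w1 w2 q :: "real^2 \<Rightarrow> real"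
  assumes w1: "w1 \<in> borel_measurable borel" "\<And>x. \<bar>w1 x\<bar> \<le> C" "\<And>x. x \<notin> unit_square \<Longrightarrow> w1 x = 0"
    and w2: "w2 \<in> borel_measurable borel" "\<And>x. \<bar>w2 x\<bar> \<le> C" "\<And>x. x \<notin> unit_square \<Longrightarrow> w2 x = 0"
    and q: "q \<in> borel_measurable borel" "\<And>x. \<bar>q x\<bar> \<le> C" "\<And>x. x \<notin> unit_square \<Longrightarrow> q x = 0"
    and div: "\<And>\<psi>. smooth \<psi> \<Longrightarrow> (LINT x|lborel. w1 x * frechet_derivative \<psi> (at x) (axis 1 1)) +
        (LINT x|lborel. w2 x * frechet_derivative \<psi> (at x) (axis 2 1)) = 0"
    and curl: "\<And>\<psi>. \<psi> \<in> test_functions unit_square \<Longrightarrow> (LINT x|lborel. (w2 x + q x) * frechet_derivative \<psi> (at x) (axis 1 1)) =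
        (LINT x|lborel. w1 x * frechet_derivative \<psi> (at x) (axis 2 1))"
  shows "(LINT x|lborel. w1 x * w1 x) + (LINT x|lborel. (w2 x + q x) * w2 x) = 0"
proof -
  obtain b B :: "real \<Rightarrow> real" and k where b: "smooth b" "\<And>t. b t \<ge> 0" "\<And>t. \<bar>t\<bar> \<ge> 1 \<Longrightarrow> b t = 0" "b 0 > 0"
    and B: "smooth B" "\<And>t. (B has_real_derivative b t) (at t)" "\<And>t. t \<le> -1 \<Longrightarrow> B t = 0" "\<And>t. t \<ge> 1 \<Longrightarrow> B t = k"
    by (rule smooth_bump_exists) blast
  define b' where "b' t = frechet_derivative b (at t) 1" for t
  have db: "(b has_real_derivative b' t) (at t)" for t
  proof -
    have "frechet_derivative b (at t) h = b' t * h" for h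
      using linear_frechet_derivative[OF smooth_differentiable[OF b(1), of t]]
        linear_scale[of "frechet_derivative b (at t)" h 1] by (simp add: b'_def)
    then have "frechet_derivative b (at t) = (*) (b' t)" by (rule ext)
    with smooth_has_derivative[OF b(1), of t] show ?thesis by (simp only: has_field_derivative_def)
  qed
  have C: "C \<ge> 0" using w1(2)[of undefined] by linarith
  define \<eta> where "\<eta> x = b (x $ 1) * b (x $ 2)" for x :: "real^2"
  define Q where "Q = cbox (vector [-1, -1]) (vector [1, 1] :: real^2)"
  have bc: "continuous_on UNIV b" by (rule smooth_continuous[OF b(1)])
  have \<eta>: "continuous_on UNIV \<eta>" "\<And>x. \<eta> x \<ge> 0" "compact Q" "\<And>x. x \<notin> Q \<Longrightarrow> \<eta> x = 0"
  proof -
    show "continuous_on UNIV \<eta>" unfolding \<eta>_def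
      by (intro continuous_intros continuous_on_compose2[OF bc]) auto
    show "\<eta> x \<ge> 0" for x unfolding \<eta>_def using b(2) by simp
    show "compact Q" by (simp add: Q_def)
    fix x :: "real^2" assume "x \<notin> Q"
    then have "\<bar>x $ 1\<bar> \<ge> 1 \<or> \<bar>x $ 2\<bar> \<ge> 1" by (auto simp: Q_def mem_box_cart forall_2)
    then show "\<eta> x = 0" using b(3) by (auto simp: \<eta>_def)
  qed
  \<comment> \<open>The offset 3 gives \<epsilon> \<le> 1/3 from n = 0 on.\<close>
  define \<epsilon> where "\<epsilon> n = 1 / (real n + 3)" for n
  have \<epsilon>: "\<epsilon> \<longlonglongrightarrow> 0" "\<And>n. \<epsilon> n > 0" "\<And>n. \<epsilon> n \<le> 1 / 3"
  proof -
    have "(\<lambda>n. 1 / (real n + 3)) \<longlonglongrightarrow> 0"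
      using LIMSEQ_ignore_initial_segment[OF lim_1_over_n, of 3] by simp
    then show "\<epsilon> \<longlonglongrightarrow> 0" unfolding \<epsilon>_def .
  qed (simp_all add: \<epsilon>_def field_simps)
  \<comment> \<open>Each coordinate has modulus at most (1 - 2 \<epsilon>) + \<epsilon> = 1 -
    \<epsilon>.\<close>
  have inS: "(1 - 2 * \<epsilon> n) *\<^sub>R y + \<epsilon> n *\<^sub>R s \<in> unit_square" if "y \<in> unit_square" "s \<in> Q" for n y s
  proof -
    have "\<bar>((1 - 2 * \<epsilon> n) *\<^sub>R y + \<epsilon> n *\<^sub>R s) $ i\<bar> < 1" if "\<bar>y $ i\<bar> < 1" "\<bar>s $ i\<bar> \<le> 1" for i
    proof -
      have "\<bar>(1 - 2 * \<epsilon> n) * y $ i\<bar> \<le> (1 - 2 * \<epsilon> n) * 1"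
        unfolding abs_mult using that \<epsilon>(2,3)[of n] by (intro mult_mono) auto
      moreover have "\<bar>\<epsilon> n * s $ i\<bar> \<le> \<epsilon> n * 1"
        unfolding abs_mult using that \<epsilon>(2,3)[of n] by (intro mult_mono) auto
      ultimately show ?thesis using \<epsilon>(2)[of n] by simp
    qed
    from this[of 1] this[of 2] that show ?thesis
      by (simp add: unit_square_def Q_def mem_box_cart forall_2 abs_less_iff abs_le_iff)
  qed
  \<comment> \<open>Before the limit the identity is exact: it is the curl equation tested with the
    stream function of the mollified field.\<close>
  have zero: "(LINT x|lborel. w1 x * (LINT y|lborel. w1 y * \<eta> ((1 / \<epsilon> n) *\<^sub>R (x - (1 - 2 * \<epsilon> n) *\<^sub>R y)))) +
     (LINT x|lborel. (w2 x + q x) * (LINT y|lborel. w2 y * \<eta> ((1 / \<epsilon> n) *\<^sub>R (x - (1 - 2 * \<epsilon> n) *\<^sub>R y)))) = 0" for n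
  proof -
    define e l where "e = \<epsilon> n" and "l = 1 - 2 * e"
    have e: "e > 0" "e \<le> 1 / 3" using \<epsilon>(2,3)[of n] by (simp_all add: e_def)
    have l: "l > 0" "l + e = 1 - e" using e by (simp_all add: l_def)
    \<comment> \<open>A primitive of the mollifier in the first variable: d1 K is \<eta>(z/e)/e.
      Convolving w2 with K thus gives a function whose first partial derivative is the mollified
      w2.\<close>
    define K where "K z = B (z $ 1 / e) * b (z $ 2 / e)" for z :: "real^2"
    define K2 where "K2 z = B (z $ 1 / e) * b' (z $ 2 / e) / e" for z :: "real^2"
    have affine: "f (a + c * z $ i) = f (a + (c *\<^sub>R axis i 1) \<bullet> z)" for f :: "real \<Rightarrow> real" and a c i and z :: "real^2"
      by (simp add: axis_inner_real2)
    have sK: "smooth K"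
    proof -
      have "smooth (\<lambda>z::real^2. B (0 + (1 / e) * z $ 1) * b (0 + (1 / e) * z $ 2))"
        unfolding affine[of B] affine[of b] by (intro smooth_mult smooth_compose_affine B(1) b(1))
      then show ?thesis by (simp add: K_def[abs_def])
    qed
    have dK: "(K has_derivative (\<lambda>h. h $ 1 * (\<eta> ((1 / e) *\<^sub>R z) / e) + h $ 2 * K2 z)) (at z)" for z
    proof -
      have c: "((\<lambda>z::real^2. z $ i / e) has_derivative (\<lambda>h. h $ i / e)) (at z)" for i
      proof -
        have "bounded_linear (\<lambda>h::real^2. h $ i / e)"
          by (intro bounded_linear_compose[OF bounded_linear_divide] bounded_linear_vec_nth)
        then show ?thesis by (rule bounded_linear_imp_has_derivative)
      qed
      have 1: "((\<lambda>z. B (z $ 1 / e)) has_derivative (\<lambda>h. b (z $ 1 / e) * (h $ 1 / e))) (at z)"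
        using has_derivative_compose[OF c[of 1], of B "(*) (b (z $ 1 / e))"] B(2) by (simp add: has_field_derivative_def)
      have 2: "((\<lambda>z. b (z $ 2 / e)) has_derivative (\<lambda>h. b' (z $ 2 / e) * (h $ 2 / e))) (at z)"
        using has_derivative_compose[OF c[of 2], of b "(*) (b' (z $ 2 / e))"] db by (simp add: has_field_derivative_def)
      show ?thesis unfolding K_def
        by (rule has_derivative_eq_rhs[OF has_derivative_mult[OF 1 2]])
           (simp add: K2_def \<eta>_def fun_eq_iff algebra_simps)
    qed
    have fK: "frechet_derivative K (at z) = (\<lambda>h. h $ 1 * (\<eta> ((1 / e) *\<^sub>R z) / e) + h $ 2 * K2 z)" for z
      by (rule frechet_derivative_at[OF dK, symmetric])
    have w2i: "integrable lborel w2"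
    proof (rule Bochner_Integration.integrable_bound)
      show "integrable lborel (\<lambda>x. C * indicator unit_square x)"
        using emeasure_bounded_finite[OF bounded_unit_square] open_unit_square by auto
      show "AE x in lborel. norm (w2 x) \<le> norm (C * indicator unit_square x)"
      proof (intro AE_I2)
        fix x show "norm (w2 x) \<le> norm (C * indicator unit_square x)" using w2(2)[of x] w2(3)[of x] by (cases "x \<in> unit_square") auto
      qed
    qed (use w2 in simp)
    have w2R: "w2 y = 0" if "norm y > 2" for y
    proof (rule w2(3), rule notI)
      assume y: "y \<in> unit_square"
      then have "norm y \<le> 1 + 1"
        using norm_le_l1_cart[of y] by (auto simp: unit_square_def sum_2)
      then show False using that by simp
    qed
    define \<Psi> where "\<Psi> x = (LINT y|lborel. w2 y * K (x - l *\<^sub>R y))" for x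
    have s\<Psi>: "smooth \<Psi>" unfolding \<Psi>_def by (rule smooth_convolution[OF w2i w2R sK])
    have d\<Psi>: "frechet_derivative \<Psi> (at x) h = (LINT y|lborel. w2 y * frechet_derivative K (at (x - l *\<^sub>R y)) h)" for x h
      using frechet_derivative_at[OF convolution_has_derivative[OF w2i w2R sK, where l=l and x=x]]
      unfolding \<Psi>_def by (metis (no_types))
    have D1: "frechet_derivative \<Psi> (at x) (axis 1 1) = (LINT y|lborel. w2 y * \<eta> ((1 / e) *\<^sub>R (x - l *\<^sub>R y))) / e" for x
      unfolding d\<Psi> fK by (simp add: axis_def)
    \<comment> \<open>The divergence equation with the test function K(x - l y) of y trades d2 K
      against w2 for - d1 K against w1. This test function is not compactly supported in the
      square.\<close>
    have D2: "frechet_derivative \<Psi> (at x) (axis 2 1) = - (LINT y|lborel. w1 y * \<eta> ((1 / e) *\<^sub>R (x - l *\<^sub>R y))) / e" for x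
    proof -
      define \<psi> where "\<psi> y = K (x - l *\<^sub>R y)" for y
      have s: "smooth \<psi>"
      proof -
        have "smooth (\<lambda>y::real^2. B (x $ 1 / e + (- (l / e)) * y $ 1) * b (x $ 2 / e + (- (l / e)) * y $ 2))"
          unfolding affine[of B] affine[of b] by (intro smooth_mult smooth_compose_affine B(1) b(1))
        then show ?thesis by (simp add: \<psi>_def[abs_def] K_def[abs_def] diff_divide_distrib)
      qed
      have "(\<psi> has_derivative (\<lambda>h. frechet_derivative K (at (x - l *\<^sub>R y)) (- (l *\<^sub>R h)))) (at y)" for y
        unfolding \<psi>_def
        by (rule has_derivative_compose[where f="\<lambda>y. x - l *\<^sub>R y" and g=K and f'="\<lambda>h. - (l *\<^sub>R h)"])
           (auto intro!: derivative_eq_intros smooth_has_derivative[OF sK])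
      from frechet_derivative_at[OF this, symmetric]
      have f\<psi>: "frechet_derivative \<psi> (at y) h = - l * frechet_derivative K (at (x - l *\<^sub>R y)) h" for y h
        by (simp add: fK algebra_simps)
      have "- l * ((LINT y|lborel. w1 y * frechet_derivative K (at (x - l *\<^sub>R y)) (axis 1 1)) +
          (LINT y|lborel. w2 y * frechet_derivative K (at (x - l *\<^sub>R y)) (axis 2 1))) = 0"
        using div[OF s] unfolding f\<psi> mult.left_commute[where a="- l"] integral_mult_right_zero by (simp add: distrib_left)
      then have "(LINT y|lborel. w1 y * frechet_derivative K (at (x - l *\<^sub>R y)) (axis 1 1)) +
          (LINT y|lborel. w2 y * frechet_derivative K (at (x - l *\<^sub>R y)) (axis 2 1)) = 0" using l(1) by simp
      moreover have "(LINT y|lborel. w1 y * frechet_derivative K (at (x - l *\<^sub>R y)) (axis 1 1)) =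
          (LINT y|lborel. w1 y * \<eta> ((1 / e) *\<^sub>R (x - l *\<^sub>R y))) / e" unfolding fK by (simp add: axis_def)
      ultimately show ?thesis unfolding d\<Psi> by (simp add: eq_neg_iff_add_eq_0 add.commute)
    qed
    \<comment> \<open>Above, below and to the left the kernel vanishes for all y in the square. To
      the right B has reached its constant k, and \<Psi> reduces to an averaged flux of w2 through
      horizontal lines, which is zero.\<close>
    have \<Psi>0: "\<Psi> x = 0" if nb: "\<not> (\<bar>x $ 1\<bar> \<le> 1 - e \<and> \<bar>x $ 2\<bar> \<le> 1 - e)" for x
    proof -
      have sup: "\<bar>l * y $ 1\<bar> \<le> l \<and> \<bar>l * y $ 2\<bar> \<le> l" if "y \<in> unit_square" for y
      proof -
        have "\<bar>y $ 1\<bar> \<le> 1" "\<bar>y $ 2\<bar> \<le> 1" using that by (auto simp: unit_square_def)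
        then show ?thesis using l(1) by (simp add: abs_mult mult_left_le)
      qed
      consider "\<bar>x $ 2\<bar> > 1 - e" | "x $ 1 < - (1 - e)" | "x $ 1 > 1 - e" using nb by linarith
      then show ?thesis
      proof cases
        case 1
        have "w2 y * K (x - l *\<^sub>R y) = 0" for y
        proof (cases "y \<in> unit_square")
          case True
          then have "\<bar>x $ 2 - l * y $ 2\<bar> \<ge> e" using sup[OF True] 1 l(2) by linarith
          then have "\<bar>(x $ 2 - l * y $ 2) / e\<bar> \<ge> 1" using e(1) by (simp add: le_divide_eq)
          then show ?thesis using b(3) by (simp add: K_def)
        qed (simp add: w2(3))
        then show ?thesis unfolding \<Psi>_def by (simp only: Bochner_Integration.integral_zero)
      next
        case 2
        have "w2 y * K (x - l *\<^sub>R y) = 0" for y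
        proof (cases "y \<in> unit_square")
          case True
          then have "x $ 1 - l * y $ 1 \<le> - e" using sup[OF True] 2 l(2) by linarith
          then have "(x $ 1 - l * y $ 1) / e \<le> -1" using e(1) by (simp add: divide_le_eq)
          then show ?thesis using B(3) by (simp add: K_def)
        qed (simp add: w2(3))
        then show ?thesis unfolding \<Psi>_def by (simp only: Bochner_Integration.integral_zero)
      next
        case 3
        \<comment> \<open>A function of the second coordinate alone: its gradient sees only w2, and
          its derivative is the weight b((x2 - l y2)/e) up to the factor -l/e.\<close>
        define \<psi> where "\<psi> y = B (x $ 2 / e + (- (l / e)) * y $ 2)" for y :: "real^2"
        have s: "smooth \<psi>" unfolding \<psi>_def affine[of B] by (intro smooth_compose_affine B(1))
        have "(\<psi> has_derivative (\<lambda>h. b ((x $ 2 - l * y $ 2) / e) * (- (l / e) * h $ 2))) (at y)" for y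
        proof -
          have "((\<lambda>y::real^2. x $ 2 / e + (- (l / e)) * y $ 2) has_derivative (\<lambda>h. - (l / e) * h $ 2)) (at y)"
          proof -
            have "bounded_linear (\<lambda>h::real^2. - (l / e) * h $ 2)"
              by (intro bounded_linear_compose[OF bounded_linear_mult_right] bounded_linear_vec_nth)
            from has_derivative_add[OF has_derivative_const bounded_linear_imp_has_derivative[OF this]]
            show ?thesis by simp
          qed
          from has_derivative_compose[OF this, of B "(*) (b (x $ 2 / e + - (l / e) * y $ 2))"] B(2)
          have "(\<psi> has_derivative (\<lambda>h. b (x $ 2 / e + - (l / e) * y $ 2) * (- (l / e) * h $ 2))) (at y)"
            unfolding \<psi>_def by (simp add: has_field_derivative_def)
          moreover have "x $ 2 / e + - (l / e) * y $ 2 = (x $ 2 - l * y $ 2) / e"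
            by (simp add: diff_divide_distrib)
          ultimately show ?thesis by simp
        qed
        from frechet_derivative_at[OF this, symmetric]
        have f\<psi>: "frechet_derivative \<psi> (at y) h = - (l / e) * (b ((x $ 2 - l * y $ 2) / e) * h $ 2)" for y h
          by simp
        have "- (l / e) * (LINT y|lborel. w2 y * (b ((x $ 2 - l * y $ 2) / e) * axis 2 1 $ 2)) = 0"
          using div[OF s] unfolding f\<psi> mult.left_commute[where a="- (l / e)"] integral_mult_right_zero by (simp add: axis_def)
        then have "(LINT y|lborel. w2 y * b ((x $ 2 - l * y $ 2) / e)) = 0" using l(1) e(1) by (simp add: axis_def)
        moreover have "w2 y * K (x - l *\<^sub>R y) = k * (w2 y * b ((x $ 2 - l * y $ 2) / e))" for y
        proof (cases "y \<in> unit_square")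
          case True
          then have "x $ 1 - l * y $ 1 \<ge> e" using sup[OF True] 3 l(2) by linarith
          then have "(x $ 1 - l * y $ 1) / e \<ge> 1" using e(1) by (simp add: le_divide_eq)
          then show ?thesis using B(4) by (simp add: K_def)
        qed (simp add: w2(3))
        ultimately show ?thesis unfolding \<Psi>_def by (simp only: integral_mult_right_zero mult_zero_right)
      qed
    qed
    \<comment> \<open>The closed square left over by the contraction. It is compact in the open
      square, so \<Psi> is admissible in the curl equation.\<close>
    define Qe where "Qe = cbox (vector [-(1 - e), -(1 - e)]) (vector [1 - e, 1 - e] :: real^2)"
    have "{x. \<Psi> x \<noteq> 0} \<subseteq> Qe"
    proof
      fix x assume "x \<in> {x. \<Psi> x \<noteq> 0}"
      then have "\<bar>x $ 1\<bar> \<le> 1 - e \<and> \<bar>x $ 2\<bar> \<le> 1 - e" using \<Psi>0[of x] by blast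
      then show "x \<in> Qe" unfolding Qe_def mem_box_cart forall_2 vector_sel by linarith
    qed
    then have cl: "closure {x. \<Psi> x \<noteq> 0} \<subseteq> Qe"
      by (rule closure_minimal) (simp add: Qe_def closed_cbox)
    have "compact Qe" "Qe \<subseteq> unit_square"
      using e by (auto simp: Qe_def compact_cbox unit_square_def mem_box_cart forall_2)
    with cl have "\<Psi> \<in> test_functions unit_square"
      using s\<Psi> bounded_subset[OF compact_imp_bounded, of Qe "{x. \<Psi> x \<noteq> 0}"] closure_subset[of "{x. \<Psi> x \<noteq> 0}"]
      by (auto simp: test_functions_def compact_closure)
    from curl[OF this] have "(LINT x|lborel. (w2 x + q x) * (LINT y|lborel. w2 y * \<eta> ((1 / e) *\<^sub>R (x - l *\<^sub>R y)))) / e =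
        - (LINT x|lborel. w1 x * (LINT y|lborel. w1 y * \<eta> ((1 / e) *\<^sub>R (x - l *\<^sub>R y)))) / e"
      unfolding D1 D2 by simp
    then show ?thesis using e(1) unfolding e_def l_def by (simp add: field_simps)
  qed
  \<comment> \<open>The factor 2 covers the sum w2 + q.\<close>
  have C2: "\<bar>w1 x\<bar> \<le> 2 * C" "\<bar>w2 x\<bar> \<le> 2 * C" "\<bar>w2 x + q x\<bar> \<le> 2 * C" for x
    using w1(2)[of x] w2(2)[of x] q(2)[of x] by linarith+
  have m: "(\<lambda>x. w2 x + q x) \<in> borel_measurable borel" using w2(1) q(1) by auto
  have z: "w2 x + q x = 0" if "x \<notin> unit_square" for x using w2(3)[OF that] q(3)[OF that] by simp
  define c where "c = (LINT s|lborel. \<eta> s)"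
  have c: "c > 0" unfolding c_def
    by (rule integral_continuous_nonneg_pos[where a=0])
       (use \<eta> b(4) integrable_lborel_continuous_compact_support[OF \<eta>(1,3,4)] in \<open>auto simp: \<eta>_def\<close>)
  note lim = contracted_mollifier_weak_limit[where C="2 * C", OF _ _ _ _ _ _ bounded_unit_square open_unit_square \<eta> \<epsilon> inS, folded c_def]
  have "(\<lambda>n. (LINT x|lborel. w1 x * (LINT y|lborel. w1 y * \<eta> ((1 / \<epsilon> n) *\<^sub>R (x - (1 - 2 * \<epsilon> n) *\<^sub>R y)))) / \<epsilon> n ^ DIM(real^2) +
     (LINT x|lborel. (w2 x + q x) * (LINT y|lborel. w2 y * \<eta> ((1 / \<epsilon> n) *\<^sub>R (x - (1 - 2 * \<epsilon> n) *\<^sub>R y)))) / \<epsilon> n ^ DIM(real^2))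
     \<longlonglongrightarrow> c * (LINT x|lborel. w1 x * w1 x) + c * (LINT x|lborel. (w2 x + q x) * w2 x)"
    by (intro tendsto_add lim w1 w2 m z C2) 
  then have "(\<lambda>n. 0) \<longlonglongrightarrow> c * (LINT x|lborel. w1 x * w1 x) + c * (LINT x|lborel. (w2 x + q x) * w2 x)"
    unfolding add_divide_distrib[symmetric] zero by simp
  then have "c * ((LINT x|lborel. w1 x * w1 x) + (LINT x|lborel. (w2 x + q x) * w2 x)) = 0"
    by (simp add: LIMSEQ_const_iff distrib_left)
  then show ?thesis using c by simp
qed

text \<open>The stream function identity says that the squared norm of v equals minus the integral
  of r v_2. Together with the nonnegativity of the integral of (r + v_2)^2 this bounds v by r in L2
  with constant 1.\<close>

lemma velocity_bound:
  fixes v :: "real^2 \<Rightarrow> real^2" and r :: "real^2 \<Rightarrow> real"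
  assumes v: "v \<in> borel_measurable (lebesgue_on unit_square)" "AE x in lebesgue_on unit_square. norm (v x) \<le> C"
    and r: "r \<in> borel_measurable (lebesgue_on unit_square)" "AE x in lebesgue_on unit_square. \<bar>r x\<bar> \<le> C"
    and div: "\<And>\<psi>. smooth \<psi> \<Longrightarrow> (LINT x|lebesgue_on unit_square. v x \<bullet> gradient \<psi> x) = 0"
    and curl: "\<And>\<psi>. \<psi> \<in> test_functions unit_square \<Longrightarrow>
      (LINT x|lebesgue_on unit_square. (v x + vector [0, r x]) \<bullet> perp_gradient \<psi> x) = 0"
  shows "(LINT x|lebesgue_on unit_square. (norm (v x))\<^sup>2) \<le> (LINT x|lebesgue_on unit_square. (r x)\<^sup>2)"
proof -
  define C' where "C' = max C 0"
  have S: "unit_square \<in> sets borel" "unit_square \<in> lmeasurable"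
    using open_unit_square bounded_unit_square by (auto intro: lmeasurable_open)
  have vm: "(\<lambda>x. v x $ i) \<in> borel_measurable (lebesgue_on unit_square)" for i
    using v(1) by (rule measurable_compose) (auto intro!: borel_measurable_continuous_onI continuous_intros)
  have vb: "AE x in lebesgue_on unit_square. \<bar>v x $ i\<bar> \<le> C'" for i
    using v(2) by eventually_elim (use component_le_norm_cart in \<open>force simp: C'_def intro: order_trans\<close>)
  have rb: "AE x in lebesgue_on unit_square. \<bar>r x\<bar> \<le> C'"
    using r(2) by eventually_elim (auto simp: C'_def)
  have C': "C' \<ge> 0" by (simp add: C'_def)
  obtain w1 where w1: "w1 \<in> borel_measurable borel" "\<And>x. \<bar>w1 x\<bar> \<le> C'" "\<And>x. x \<notin> unit_square \<Longrightarrow> w1 x = 0"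
     "AE x in lebesgue_on unit_square. v x $ 1 = w1 x"
     "\<And>h. h \<in> borel_measurable borel \<Longrightarrow> (LINT x|lebesgue_on unit_square. v x $ 1 * h x) = (LINT x|lborel. w1 x * h x)"
    by (rule bounded_borel_representative[OF vm[of 1] S(1) vb C']) blast
  obtain w2 where w2: "w2 \<in> borel_measurable borel" "\<And>x. \<bar>w2 x\<bar> \<le> C'" "\<And>x. x \<notin> unit_square \<Longrightarrow> w2 x = 0"
     "AE x in lebesgue_on unit_square. v x $ 2 = w2 x"
     "\<And>h. h \<in> borel_measurable borel \<Longrightarrow> (LINT x|lebesgue_on unit_square. v x $ 2 * h x) = (LINT x|lborel. w2 x * h x)"
    by (rule bounded_borel_representative[OF vm[of 2] S(1) vb C']) blast
  obtain q where q: "q \<in> borel_measurable borel" "\<And>x. \<bar>q x\<bar> \<le> C'" "\<And>x. x \<notin> unit_square \<Longrightarrow> q x = 0"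
     "AE x in lebesgue_on unit_square. r x = q x"
     "\<And>h. h \<in> borel_measurable borel \<Longrightarrow> (LINT x|lebesgue_on unit_square. r x * h x) = (LINT x|lborel. q x * h x)"
    by (rule bounded_borel_representative[OF r(1) S(1) rb C']) blast
  have vi: "integrable (lebesgue_on unit_square) (\<lambda>x. v x $ i)" for i
    using vm vb S(2) by (intro integrable_bounded_lebesgue_on[where C=C']) auto
  have ri: "integrable (lebesgue_on unit_square) r"
    using r(1) rb S(2) by (intro integrable_bounded_lebesgue_on[where C=C']) auto
  note mc = integrable_lebesgue_on_mult_continuous[OF _ bounded_unit_square]
  have cont: "continuous_on UNIV (\<lambda>x. frechet_derivative \<psi> (at x) h)" if "smooth \<psi>" for \<psi> :: "real^2 \<Rightarrow> real" and h
    using smooth_continuous[OF smooth_frechet_derivative[OF that]] .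
  have meas: "(\<lambda>x. frechet_derivative \<psi> (at x) h) \<in> borel_measurable borel" if "smooth \<psi>" for \<psi> :: "real^2 \<Rightarrow> real" and h
    using borel_measurable_continuous_onI[OF cont[OF that]] .
  have id: "(LINT x|lborel. w1 x * w1 x) + (LINT x|lborel. (w2 x + q x) * w2 x) = 0"
  proof (rule stream_function_identity[OF w1(1-3) w2(1-3) q(1-3)])
    fix \<psi> :: "real^2 \<Rightarrow> real" assume s: "smooth \<psi>"
    have "(LINT x|lebesgue_on unit_square. v x \<bullet> gradient \<psi> x) =
      (LINT x|lebesgue_on unit_square. v x $ 1 * frechet_derivative \<psi> (at x) (axis 1 1)) +
      (LINT x|lebesgue_on unit_square. v x $ 2 * frechet_derivative \<psi> (at x) (axis 2 1))"
      unfolding inner_real2 gradient_def vec_lambda_beta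
      by (intro Bochner_Integration.integral_add mc vi cont s)
    then show "(LINT x|lborel. w1 x * frechet_derivative \<psi> (at x) (axis 1 1)) +
        (LINT x|lborel. w2 x * frechet_derivative \<psi> (at x) (axis 2 1)) = 0"
      using div[OF s] unfolding w1(5)[OF meas[OF s]] w2(5)[OF meas[OF s]] by simp
  next
    fix \<psi> :: "real^2 \<Rightarrow> real" assume t: "\<psi> \<in> test_functions unit_square"
    then have s: "smooth \<psi>" by (simp add: test_functions_def)
    have "(LINT x|lebesgue_on unit_square. (v x + vector [0, r x]) \<bullet> perp_gradient \<psi> x) =
      (LINT x|lebesgue_on unit_square. (v x $ 2 * frechet_derivative \<psi> (at x) (axis 1 1) + r x * frechet_derivative \<psi> (at x) (axis 1 1))
        - v x $ 1 * frechet_derivative \<psi> (at x) (axis 2 1))"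
      by (simp add: inner_real2 perp_gradient_def gradient_def algebra_simps)
    also have "\<dots> = (LINT x|lebesgue_on unit_square. v x $ 2 * frechet_derivative \<psi> (at x) (axis 1 1)) +
      (LINT x|lebesgue_on unit_square. r x * frechet_derivative \<psi> (at x) (axis 1 1)) -
      (LINT x|lebesgue_on unit_square. v x $ 1 * frechet_derivative \<psi> (at x) (axis 2 1))"
      using mc[OF vi cont[OF s]] mc[OF ri cont[OF s]] by simp
    finally have e: "(LINT x|lborel. w2 x * frechet_derivative \<psi> (at x) (axis 1 1)) +
      (LINT x|lborel. q x * frechet_derivative \<psi> (at x) (axis 1 1)) = (LINT x|lborel. w1 x * frechet_derivative \<psi> (at x) (axis 2 1))"
      using curl[OF t] unfolding w1(5)[OF meas[OF s]] w2(5)[OF meas[OF s]] q(5)[OF meas[OF s]] by simp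
    have i: "integrable lborel (\<lambda>x. f x * frechet_derivative \<psi> (at x) (axis 1 1))"
      if "f \<in> borel_measurable borel" "\<And>x. \<bar>f x\<bar> \<le> C'" "\<And>x. x \<notin> unit_square \<Longrightarrow> f x = 0" for f
    proof -
      have "integrable (lebesgue_on unit_square) f"
        using that S by (intro integrable_bounded_lebesgue_on[where C=C']) (auto intro!: measurable_restrict_space1 measurable_completion)
      from mc[OF this cont[OF s]] have "integrable lebesgue (\<lambda>x. indicator unit_square x *\<^sub>R (f x * frechet_derivative \<psi> (at x) (axis 1 1)))"
        using S by (subst (asm) integrable_restrict_space) auto
      moreover have "indicator unit_square x *\<^sub>R (f x * frechet_derivative \<psi> (at x) (axis 1 1)) = f x * frechet_derivative \<psi> (at x) (axis 1 1)" for x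
        using that(3)[of x] by (auto simp: indicator_def)
      ultimately have "integrable lebesgue (\<lambda>x. f x * frechet_derivative \<psi> (at x) (axis 1 1))" by (simp only:)
      then show ?thesis using that(1) meas[OF s] by (subst (asm) integrable_completion) auto
    qed
    show "(LINT x|lborel. (w2 x + q x) * frechet_derivative \<psi> (at x) (axis 1 1)) = (LINT x|lborel. w1 x * frechet_derivative \<psi> (at x) (axis 2 1))"
      using e i[OF w2(1-3)] i[OF q(1-3)] by (simp add: distrib_right)
  qed
  have sq: "integrable (lebesgue_on unit_square) (\<lambda>x. f x * g x)"
    if "f \<in> borel_measurable (lebesgue_on unit_square)" "AE x in lebesgue_on unit_square. \<bar>f x\<bar> \<le> C'"
      "g \<in> borel_measurable (lebesgue_on unit_square)" "AE x in lebesgue_on unit_square. \<bar>g x\<bar> \<le> C'" for f g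
  proof (rule integrable_bounded_lebesgue_on[where C="C' * C'"])
    show "AE x in lebesgue_on unit_square. norm (f x * g x) \<le> C' * C'"
      using that(2,4) by eventually_elim (use C' in \<open>auto simp: abs_mult intro!: mult_mono\<close>)
  qed (use that S in auto)
  have e1: "(LINT x|lborel. w1 x * w1 x) = (LINT x|lebesgue_on unit_square. v x $ 1 * v x $ 1)"
    unfolding w1(5)[OF w1(1), symmetric]
  proof (rule integral_cong_AE)
      show "(\<lambda>x. v x $ 1 * w1 x) \<in> borel_measurable (lebesgue_on unit_square)" using vm[of 1] borel_measurable_lebesgue_on_borel[OF w1(1)] by auto
      show "(\<lambda>x. v x $ 1 * v x $ 1) \<in> borel_measurable (lebesgue_on unit_square)" using vm[of 1] by auto
      show "AE x in lebesgue_on unit_square. v x $ 1 * w1 x = v x $ 1 * v x $ 1" using w1(4) by eventually_elim simp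
    qed
  have e2: "(LINT x|lborel. (w2 x + q x) * w2 x) = (LINT x|lebesgue_on unit_square. v x $ 2 * v x $ 2) + (LINT x|lebesgue_on unit_square. r x * v x $ 2)"
  proof -
    have i: "integrable lborel (\<lambda>x. f x * w2 x)" if f: "f \<in> borel_measurable borel" "\<And>x. \<bar>f x\<bar> \<le> C'" for f
    proof (rule Bochner_Integration.integrable_bound)
      show "integrable lborel (\<lambda>x. C' * C' * indicator unit_square x)"
        using emeasure_bounded_finite[OF bounded_unit_square] open_unit_square by auto
      show "AE x in lborel. norm (f x * w2 x) \<le> norm (C' * C' * indicator unit_square x)"
      proof (intro AE_I2)
        fix x
        have "\<bar>f x\<bar> * \<bar>w2 x\<bar> \<le> C' * C'" using f(2) w2(2) C' by (intro mult_mono) auto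
        then show "norm (f x * w2 x) \<le> norm (C' * C' * indicator unit_square x)"
          using w2(3)[of x] C' by (cases "x \<in> unit_square") (auto simp: abs_mult)
      qed
    qed (use f w2 in auto)
    have "(LINT x|lborel. (w2 x + q x) * w2 x) = (LINT x|lborel. w2 x * w2 x) + (LINT x|lborel. q x * w2 x)"
      using i[OF w2(1,2)] i[OF q(1,2)] by (simp add: distrib_right)
    also have "(LINT x|lborel. w2 x * w2 x) = (LINT x|lebesgue_on unit_square. v x $ 2 * v x $ 2)"
      unfolding w2(5)[OF w2(1), symmetric]
    proof (rule integral_cong_AE)
      show "(\<lambda>x. v x $ 2 * w2 x) \<in> borel_measurable (lebesgue_on unit_square)" using vm[of 2] borel_measurable_lebesgue_on_borel[OF w2(1)] by auto
      show "(\<lambda>x. v x $ 2 * v x $ 2) \<in> borel_measurable (lebesgue_on unit_square)" using vm[of 2] by auto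
      show "AE x in lebesgue_on unit_square. v x $ 2 * w2 x = v x $ 2 * v x $ 2" using w2(4) by eventually_elim simp
    qed
    also have "(LINT x|lborel. q x * w2 x) = (LINT x|lebesgue_on unit_square. r x * v x $ 2)"
      unfolding q(5)[OF w2(1), symmetric]
    proof (rule integral_cong_AE)
      show "(\<lambda>x. r x * w2 x) \<in> borel_measurable (lebesgue_on unit_square)" using r(1) borel_measurable_lebesgue_on_borel[OF w2(1)] by auto
      show "(\<lambda>x. r x * v x $ 2) \<in> borel_measurable (lebesgue_on unit_square)" using vm[of 2] r(1) by auto
      show "AE x in lebesgue_on unit_square. r x * w2 x = r x * v x $ 2" using w2(4) by eventually_elim simp
    qed
    finally show ?thesis .
  qed
  define V1 where "V1 = (LINT x|lebesgue_on unit_square. v x $ 1 * v x $ 1)"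
  define V2 where "V2 = (LINT x|lebesgue_on unit_square. v x $ 2 * v x $ 2)"
  define RV where "RV = (LINT x|lebesgue_on unit_square. r x * v x $ 2)"
  define RR where "RR = (LINT x|lebesgue_on unit_square. r x * r x)"
  have eq: "V1 + V2 + RV = 0" using id unfolding e1 e2 V1_def V2_def RV_def by simp
  \<comment> \<open>Expanding and inserting \<open>eq\<close> gives RR \<ge> 2 V1 + V2.\<close>
  have "0 \<le> (LINT x|lebesgue_on unit_square. (r x + v x $ 2)\<^sup>2)" by simp
  also have "(\<lambda>x. (r x + v x $ 2)\<^sup>2) = (\<lambda>x. r x * r x + 2 * (r x * v x $ 2) + v x $ 2 * v x $ 2)"
    by (rule ext) (simp add: power2_eq_square algebra_simps)
  also have "(LINT x|lebesgue_on unit_square. r x * r x + 2 * (r x * v x $ 2) + v x $ 2 * v x $ 2) = RR + 2 * RV + V2"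
    unfolding RR_def RV_def V2_def using sq[OF r(1) rb r(1) rb] sq[OF r(1) rb vm vb, of 2] sq[OF vm vb vm vb, of 2 2] by simp
  finally have "0 \<le> RR + 2 * RV + V2" .
  moreover have "V1 \<ge> 0" unfolding V1_def by simp
  ultimately have "V1 + V2 \<le> RR" using eq by linarith
  moreover have "(LINT x|lebesgue_on unit_square. (norm (v x))\<^sup>2) = V1 + V2"
    unfolding norm_real2_sq V1_def V2_def unfolding power2_eq_square
    using sq[OF vm vb vm vb, of 1 1] sq[OF vm vb vm vb, of 2 2] by simp
  ultimately show ?thesis by (simp add: RR_def power2_eq_square)
qed

section \<open>Cutoffs and oscillating integrals\<close>

text \<open>From exponent 2 on the power of the positive part is differentiable at 0 too: the
  quotient there is a positive power, tending to 0, times a factor between 0 and 1.\<close>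

lemma max_power_has_real_derivative:
  "((\<lambda>s::real. (max 0 s) ^ Suc (Suc n)) has_real_derivative real (Suc (Suc n)) * (max 0 s) ^ Suc n) (at s)"
proof -
  consider "s > 0" | "s < 0" | "s = 0" by linarith
  then show ?thesis
  proof cases
    case 1
    have "((\<lambda>s::real. s ^ Suc (Suc n)) has_real_derivative real (Suc (Suc n)) * s ^ Suc n) (at s)"
      by (rule DERIV_cong[OF DERIV_pow]) simp
    then have "((\<lambda>s::real. (max 0 s) ^ Suc (Suc n)) has_real_derivative real (Suc (Suc n)) * s ^ Suc n) (at s)"
      by (rule has_field_derivative_transform_within_open[of _ _ _ "{0<..}"]) (use 1 in auto)
    then show ?thesis using 1 by simp
  next
    case 2
    have "((\<lambda>s::real. 0) has_real_derivative 0) (at s)" by simp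
    then have "((\<lambda>s::real. (max 0 s) ^ Suc (Suc n)) has_real_derivative 0) (at s)"
      by (rule has_field_derivative_transform_within_open[of _ _ _ "{..<0}"]) (use 2 in auto)
    then show ?thesis using 2 by simp
  next
    case 3
    have "((\<lambda>h. (max 0 h) ^ Suc n * (max 0 h / h)) \<longlongrightarrow> 0) (at (0::real))"
    proof (rule tendsto_0_le[where K=1])
      have "((\<lambda>h. (max 0 h) ^ Suc n) \<longlongrightarrow> (max 0 0) ^ Suc n) (at (0::real))" by (intro tendsto_intros)
      then show "((\<lambda>h. (max 0 h) ^ Suc n) \<longlongrightarrow> 0) (at (0::real))" by simp
      have le: "norm ((max 0 h) ^ Suc n * (max 0 h / h)) \<le> norm ((max 0 h) ^ Suc n) * 1" for h :: real
        unfolding norm_mult by (intro mult_left_mono) (auto simp: max_def)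
      show "\<forall>\<^sub>F h in at (0::real). norm ((max 0 h) ^ Suc n * (max 0 h / h)) \<le> norm ((max 0 h) ^ Suc n) * (1::real)"
        by (intro always_eventually allI le)
    qed
    then show ?thesis using 3 by (simp add: DERIV_def mult_ac)
  qed
qed

text \<open>The cutoff is the third power of the positive part of 1 - |z - a|^2 / r^2. It is only
  C^2, which suffices because the waves contain at most two of its derivatives, and these as well as
  lower bounds are explicit.\<close>

definition cutoff_arg :: "'a::euclidean_space \<Rightarrow> real \<Rightarrow> 'a \<Rightarrow> real" where
  "cutoff_arg a r z = max 0 (1 - ((z - a) \<bullet> (z - a)) / r\<^sup>2)"

definition cutoff :: "'a::euclidean_space \<Rightarrow> real \<Rightarrow> 'a \<Rightarrow> real" where
  "cutoff a r z = cutoff_arg a r z ^ 3"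

definition cutoff1 :: "'a::euclidean_space \<Rightarrow> real \<Rightarrow> 'a \<Rightarrow> 'a \<Rightarrow> real" where
  "cutoff1 a r h z = 3 * cutoff_arg a r z ^ 2 * (- 2 * ((z - a) \<bullet> h) / r\<^sup>2)"

definition cutoff2 :: "'a::euclidean_space \<Rightarrow> real \<Rightarrow> 'a \<Rightarrow> 'a \<Rightarrow> 'a \<Rightarrow> real" where
  "cutoff2 a r h h' z = 6 * cutoff_arg a r z * (- 2 * ((z - a) \<bullet> h') / r\<^sup>2) * (- 2 * ((z - a) \<bullet> h) / r\<^sup>2)
     + 3 * cutoff_arg a r z ^ 2 * (- 2 * (h' \<bullet> h) / r\<^sup>2)"

lemma cutoff_arg_power_has_derivative:
  "((\<lambda>z. cutoff_arg a r z ^ Suc (Suc n)) has_derivative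
     (\<lambda>h. real (Suc (Suc n)) * cutoff_arg a r z ^ Suc n * (- 2 * ((z - a) \<bullet> h) / r\<^sup>2))) (at z)"
proof -
  have i: "((\<lambda>z. z - a) has_derivative (\<lambda>h. h)) (at z)" by (auto intro!: derivative_eq_intros)
  have "((\<lambda>z. 1 - (1 / r\<^sup>2) * ((z - a) \<bullet> (z - a))) has_derivative (\<lambda>h. 0 - (1 / r\<^sup>2) * ((z - a) \<bullet> h + h \<bullet> (z - a)))) (at z)"
    by (intro has_derivative_diff has_derivative_const has_derivative_mult_right has_derivative_inner i)
  moreover have "0 - (1 / r\<^sup>2) * ((z - a) \<bullet> h + h \<bullet> (z - a)) = - 2 * ((z - a) \<bullet> h) / r\<^sup>2" for h
    using inner_commute[of h "z - a"] by simp
  ultimately have "((\<lambda>z. 1 - (1 / r\<^sup>2) * ((z - a) \<bullet> (z - a))) has_derivative (\<lambda>h. - 2 * ((z - a) \<bullet> h) / r\<^sup>2)) (at z)"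
    by (simp only:)
  then have "((\<lambda>z. 1 - ((z - a) \<bullet> (z - a)) / r\<^sup>2) has_derivative (\<lambda>h. - 2 * ((z - a) \<bullet> h) / r\<^sup>2)) (at z)"
    by simp
  from has_derivative_compose[OF this, of "\<lambda>s. (max 0 s) ^ Suc (Suc n)"
      "(*) (real (Suc (Suc n)) * (max 0 (1 - ((z - a) \<bullet> (z - a)) / r\<^sup>2)) ^ Suc n)"]
  show ?thesis
    using max_power_has_real_derivative[of n "1 - ((z - a) \<bullet> (z - a)) / r\<^sup>2"]
    unfolding has_field_derivative_def cutoff_arg_def by simp
qed

lemma cutoff_has_derivative: "(cutoff a r has_derivative (\<lambda>h. cutoff1 a r h z)) (at z)"
  using cutoff_arg_power_has_derivative[of a r 1 z]
  unfolding cutoff_def cutoff1_def by (simp add: numeral_eq_Suc)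

lemma cutoff1_has_derivative: "(cutoff1 a r h has_derivative (\<lambda>h'. cutoff2 a r h h' z)) (at z)"
proof -
  have 1: "((\<lambda>z. cutoff_arg a r z ^ 2) has_derivative (\<lambda>h'. 2 * cutoff_arg a r z * (- 2 * ((z - a) \<bullet> h') / r\<^sup>2))) (at z)"
    using cutoff_arg_power_has_derivative[of a r 0 z] by (simp add: numeral_eq_Suc)
  have i: "((\<lambda>z. z - a) has_derivative (\<lambda>h. h)) (at z)" by (auto intro!: derivative_eq_intros)
  have "((\<lambda>z. (- 2 / r\<^sup>2) * ((z - a) \<bullet> h)) has_derivative (\<lambda>h'. (- 2 / r\<^sup>2) * (h' \<bullet> h))) (at z)"
    by (intro has_derivative_mult_right has_derivative_inner_left i)
  then have 2: "((\<lambda>z. - 2 * ((z - a) \<bullet> h) / r\<^sup>2) has_derivative (\<lambda>h'. - 2 * (h' \<bullet> h) / r\<^sup>2)) (at z)"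
    by simp
  have "((\<lambda>z. 3 * (cutoff_arg a r z ^ 2 * (- 2 * ((z - a) \<bullet> h) / r\<^sup>2))) has_derivative
     (\<lambda>h'. 3 * (cutoff_arg a r z ^ 2 * (- 2 * (h' \<bullet> h) / r\<^sup>2) +
        2 * cutoff_arg a r z * (- 2 * ((z - a) \<bullet> h') / r\<^sup>2) * (- 2 * ((z - a) \<bullet> h) / r\<^sup>2)))) (at z)"
    by (intro has_derivative_mult_right has_derivative_mult[OF 1 2])
  moreover have "cutoff1 a r h = (\<lambda>z. 3 * (cutoff_arg a r z ^ 2 * (- 2 * ((z - a) \<bullet> h) / r\<^sup>2)))"
    by (simp add: cutoff1_def fun_eq_iff)
  moreover have "cutoff2 a r h h' z = 3 * (cutoff_arg a r z ^ 2 * (- 2 * (h' \<bullet> h) / r\<^sup>2) +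
        2 * cutoff_arg a r z * (- 2 * ((z - a) \<bullet> h') / r\<^sup>2) * (- 2 * ((z - a) \<bullet> h) / r\<^sup>2))" for h'
    by (simp add: cutoff2_def)
  ultimately show ?thesis by simp
qed

lemma cutoff_arg_continuous: "continuous_on UNIV (cutoff_arg a r)"
  unfolding cutoff_arg_def by (cases "r = 0") (auto intro!: continuous_intros)

lemma cutoff_continuous: "continuous_on UNIV (cutoff a r)"
  unfolding cutoff_def by (intro continuous_intros cutoff_arg_continuous)

lemma cutoff1_continuous: "continuous_on UNIV (cutoff1 a r h)"
  unfolding cutoff1_def by (cases "r = 0") (auto intro!: continuous_intros cutoff_arg_continuous)

lemma cutoff2_continuous: "continuous_on UNIV (cutoff2 a r h h')"
  unfolding cutoff2_def by (cases "r = 0") (auto intro!: continuous_intros cutoff_arg_continuous)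

lemma cutoff_arg_outside: "r > 0 \<Longrightarrow> z \<notin> cball a r \<Longrightarrow> cutoff_arg a r z = 0"
proof -
  assume r: "r > 0" and z: "z \<notin> cball a r"
  then have "r\<^sup>2 \<le> (norm (z - a))\<^sup>2" by (intro power_mono) (auto simp: dist_norm norm_minus_commute)
  then show ?thesis using r by (simp add: cutoff_arg_def power2_norm_eq_inner)
qed

lemma cutoff_outside:
  assumes "r > 0" "z \<notin> cball a r"
  shows "cutoff a r z = 0" "cutoff1 a r h z = 0" "cutoff2 a r h h' z = 0"
  using cutoff_arg_outside[OF assms] by (simp_all add: cutoff_def cutoff1_def cutoff2_def)

lemma cutoff_bounds: "0 \<le> cutoff a r z" "cutoff a r z \<le> 1"
  unfolding cutoff_def cutoff_arg_def by (auto intro!: power_le_one zero_le_divide_iff[THEN iffD2])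

lemma cutoff_lower:
  assumes "r > 0" "z \<in> ball a (r / 2)"
  shows "27 / 64 \<le> cutoff a r z"
proof -
  have "(norm (z - a))\<^sup>2 \<le> (r / 2)\<^sup>2" using assms by (intro power_mono) (auto simp: dist_norm norm_minus_commute)
  then have "((z - a) \<bullet> (z - a)) / r\<^sup>2 \<le> 1 / 4"
    using assms(1) by (simp add: power2_norm_eq_inner divide_le_eq power_divide)
  then have "3 / 4 \<le> cutoff_arg a r z" unfolding cutoff_arg_def by linarith
  then have "(3 / 4) ^ 3 \<le> cutoff_arg a r z ^ 3" by (intro power_mono) auto
  then show ?thesis by (simp add: cutoff_def power3_eq_cube)
qed

text \<open>Translation by half a wave length, \<open>y n\<close>, reverses the sign of the cosine.
  Twice the integral is therefore that of (H(z) - H(z + y_n)) times the cosine, and this difference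
  tends to 0 in L1 because H is continuous with compact support.\<close>

lemma riemann_lebesgue_continuous:
  fixes H :: "'a::euclidean_space \<Rightarrow> real"
  assumes H: "continuous_on UNIV H" "\<And>z. z \<notin> cball a r \<Longrightarrow> H z = 0" and k: "k \<noteq> 0"
  shows "(\<lambda>n. LINT z|lborel. H z * cos (real n * (k \<bullet> z))) \<longlonglongrightarrow> 0"
proof -
  define y where "y n = (pi / (real n * (k \<bullet> k))) *\<^sub>R k" for n
  have kk: "k \<bullet> k > 0" using k by simp
  have yl: "y \<longlonglongrightarrow> 0"
  proof -
    have "(\<lambda>n. (pi / (k \<bullet> k)) * (1 / real n)) \<longlonglongrightarrow> (pi / (k \<bullet> k)) * 0"
      by (intro tendsto_mult tendsto_const lim_1_over_n)
    then have "(\<lambda>n. ((pi / (k \<bullet> k)) * (1 / real n)) *\<^sub>R k) \<longlonglongrightarrow> (0::real) *\<^sub>R k"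
      by (intro tendsto_scaleR tendsto_const) simp
    then show ?thesis unfolding y_def by (simp add: mult_ac)
  qed
  obtain C where C: "C \<ge> 0" "\<And>z. \<bar>H z\<bar> \<le> C"
    using continuous_compact_support_bounded[OF H(1) compact_cball H(2)] by metis
  have Hm: "H \<in> borel_measurable borel" by (rule borel_measurable_continuous_onI[OF H(1)])
  have Hi: "integrable lborel H" by (rule integrable_lborel_continuous_compact_support[OF H(1) compact_cball H(2)])
  have "eventually (\<lambda>n. norm (y n) < 1) sequentially"
    using yl by (auto dest!: tendstoD[where e=1])
  then obtain N where N: "\<And>n. n \<ge> N \<Longrightarrow> norm (y n) < 1" by (auto simp: eventually_sequentially)
  have Hti: "integrable lborel (\<lambda>z. H (z + y n))" for n
    using Hi lborel_integrable_translation[OF Hm] by blast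
  have lim: "(\<lambda>n. LINT z|lborel. \<bar>H z - H (z + y (n + N))\<bar>) \<longlonglongrightarrow> (LINT z|(lborel :: 'a measure). (0::real))"
  proof (rule integral_dominated_convergence[where w="\<lambda>z. 2 * C * indicator (cball a (\<bar>r\<bar> + 1)) z"])
    show "integrable lborel (\<lambda>z. 2 * C * indicator (cball a (\<bar>r\<bar> + 1)) z)"
      using emeasure_bounded_finite[OF bounded_cball[of a "\<bar>r\<bar> + 1"]] by auto
    show "AE z in lborel. (\<lambda>n. \<bar>H z - H (z + y (n + N))\<bar>) \<longlonglongrightarrow> 0"
    proof (intro AE_I2)
      fix z
      have "(\<lambda>n. z + y (n + N)) \<longlonglongrightarrow> z + 0" by (intro tendsto_add tendsto_const LIMSEQ_ignore_initial_segment yl)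
      then have "(\<lambda>n. H (z + y (n + N))) \<longlonglongrightarrow> H z"
        using continuous_on_tendsto_compose[OF H(1), of "\<lambda>n. z + y (n + N)" z] by simp
      from tendsto_rabs[OF tendsto_diff[OF tendsto_const[of "H z"] this]]
      show "(\<lambda>n. \<bar>H z - H (z + y (n + N))\<bar>) \<longlonglongrightarrow> 0" by simp
    qed
    show "AE z in lborel. norm \<bar>H z - H (z + y (n + N))\<bar> \<le> 2 * C * indicator (cball a (\<bar>r\<bar> + 1)) z" for n
    proof (intro AE_I2)
      fix z
      show "norm \<bar>H z - H (z + y (n + N))\<bar> \<le> 2 * C * indicator (cball a (\<bar>r\<bar> + 1)) z"
      proof (cases "z \<in> cball a (\<bar>r\<bar> + 1)")
        case True then show ?thesis using C(2)[of z] C(2)[of "z + y (n + N)"] by simp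
      next
        case False
        have "dist a z \<le> dist a (z + y (n + N)) + norm (y (n + N))"
          using dist_triangle[of a z "z + y (n + N)"] by (simp add: dist_norm)
        then have "z \<notin> cball a r" "z + y (n + N) \<notin> cball a r" using False N[of "n + N"] by auto
        then show ?thesis using H(2) False by simp
      qed
    qed
    show "(\<lambda>z. \<bar>H z - H (z + y (n + N))\<bar>) \<in> borel_measurable lborel" for n
      using borel_measurable_integrable[OF Hti] Hm by auto
  qed simp
  have bd: "\<bar>LINT z|lborel. H z * cos (real n * (k \<bullet> z))\<bar> \<le> (LINT z|lborel. \<bar>H z - H (z + y n)\<bar>)" if n: "n > 0" for n
  proof -
    define c where "c z = cos (real n * (k \<bullet> z))" for z
    have cc: "continuous_on UNIV c" unfolding c_def by (intro continuous_intros)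
    have cm: "c \<in> borel_measurable borel" by (rule borel_measurable_continuous_onI[OF cc])
    have cs: "c (z + y n) = - c z" for z
    proof -
      have "real n * (k \<bullet> (z + y n)) = real n * (k \<bullet> z) + pi"
        using n kk by (simp add: y_def inner_add_right distrib_left)
      then show ?thesis by (simp add: c_def)
    qed
    have i: "integrable lborel (\<lambda>z. f z * c z)" if "integrable lborel f" for f
    proof (rule Bochner_Integration.integrable_bound[OF that])
      show "(\<lambda>z. f z * c z) \<in> borel_measurable lborel" using borel_measurable_integrable[OF that] cm by auto
      show "AE z in lborel. norm (f z * c z) \<le> norm (f z)"
        by (intro AE_I2) (auto simp: c_def abs_mult mult_left_le)
    qed
    have "(LINT z|lborel. H z * c z) = (LINT z|lborel. H (z + y n) * c (z + y n))"
      using lborel_integral_translation[of "\<lambda>z. H z * c z" "y n"] Hm cm by simp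
    also have "\<dots> = - (LINT z|lborel. H (z + y n) * c z)" unfolding cs by simp
    finally have "2 * (LINT z|lborel. H z * c z) = (LINT z|lborel. H z * c z) - (LINT z|lborel. H (z + y n) * c z)" by simp
    also have "\<dots> = (LINT z|lborel. (H z - H (z + y n)) * c z)"
      using i[OF Hi] i[OF Hti[of n]] by (simp add: left_diff_distrib)
    also have "\<bar>\<dots>\<bar> \<le> (LINT z|lborel. \<bar>H z - H (z + y n)\<bar>)"
      using Hi Hti[of n] by (intro order_trans[OF integral_abs_bound integral_mono']) (auto simp: c_def abs_mult mult_left_le)
    finally have "\<bar>2 * (LINT z|lborel. H z * c z)\<bar> \<le> (LINT z|lborel. \<bar>H z - H (z + y n)\<bar>)" .
    then show ?thesis unfolding c_def by simp
  qed
  \<comment> \<open>Frequency 0 has no half wave length, and from N on the shift is shorter than 1,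
    which keeps all supports in one ball.\<close>
  have "(\<lambda>n. LINT z|lborel. H z * cos (real (n + Suc N) * (k \<bullet> z))) \<longlonglongrightarrow> 0"
  proof (rule tendsto_0_le[where K=1])
    show "(\<lambda>n. LINT z|lborel. \<bar>H z - H (z + y (Suc n + N))\<bar>) \<longlonglongrightarrow> 0"
      using LIMSEQ_Suc[OF lim] by simp
    show "\<forall>\<^sub>F n in sequentially. norm (LINT z|lborel. H z * cos (real (n + Suc N) * (k \<bullet> z)))
       \<le> norm (LINT z|lborel. \<bar>H z - H (z + y (Suc n + N))\<bar>) * 1"
    proof (intro always_eventually allI)
      fix n
      show "norm (LINT z|lborel. H z * cos (real (n + Suc N) * (k \<bullet> z)))
       \<le> norm (LINT z|lborel. \<bar>H z - H (z + y (Suc n + N))\<bar>) * 1"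
        using bd[of "n + Suc N"] by simp
    qed
  qed
  then show ?thesis by (rule LIMSEQ_offset)
qed

lemma lebesgue_on_integral_eq_lborel:
  fixes f :: "'a::euclidean_space \<Rightarrow> real"
  assumes "f \<in> borel_measurable borel" "S \<in> sets lebesgue" "\<And>x. x \<notin> S \<Longrightarrow> f x = 0"
  shows "(LINT x|lebesgue_on S. f x) = (LINT x|lborel. f x)"
proof -
  have "(LINT x|lebesgue_on S. f x) = (LINT x|lebesgue. indicator S x *\<^sub>R f x)"
    using assms by (intro integral_restrict_space) auto
  also have "\<dots> = (LINT x|lebesgue. f x)"
    by (intro Bochner_Integration.integral_cong) (auto simp: indicator_def assms(3))
  also have "\<dots> = (LINT x|lborel. f x)" using assms by (intro integral_completion) auto
  finally show ?thesis .
qed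

text \<open>The oscillating factor has modulus at most 1, so replacing G by a continuous L1
  approximation costs an error uniform in n. As \<theta> lives inside S, the remaining integral
  extends to the whole space.\<close>

lemma riemann_lebesgue:
  fixes G \<theta> :: "'a::euclidean_space \<Rightarrow> real"
  assumes G: "integrable (lebesgue_on S) G" and S: "S \<in> lmeasurable"
    and \<theta>: "continuous_on UNIV \<theta>" "\<And>z. z \<notin> cball a r \<Longrightarrow> \<theta> z = 0" "\<And>z. \<bar>\<theta> z\<bar> \<le> 1" and sub: "cball a r \<subseteq> S" and k: "k \<noteq> 0"
  shows "(\<lambda>n. LINT z|lebesgue_on S. G z * (\<theta> z * cos (real n * (k \<bullet> z)))) \<longlonglongrightarrow> 0"
proof (rule LIMSEQ_I)
  fix e :: real assume e: "e > 0"
  then have "e / 2 > 0" by simp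
  from integrable_approx_continuous[OF G S this]
  obtain g C where g: "continuous_on UNIV g" "\<And>x. \<bar>g x\<bar> \<le> C" "integrable (lebesgue_on S) (\<lambda>x. G x - g x)"
    "(LINT x|lebesgue_on S. \<bar>G x - g x\<bar>) < e / 2" by metis
  define c where "c n z = \<theta> z * cos (real n * (k \<bullet> z))" for n z
  have cc: "continuous_on UNIV (c n)" for n unfolding c_def by (intro continuous_intros \<theta>(1))
  have cb: "\<bar>c n z\<bar> \<le> 1" for n z
    unfolding c_def abs_mult using \<theta>(3)[of z] by (intro mult_le_one) auto
  have cm: "c n \<in> borel_measurable (lebesgue_on S)" for n
    by (rule borel_measurable_lebesgue_on_borel[OF borel_measurable_continuous_onI[OF cc]])
  have i: "integrable (lebesgue_on S) (\<lambda>z. f z * c n z)" if "integrable (lebesgue_on S) f" for f n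
  proof (rule Bochner_Integration.integrable_bound[OF that])
    show "(\<lambda>z. f z * c n z) \<in> borel_measurable (lebesgue_on S)" using borel_measurable_integrable[OF that] cm by auto
    show "AE z in lebesgue_on S. norm (f z * c n z) \<le> norm (f z)"
      using cb by (intro AE_I2) (auto simp: abs_mult mult_left_le)
  qed
  have t0: "\<theta> z = 0" if "z \<notin> S" for z using sub \<theta>(2) that by blast
  have gi: "integrable (lebesgue_on S) g" using Bochner_Integration.integrable_diff[OF G g(3)] by simp
  have "(\<lambda>n. LINT z|lborel. (g z * \<theta> z) * cos (real n * (k \<bullet> z))) \<longlonglongrightarrow> 0"
    by (rule riemann_lebesgue_continuous[where a=a and r=r]) (use \<theta> g k in \<open>auto intro!: continuous_intros\<close>)
  moreover have "(LINT z|lebesgue_on S. g z * c n z) = (LINT z|lborel. (g z * \<theta> z) * cos (real n * (k \<bullet> z)))" for n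
    unfolding c_def mult.assoc[symmetric] using S t0
    by (intro lebesgue_on_integral_eq_lborel borel_measurable_continuous_onI continuous_intros g \<theta>) auto
  ultimately have "(\<lambda>n. LINT z|lebesgue_on S. g z * c n z) \<longlonglongrightarrow> 0" by simp
  then obtain N where N: "\<And>n. n \<ge> N \<Longrightarrow> \<bar>LINT z|lebesgue_on S. g z * c n z\<bar> < e / 2"
    using LIMSEQ_D[of "\<lambda>n. LINT z|lebesgue_on S. g z * c n z" 0 "e / 2"] e by auto
  show "\<exists>N. \<forall>n\<ge>N. norm ((LINT z|lebesgue_on S. G z * (\<theta> z * cos (real n * (k \<bullet> z)))) - 0) < e"
  proof (intro exI allI impI)
    fix n assume n: "n \<ge> N"
    have "(LINT z|lebesgue_on S. G z * c n z) = (LINT z|lebesgue_on S. (G z - g z) * c n z) + (LINT z|lebesgue_on S. g z * c n z)"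
      using i[OF g(3)] i[OF gi] by (subst Bochner_Integration.integral_add[symmetric]) (auto simp: left_diff_distrib)
    moreover have "\<bar>LINT z|lebesgue_on S. (G z - g z) * c n z\<bar> \<le> (LINT z|lebesgue_on S. \<bar>G z - g z\<bar>)"
      using g(3) cb by (intro order_trans[OF integral_abs_bound integral_mono']) (auto simp: abs_mult mult_left_le)
    ultimately show "norm ((LINT z|lebesgue_on S. G z * (\<theta> z * cos (real n * (k \<bullet> z)))) - 0) < e"
      using g(4) N[OF n] unfolding c_def[symmetric] by simp
  qed
qed

text \<open>\<open>packet_grad\<close> and \<open>packet_hess\<close> are the first and second
  directional derivatives of the potential \<theta>(z) cos(N (k \<bullet> z)) / N^2, with \<theta>
  the cutoff. The potential itself never occurs. The factor 1/N^2 leaves second derivatives of order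
  one.\<close>

definition packet_grad :: "'a::euclidean_space \<Rightarrow> real \<Rightarrow> 'a \<Rightarrow> real \<Rightarrow> 'a \<Rightarrow> 'a \<Rightarrow> real" where
  "packet_grad a r k N h z = (cutoff1 a r h z * cos (N * (k \<bullet> z)) - N * (k \<bullet> h) * (cutoff a r z * sin (N * (k \<bullet> z)))) / N\<^sup>2"

definition packet_hess :: "'a::euclidean_space \<Rightarrow> real \<Rightarrow> 'a \<Rightarrow> real \<Rightarrow> 'a \<Rightarrow> 'a \<Rightarrow> 'a \<Rightarrow> real" where
  "packet_hess a r k N h h' z =
     (cutoff2 a r h h' z * cos (N * (k \<bullet> z)) - N * (k \<bullet> h') * (cutoff1 a r h z * sin (N * (k \<bullet> z)))
       - N * (k \<bullet> h) * (cutoff1 a r h' z * sin (N * (k \<bullet> z)))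
       - N\<^sup>2 * (k \<bullet> h) * (k \<bullet> h') * (cutoff a r z * cos (N * (k \<bullet> z)))) / N\<^sup>2"

text \<open>Only one derivative of the stream function enters the flux, hence 1/N in place of 1/N^2;
  the sine makes its leading term a cosine, in phase with the Hessian.\<close>

definition packet_stream :: "'a::euclidean_space \<Rightarrow> real \<Rightarrow> 'a \<Rightarrow> real \<Rightarrow> 'a \<Rightarrow> real" where
  "packet_stream a r k N z = cutoff a r z * sin (N * (k \<bullet> z)) / N"

definition packet_stream1 :: "'a::euclidean_space \<Rightarrow> real \<Rightarrow> 'a \<Rightarrow> real \<Rightarrow> 'a \<Rightarrow> 'a \<Rightarrow> real" where
  "packet_stream1 a r k N h z = cutoff1 a r h z * sin (N * (k \<bullet> z)) / N + (k \<bullet> h) * (cutoff a r z * cos (N * (k \<bullet> z)))"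

lemma phase_has_derivative:
  "((\<lambda>z. cos (N * (k \<bullet> z))) has_derivative (\<lambda>h. - sin (N * (k \<bullet> z)) * (N * (k \<bullet> h)))) (at z)"
  "((\<lambda>z. sin (N * (k \<bullet> z))) has_derivative (\<lambda>h. cos (N * (k \<bullet> z)) * (N * (k \<bullet> h)))) (at z)"
  by (auto intro!: derivative_eq_intros)

lemma packet_grad_has_derivative:
  assumes "N \<noteq> 0"
  shows "(packet_grad a r k N h has_derivative (\<lambda>h'. packet_hess a r k N h h' z)) (at z)"
proof -
  have "((\<lambda>z. (1 / N\<^sup>2) * (cutoff1 a r h z * cos (N * (k \<bullet> z)) - N * (k \<bullet> h) * (cutoff a r z * sin (N * (k \<bullet> z)))))
    has_derivative (\<lambda>h'. (1 / N\<^sup>2) * ((cutoff1 a r h z * (- sin (N * (k \<bullet> z)) * (N * (k \<bullet> h'))) + cutoff2 a r h h' z * cos (N * (k \<bullet> z)))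
      - N * (k \<bullet> h) * (cutoff a r z * (cos (N * (k \<bullet> z)) * (N * (k \<bullet> h'))) + cutoff1 a r h' z * sin (N * (k \<bullet> z)))))) (at z)"
    by (intro has_derivative_mult_right has_derivative_diff has_derivative_mult phase_has_derivative
        cutoff_has_derivative cutoff1_has_derivative)
  moreover have "packet_grad a r k N h = (\<lambda>z. (1 / N\<^sup>2) * (cutoff1 a r h z * cos (N * (k \<bullet> z)) - N * (k \<bullet> h) * (cutoff a r z * sin (N * (k \<bullet> z)))))"
    by (simp add: packet_grad_def fun_eq_iff)
  moreover have "packet_hess a r k N h h' z = (1 / N\<^sup>2) * ((cutoff1 a r h z * (- sin (N * (k \<bullet> z)) * (N * (k \<bullet> h'))) + cutoff2 a r h h' z * cos (N * (k \<bullet> z)))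
      - N * (k \<bullet> h) * (cutoff a r z * (cos (N * (k \<bullet> z)) * (N * (k \<bullet> h'))) + cutoff1 a r h' z * sin (N * (k \<bullet> z))))" for h'
  proof -
    have "P * c - N * b' * (X * s) - N * b * (Y * s) - N\<^sup>2 * b * b' * (Z * c) =
      (X * (- s * (N * b')) + P * c) - N * b * (Z * (c * (N * b')) + Y * s)" for P c b b' X Y Z s :: real
      by (simp add: power2_eq_square algebra_simps)
    note num = this[of "cutoff2 a r h h' z" "cos (N * (k \<bullet> z))" "k \<bullet> h'" "cutoff1 a r h z" "sin (N * (k \<bullet> z))"
        "k \<bullet> h" "cutoff1 a r h' z" "cutoff a r z"]
    show ?thesis unfolding packet_hess_def num by simp
  qed
  ultimately show ?thesis by simp
qed

lemma packet_stream_has_derivative: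
  assumes "N \<noteq> 0"
  shows "(packet_stream a r k N has_derivative (\<lambda>h. packet_stream1 a r k N h z)) (at z)"
proof -
  have "((\<lambda>z. (1 / N) * (cutoff a r z * sin (N * (k \<bullet> z)))) has_derivative
     (\<lambda>h. (1 / N) * (cutoff a r z * (cos (N * (k \<bullet> z)) * (N * (k \<bullet> h))) + cutoff1 a r h z * sin (N * (k \<bullet> z))))) (at z)"
    by (intro has_derivative_mult_right has_derivative_mult phase_has_derivative cutoff_has_derivative)
  moreover have "packet_stream1 a r k N h z = (1 / N) * (cutoff a r z * (cos (N * (k \<bullet> z)) * (N * (k \<bullet> h))) + cutoff1 a r h z * sin (N * (k \<bullet> z)))" for h
    using assms by (simp add: packet_stream1_def field_simps)
  moreover have "packet_stream a r k N = (\<lambda>z. (1 / N) * (cutoff a r z * sin (N * (k \<bullet> z))))"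
    by (simp add: packet_stream_def fun_eq_iff)
  ultimately show ?thesis by simp
qed

lemma packet_continuous:
  "continuous_on UNIV (packet_grad a r k N h)" "continuous_on UNIV (packet_hess a r k N h h')"
  "continuous_on UNIV (packet_stream1 a r k N h)"
  unfolding packet_grad_def packet_hess_def packet_stream1_def
  by (cases "N = 0"; auto intro!: continuous_intros cutoff_continuous cutoff1_continuous cutoff2_continuous)+

lemma packet_outside:
  assumes "r > 0" "z \<notin> cball a r"
  shows "packet_grad a r k N h z = 0" "packet_hess a r k N h h' z = 0" "packet_stream a r k N z = 0" "packet_stream1 a r k N h z = 0"
  using cutoff_outside[OF assms] by (simp_all add: packet_grad_def packet_hess_def packet_stream_def packet_stream1_def)

lemma cutoff2_commute: "cutoff2 a r h h' z = cutoff2 a r h' h z"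
  unfolding cutoff2_def inner_commute[of h h'] by (simp only: mult.assoc mult.commute mult.left_commute)

lemma packet_hess_commute: "packet_hess a r k N h h' z = packet_hess a r k N h' h z"
  unfolding packet_hess_def cutoff2_commute[of a r h h'] by (simp add: algebra_simps)

text \<open>Only the term in which both derivatives hit the phase carries N^2. In every other term a
  derivative falls on the cutoff and at least one factor 1/N remains.\<close>

lemma packet_hess_approx:
  assumes "r > 0"
  obtains C where "\<And>N z. N \<ge> 1 \<Longrightarrow> \<bar>packet_hess a r k N h h' z + (k \<bullet> h) * (k \<bullet> h') * (cutoff a r z * cos (N * (k \<bullet> z)))\<bar> \<le> C / N"
proof -
  obtain A where A: "A \<ge> 0" "\<And>z. \<bar>cutoff2 a r h h' z\<bar> \<le> A"
    using continuous_compact_support_bounded[OF cutoff2_continuous compact_cball cutoff_outside(3)[OF assms]] by metis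
  obtain B where B: "B \<ge> 0" "\<And>z. \<bar>cutoff1 a r h z\<bar> \<le> B"
    using continuous_compact_support_bounded[OF cutoff1_continuous compact_cball cutoff_outside(2)[OF assms]] by metis
  obtain D where D: "D \<ge> 0" "\<And>z. \<bar>cutoff1 a r h' z\<bar> \<le> D"
    using continuous_compact_support_bounded[OF cutoff1_continuous compact_cball cutoff_outside(2)[OF assms]] by metis
  define C where "C = A + \<bar>k \<bullet> h'\<bar> * B + \<bar>k \<bullet> h\<bar> * D"
  have "\<bar>packet_hess a r k N h h' z + (k \<bullet> h) * (k \<bullet> h') * (cutoff a r z * cos (N * (k \<bullet> z)))\<bar> \<le> C / N" if N: "N \<ge> 1" for N z
  proof -
    define c s where "c = cos (N * (k \<bullet> z))" and "s = sin (N * (k \<bullet> z))"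
    have cs: "\<bar>c\<bar> \<le> 1" "\<bar>s\<bar> \<le> 1" by (simp_all add: c_def s_def)
    have "packet_hess a r k N h h' z + (k \<bullet> h) * (k \<bullet> h') * (cutoff a r z * c) =
      (1 / N\<^sup>2) * (cutoff2 a r h h' z * c) - (1 / N) * ((k \<bullet> h') * (cutoff1 a r h z * s)) - (1 / N) * ((k \<bullet> h) * (cutoff1 a r h' z * s))"
    proof -
      have "(P - N * b * S - N * d * R - N\<^sup>2 * d * b * X) / N\<^sup>2 + d * b * X = (1 / N\<^sup>2) * P - (1 / N) * (b * S) - (1 / N) * (d * R)"
        for P b S d R X :: real
        using N by (simp add: field_simps power2_eq_square)
      then show ?thesis unfolding packet_hess_def c_def[symmetric] s_def[symmetric] by blast
    qed
    moreover have "\<bar>(1 / N\<^sup>2) * (cutoff2 a r h h' z * c)\<bar> \<le> (1 / N) * (A * 1)"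
    proof -
      have "N * 1 \<le> N * N" using N by (intro mult_left_mono) auto
      then have "1 / N\<^sup>2 \<le> 1 / N" using N by (intro divide_left_mono) (auto simp: power2_eq_square)
      then have "\<bar>1 / N\<^sup>2\<bar> * (\<bar>cutoff2 a r h h' z\<bar> * \<bar>c\<bar>) \<le> (1 / N) * (A * 1)"
        using N A cs by (intro mult_mono) auto
      then show ?thesis by (simp only: abs_mult)
    qed
    moreover have "\<bar>(1 / N) * ((k \<bullet> h') * (cutoff1 a r h z * s))\<bar> \<le> (1 / N) * (\<bar>k \<bullet> h'\<bar> * (B * 1))"
      unfolding abs_mult using N B cs by (intro mult_mono) auto
    moreover have "\<bar>(1 / N) * ((k \<bullet> h) * (cutoff1 a r h' z * s))\<bar> \<le> (1 / N) * (\<bar>k \<bullet> h\<bar> * (D * 1))"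
      unfolding abs_mult using N D cs by (intro mult_mono) auto
    moreover have "C / N = (1 / N) * (A * 1) + (1 / N) * (\<bar>k \<bullet> h'\<bar> * (B * 1)) + (1 / N) * (\<bar>k \<bullet> h\<bar> * (D * 1))"
      by (simp add: C_def add_divide_distrib)
    ultimately show ?thesis unfolding c_def[symmetric] by linarith
  qed
  then show ?thesis by (rule that)
qed

lemma packet_stream1_approx:
  assumes "r > 0"
  obtains C where "\<And>N z. N \<ge> 1 \<Longrightarrow> \<bar>packet_stream1 a r k N h z - (k \<bullet> h) * (cutoff a r z * cos (N * (k \<bullet> z)))\<bar> \<le> C / N"
proof -
  obtain B where B: "B \<ge> 0" "\<And>z. \<bar>cutoff1 a r h z\<bar> \<le> B"
    using continuous_compact_support_bounded[OF cutoff1_continuous compact_cball cutoff_outside(2)[OF assms]] by metis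
  have "\<bar>packet_stream1 a r k N h z - (k \<bullet> h) * (cutoff a r z * cos (N * (k \<bullet> z)))\<bar> \<le> B / N" if N: "N \<ge> 1" for N z
  proof -
    have "\<bar>cutoff1 a r h z\<bar> * \<bar>sin (N * (k \<bullet> z))\<bar> \<le> B * 1" using B by (intro mult_mono) auto
    then have "\<bar>cutoff1 a r h z * sin (N * (k \<bullet> z))\<bar> / N \<le> B / N" using N by (intro divide_right_mono) (auto simp: abs_mult)
    then show ?thesis using N by (simp add: packet_stream1_def)
  qed
  then show ?thesis by (rule that)
qed

section \<open>Localized plane waves\<close>

text \<open>A homogeneous solution of the linear system supported in K. It is tested with arbitrary
  smooth functions on the whole space and at every time; for K inside the slab there are neither
  boundary nor initial terms, so it can be added to any solution.\<close>

definition perturbation ::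
  "((real^2) \<times> real) set \<Rightarrow> ((real^2) \<times> real \<Rightarrow> real) \<Rightarrow> ((real^2) \<times> real \<Rightarrow> real^2) \<Rightarrow> ((real^2) \<times> real \<Rightarrow> real^2) \<Rightarrow> bool" where
  "perturbation K \<rho> v m \<longleftrightarrow>
     continuous_on UNIV (\<lambda>z. (\<rho> z, v z, m z)) \<and> (\<forall>z. z \<notin> K \<longrightarrow> \<rho> z = 0 \<and> v z = 0 \<and> m z = 0) \<and>
     (\<forall>\<phi>. smooth \<phi> \<longrightarrow> (LINT z|lborel. \<rho> z * time_deriv \<phi> z + m z \<bullet> space_gradient \<phi> z) = 0) \<and>
     (\<forall>t \<psi>. smooth \<psi> \<longrightarrow> (LINT x|lborel. v (x, t) \<bullet> gradient \<psi> x) = 0) \<and>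
     (\<forall>t \<psi>. smooth \<psi> \<longrightarrow> (LINT x|lborel. (v (x, t) + vector [0, \<rho> (x, t)]) \<bullet> perp_gradient \<psi> x) = 0)"

abbreviation "dir1 \<equiv> (axis 1 1, 0) :: (real^2) \<times> real"
abbreviation "dir2 \<equiv> (axis 2 1, 0) :: (real^2) \<times> real"
abbreviation "dirt \<equiv> (0, 1) :: (real^2) \<times> real"

lemma vector_real2_eq: "(vector [a, b] :: real^2) = a *\<^sub>R axis 1 1 + b *\<^sub>R axis 2 1"
  by (simp add: vec_eq_iff forall_2 axis_def)

lemma continuous_on_vector [continuous_intros]:
  "continuous_on S f \<Longrightarrow> continuous_on S g \<Longrightarrow> continuous_on S (\<lambda>x. vector [f x, g x] :: real^2)"
  unfolding vector_real2_eq by (intro continuous_intros)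

text \<open>The potentials: with \<open>f = - A \<theta> cos (N (k \<bullet> z)) / N\<^sup>2\<close> and \<open>\<vartheta> = B \<theta> sin (N (k \<bullet> z)) / N\<close> for a
  cutoff \<open>\<theta>\<close>, the density is the Laplacian of \<open>f\<close>, the velocity is \<open>- \<nabla>\<^sup>\<bottom> \<partial>\<^sub>1 f\<close> and the flux is
  \<open>- \<partial>\<^sub>t \<nabla> f + \<nabla>\<^sup>\<bottom> \<vartheta>\<close>.\<close>

definition wave_density where
  "wave_density a r k A N z = - A * (packet_hess a r k N dir1 dir1 z + packet_hess a r k N dir2 dir2 z)"

definition wave_velocity :: "_ \<Rightarrow> _ \<Rightarrow> _ \<Rightarrow> _ \<Rightarrow> _ \<Rightarrow> _ \<Rightarrow> real^2" where
  "wave_velocity a r k A N z = vector [- A * packet_hess a r k N dir1 dir2 z, A * packet_hess a r k N dir1 dir1 z]"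

definition wave_flux :: "_ \<Rightarrow> _ \<Rightarrow> _ \<Rightarrow> _ \<Rightarrow> _ \<Rightarrow> _ \<Rightarrow> _ \<Rightarrow> real^2" where
  "wave_flux a r k A B N z = vector [A * packet_hess a r k N dir1 dirt z - B * packet_stream1 a r k N dir2 z,
     A * packet_hess a r k N dir2 dirt z + B * packet_stream1 a r k N dir1 z]"

text \<open>Each equation integrates an antisymmetric combination d_p g d_q \<phi> - d_q g d_p
  \<phi>, where g is a first derivative of the potential or the stream function.
  \<open>integral_swap_derivatives\<close> makes it vanish, so the C^2 cutoff is smooth
  enough.\<close>

lemma wave_perturbation:
  assumes r: "r > 0" and N: "N \<noteq> 0"
  shows "perturbation (cball a r) (wave_density a r k A N) (wave_velocity a r k A N) (wave_flux a r k A B N)"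
proof -
  define H where "H = packet_hess a r k N"
  define G where "G = packet_grad a r k N"
  define S where "S = packet_stream1 a r k N"
  define \<Theta> where "\<Theta> = packet_stream a r k N"
  have dG: "(G h has_derivative (\<lambda>h'. H h h' z)) (at z)" for h z
    unfolding G_def H_def by (rule packet_grad_has_derivative[OF N])
  have dS: "(\<Theta> has_derivative (\<lambda>h. S h z)) (at z)" for z
    unfolding \<Theta>_def S_def by (rule packet_stream_has_derivative[OF N])
  have cH: "continuous_on UNIV (H h h')" for h h' unfolding H_def by (rule packet_continuous)
  have cS: "continuous_on UNIV (S h)" for h unfolding S_def by (rule packet_continuous)
  have out: "G h z = 0" "H h h' z = 0" "\<Theta> z = 0" "S h z = 0" if "z \<notin> cball a r" for h h' z
    using packet_outside[OF r that] by (simp_all add: G_def H_def \<Theta>_def S_def)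
  have Hcom: "H h h' z = H h' h z" for h h' z unfolding H_def by (rule packet_hess_commute)
  have dens: "wave_density a r k A N z = - A * (H dir1 dir1 z + H dir2 dir2 z)" for z
    by (simp add: wave_density_def H_def)
  have vel: "wave_velocity a r k A N z = vector [- A * H dir1 dir2 z, A * H dir1 dir1 z]" for z
    by (simp add: wave_velocity_def H_def)
  have flux: "wave_flux a r k A B N z = vector [A * H dir1 dirt z - B * S dir2 z, A * H dir2 dirt z + B * S dir1 z]" for z
    by (simp add: wave_flux_def H_def S_def)
  show ?thesis
    unfolding perturbation_def
  proof (intro conjI allI impI)
    show "continuous_on UNIV (\<lambda>z. (wave_density a r k A N z, wave_velocity a r k A N z, wave_flux a r k A B N z))"
      unfolding dens vel flux by (intro continuous_intros cH cS)
  next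
    fix z assume z: "z \<notin> cball a r"
    show "wave_density a r k A N z = 0" "wave_velocity a r k A N z = 0" "wave_flux a r k A B N z = 0"
      using out[OF z] by (simp_all add: dens vel flux vec_eq_iff forall_2)
  next
    fix \<phi> :: "(real^2) \<times> real \<Rightarrow> real" assume s: "smooth \<phi>"
    define D where "D h z = frechet_derivative \<phi> (at z) h" for h z
    have dD: "(\<phi> has_derivative (\<lambda>h. D h z)) (at z)" for z
      using smooth_has_derivative[OF s] by (simp add: D_def)
    have cD: "continuous_on UNIV (D h)" for h unfolding D_def by (rule smooth_continuous[OF smooth_frechet_derivative[OF s]])
    have swG: "(LINT z|lborel. H h p z * D q z) = (LINT z|lborel. H h q z * D p z)" for h p q
      by (rule integral_swap_derivatives[where K="cball a r" and g="G h" and \<phi>=\<phi>]) (use dG dD cH cD out in auto)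
    have swS: "(LINT z|lborel. S p z * D q z) = (LINT z|lborel. S q z * D p z)" for p q
      by (rule integral_swap_derivatives[where K="cball a r" and g=\<Theta> and \<phi>=\<phi>]) (use dS dD cS cD out in auto)
    have iG: "integrable lborel (\<lambda>z. H h p z * D q z)" for h p q
      by (rule integrable_lborel_continuous_compact_support[OF continuous_on_mult[OF cH cD] compact_cball[of a r]]) (simp add: out(2))
    have iS: "integrable lborel (\<lambda>z. S p z * D q z)" for p q
      by (rule integrable_lborel_continuous_compact_support[OF continuous_on_mult[OF cS cD] compact_cball[of a r]]) (simp add: out(4))
    have "wave_density a r k A N z * time_deriv \<phi> z + wave_flux a r k A B N z \<bullet> space_gradient \<phi> z =
        A * (H dir1 dirt z * D dir1 z - H dir1 dir1 z * D dirt z) + A * (H dir2 dirt z * D dir2 z - H dir2 dir2 z * D dirt z)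
        + B * (S dir1 z * D dir2 z - S dir2 z * D dir1 z)" for z
      unfolding dens flux time_deriv_eq[OF s] space_gradient_eq[OF s] inner_real2 vector_sel vec_lambda_beta D_def
      by (simp add: algebra_simps)
    then have "(LINT z|lborel. wave_density a r k A N z * time_deriv \<phi> z + wave_flux a r k A B N z \<bullet> space_gradient \<phi> z) =
       A * ((LINT z|lborel. H dir1 dirt z * D dir1 z) - (LINT z|lborel. H dir1 dir1 z * D dirt z)) +
       A * ((LINT z|lborel. H dir2 dirt z * D dir2 z) - (LINT z|lborel. H dir2 dir2 z * D dirt z)) +
       B * ((LINT z|lborel. S dir1 z * D dir2 z) - (LINT z|lborel. S dir2 z * D dir1 z))"
      using iG iS by simp
    also have "\<dots> = 0" using swG[of dir1 dirt dir1] swG[of dir2 dirt dir2] swS[of dir1 dir2] by simp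
    finally show "(LINT z|lborel. wave_density a r k A N z * time_deriv \<phi> z + wave_flux a r k A B N z \<bullet> space_gradient \<phi> z) = 0" .
  next
    fix t :: real and \<psi> :: "real^2 \<Rightarrow> real" assume s: "smooth \<psi>"
    define D where "D h x = frechet_derivative \<psi> (at x) h" for h x
    have dD: "(\<psi> has_derivative (\<lambda>h. D h x)) (at x)" for x
      using smooth_has_derivative[OF s] by (simp add: D_def)
    have cD: "continuous_on UNIV (D h)" for h unfolding D_def by (rule smooth_continuous[OF smooth_frechet_derivative[OF s]])
    have grad: "gradient \<psi> x = vector [D (axis 1 1) x, D (axis 2 1) x]" for x
      by (simp add: gradient_def D_def vec_eq_iff forall_2)
    have outx: "(x, t) \<notin> cball a r" if "x \<notin> cball (fst a) r" for x
      using that dist_fst_le[of a "(x, t)"] by auto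
    have cHx: "continuous_on UNIV (\<lambda>x. H h p (x, t))" for h p
      by (intro continuous_on_compose2[OF cH] continuous_intros) auto
    have sw: "(LINT x|lborel. H h (p, 0) (x, t) * D q x) = (LINT x|lborel. H h (q, 0) (x, t) * D p x)" for h p q
      by (rule integral_swap_derivatives[where K="cball (fst a) r" and g="\<lambda>x. G h (x, t)" and \<phi>=\<psi> and g'="\<lambda>x p. H h (p, 0) (x, t)"])
         (use has_derivative_slice_fst[OF dG] dD cHx cD out(1)[OF outx] in auto)
    have i: "integrable lborel (\<lambda>x. H h p (x, t) * D q x)" for h p q
      by (rule integrable_lborel_continuous_compact_support[OF continuous_on_mult[OF cHx cD] compact_cball[of "fst a" r]])
         (simp add: out(2)[OF outx])
    have "wave_velocity a r k A N (x, t) \<bullet> gradient \<psi> x = A * (H dir1 dir1 (x, t) * D (axis 2 1) x - H dir1 dir2 (x, t) * D (axis 1 1) x)" for x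
      unfolding vel grad inner_real2 vector_sel by (simp add: algebra_simps)
    then show "(LINT x|lborel. wave_velocity a r k A N (x, t) \<bullet> gradient \<psi> x) = 0"
      using i sw[of dir1 "axis 1 1" "axis 2 1"] by simp
    \<comment> \<open>Symmetry of the Hessian lets both terms be derivatives of one function, the
      second partial derivative of the potential, to which the swap applies.\<close>
    have "(wave_velocity a r k A N (x, t) + vector [0, wave_density a r k A N (x, t)]) \<bullet> perp_gradient \<psi> x =
        A * (H dir2 dir1 (x, t) * D (axis 2 1) x - H dir2 dir2 (x, t) * D (axis 1 1) x)" for x
      unfolding vel dens perp_gradient_def grad inner_real2 vector_sel vector_add_component Hcom[of dir1 dir2] by (simp add: algebra_simps)
    then show "(LINT x|lborel. (wave_velocity a r k A N (x, t) + vector [0, wave_density a r k A N (x, t)]) \<bullet> perp_gradient \<psi> x) = 0"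
      using i sw[of dir2 "axis 1 1" "axis 2 1"] by simp
  qed
qed

text \<open>In the variables \<open>u = 2v + (0,\<rho>)\<close>, \<open>m' = 2m + (0,1)\<close> the inequality reads \<open>|m' - \<rho>u| < 1 - \<rho>\<^sup>2\<close>; the
  increment is \<open>h (1, e, u - \<rho>e)\<close> with \<open>e\<close> the direction of \<open>m' - \<rho>u\<close>.\<close>

lemma hull_direction:
  assumes gap: "hull_gap a b c < (1 - a\<^sup>2) / 2"
  obtains \<xi> :: "real^2" and \<kappa> \<beta> where "norm \<xi> = 1"
    "\<And>h. \<bar>h\<bar> \<le> (1 - a\<^sup>2) / 8 \<Longrightarrow>
      hull_gap (a + h) (b + h *\<^sub>R vector [\<xi> $ 1 * \<xi> $ 2, - (\<xi> $ 1)\<^sup>2])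
        (c + h *\<^sub>R vector [- \<xi> $ 1 * \<kappa> - \<beta> * \<xi> $ 2, - \<xi> $ 2 * \<kappa> + \<beta> * \<xi> $ 1]) < (1 - (a + h)\<^sup>2) / 2"
proof -
  have gapw: "hull_gap a b c = norm (2 *\<^sub>R (c - a *\<^sub>R b) + vector [0, 1 - a\<^sup>2]) / 2" for a :: real and b c :: "real^2"
  proof -
    have "2 *\<^sub>R (c - a *\<^sub>R b) + vector [0, 1 - a\<^sup>2] = 2 *\<^sub>R (c - a *\<^sub>R b + (1/2) *\<^sub>R vector [0, 1 - a\<^sup>2])"
      by (simp add: scaleR_add_right)
    then show ?thesis by (simp add: hull_gap_def)
  qed
  \<comment> \<open>This is m' - \<rho> u at the given point.\<close>
  define w where "w = 2 *\<^sub>R (c - a *\<^sub>R b) + vector [0, 1 - a\<^sup>2]"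
  have w: "norm w < 1 - a\<^sup>2" using gap unfolding gapw w_def by simp
  \<comment> \<open>For w = 0 any unit vector serves.\<close>
  define e where "e = (if w = 0 then axis 1 1 else (1 / norm w) *\<^sub>R w)"
  have e: "norm e = 1" "w = norm w *\<^sub>R e" by (auto simp: e_def norm_axis_1)
  have "(e $ 2)\<^sup>2 + (e $ 1)\<^sup>2 = 1" using norm_real2_sq[of e] e(1) by simp
  then obtain t where t: "e $ 2 = cos t" "e $ 1 = sin t" using sincos_total_2pi by metis
  \<comment> \<open>Half angles: with \<xi> = (sin(t/2), cos(t/2)) the wave changes u by 2 (\<xi>_1
    \<xi>_2, - \<xi>_1^2) + (0,1) = (sin t, cos t) = e per unit of density.\<close>
  define s\<^sub>1 s\<^sub>2 where "s\<^sub>1 = sin (t / 2)" and "s\<^sub>2 = cos (t / 2)"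
  have s: "s\<^sub>1\<^sup>2 + s\<^sub>2\<^sup>2 = 1" "e $ 1 = 2 * s\<^sub>1 * s\<^sub>2" "e $ 2 = 1 - 2 * s\<^sub>1\<^sup>2"
    using sin_double[of "t / 2"] cos_double_sin[of "t / 2"] t by (simp_all add: s\<^sub>1_def s\<^sub>2_def)
  define \<xi> where "\<xi> = (vector [s\<^sub>1, s\<^sub>2] :: real^2)"
  have xi: "\<xi> $ 1 = s\<^sub>1" "\<xi> $ 2 = s\<^sub>2" by (simp_all add: \<xi>_def)
  have "(norm \<xi>)\<^sup>2 = 1\<^sup>2" using norm_real2_sq[of \<xi>] s(1) xi by simp
  then have n\<xi>: "norm \<xi> = 1" by (rule power2_eq_imp_eq) auto
  \<comment> \<open>The increment of 2m per unit of density that keeps m' - \<rho> u on the line of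
    e. Up to sign, \<open>\<kappa>\<close> and \<open>\<beta>\<close> are half its components along
    and across \<xi>.\<close>
  define \<mu> where "\<mu> = 2 *\<^sub>R b + vector [0, a] - a *\<^sub>R e"
  define \<kappa> \<beta> where "\<kappa> = - (\<mu> $ 1 * s\<^sub>1 + \<mu> $ 2 * s\<^sub>2) / 2" and "\<beta> = (\<mu> $ 2 * s\<^sub>1 - \<mu> $ 1 * s\<^sub>2) / 2"
  have mu: "vector [- \<xi> $ 1 * \<kappa> - \<beta> * \<xi> $ 2, - \<xi> $ 2 * \<kappa> + \<beta> * \<xi> $ 1] = (1/2) *\<^sub>R \<mu>"
  proof -
    have "- s\<^sub>1 * \<kappa> - \<beta> * s\<^sub>2 = (s\<^sub>1\<^sup>2 + s\<^sub>2\<^sup>2) * \<mu> $ 1 / 2" by (simp add: \<kappa>_def \<beta>_def power2_eq_square field_simps)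
    moreover have "- s\<^sub>2 * \<kappa> + \<beta> * s\<^sub>1 = (s\<^sub>1\<^sup>2 + s\<^sub>2\<^sup>2) * \<mu> $ 2 / 2" by (simp add: \<kappa>_def \<beta>_def power2_eq_square field_simps)
    ultimately show ?thesis using s(1) by (simp add: vec_eq_iff forall_2 xi)
  qed
  have "hull_gap (a + h) (b + h *\<^sub>R vector [\<xi> $ 1 * \<xi> $ 2, - (\<xi> $ 1)\<^sup>2])
        (c + h *\<^sub>R vector [- \<xi> $ 1 * \<kappa> - \<beta> * \<xi> $ 2, - \<xi> $ 2 * \<kappa> + \<beta> * \<xi> $ 1]) < (1 - (a + h)\<^sup>2) / 2"
    if h: "\<bar>h\<bar> \<le> (1 - a\<^sup>2) / 8" for h
  proof -
    have we: "w $ i = norm w * e $ i" for i using e(2) by (metis vector_scaleR_component real_scaleR_def)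
    \<comment> \<open>The difference |w| - (1 - a^2) is transported unchanged: the new vector is e
      times this difference plus the new radius 1 - (a + h)^2. The upper bound thus persists, and
      the coefficient only has to be kept from becoming too negative.\<close>
    have eq: "2 *\<^sub>R ((c + h *\<^sub>R ((1/2) *\<^sub>R \<mu>)) - (a + h) *\<^sub>R (b + h *\<^sub>R vector [s\<^sub>1 * s\<^sub>2, - s\<^sub>1\<^sup>2])) + vector [0, 1 - (a + h)\<^sup>2]
       = (norm w - (1 - a\<^sup>2) + (1 - (a + h)\<^sup>2)) *\<^sub>R e"
    proof -
      have w1: "norm w * e $ 1 = 2 * (c $ 1 - a * b $ 1)" unfolding we[of 1, symmetric] by (simp add: w_def)
      have w2: "norm w * e $ 2 = 2 * (c $ 2 - a * b $ 2) + (1 - a\<^sup>2)" unfolding we[of 2, symmetric] by (simp add: w_def)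
      have "2 * ((c $ 1 + h * (\<mu> $ 1 / 2)) - (a + h) * (b $ 1 + h * (s\<^sub>1 * s\<^sub>2))) = (norm w - (1 - a\<^sup>2) + (1 - (a + h)\<^sup>2)) * e $ 1"
      proof -
        have m1: "\<mu> $ 1 = 2 * b $ 1 - a * e $ 1" by (simp add: \<mu>_def)
        have p1: "s\<^sub>1 * s\<^sub>2 = e $ 1 / 2" using s(2) by simp
        show ?thesis unfolding m1 p1 distrib_right left_diff_distrib w1
          by (simp add: power2_eq_square algebra_simps diff_divide_distrib add_divide_distrib)
      qed
      moreover have "2 * ((c $ 2 + h * (\<mu> $ 2 / 2)) - (a + h) * (b $ 2 + h * (- s\<^sub>1\<^sup>2))) + (1 - (a + h)\<^sup>2) = (norm w - (1 - a\<^sup>2) + (1 - (a + h)\<^sup>2)) * e $ 2"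
      proof -
        have m1: "\<mu> $ 2 = 2 * b $ 2 + a - a * e $ 2" by (simp add: \<mu>_def)
        have p1: "- s\<^sub>1\<^sup>2 = (e $ 2 - 1) / 2" using s(3) by simp
        show ?thesis unfolding m1 p1 distrib_right left_diff_distrib w2
          by (simp add: power2_eq_square algebra_simps diff_divide_distrib add_divide_distrib)
      qed
      ultimately show ?thesis by (simp add: vec_eq_iff forall_2)
    qed
    have "a\<^sup>2 \<le> 1" using w norm_ge_zero[of w] by linarith
    then have a1: "\<bar>a\<bar> \<le> 1" by (simp add: abs_square_le_1)
    define y where "y = 1 - a\<^sup>2"
    have y: "0 < y" "y \<le> 1" unfolding y_def using w norm_ge_zero[of w] zero_le_power2[of a] by linarith+
    have hy: "\<bar>h\<bar> \<le> y / 8" using h by (simp add: y_def)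
    then have h1: "\<bar>h\<bar> \<le> 1" using y(2) by linarith
    have "\<bar>2 * a * h\<bar> \<le> 2 * 1 * (y / 8)" unfolding abs_mult using a1 hy by (intro mult_mono) auto
    moreover have "h\<^sup>2 \<le> y / 8"
    proof -
      have "\<bar>h\<bar> * \<bar>h\<bar> \<le> (y / 8) * 1" using hy h1 by (intro mult_mono) auto
      then show ?thesis by (simp add: power2_eq_square)
    qed
    moreover have "1 - (a + h)\<^sup>2 = y - (2 * a * h + h\<^sup>2)" by (simp add: y_def power2_sum)
    \<comment> \<open>The loss is at most y/4 + y/8. Any value above y/2 would do: the coefficient
      is at least the new radius minus y, hence larger than minus the new radius.\<close>
    ultimately have "1 - (a + h)\<^sup>2 \<ge> y * (5 / 8)" by linarith
    then have "\<bar>norm w - (1 - a\<^sup>2) + (1 - (a + h)\<^sup>2)\<bar> < 1 - (a + h)\<^sup>2"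
      using w norm_ge_zero[of w] y unfolding y_def[symmetric] by linarith
    then show ?thesis
      unfolding gapw mu unfolding xi unfolding eq using e(1) by simp
  qed
  with n\<xi> show ?thesis by (rule that)
qed

lemma open_strict_hull: "open {p. hull_gap (fst p) (fst (snd p)) (snd (snd p)) < (1 - (fst p)\<^sup>2) / 2}"
  unfolding hull_gap_def by (intro open_Collect_less continuous_intros) auto

text \<open>To leading order the density is A \<theta> cos(...), and velocity and flux carry the
  same oscillation along the direction of \<open>hull_direction\<close>. The rest is O(1/N)
  uniformly in z.\<close>

lemma wave_approx:
  assumes r: "r > 0" and \<xi>: "norm \<xi> = 1"
  obtains C where
    "\<And>N z. N \<ge> 1 \<Longrightarrow> \<bar>wave_density a r (\<xi>, \<kappa>) A N z - A * (cutoff a r z * cos (N * ((\<xi>, \<kappa>) \<bullet> z)))\<bar> \<le> C / N"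
    "\<And>N z. N \<ge> 1 \<Longrightarrow> \<bar>wave_velocity a r (\<xi>, \<kappa>) A N z $ 1 - A * (\<xi> $ 1 * \<xi> $ 2) * (cutoff a r z * cos (N * ((\<xi>, \<kappa>) \<bullet> z)))\<bar> \<le> C / N"
    "\<And>N z. N \<ge> 1 \<Longrightarrow> \<bar>wave_velocity a r (\<xi>, \<kappa>) A N z $ 2 - A * (- (\<xi> $ 1)\<^sup>2) * (cutoff a r z * cos (N * ((\<xi>, \<kappa>) \<bullet> z)))\<bar> \<le> C / N"
    "\<And>N z. N \<ge> 1 \<Longrightarrow> \<bar>wave_flux a r (\<xi>, \<kappa>) A (A * \<beta>) N z $ 1 - A * (- \<xi> $ 1 * \<kappa> - \<beta> * \<xi> $ 2) * (cutoff a r z * cos (N * ((\<xi>, \<kappa>) \<bullet> z)))\<bar> \<le> C / N"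
    "\<And>N z. N \<ge> 1 \<Longrightarrow> \<bar>wave_flux a r (\<xi>, \<kappa>) A (A * \<beta>) N z $ 2 - A * (- \<xi> $ 2 * \<kappa> + \<beta> * \<xi> $ 1) * (cutoff a r z * cos (N * ((\<xi>, \<kappa>) \<bullet> z)))\<bar> \<le> C / N"
proof -
  define k where "k = (\<xi>, \<kappa>)"
  have kd: "k \<bullet> dir1 = \<xi> $ 1" "k \<bullet> dir2 = \<xi> $ 2" "k \<bullet> dirt = \<kappa>"
    by (simp_all add: k_def inner_axis)
  define X where "X N z = cutoff a r z * cos (N * (k \<bullet> z))" for N z
  obtain C11 where C11: "\<And>N z. N \<ge> 1 \<Longrightarrow> \<bar>packet_hess a r k N dir1 dir1 z + (k \<bullet> dir1) * (k \<bullet> dir1) * X N z\<bar> \<le> C11 / N"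
    unfolding X_def using packet_hess_approx[OF r] by metis
  obtain C22 where C22: "\<And>N z. N \<ge> 1 \<Longrightarrow> \<bar>packet_hess a r k N dir2 dir2 z + (k \<bullet> dir2) * (k \<bullet> dir2) * X N z\<bar> \<le> C22 / N"
    unfolding X_def using packet_hess_approx[OF r] by metis
  obtain C12 where C12: "\<And>N z. N \<ge> 1 \<Longrightarrow> \<bar>packet_hess a r k N dir1 dir2 z + (k \<bullet> dir1) * (k \<bullet> dir2) * X N z\<bar> \<le> C12 / N"
    unfolding X_def using packet_hess_approx[OF r] by metis
  obtain C1t where C1t: "\<And>N z. N \<ge> 1 \<Longrightarrow> \<bar>packet_hess a r k N dir1 dirt z + (k \<bullet> dir1) * (k \<bullet> dirt) * X N z\<bar> \<le> C1t / N"
    unfolding X_def using packet_hess_approx[OF r] by metis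
  obtain C2t where C2t: "\<And>N z. N \<ge> 1 \<Longrightarrow> \<bar>packet_hess a r k N dir2 dirt z + (k \<bullet> dir2) * (k \<bullet> dirt) * X N z\<bar> \<le> C2t / N"
    unfolding X_def using packet_hess_approx[OF r] by metis
  obtain D1 where D1: "\<And>N z. N \<ge> 1 \<Longrightarrow> \<bar>packet_stream1 a r k N dir1 z - (k \<bullet> dir1) * X N z\<bar> \<le> D1 / N"
    unfolding X_def using packet_stream1_approx[OF r] by metis
  obtain D2 where D2: "\<And>N z. N \<ge> 1 \<Longrightarrow> \<bar>packet_stream1 a r k N dir2 z - (k \<bullet> dir2) * X N z\<bar> \<le> D2 / N"
    unfolding X_def using packet_stream1_approx[OF r] by metis
  \<comment> \<open>One crude constant for all five components.\<close>
  define C where "C = (\<bar>A\<bar> + \<bar>A * \<beta>\<bar>) * (\<bar>C11\<bar> + \<bar>C22\<bar> + \<bar>C12\<bar> + \<bar>C1t\<bar> + \<bar>C2t\<bar> + \<bar>D1\<bar> + \<bar>D2\<bar>)"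
  \<comment> \<open>Two alternatives for the coefficients: in the density both have modulus |A| and
    the two error constants add up to at most s, whereas in the other components the moduli add up
    to at most |A| + |A \<beta>|.\<close>
  have lin: "\<bar>p * E + q * F\<bar> \<le> C / N"
    if E: "\<bar>E\<bar> \<le> c / N" and F: "\<bar>F\<bar> \<le> d / N" and pq: "\<bar>p\<bar> + \<bar>q\<bar> \<le> \<bar>A\<bar> + \<bar>A * \<beta>\<bar> \<or> (\<bar>p\<bar> \<le> \<bar>A\<bar> \<and> \<bar>q\<bar> \<le> \<bar>A\<bar> \<and> \<bar>c\<bar> + \<bar>d\<bar> \<le> s)"
      and cd: "\<bar>c\<bar> \<le> s" "\<bar>d\<bar> \<le> s" and s: "s = \<bar>C11\<bar> + \<bar>C22\<bar> + \<bar>C12\<bar> + \<bar>C1t\<bar> + \<bar>C2t\<bar> + \<bar>D1\<bar> + \<bar>D2\<bar>"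
      and N: "N \<ge> 1" for p E q F c d s N :: real
  proof -
    have E': "\<bar>E\<bar> \<le> \<bar>c\<bar> / N" and F': "\<bar>F\<bar> \<le> \<bar>d\<bar> / N"
      using E F N by (meson abs_ge_self divide_right_mono order_trans zero_le_one)+
    have "\<bar>p * E + q * F\<bar> \<le> \<bar>p\<bar> * (\<bar>c\<bar> / N) + \<bar>q\<bar> * (\<bar>d\<bar> / N)"
      using mult_left_mono[OF E' abs_ge_zero[of p]] mult_left_mono[OF F' abs_ge_zero[of q]] abs_triangle_ineq[of "p * E" "q * F"]
      unfolding abs_mult by linarith
    also have "\<dots> = (\<bar>p\<bar> * \<bar>c\<bar> + \<bar>q\<bar> * \<bar>d\<bar>) / N" by (simp add: add_divide_distrib)
    also have "\<dots> \<le> C / N"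
    proof (intro divide_right_mono)
      from pq show "\<bar>p\<bar> * \<bar>c\<bar> + \<bar>q\<bar> * \<bar>d\<bar> \<le> C"
      proof
        assume a: "\<bar>p\<bar> + \<bar>q\<bar> \<le> \<bar>A\<bar> + \<bar>A * \<beta>\<bar>"
        have "\<bar>p\<bar> * \<bar>c\<bar> + \<bar>q\<bar> * \<bar>d\<bar> \<le> \<bar>p\<bar> * s + \<bar>q\<bar> * s" using cd by (intro add_mono mult_left_mono) auto
        also have "\<dots> = (\<bar>p\<bar> + \<bar>q\<bar>) * s" by (simp add: distrib_right)
        also have "\<dots> \<le> (\<bar>A\<bar> + \<bar>A * \<beta>\<bar>) * s" using a s by (intro mult_right_mono) auto
        finally show ?thesis by (simp add: C_def s)
      next
        assume a: "\<bar>p\<bar> \<le> \<bar>A\<bar> \<and> \<bar>q\<bar> \<le> \<bar>A\<bar> \<and> \<bar>c\<bar> + \<bar>d\<bar> \<le> s"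
        have "\<bar>p\<bar> * \<bar>c\<bar> + \<bar>q\<bar> * \<bar>d\<bar> \<le> \<bar>A\<bar> * \<bar>c\<bar> + \<bar>A\<bar> * \<bar>d\<bar>" using a by (intro add_mono mult_right_mono) auto
        also have "\<dots> = \<bar>A\<bar> * (\<bar>c\<bar> + \<bar>d\<bar>)" by (simp add: distrib_left)
        also have "\<dots> \<le> (\<bar>A\<bar> + \<bar>A * \<beta>\<bar>) * s" using a by (intro mult_mono) auto
        finally show ?thesis by (simp add: C_def s)
      qed
    qed (use N in simp)
    finally show ?thesis .
  qed
  define s where "s = \<bar>C11\<bar> + \<bar>C22\<bar> + \<bar>C12\<bar> + \<bar>C1t\<bar> + \<bar>C2t\<bar> + \<bar>D1\<bar> + \<bar>D2\<bar>"
  have \<xi>1: "\<xi> $ 1 * \<xi> $ 1 + \<xi> $ 2 * \<xi> $ 2 = 1" using norm_real2_sq[of \<xi>] \<xi> by (simp add: power2_eq_square)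
  show ?thesis
  proof (rule that[of C, folded k_def])
    fix N :: real and z assume N: "N \<ge> 1"
    note lin' = lin[OF _ _ _ _ _ s_def N]
    have "wave_density a r k A N z - A * X N z =
       (- A) * (packet_hess a r k N dir1 dir1 z + (k \<bullet> dir1) * (k \<bullet> dir1) * X N z) + (- A) * (packet_hess a r k N dir2 dir2 z + (k \<bullet> dir2) * (k \<bullet> dir2) * X N z)"
    proof -
      have "A * X N z = A * (\<xi> $ 1 * \<xi> $ 1 + \<xi> $ 2 * \<xi> $ 2) * X N z" by (simp add: \<xi>1)
      then show ?thesis unfolding wave_density_def kd by (simp add: algebra_simps)
    qed
    with lin'[OF C11[OF N] C22[OF N], of "- A" "- A"]
    show "\<bar>wave_density a r k A N z - A * (cutoff a r z * cos (N * (k \<bullet> z)))\<bar> \<le> C / N"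
      unfolding X_def[symmetric] by (simp add: s_def)
    have "wave_velocity a r k A N z $ 1 - A * (\<xi> $ 1 * \<xi> $ 2) * X N z =
       (- A) * (packet_hess a r k N dir1 dir2 z + (k \<bullet> dir1) * (k \<bullet> dir2) * X N z) + 0 * (packet_hess a r k N dir2 dir2 z + (k \<bullet> dir2) * (k \<bullet> dir2) * X N z)"
      unfolding wave_velocity_def kd vector_sel by (simp add: algebra_simps)
    with lin'[OF C12[OF N] C22[OF N], of "- A" 0]
    show "\<bar>wave_velocity a r k A N z $ 1 - A * (\<xi> $ 1 * \<xi> $ 2) * (cutoff a r z * cos (N * (k \<bullet> z)))\<bar> \<le> C / N"
      unfolding X_def[symmetric] by (simp add: s_def)
    have "wave_velocity a r k A N z $ 2 - A * (- (\<xi> $ 1)\<^sup>2) * X N z =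
       A * (packet_hess a r k N dir1 dir1 z + (k \<bullet> dir1) * (k \<bullet> dir1) * X N z) + 0 * (packet_hess a r k N dir2 dir2 z + (k \<bullet> dir2) * (k \<bullet> dir2) * X N z)"
      unfolding wave_velocity_def kd vector_sel by (simp add: algebra_simps power2_eq_square)
    with lin'[OF C11[OF N] C22[OF N], of A 0]
    show "\<bar>wave_velocity a r k A N z $ 2 - A * (- (\<xi> $ 1)\<^sup>2) * (cutoff a r z * cos (N * (k \<bullet> z)))\<bar> \<le> C / N"
      unfolding X_def[symmetric] by (simp add: s_def)
    have "wave_flux a r k A (A * \<beta>) N z $ 1 - A * (- \<xi> $ 1 * \<kappa> - \<beta> * \<xi> $ 2) * X N z =
       A * (packet_hess a r k N dir1 dirt z + (k \<bullet> dir1) * (k \<bullet> dirt) * X N z) + (- (A * \<beta>)) * (packet_stream1 a r k N dir2 z - (k \<bullet> dir2) * X N z)"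
      unfolding wave_flux_def kd vector_sel by (simp add: algebra_simps)
    with lin'[OF C1t[OF N] D2[OF N], of A "- (A * \<beta>)"]
    show "\<bar>wave_flux a r k A (A * \<beta>) N z $ 1 - A * (- \<xi> $ 1 * \<kappa> - \<beta> * \<xi> $ 2) * (cutoff a r z * cos (N * (k \<bullet> z)))\<bar> \<le> C / N"
      unfolding X_def[symmetric] by (simp add: s_def)
    have "wave_flux a r k A (A * \<beta>) N z $ 2 - A * (- \<xi> $ 2 * \<kappa> + \<beta> * \<xi> $ 1) * X N z =
       A * (packet_hess a r k N dir2 dirt z + (k \<bullet> dir2) * (k \<bullet> dirt) * X N z) + (A * \<beta>) * (packet_stream1 a r k N dir1 z - (k \<bullet> dir1) * X N z)"
      unfolding wave_flux_def kd vector_sel by (simp add: algebra_simps)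
    with lin'[OF C2t[OF N] D1[OF N], of A "A * \<beta>"]
    show "\<bar>wave_flux a r k A (A * \<beta>) N z $ 2 - A * (- \<xi> $ 2 * \<kappa> + \<beta> * \<xi> $ 1) * (cutoff a r z * cos (N * (k \<bullet> z)))\<bar> \<le> C / N"
      unfolding X_def[symmetric] by (simp add: s_def)
  qed
qed

section \<open>Perturbation on a small ball\<close>

text \<open>The leading oscillation tends weakly to 0 by Riemann-Lebesgue, and the remainder is at
  most C/N times the L1 norm of G. Frequencies \<open>Suc n\<close> start at 1, where the O(1/N)
  estimates hold.\<close>

lemma wave_component_weak_limit:
  fixes X :: "nat \<Rightarrow> 'a::euclidean_space \<Rightarrow> real"
  assumes r: "r > 0" and X: "\<And>n. continuous_on UNIV (X n)"
    and ap: "\<And>n z. \<bar>X n z - d * (cutoff a r z * cos (real (Suc n) * (k \<bullet> z)))\<bar> \<le> C / real (Suc n)"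
    and G: "integrable (lebesgue_on S) G" and S: "S \<in> lmeasurable" "cball a r \<subseteq> S" and k: "k \<noteq> 0"
  shows "(\<lambda>n. LINT z|lebesgue_on S. G z * X n z) \<longlonglongrightarrow> 0"
proof -
  define Y where "Y n z = cutoff a r z * cos (real (Suc n) * (k \<bullet> z))" for n z
  have Yc: "continuous_on UNIV (Y n)" for n unfolding Y_def by (intro continuous_intros cutoff_continuous)
  have Yb: "\<bar>Y n z\<bar> \<le> 1" for n z
    unfolding Y_def abs_mult using cutoff_bounds[of a r z] by (intro mult_le_one) auto
  have m: "f \<in> borel_measurable (lebesgue_on S)" if "continuous_on UNIV f" for f :: "'a \<Rightarrow> real"
    by (rule borel_measurable_lebesgue_on_borel[OF borel_measurable_continuous_onI[OF that]])
  have i: "integrable (lebesgue_on S) (\<lambda>z. G z * f z)" if "continuous_on UNIV f" "\<And>z. \<bar>f z\<bar> \<le> B" for f B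
  proof (rule Bochner_Integration.integrable_bound)
    show "integrable (lebesgue_on S) (\<lambda>z. B * G z)" using G by auto
    show "(\<lambda>z. G z * f z) \<in> borel_measurable (lebesgue_on S)"
      using borel_measurable_integrable[OF G] m[OF that(1)] by auto
    show "AE z in lebesgue_on S. norm (G z * f z) \<le> norm (B * G z)"
    proof (intro AE_I2)
      fix z have "\<bar>f z\<bar> \<le> \<bar>B\<bar>" using that(2)[of z] by linarith
      then show "norm (G z * f z) \<le> norm (B * G z)"
        using mult_left_mono[of "\<bar>f z\<bar>" "\<bar>B\<bar>" "\<bar>G z\<bar>"] by (simp add: abs_mult mult.commute)
    qed
  qed
  have 1: "(\<lambda>n. LINT z|lebesgue_on S. G z * Y n z) \<longlonglongrightarrow> 0"
    unfolding Y_def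
    by (rule LIMSEQ_Suc[OF riemann_lebesgue[OF G S(1) cutoff_continuous[of a r] cutoff_outside(1)[OF r] _ S(2) k]])
       (use cutoff_bounds[of a r] in \<open>simp_all add: abs_of_nonneg\<close>)
  have 2: "(\<lambda>n. LINT z|lebesgue_on S. G z * (X n z - d * Y n z)) \<longlonglongrightarrow> 0"
  proof (rule tendsto_0_le[where K=1])
    show "(\<lambda>n. C / real (Suc n) * (LINT z|lebesgue_on S. \<bar>G z\<bar>)) \<longlonglongrightarrow> 0"
    proof -
      have "(\<lambda>n. C * (1 / real (Suc n)) * (LINT z|lebesgue_on S. \<bar>G z\<bar>)) \<longlonglongrightarrow> C * 0 * (LINT z|lebesgue_on S. \<bar>G z\<bar>)"
        by (intro tendsto_mult tendsto_const LIMSEQ_Suc[OF lim_1_over_n])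
      then show ?thesis by simp
    qed
    show "\<forall>\<^sub>F n in sequentially. norm (LINT z|lebesgue_on S. G z * (X n z - d * Y n z)) \<le> norm (C / real (Suc n) * (LINT z|lebesgue_on S. \<bar>G z\<bar>)) * 1"
    proof (intro always_eventually allI)
      fix n
      have C: "C / real (Suc n) \<ge> 0" using ap[of n undefined] by linarith
      have "\<bar>LINT z|lebesgue_on S. G z * (X n z - d * Y n z)\<bar> \<le> (LINT z|lebesgue_on S. \<bar>G z\<bar> * (C / real (Suc n)))"
      proof (intro order_trans[OF integral_abs_bound] integral_mono')
        show "integrable (lebesgue_on S) (\<lambda>z. \<bar>G z\<bar> * (C / real (Suc n)))" using G by auto
        show "\<bar>G z * (X n z - d * Y n z)\<bar> \<le> \<bar>G z\<bar> * (C / real (Suc n))" for z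
          unfolding abs_mult using ap[of n z, folded Y_def] by (intro mult_left_mono) auto
        show "0 \<le> \<bar>G z\<bar> * (C / real (Suc n))" for z using C by (intro mult_nonneg_nonneg) auto
      qed
      also have "\<dots> = C / real (Suc n) * (LINT z|lebesgue_on S. \<bar>G z\<bar>)" by simp
      also have "\<dots> \<le> \<bar>C / real (Suc n) * (LINT z|lebesgue_on S. \<bar>G z\<bar>)\<bar>" by (rule abs_ge_self)
      finally show "norm (LINT z|lebesgue_on S. G z * (X n z - d * Y n z)) \<le> norm (C / real (Suc n) * (LINT z|lebesgue_on S. \<bar>G z\<bar>)) * 1"
        by simp
    qed
  qed
  have "(LINT z|lebesgue_on S. G z * X n z) = (LINT z|lebesgue_on S. G z * (X n z - d * Y n z)) + d * (LINT z|lebesgue_on S. G z * Y n z)" for n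
  proof -
    have b: "\<bar>X n z - d * Y n z\<bar> \<le> C / real (Suc n)" for z using ap[of n z] unfolding Y_def .
    have i1: "integrable (lebesgue_on S) (\<lambda>z. G z * (X n z - d * Y n z))"
      by (rule i[OF _ b]) (intro continuous_intros X Yc)
    have "(LINT z|lebesgue_on S. G z * X n z) = (LINT z|lebesgue_on S. G z * (X n z - d * Y n z) + d * (G z * Y n z))"
      by (intro Bochner_Integration.integral_cong) (auto simp: algebra_simps)
    also have "\<dots> = (LINT z|lebesgue_on S. G z * (X n z - d * Y n z)) + d * (LINT z|lebesgue_on S. G z * Y n z)"
      using i1 i[OF Yc Yb] by simp
    finally show ?thesis .
  qed
  moreover have "(\<lambda>n. (LINT z|lebesgue_on S. G z * (X n z - d * Y n z)) + d * (LINT z|lebesgue_on S. G z * Y n z)) \<longlonglongrightarrow> 0 + d * 0"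
    by (intro tendsto_add tendsto_mult tendsto_const 1 2)
  ultimately show ?thesis by simp
qed

text \<open>The square of the cosine averages to 1/2, so the integrals tend to half of d^2 times
  that of \<theta>^2. On the half ball, which has 1/8 of the volume in dimension 3, the cutoff is at
  least 27/64, and (27/64)^2 / 8 exceeds 1/45; hence the constant 1/90.\<close>

lemma wave_component_gain:
  fixes X :: "nat \<Rightarrow> (real^2) \<times> real \<Rightarrow> real"
  assumes r: "r > 0" and X: "\<And>n. continuous_on UNIV (X n)" "\<And>n z. z \<notin> cball a r \<Longrightarrow> X n z = 0"
    and ap: "\<And>n z. \<bar>X n z - d * (cutoff a r z * cos (real (Suc n) * (k \<bullet> z)))\<bar> \<le> C / real (Suc n)"
    and k: "k \<noteq> 0" and g: "g < d\<^sup>2 * measure lborel (cball a r) * (1 / 90)"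
  shows "\<forall>\<^sub>F n in sequentially. (LINT z|lborel. (X n z)\<^sup>2) > g"
proof -
  define \<theta> where "\<theta> = cutoff a r"
  have \<theta>c: "continuous_on UNIV \<theta>" unfolding \<theta>_def by (rule cutoff_continuous)
  have \<theta>0: "\<theta> z = 0" if "z \<notin> cball a r" for z unfolding \<theta>_def by (rule cutoff_outside(1)[OF r that])
  have \<theta>b: "0 \<le> \<theta> z" "\<theta> z \<le> 1" for z unfolding \<theta>_def by (rule cutoff_bounds)+
  define Y where "Y n z = \<theta> z * cos (real (Suc n) * (k \<bullet> z))" for n z
  have Yc: "continuous_on UNIV (Y n)" for n unfolding Y_def by (intro continuous_intros \<theta>c)
  have Yb: "\<bar>Y n z\<bar> \<le> 1" for n z
    unfolding Y_def abs_mult using \<theta>b[of z] by (intro mult_le_one) auto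
  have Y0: "Y n z = 0" if "z \<notin> cball a r" for n z using \<theta>0[OF that] by (simp add: Y_def)
  have i\<theta>: "integrable lborel (\<lambda>z. (\<theta> z)\<^sup>2)"
    by (rule integrable_lborel_continuous_compact_support[OF _ compact_cball[of a r]]) (use \<theta>c \<theta>0 in \<open>auto intro!: continuous_intros\<close>)
  have cb: "emeasure lborel (cball a r) < \<infinity>" using emeasure_bounded_finite[OF bounded_cball[of a r]] .
  define V where "V = measure lborel (cball a r)"
  have VI: "integrable lborel (indicator (cball a r) :: _ \<Rightarrow> real)" "(LINT z|lborel. indicator (cball a r) z) = V"
    using cb by (auto simp: V_def)
  have low: "(LINT z|lborel. (\<theta> z)\<^sup>2) \<ge> (1 / 45) * V"
  proof -
    have "measure lborel (cball a r) = measure lborel (ball a r)" by (rule content_cball_conv_ball)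
    also have "\<dots> = r ^ DIM((real^2) \<times> real) * measure lborel (ball (0::(real^2) \<times> real) 1)" using r by (intro content_ball_conv_unit_ball) auto
    finally have c1: "V = r ^ 3 * measure lborel (ball (0::(real^2) \<times> real) 1)" by (simp add: V_def)
    have "measure lborel (ball a (r / 2)) = (r / 2) ^ DIM((real^2) \<times> real) * measure lborel (ball (0::(real^2) \<times> real) 1)" using r by (intro content_ball_conv_unit_ball) auto
    then have c2: "measure lborel (ball a (r / 2)) = V / 8" unfolding c1 by (simp add: power_divide)
    have fin: "emeasure lborel (ball a (r / 2)) < \<infinity>" using emeasure_bounded_finite[OF bounded_ball] .
    have V0: "V \<ge> 0" by (simp add: V_def)
    have "(1 / 45) * V \<le> (27 / 64)\<^sup>2 * (V / 8)" using V0 by (simp add: power2_eq_square)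
    also have "\<dots> = (LINT z|lborel. (27 / 64)\<^sup>2 * indicator (ball a (r / 2)) z)" using fin c2 by simp
    also have "\<dots> \<le> (LINT z|lborel. (\<theta> z)\<^sup>2)"
    proof (rule integral_mono)
      show "integrable lborel (\<lambda>z. (27 / 64)\<^sup>2 * indicator (ball a (r / 2)) z :: real)" using fin by auto
      show "(27 / 64)\<^sup>2 * indicator (ball a (r / 2)) z \<le> (\<theta> z)\<^sup>2" for z
      proof (cases "z \<in> ball a (r / 2)")
        case True
        from cutoff_lower[OF r True] have "(27 / 64)\<^sup>2 \<le> (\<theta> z)\<^sup>2" unfolding \<theta>_def by (intro power_mono) auto
        then show ?thesis using True by simp
      qed simp
    qed (rule i\<theta>)
    finally show ?thesis .
  qed
  have osc: "(\<lambda>n. LINT z|lborel. (\<theta> z)\<^sup>2 * cos (real (Suc n) * ((2 *\<^sub>R k) \<bullet> z))) \<longlonglongrightarrow> 0"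
    by (rule LIMSEQ_Suc[OF riemann_lebesgue_continuous[where a=a and r=r]])
       (use \<theta>c \<theta>0 k in \<open>auto intro!: continuous_intros\<close>)
  \<comment> \<open>The double angle formula splits off a term with doubled frequency, which again
    averages out.\<close>
  have Y2: "(LINT z|lborel. (Y n z)\<^sup>2) = (LINT z|lborel. (\<theta> z)\<^sup>2) / 2 + (LINT z|lborel. (\<theta> z)\<^sup>2 * cos (real (Suc n) * ((2 *\<^sub>R k) \<bullet> z))) / 2" for n
  proof -
    have "(Y n z)\<^sup>2 = (\<theta> z)\<^sup>2 / 2 + ((\<theta> z)\<^sup>2 * cos (real (Suc n) * ((2 *\<^sub>R k) \<bullet> z))) / 2" for z
    proof -
      have "cos (2 * (real (Suc n) * (k \<bullet> z))) = 2 * (cos (real (Suc n) * (k \<bullet> z)))\<^sup>2 - 1" by (rule cos_double_cos)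
      then have "(cos (real (Suc n) * (k \<bullet> z)))\<^sup>2 = 1 / 2 + cos (real (Suc n) * ((2 *\<^sub>R k) \<bullet> z)) / 2"
        by (simp add: mult.left_commute diff_divide_distrib)
      then show ?thesis unfolding Y_def power_mult_distrib by (simp add: distrib_left)
    qed
    moreover have "integrable lborel (\<lambda>z. (\<theta> z)\<^sup>2 * cos (real (Suc n) * ((2 *\<^sub>R k) \<bullet> z)))"
      by (rule integrable_lborel_continuous_compact_support[OF _ compact_cball[of a r]]) (use \<theta>c \<theta>0 in \<open>auto intro!: continuous_intros\<close>)
    ultimately show ?thesis using i\<theta> by simp
  qed
  \<comment> \<open>With E = X - d Y, the square E^2 is dropped and the cross term is bounded by |Y|
    \<le> 1.\<close>
  have step: "(LINT z|lborel. (X n z)\<^sup>2) \<ge> d\<^sup>2 * (LINT z|lborel. (Y n z)\<^sup>2) - 2 * \<bar>d\<bar> * (C / real (Suc n)) * V" for n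
  proof -
    have iX: "integrable lborel (\<lambda>z. (X n z)\<^sup>2)"
      by (rule integrable_lborel_continuous_compact_support[OF _ compact_cball[of a r]]) (use X in \<open>auto intro!: continuous_intros\<close>)
    have iY: "integrable lborel (\<lambda>z. (Y n z)\<^sup>2)"
      by (rule integrable_lborel_continuous_compact_support[OF _ compact_cball[of a r]]) (use Yc Y0 in \<open>auto intro!: continuous_intros\<close>)
    have "(LINT z|lborel. d\<^sup>2 * (Y n z)\<^sup>2 - 2 * \<bar>d\<bar> * (C / real (Suc n)) * indicator (cball a r) z) \<le> (LINT z|lborel. (X n z)\<^sup>2)"
    proof (rule integral_mono)
      show "integrable lborel (\<lambda>z. d\<^sup>2 * (Y n z)\<^sup>2 - 2 * \<bar>d\<bar> * (C / real (Suc n)) * indicator (cball a r) z)"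
        using iY VI(1) by auto
      fix z
      show "d\<^sup>2 * (Y n z)\<^sup>2 - 2 * \<bar>d\<bar> * (C / real (Suc n)) * indicator (cball a r) z \<le> (X n z)\<^sup>2"
      proof (cases "z \<in> cball a r")
        case True
        define E where "E = X n z - d * Y n z"
        have E: "\<bar>E\<bar> \<le> C / real (Suc n)" using ap[of n z] unfolding E_def Y_def \<theta>_def .
        have "\<bar>2 * d * Y n z * E\<bar> = 2 * \<bar>d\<bar> * (\<bar>Y n z\<bar> * \<bar>E\<bar>)" by (simp add: abs_mult)
        also have "\<dots> \<le> 2 * \<bar>d\<bar> * (1 * (C / real (Suc n)))" using Yb E by (intro mult_left_mono mult_mono) auto
        finally have "- (2 * \<bar>d\<bar> * (C / real (Suc n))) \<le> 2 * d * Y n z * E" by simp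
        moreover have "(X n z)\<^sup>2 = d\<^sup>2 * (Y n z)\<^sup>2 + 2 * d * Y n z * E + E\<^sup>2"
          unfolding E_def by (simp add: power2_eq_square algebra_simps)
        moreover have "E\<^sup>2 \<ge> 0" by simp
        moreover have "indicator (cball a r) z = (1::real)" using True by simp
        ultimately show ?thesis by (simp only: mult_1_right)
      next
        case False then show ?thesis using Y0 X(2) by simp
      qed
    qed (rule iX)
    also have "(LINT z|lborel. d\<^sup>2 * (Y n z)\<^sup>2 - 2 * \<bar>d\<bar> * (C / real (Suc n)) * indicator (cball a r) z) =
      d\<^sup>2 * (LINT z|lborel. (Y n z)\<^sup>2) - 2 * \<bar>d\<bar> * (C / real (Suc n)) * V"
      using iY VI by simp
    finally show ?thesis .
  qed
  have "(\<lambda>n. d\<^sup>2 * ((LINT z|lborel. (\<theta> z)\<^sup>2) / 2 + (LINT z|lborel. (\<theta> z)\<^sup>2 * cos (real (Suc n) * ((2 *\<^sub>R k) \<bullet> z))) / 2) - 2 * \<bar>d\<bar> * (C * (1 / real (Suc n))) * V)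
     \<longlonglongrightarrow> d\<^sup>2 * ((LINT z|lborel. (\<theta> z)\<^sup>2) / 2 + 0 / 2) - 2 * \<bar>d\<bar> * (C * 0) * V"
    by (intro tendsto_intros osc LIMSEQ_Suc[OF lim_1_over_n]) auto
  moreover have "g < d\<^sup>2 * ((LINT z|lborel. (\<theta> z)\<^sup>2) / 2 + 0 / 2) - 2 * \<bar>d\<bar> * (C * 0) * V"
  proof -
    have "d\<^sup>2 * V * (1 / 90) \<le> d\<^sup>2 * ((LINT z|lborel. (\<theta> z)\<^sup>2) / 2)"
      using low mult_left_mono[of "(1/90) * V" "(LINT z|lborel. (\<theta> z)\<^sup>2) / 2" "d\<^sup>2"] by simp
    moreover have "d\<^sup>2 * ((LINT z|lborel. (\<theta> z)\<^sup>2) / 2 + 0 / 2) - 2 * \<bar>d\<bar> * (C * 0) * V = d\<^sup>2 * ((LINT z|lborel. (\<theta> z)\<^sup>2) / 2)" by simp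
    ultimately show ?thesis using g unfolding V_def[symmetric] by linarith
  qed
  ultimately have "\<forall>\<^sub>F n in sequentially. g < d\<^sup>2 * ((LINT z|lborel. (\<theta> z)\<^sup>2) / 2 + (LINT z|lborel. (\<theta> z)\<^sup>2 * cos (real (Suc n) * ((2 *\<^sub>R k) \<bullet> z))) / 2) - 2 * \<bar>d\<bar> * (C * (1 / real (Suc n))) * V"
    by (rule order_tendstoD(1))
  then show ?thesis
  proof eventually_elim
    case (elim n)
    then show ?case using step[of n] unfolding Y2 by simp
  qed
qed

lemma perturbationD:
  assumes "perturbation K \<rho> v m"
  shows "continuous_on UNIV \<rho>" "continuous_on UNIV v" "continuous_on UNIV m"
    "z \<notin> K \<Longrightarrow> \<rho> z = 0" "z \<notin> K \<Longrightarrow> v z = 0" "z \<notin> K \<Longrightarrow> m z = 0"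
    "smooth \<phi> \<Longrightarrow> (LINT z|lborel. \<rho> z * time_deriv \<phi> z + m z \<bullet> space_gradient \<phi> z) = 0"
    "smooth \<psi> \<Longrightarrow> (LINT x|lborel. v (x, t) \<bullet> gradient \<psi> x) = 0"
    "smooth \<psi> \<Longrightarrow> (LINT x|lborel. (v (x, t) + vector [0, \<rho> (x, t)]) \<bullet> perp_gradient \<psi> x) = 0"
proof -
  have c: "continuous_on UNIV (\<lambda>z. (\<rho> z, v z, m z))" using assms by (simp add: perturbation_def)
  from continuous_on_fst[OF c] continuous_on_fst[OF continuous_on_snd[OF c]] continuous_on_snd[OF continuous_on_snd[OF c]]
  show "continuous_on UNIV \<rho>" "continuous_on UNIV v" "continuous_on UNIV m" by simp_all
qed (use assms in \<open>unfold perturbation_def, blast+\<close>)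

lemma continuous_component: "continuous_on UNIV (f :: 'a::topological_space \<Rightarrow> real^2) \<Longrightarrow> continuous_on UNIV (\<lambda>z. f z $ i)"
  by (intro continuous_intros)

text \<open>The admissible increments at z0 form a compact segment in the open set of strict
  triples, so a neighbourhood of the segment is strict as well. Continuity at z0 and the O(1/N)
  error of the wave keep the perturbed triple in it once the ball is small and the frequency large.
  All radii up to \<open>r0\<close> are covered, as a Vitali covering requires.\<close>

lemma local_perturbation:
  assumes st: "strict_on U \<rho> v m" and U: "open U" and z0: "z0 \<in> U"
  obtains r0 where "r0 > 0" "\<And>r. 0 < r \<Longrightarrow> r \<le> r0 \<Longrightarrow> cball z0 r \<subseteq> U \<and> (\<exists>R V M.
      (\<forall>n::nat. perturbation (cball z0 r) (R n) (V n) (M n)) \<and>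
      (\<forall>\<^sub>F n in sequentially. \<forall>z\<in>cball z0 r. hull_gap (\<rho> z + R n z) (v z + V n z) (m z + M n z) < (1 - (\<rho> z + R n z)\<^sup>2) / 2) \<and>
      (\<forall>S G. S \<in> lmeasurable \<longrightarrow> cball z0 r \<subseteq> S \<longrightarrow> integrable (lebesgue_on S) G \<longrightarrow>
         (\<lambda>n. LINT z|lebesgue_on S. G z * R n z) \<longlonglongrightarrow> 0 \<and>
         (\<forall>i. (\<lambda>n. LINT z|lebesgue_on S. G z * V n z $ i) \<longlonglongrightarrow> 0) \<and>
         (\<forall>i. (\<lambda>n. LINT z|lebesgue_on S. G z * M n z $ i) \<longlonglongrightarrow> 0)) \<and>
      (\<forall>\<^sub>F n in sequentially. (LINT z|lborel. (R n z)\<^sup>2) > (1 / 30000) * (LINT z|lebesgue_on (cball z0 r). (1 - (\<rho> z)\<^sup>2)\<^sup>2)))"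
proof -
  define a b c where "a = \<rho> z0" and "b = v z0" and "c = m z0"
  have gap: "hull_gap a b c < (1 - a\<^sup>2) / 2" using st z0 by (simp add: strict_on_def a_def b_def c_def)
  define y where "y = 1 - a\<^sup>2"
  have y: "y > 0"
  proof -
    have "0 \<le> hull_gap a b c" by (simp add: hull_gap_def)
    then show ?thesis using gap by (simp add: y_def)
  qed
  obtain \<xi> :: "real^2" and \<kappa> \<beta> where \<xi>: "norm \<xi> = 1"
    and dir: "\<And>h. \<bar>h\<bar> \<le> (1 - a\<^sup>2) / 8 \<Longrightarrow>
      hull_gap (a + h) (b + h *\<^sub>R vector [\<xi> $ 1 * \<xi> $ 2, - (\<xi> $ 1)\<^sup>2])
        (c + h *\<^sub>R vector [- \<xi> $ 1 * \<kappa> - \<beta> * \<xi> $ 2, - \<xi> $ 2 * \<kappa> + \<beta> * \<xi> $ 1]) < (1 - (a + h)\<^sup>2) / 2"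
    using hull_direction[OF gap] by metis
  define p where "p = (vector [\<xi> $ 1 * \<xi> $ 2, - (\<xi> $ 1)\<^sup>2] :: real^2)"
  define q where "q = (vector [- \<xi> $ 1 * \<kappa> - \<beta> * \<xi> $ 2, - \<xi> $ 2 * \<kappa> + \<beta> * \<xi> $ 1] :: real^2)"
  \<comment> \<open>The largest amplitude that \<open>hull_direction\<close> permits.\<close>
  define A where "A = y / 8"
  define k where "k = (\<xi>, \<kappa>)"
  have k: "k \<noteq> 0" using \<xi> by (auto simp: k_def zero_prod_def)
  define K where "K = (\<lambda>h. (a + h, b + h *\<^sub>R p, c + h *\<^sub>R q)) ` {- A..A}"
  define Oset where "Oset = {p. hull_gap (fst p) (fst (snd p)) (snd (snd p)) < (1 - (fst p)\<^sup>2) / 2}"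
  have "compact K" unfolding K_def by (intro compact_continuous_image continuous_intros) auto
  moreover have "open Oset" unfolding Oset_def by (rule open_strict_hull)
  moreover have "K \<subseteq> Oset"
  proof
    fix P assume "P \<in> K"
    then obtain h where h: "\<bar>h\<bar> \<le> A" and P: "P = (a + h, b + h *\<^sub>R p, c + h *\<^sub>R q)"
      unfolding K_def by (auto simp: abs_le_iff)
    have "hull_gap (a + h) (b + h *\<^sub>R p) (c + h *\<^sub>R q) < (1 - (a + h)\<^sup>2) / 2"
      unfolding p_def q_def by (rule dir) (use h in \<open>simp add: A_def y_def\<close>)
    then show "P \<in> Oset" by (simp add: P Oset_def)
  qed
  ultimately obtain \<delta> where \<delta>: "\<delta> > 0" "(\<Union>x\<in>K. ball x \<delta>) \<subseteq> Oset"
    using compact_subset_open_imp_ball_epsilon_subset by metis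
  have cont: "continuous (at z0) (\<lambda>z. (\<rho> z, v z, m z))"
    using st U z0 by (simp add: strict_on_def continuous_on_eq_continuous_at)
  then obtain d1 where d1: "d1 > 0" "\<And>z. dist z z0 < d1 \<Longrightarrow> dist (\<rho> z, v z, m z) (a, b, c) < \<delta> / 2"
    unfolding continuous_at_eps_delta a_def b_def c_def using half_gt_zero[OF \<delta>(1)] by metis
  have "isCont \<rho> z0" using cont continuous_fst by fastforce
  then have "isCont (\<lambda>z. 1 - (\<rho> z)\<^sup>2) z0" by (intro continuous_intros)
  then obtain d2 where d2: "d2 > 0" "\<And>z. dist z z0 < d2 \<Longrightarrow> dist (1 - (\<rho> z)\<^sup>2) (1 - (\<rho> z0)\<^sup>2) < y"
    unfolding continuous_at_eps_delta using y by metis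
  obtain d3 where d3: "d3 > 0" "cball z0 d3 \<subseteq> U" using U z0 open_contains_cball by blast
  \<comment> \<open>The halves make the strict distance bounds valid on closed balls.\<close>
  define r0 where "r0 = min (min (d1 / 2) (d2 / 2)) d3"
  have r0: "r0 > 0" using d1(1) d2(1) d3(1) by (simp add: r0_def)
  show ?thesis
  proof (rule that[OF r0], intro conjI)
    fix r assume r: "0 < r" "r \<le> r0"
    show sub: "cball z0 r \<subseteq> U" using r d3(2) by (auto simp: r0_def)
    have ball1: "dist (\<rho> z, v z, m z) (a, b, c) < \<delta> / 2" "1 - (\<rho> z)\<^sup>2 < 2 * y" if "z \<in> cball z0 r" for z
    proof -
      have ds: "dist z z0 < d1" "dist z z0 < d2" using that r d1(1) d2(1) by (auto simp: r0_def dist_commute)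
      show "dist (\<rho> z, v z, m z) (a, b, c) < \<delta> / 2" by (rule d1(2)[OF ds(1)])
      have "\<bar>1 - (\<rho> z)\<^sup>2 - y\<bar> < y" using d2(2)[OF ds(2)] by (simp only: y_def a_def dist_real_def)
      then have "1 - (\<rho> z)\<^sup>2 - y < y" using abs_less_iff by blast
      then show "1 - (\<rho> z)\<^sup>2 < 2 * y" by linarith
    qed
    have pos: "0 < 1 - (\<rho> z)\<^sup>2" if "z \<in> cball z0 r" for z
    proof -
      have "0 \<le> hull_gap (\<rho> z) (v z) (m z)" by (simp add: hull_gap_def)
      moreover have "hull_gap (\<rho> z) (v z) (m z) < (1 - (\<rho> z)\<^sup>2) / 2" using st sub that by (auto simp: strict_on_def)
      ultimately show ?thesis by simp
    qed
    obtain C where C: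
      "\<And>N z. N \<ge> 1 \<Longrightarrow> \<bar>wave_density z0 r k A N z - A * (cutoff z0 r z * cos (N * (k \<bullet> z)))\<bar> \<le> C / N"
      "\<And>N z. N \<ge> 1 \<Longrightarrow> \<bar>wave_velocity z0 r k A N z $ 1 - A * (\<xi> $ 1 * \<xi> $ 2) * (cutoff z0 r z * cos (N * (k \<bullet> z)))\<bar> \<le> C / N"
      "\<And>N z. N \<ge> 1 \<Longrightarrow> \<bar>wave_velocity z0 r k A N z $ 2 - A * (- (\<xi> $ 1)\<^sup>2) * (cutoff z0 r z * cos (N * (k \<bullet> z)))\<bar> \<le> C / N"
      "\<And>N z. N \<ge> 1 \<Longrightarrow> \<bar>wave_flux z0 r k A (A * \<beta>) N z $ 1 - A * (- \<xi> $ 1 * \<kappa> - \<beta> * \<xi> $ 2) * (cutoff z0 r z * cos (N * (k \<bullet> z)))\<bar> \<le> C / N"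
      "\<And>N z. N \<ge> 1 \<Longrightarrow> \<bar>wave_flux z0 r k A (A * \<beta>) N z $ 2 - A * (- \<xi> $ 2 * \<kappa> + \<beta> * \<xi> $ 1) * (cutoff z0 r z * cos (N * (k \<bullet> z)))\<bar> \<le> C / N"
      unfolding k_def by (rule wave_approx[OF r(1) \<xi>]) blast
    define R where "R n = wave_density z0 r k A (real (Suc n))" for n
    define V where "V n = wave_velocity z0 r k A (real (Suc n))" for n
    define M where "M n = wave_flux z0 r k A (A * \<beta>) (real (Suc n))" for n
    have N1: "real (Suc n) \<ge> 1" for n by simp
    have ap: "\<bar>R n z - A * (cutoff z0 r z * cos (real (Suc n) * (k \<bullet> z)))\<bar> \<le> C / real (Suc n)"
      "\<bar>V n z $ 1 - (A * p $ 1) * (cutoff z0 r z * cos (real (Suc n) * (k \<bullet> z)))\<bar> \<le> C / real (Suc n)"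
      "\<bar>V n z $ 2 - (A * p $ 2) * (cutoff z0 r z * cos (real (Suc n) * (k \<bullet> z)))\<bar> \<le> C / real (Suc n)"
      "\<bar>M n z $ 1 - (A * q $ 1) * (cutoff z0 r z * cos (real (Suc n) * (k \<bullet> z)))\<bar> \<le> C / real (Suc n)"
      "\<bar>M n z $ 2 - (A * q $ 2) * (cutoff z0 r z * cos (real (Suc n) * (k \<bullet> z)))\<bar> \<le> C / real (Suc n)" for n z
      unfolding R_def V_def M_def p_def q_def vector_sel using C[OF N1] by blast+
    have pert: "perturbation (cball z0 r) (R n) (V n) (M n)" for n
      unfolding R_def V_def M_def by (rule wave_perturbation[OF r(1)]) simp
    note cR = perturbationD(1)[OF pert] and cV = perturbationD(2)[OF pert] and cM = perturbationD(3)[OF pert]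
    note R0 = perturbationD(4)[OF pert]
    \<comment> \<open>Five scalar components: one of the density and two each of velocity and flux.
      The other half of \<delta> is spent on the variation of (\<rho>, v, m) over the ball.\<close>
    have "(\<lambda>n. 5 * (C * (1 / real (Suc n)))) \<longlonglongrightarrow> 5 * (C * 0)" by (intro tendsto_mult tendsto_const LIMSEQ_Suc[OF lim_1_over_n])
    then have "\<forall>\<^sub>F n in sequentially. 5 * (C * (1 / real (Suc n))) < \<delta> / 2" using \<delta>(1) by (intro order_tendstoD(2)) auto
    then have hull: "\<forall>\<^sub>F n in sequentially. \<forall>z\<in>cball z0 r. hull_gap (\<rho> z + R n z) (v z + V n z) (m z + M n z) < (1 - (\<rho> z + R n z)\<^sup>2) / 2"
    proof eventually_elim
      case (elim n)
      show ?case
      proof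
        fix z assume z: "z \<in> cball z0 r"
        define h where "h = A * (cutoff z0 r z * cos (real (Suc n) * (k \<bullet> z)))"
        have "\<bar>cutoff z0 r z * cos (real (Suc n) * (k \<bullet> z))\<bar> \<le> 1"
          unfolding abs_mult using cutoff_bounds[of z0 r z] by (intro mult_le_one) auto
        then have h: "\<bar>h\<bar> \<le> A" using y by (simp add: h_def abs_mult A_def mult_left_le)
        define P where "P = (a + h, b + h *\<^sub>R p, c + h *\<^sub>R q)"
        have PK: "P \<in> K" unfolding P_def K_def using h by (intro image_eqI[of _ _ h]) auto
        have V2: "norm (V n z - h *\<^sub>R p) \<le> 2 * (C / real (Suc n))"
        proof -
          have "norm (V n z - h *\<^sub>R p) \<le> \<bar>(V n z - h *\<^sub>R p) $ 1\<bar> + \<bar>(V n z - h *\<^sub>R p) $ 2\<bar>"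
            using norm_le_l1_cart[of "V n z - h *\<^sub>R p"] by (simp add: sum_2)
          also have "\<dots> \<le> C / real (Suc n) + C / real (Suc n)"
            using ap(2,3)[of n z] by (intro add_mono) (simp_all add: h_def mult_ac)
          finally show ?thesis by simp
        qed
        have M2: "norm (M n z - h *\<^sub>R q) \<le> 2 * (C / real (Suc n))"
        proof -
          have "norm (M n z - h *\<^sub>R q) \<le> \<bar>(M n z - h *\<^sub>R q) $ 1\<bar> + \<bar>(M n z - h *\<^sub>R q) $ 2\<bar>"
            using norm_le_l1_cart[of "M n z - h *\<^sub>R q"] by (simp add: sum_2)
          also have "\<dots> \<le> C / real (Suc n) + C / real (Suc n)"
            using ap(4,5)[of n z] by (intro add_mono) (simp_all add: h_def mult_ac)
          finally show ?thesis by simp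
        qed
        have R2: "\<bar>R n z - h\<bar> \<le> C / real (Suc n)" using ap(1)[of n z] by (simp add: h_def)
        have "dist (\<rho> z + R n z, v z + V n z, m z + M n z) P
          = norm (((\<rho> z, v z, m z) - (a, b, c)) + (R n z - h, V n z - h *\<^sub>R p, M n z - h *\<^sub>R q))"
          unfolding P_def dist_norm by (simp add: algebra_simps)
        also have "\<dots> \<le> dist (\<rho> z, v z, m z) (a, b, c) + norm (R n z - h, V n z - h *\<^sub>R p, M n z - h *\<^sub>R q)"
          unfolding dist_norm by (rule norm_triangle_ineq)
        also have "norm (R n z - h, V n z - h *\<^sub>R p, M n z - h *\<^sub>R q) \<le> norm (R n z - h) + (norm (V n z - h *\<^sub>R p) + norm (M n z - h *\<^sub>R q))"
          by (intro order_trans[OF norm_Pair_le] add_left_mono norm_Pair_le)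
        also have "\<dots> \<le> C / real (Suc n) + (2 * (C / real (Suc n)) + 2 * (C / real (Suc n)))"
          using R2 V2 M2 by (intro add_mono) auto
        also have "\<dots> = 5 * (C * (1 / real (Suc n)))" by simp
        finally have "dist (\<rho> z + R n z, v z + V n z, m z + M n z) P < \<delta>"
          using ball1(1)[OF z] elim by linarith
        then have "(\<rho> z + R n z, v z + V n z, m z + M n z) \<in> ball P \<delta>" by (simp add: dist_commute)
        then have "(\<rho> z + R n z, v z + V n z, m z + M n z) \<in> Oset" using \<delta>(2) PK by blast
        then show "hull_gap (\<rho> z + R n z) (v z + V n z) (m z + M n z) < (1 - (\<rho> z + R n z)\<^sup>2) / 2"
          by (simp add: Oset_def)
      qed
    qed
    have weak: "(\<lambda>n. LINT z|lebesgue_on S. G z * R n z) \<longlonglongrightarrow> 0 \<and>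
         (\<forall>i. (\<lambda>n. LINT z|lebesgue_on S. G z * V n z $ i) \<longlonglongrightarrow> 0) \<and>
         (\<forall>i. (\<lambda>n. LINT z|lebesgue_on S. G z * M n z $ i) \<longlonglongrightarrow> 0)"
      if S: "S \<in> lmeasurable" "cball z0 r \<subseteq> S" "integrable (lebesgue_on S) G" for S G
      unfolding forall_2
      by (intro conjI wave_component_weak_limit[OF r(1) cR ap(1) S(3,1,2) k]
          wave_component_weak_limit[OF r(1) continuous_component[OF cV] ap(2) S(3,1,2) k]
          wave_component_weak_limit[OF r(1) continuous_component[OF cV] ap(3) S(3,1,2) k]
          wave_component_weak_limit[OF r(1) continuous_component[OF cM] ap(4) S(3,1,2) k]
          wave_component_weak_limit[OF r(1) continuous_component[OF cM] ap(5) S(3,1,2) k])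
    have cpos: "measure lborel (cball z0 r) > 0" using r(1) by (simp add: content_cball_pos)
    have upper: "(LINT z|lebesgue_on (cball z0 r). (1 - (\<rho> z)\<^sup>2)\<^sup>2) \<le> 4 * y\<^sup>2 * measure lborel (cball z0 r)"
    proof -
      have "(LINT z|lebesgue_on (cball z0 r). (1 - (\<rho> z)\<^sup>2)\<^sup>2) \<le> (LINT z|lebesgue_on (cball z0 r). 4 * y\<^sup>2)"
      proof (rule integral_mono')
        interpret finite_measure "lebesgue_on (cball z0 r)" by (rule finite_measure_lebesgue_on) auto
        show "integrable (lebesgue_on (cball z0 r)) (\<lambda>z. 4 * y\<^sup>2)" by simp
        fix z assume "z \<in> space (lebesgue_on (cball z0 r))"
        then have z: "z \<in> cball z0 r" by simp
        have "(1 - (\<rho> z)\<^sup>2)\<^sup>2 \<le> (2 * y)\<^sup>2" using pos[OF z] ball1(2)[OF z] by (intro power_mono) auto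
        then show "(1 - (\<rho> z)\<^sup>2)\<^sup>2 \<le> 4 * y\<^sup>2" by (simp add: power_mult_distrib)
      qed simp
      also have "\<dots> = 4 * y\<^sup>2 * measure lborel (cball z0 r)" by (simp add: measure_restrict_space)
      finally show ?thesis .
    qed
    \<comment> \<open>On the ball 1 - \<rho>^2 < 2y, so the right-hand integral is at most 4 y^2
      times the volume, while the wave yields (y/8)^2 / 90 = y^2/5760 times the volume; 4/30000 =
      1/7500 stays below.\<close>
    have "(1 / 30000) * (LINT z|lebesgue_on (cball z0 r). (1 - (\<rho> z)\<^sup>2)\<^sup>2) \<le> (1 / 30000) * (4 * y\<^sup>2 * measure lborel (cball z0 r))"
      using upper by (intro mult_left_mono) auto
    also have "\<dots> < A\<^sup>2 * measure lborel (cball z0 r) * (1 / 90)"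
    proof -
      have "y\<^sup>2 * measure lborel (cball z0 r) > 0" using y cpos by simp
      then show ?thesis by (simp add: A_def power_divide)
    qed
    finally have lt: "(1 / 30000) * (LINT z|lebesgue_on (cball z0 r). (1 - (\<rho> z)\<^sup>2)\<^sup>2) < A\<^sup>2 * measure lborel (cball z0 r) * (1 / 90)" .
    have gain: "\<forall>\<^sub>F n in sequentially. (LINT z|lborel. (R n z)\<^sup>2) > (1 / 30000) * (LINT z|lebesgue_on (cball z0 r). (1 - (\<rho> z)\<^sup>2)\<^sup>2)"
      by (rule wave_component_gain[where X=R and a=z0 and r=r and k=k and d=A and C=C, OF r(1) cR R0 ap(1) k lt])
    show "\<exists>R V M. (\<forall>n::nat. perturbation (cball z0 r) (R n) (V n) (M n)) \<and>
      (\<forall>\<^sub>F n in sequentially. \<forall>z\<in>cball z0 r. hull_gap (\<rho> z + R n z) (v z + V n z) (m z + M n z) < (1 - (\<rho> z + R n z)\<^sup>2) / 2) \<and>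
      (\<forall>S G. S \<in> lmeasurable \<longrightarrow> cball z0 r \<subseteq> S \<longrightarrow> integrable (lebesgue_on S) G \<longrightarrow>
         (\<lambda>n. LINT z|lebesgue_on S. G z * R n z) \<longlonglongrightarrow> 0 \<and>
         (\<forall>i. (\<lambda>n. LINT z|lebesgue_on S. G z * V n z $ i) \<longlonglongrightarrow> 0) \<and>
         (\<forall>i. (\<lambda>n. LINT z|lebesgue_on S. G z * M n z $ i) \<longlonglongrightarrow> 0)) \<and>
      (\<forall>\<^sub>F n in sequentially. (LINT z|lborel. (R n z)\<^sup>2) > (1 / 30000) * (LINT z|lebesgue_on (cball z0 r). (1 - (\<rho> z)\<^sup>2)\<^sup>2))"
      by (intro exI[of _ R] exI[of _ V] exI[of _ M] conjI allI impI pert hull gain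
          weak[THEN conjunct1] weak[THEN conjunct2, THEN conjunct1, THEN spec] weak[THEN conjunct2, THEN conjunct2, THEN spec])
  qed
qed

section \<open>Perturbing the linear system\<close>

abbreviation slab :: "real \<Rightarrow> ((real^2) \<times> real) set" where
  "slab T \<equiv> unit_square \<times> {0<..<T}"

lemma slab_props: "open (slab T)" "bounded (slab T)" "slab T \<in> lmeasurable" "slab T \<in> sets lebesgue"
  "unit_square \<in> lmeasurable" "unit_square \<in> sets borel" "unit_square \<in> sets lebesgue" "{0<..<T} \<in> lmeasurable"
proof -
  show o: "open (slab T)" using open_unit_square by (simp add: open_Times)
  show b: "bounded (slab T)" using bounded_unit_square by (simp add: bounded_Times)
  show l: "slab T \<in> lmeasurable" using b o by (rule lmeasurable_open)
  show "slab T \<in> sets lebesgue" using l by auto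
  show l2: "unit_square \<in> lmeasurable" using bounded_unit_square open_unit_square by (rule lmeasurable_open)
  show "unit_square \<in> sets borel" using open_unit_square by simp
  show "unit_square \<in> sets lebesgue" using l2 by auto
  show "{0<..<T} \<in> lmeasurable" by auto
qed

section \<open>Essentially bounded triples and integrals over slices\<close>

lemma measurable_Pair_triple:
  "(\<lambda>z. (\<rho> z :: real, v z :: real^2, m z :: real^2)) \<in> borel_measurable M \<longleftrightarrow>
    \<rho> \<in> borel_measurable M \<and> v \<in> borel_measurable M \<and> m \<in> borel_measurable M"
proof
  assume t: "(\<lambda>z. (\<rho> z, v z, m z)) \<in> borel_measurable M"
  have f: "(fst :: real \<times> (real^2) \<times> (real^2) \<Rightarrow> real) \<in> borel_measurable borel"
    "(\<lambda>p :: real \<times> (real^2) \<times> (real^2). fst (snd p)) \<in> borel_measurable borel"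
    "(\<lambda>p :: real \<times> (real^2) \<times> (real^2). snd (snd p)) \<in> borel_measurable borel"
    by (intro borel_measurable_continuous_onI continuous_intros)+
  from measurable_compose[OF t f(1)] measurable_compose[OF t f(2)] measurable_compose[OF t f(3)]
  show "\<rho> \<in> borel_measurable M \<and> v \<in> borel_measurable M \<and> m \<in> borel_measurable M" by simp
qed (auto intro!: borel_measurable_Pair)

lemma norm_triple_le: "norm (a, b, c) \<le> norm a + norm b + norm c"
  using norm_Pair_le[of a "(b, c)"] norm_Pair_le[of b c] by linarith

lemma norm_triple_ge: "norm a \<le> norm (a, b, c)" "norm b \<le> norm (a, b, c)" "norm c \<le> norm (a, b, c)"
  using norm_fst_le[of a "(b, c)"] norm_snd_le[of "(b, c)" a] norm_fst_le[of b c] norm_snd_le[of c b] by linarith+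

lemma ess_bounded_triple:
  "ess_bounded S (\<lambda>z. (\<rho> z :: real, v z :: real^2, m z :: real^2)) \<longleftrightarrow> ess_bounded S \<rho> \<and> ess_bounded S v \<and> ess_bounded S m"
proof
  assume a: "ess_bounded S (\<lambda>z. (\<rho> z, v z, m z))"
  then obtain C where C: "AE z in lebesgue_on S. norm (\<rho> z, v z, m z) \<le> C" by (auto simp: ess_bounded_def)
  have "AE z in lebesgue_on S. norm (\<rho> z) \<le> C" "AE z in lebesgue_on S. norm (v z) \<le> C" "AE z in lebesgue_on S. norm (m z) \<le> C"
    using C by (eventually_elim; use norm_triple_ge order_trans in blast)+
  then show "ess_bounded S \<rho> \<and> ess_bounded S v \<and> ess_bounded S m"
    using a unfolding ess_bounded_def measurable_Pair_triple by blast
next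
  assume a: "ess_bounded S \<rho> \<and> ess_bounded S v \<and> ess_bounded S m"
  then obtain A B C where "AE z in lebesgue_on S. norm (\<rho> z) \<le> A" "AE z in lebesgue_on S. norm (v z) \<le> B" "AE z in lebesgue_on S. norm (m z) \<le> C"
    unfolding ess_bounded_def by blast
  then have "AE z in lebesgue_on S. norm (\<rho> z, v z, m z) \<le> A + B + C"
  proof eventually_elim
    case (elim z) then show ?case using norm_triple_le[of "\<rho> z" "v z" "m z"] by linarith
  qed
  then show "ess_bounded S (\<lambda>z. (\<rho> z, v z, m z))" using a unfolding ess_bounded_def measurable_Pair_triple by blast
qed

lemma vec_component_measurable: "v \<in> borel_measurable M \<Longrightarrow> (\<lambda>x. (v x :: real^2) $ i) \<in> borel_measurable M"
  by (rule measurable_compose[of v M borel]) (auto intro!: borel_measurable_continuous_onI continuous_intros)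

lemma ess_bounded_component: "ess_bounded S v \<Longrightarrow> ess_bounded S (\<lambda>x. (v x :: real^2) $ i)"
  unfolding ess_bounded_def
proof (elim conjE exE, intro conjI exI)
  fix C assume "AE z in lebesgue_on S. norm (v z) \<le> C"
  then show "AE z in lebesgue_on S. norm (v z $ i) \<le> C"
    by eventually_elim (metis component_le_norm_cart order_trans real_norm_def)
qed (rule vec_component_measurable)

lemma ess_bounded_integrable: "ess_bounded S f \<Longrightarrow> S \<in> lmeasurable \<Longrightarrow> integrable (lebesgue_on S) f"
  using integrable_bounded_lebesgue_on by (auto simp: ess_bounded_def)

lemma ess_bounded_add: "ess_bounded S f \<Longrightarrow> ess_bounded S g \<Longrightarrow> ess_bounded S (\<lambda>z. f z + g z)"
  unfolding ess_bounded_def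
proof (elim conjE exE, intro conjI exI)
  fix C D assume "AE z in lebesgue_on S. norm (f z) \<le> C" "AE z in lebesgue_on S. norm (g z) \<le> D"
  then show "AE z in lebesgue_on S. norm (f z + g z) \<le> C + D"
  proof eventually_elim
    case (elim z) then show ?case using norm_triangle_ineq[of "f z" "g z"] by linarith
  qed
qed auto

lemma continuous_compact_support_ess_bounded:
  fixes f :: "'a::euclidean_space \<Rightarrow> 'b::euclidean_space"
  assumes f: "continuous_on UNIV f" and K: "compact K" "\<And>z. z \<notin> K \<Longrightarrow> f z = 0"
  shows "ess_bounded S f"
proof -
  have "bounded (f ` K)"
    using f K by (intro compact_imp_bounded compact_continuous_image) (auto intro: continuous_on_subset)
  then obtain C where C: "\<forall>z\<in>K. norm (f z) \<le> C" by (auto simp: bounded_iff)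
  have "norm (f z) \<le> max C 0" for z using C K(2)[of z] by (cases "z \<in> K") (auto simp: le_max_iff_disj)
  moreover have "f \<in> borel_measurable (lebesgue_on S)"
    by (intro borel_measurable_lebesgue_on_borel borel_measurable_continuous_onI f)
  ultimately show ?thesis unfolding ess_bounded_def by (intro conjI exI[of _ "max C 0"] AE_I2) auto
qed

lemma smooth_time_deriv_continuous: "smooth \<phi> \<Longrightarrow> continuous_on UNIV (time_deriv \<phi>)"
  using smooth_continuous[OF smooth_frechet_derivative[of \<phi> "(0, 1)"]] by (simp add: time_deriv_eq cong: continuous_on_cong)

lemma smooth_space_gradient_continuous: "smooth \<phi> \<Longrightarrow> continuous_on UNIV (\<lambda>z. space_gradient \<phi> z $ i)"
  using smooth_continuous[OF smooth_frechet_derivative[of \<phi> "(axis i 1, 0)"]] by (simp add: space_gradient_eq cong: continuous_on_cong)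

lemma smooth_gradient_continuous: "smooth \<psi> \<Longrightarrow> continuous_on UNIV (\<lambda>x. gradient \<psi> x $ i)"
  using smooth_continuous[OF smooth_frechet_derivative[of \<psi> "axis i 1"]] by (simp add: gradient_def)

lemma integrable_inner_continuous:
  assumes v: "\<And>i. integrable (lebesgue_on S) (\<lambda>x. (v x :: real^2) $ i)" and S: "bounded S"
    and g: "\<And>i. continuous_on UNIV (\<lambda>x. (g x :: real^2) $ i)"
  shows "integrable (lebesgue_on S) (\<lambda>x. v x \<bullet> g (x :: 'a::euclidean_space))"
  unfolding inner_real2
  by (intro Bochner_Integration.integrable_add integrable_lebesgue_on_mult_continuous[OF v S g])

lemma perp_gradient_continuous: "smooth \<psi> \<Longrightarrow> continuous_on UNIV (\<lambda>x. perp_gradient \<psi> x $ i)"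
proof -
  assume s: "smooth \<psi>"
  have "\<forall>i. continuous_on UNIV (\<lambda>x. perp_gradient \<psi> x $ i)"
    unfolding forall_2 perp_gradient_def vector_sel by (intro conjI continuous_intros smooth_gradient_continuous s)
  then show ?thesis by blast
qed

lemma ess_bounded_slices_integrable:
  assumes f: "integrable (lebesgue_on (slab T)) (f :: _ \<Rightarrow> real)"
  shows "AE t in lebesgue_on {0<..<T}. integrable (lebesgue_on unit_square) (\<lambda>x. f (x, t))"
  using fubini_lebesgue_on(1)[OF f slab_props(6)] by simp

text \<open>All conditions are linear. Because the perturbation vanishes outside the slab, its
  integrals over the slab, and over the square at each time, are integrals over the whole space and
  vanish; the initial term is untouched.\<close>

lemma linear_system_perturb:
  assumes eb: "ess_bounded (slab T) (\<lambda>z. (\<rho> z, v z, m z))" and ls: "linear_system unit_square T \<rho>\<^sub>0 \<rho> v m"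
    and p: "perturbation K R V M" and K: "compact K" "K \<subseteq> slab T"
  shows "linear_system unit_square T \<rho>\<^sub>0 (\<lambda>z. \<rho> z + R z) (\<lambda>z. v z + V z) (\<lambda>z. m z + M z)"
proof -
  note pd = perturbationD[OF p]
  have eb': "ess_bounded (slab T) \<rho>" "ess_bounded (slab T) v" "ess_bounded (slab T) m"
    using eb by (simp_all add: ess_bounded_triple)
  have i\<rho>: "integrable (lebesgue_on (slab T)) \<rho>" by (rule ess_bounded_integrable[OF eb'(1) slab_props(3)])
  have iv: "integrable (lebesgue_on (slab T)) (\<lambda>z. v z $ i)" for i by (rule ess_bounded_integrable[OF ess_bounded_component[OF eb'(2)] slab_props(3)])
  have im: "integrable (lebesgue_on (slab T)) (\<lambda>z. m z $ i)" for i by (rule ess_bounded_integrable[OF ess_bounded_component[OF eb'(3)] slab_props(3)])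
  note cR = pd(1) and cV = pd(2) and cM = pd(3)
  have iR: "integrable (lebesgue_on (slab T)) R"
    using ess_bounded_integrable[OF continuous_compact_support_ess_bounded[OF cR K(1) pd(4)] slab_props(3)] .
  have iM: "integrable (lebesgue_on (slab T)) (\<lambda>z. M z $ i)" for i
    using ess_bounded_integrable[OF ess_bounded_component[OF continuous_compact_support_ess_bounded[OF cM K(1) pd(6)]] slab_props(3)] .
  have out: "R z = 0" "V z = 0" "M z = 0" if "z \<notin> slab T" for z
    using pd(4-6)[of z] K(2) that by blast+
  show ?thesis
    unfolding linear_system_def
  proof (intro conjI ballI)
    fix \<phi> assume \<phi>: "\<phi> \<in> test_functions_rel (closure unit_square \<times> {0..<T})"
    then have s: "smooth \<phi>" by (simp add: test_functions_rel_def)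
    have 0: "(LINT z|lebesgue_on (slab T). \<rho> z * time_deriv \<phi> z + m z \<bullet> space_gradient \<phi> z)
        + (LINT x|lebesgue_on unit_square. \<phi> (x, 0) * \<rho>\<^sub>0 x) = 0"
      using ls \<phi> by (simp add: linear_system_def)
    have I1: "integrable (lebesgue_on (slab T)) (\<lambda>z. \<rho> z * time_deriv \<phi> z + m z \<bullet> space_gradient \<phi> z)"
      by (intro Bochner_Integration.integrable_add integrable_lebesgue_on_mult_continuous integrable_inner_continuous
          i\<rho> im slab_props smooth_time_deriv_continuous smooth_space_gradient_continuous s)
    have I2: "integrable (lebesgue_on (slab T)) (\<lambda>z. R z * time_deriv \<phi> z + M z \<bullet> space_gradient \<phi> z)"
      by (intro Bochner_Integration.integrable_add integrable_lebesgue_on_mult_continuous integrable_inner_continuous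
          iR iM slab_props smooth_time_deriv_continuous smooth_space_gradient_continuous s)
    have m2: "(\<lambda>z. R z * time_deriv \<phi> z + M z \<bullet> space_gradient \<phi> z) \<in> borel_measurable borel"
      unfolding inner_real2
      by (intro borel_measurable_continuous_onI continuous_intros cR continuous_component[OF cM]
          smooth_time_deriv_continuous smooth_space_gradient_continuous s)
    have "(LINT z|lebesgue_on (slab T). R z * time_deriv \<phi> z + M z \<bullet> space_gradient \<phi> z) = 0"
      using pd(7)[OF s] out
      by (subst lebesgue_on_integral_eq_lborel[OF m2 slab_props(4)]) auto
    moreover have "(LINT z|lebesgue_on (slab T). (\<rho> z + R z) * time_deriv \<phi> z + (m z + M z) \<bullet> space_gradient \<phi> z) =
       (LINT z|lebesgue_on (slab T). \<rho> z * time_deriv \<phi> z + m z \<bullet> space_gradient \<phi> z) +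
       (LINT z|lebesgue_on (slab T). R z * time_deriv \<phi> z + M z \<bullet> space_gradient \<phi> z)"
      using I1 I2 by (subst Bochner_Integration.integral_add[symmetric]) (auto simp: algebra_simps inner_add_left)
    ultimately show "(LINT z|lebesgue_on (slab T). (\<rho> z + R z) * time_deriv \<phi> z + (m z + M z) \<bullet> space_gradient \<phi> z)
        + (LINT x|lebesgue_on unit_square. \<phi> (x, 0) * \<rho>\<^sub>0 x) = 0"
      using 0 by simp
  next
    have cVt: "continuous_on UNIV (\<lambda>x. V (x, t) $ i)" for t i
      by (intro continuous_on_compose2[OF continuous_component[OF cV]] continuous_intros) auto
    have cRt: "continuous_on UNIV (\<lambda>x. R (x, t))" for t
      by (intro continuous_on_compose2[OF cR] continuous_intros) auto
    have iVt: "integrable (lebesgue_on unit_square) (\<lambda>x. V (x, t) $ i)" for t i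
    proof -
      have "integrable (lebesgue_on unit_square) (\<lambda>x. 1 * V (x, t) $ i)"
        by (rule integrable_lebesgue_on_mult_continuous[OF _ bounded_unit_square cVt])
           (rule ess_bounded_integrable[OF _ slab_props(5)], auto simp: ess_bounded_def)
      then show ?thesis by simp
    qed
    have iRt: "integrable (lebesgue_on unit_square) (\<lambda>x. R (x, t))" for t
    proof -
      have "integrable (lebesgue_on unit_square) (\<lambda>x. 1 * R (x, t))"
        by (rule integrable_lebesgue_on_mult_continuous[OF _ bounded_unit_square cRt])
           (rule ess_bounded_integrable[OF _ slab_props(5)], auto simp: ess_bounded_def)
      then show ?thesis by simp
    qed
    have outt: "R (x, t) = 0" "V (x, t) = 0" if "x \<notin> unit_square" for x t
      using out[of "(x, t)"] that by auto
    \<comment> \<open>Splitting the slice integrals requires integrable slices of v and \<rho>,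
      which Fubini provides for almost every t.\<close>
    have ae: "AE t in lebesgue_on {0<..<T}. integrable (lebesgue_on unit_square) (\<lambda>x. v (x, t) $ 1) \<and>
        integrable (lebesgue_on unit_square) (\<lambda>x. v (x, t) $ 2) \<and> integrable (lebesgue_on unit_square) (\<lambda>x. \<rho> (x, t))"
      using ess_bounded_slices_integrable[OF iv[of 1]] ess_bounded_slices_integrable[OF iv[of 2]] ess_bounded_slices_integrable[OF i\<rho>]
      by eventually_elim auto
    have ls2: "AE t in lebesgue_on {0<..<T}. \<forall>\<psi>. smooth \<psi> \<longrightarrow> (LINT x|lebesgue_on unit_square. v (x, t) \<bullet> gradient \<psi> x) = 0"
      and ls3: "AE t in lebesgue_on {0<..<T}. \<forall>\<psi>\<in>test_functions unit_square.
        (LINT x|lebesgue_on unit_square. (v (x, t) + vector [0, \<rho> (x, t)]) \<bullet> perp_gradient \<psi> x) = 0"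
      using ls by (simp_all add: linear_system_def)
    show "AE t in lebesgue_on {0<..<T}. \<forall>\<psi>. smooth \<psi> \<longrightarrow> (LINT x|lebesgue_on unit_square. (v (x, t) + V (x, t)) \<bullet> gradient \<psi> x) = 0"
      using ae ls2
    proof eventually_elim
      case (elim t)
      show ?case
      proof (intro allI impI)
        fix \<psi> :: "real^2 \<Rightarrow> real" assume s: "smooth \<psi>"
        have vt: "integrable (lebesgue_on unit_square) (\<lambda>x. v (x, t) $ i)" for i
        proof -
          have "\<forall>i. integrable (lebesgue_on unit_square) (\<lambda>x. v (x, t) $ i)"
            unfolding forall_2 using elim(1) by simp
          then show ?thesis by blast
        qed
        have m: "(\<lambda>x. V (x, t) \<bullet> gradient \<psi> x) \<in> borel_measurable borel"
          unfolding inner_real2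
          by (intro borel_measurable_continuous_onI continuous_intros cVt smooth_gradient_continuous s)
        have "(LINT x|lebesgue_on unit_square. V (x, t) \<bullet> gradient \<psi> x) = 0"
          using pd(8)[OF s] outt by (subst lebesgue_on_integral_eq_lborel[OF m slab_props(7)]) auto
        moreover have "(LINT x|lebesgue_on unit_square. (v (x, t) + V (x, t)) \<bullet> gradient \<psi> x) =
           (LINT x|lebesgue_on unit_square. v (x, t) \<bullet> gradient \<psi> x) + (LINT x|lebesgue_on unit_square. V (x, t) \<bullet> gradient \<psi> x)"
          unfolding inner_add_left
          by (intro Bochner_Integration.integral_add integrable_inner_continuous vt iVt bounded_unit_square smooth_gradient_continuous s)
        ultimately show "(LINT x|lebesgue_on unit_square. (v (x, t) + V (x, t)) \<bullet> gradient \<psi> x) = 0"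
          using elim(2) s by simp
      qed
    qed
    show "AE t in lebesgue_on {0<..<T}. \<forall>\<psi>\<in>test_functions unit_square.
        (LINT x|lebesgue_on unit_square. (v (x, t) + V (x, t) + vector [0, \<rho> (x, t) + R (x, t)]) \<bullet> perp_gradient \<psi> x) = 0"
      using ae ls3
    proof eventually_elim
      case (elim t)
      show ?case
      proof
        fix \<psi> :: "real^2 \<Rightarrow> real" assume t: "\<psi> \<in> test_functions unit_square"
        then have s: "smooth \<psi>" by (simp add: test_functions_def)
        have vt: "integrable (lebesgue_on unit_square) (\<lambda>x. (v (x, t) + vector [0, \<rho> (x, t)]) $ i)" for i
        proof -
          have "\<forall>i. integrable (lebesgue_on unit_square) (\<lambda>x. (v (x, t) + vector [0, \<rho> (x, t)]) $ i)"
            unfolding forall_2 vector_add_component vector_sel using elim(1) by auto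
          then show ?thesis by blast
        qed
        have Vt: "integrable (lebesgue_on unit_square) (\<lambda>x. (V (x, t) + vector [0, R (x, t)]) $ i)" for i
        proof -
          have "\<forall>i. integrable (lebesgue_on unit_square) (\<lambda>x. (V (x, t) + vector [0, R (x, t)]) $ i)"
            unfolding forall_2 vector_add_component vector_sel using iVt iRt by auto
          then show ?thesis by blast
        qed
        have m: "(\<lambda>x. (V (x, t) + vector [0, R (x, t)]) \<bullet> perp_gradient \<psi> x) \<in> borel_measurable borel"
          unfolding inner_real2 vector_add_component vector_sel
          by (intro borel_measurable_continuous_onI continuous_intros cVt cRt perp_gradient_continuous s)
        have "(LINT x|lebesgue_on unit_square. (V (x, t) + vector [0, R (x, t)]) \<bullet> perp_gradient \<psi> x) = 0"
          using pd(9)[OF s, of t] outt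
          by (subst lebesgue_on_integral_eq_lborel[OF m slab_props(7)]) (auto simp: inner_real2)
        moreover have "(LINT x|lebesgue_on unit_square. (v (x, t) + V (x, t) + vector [0, \<rho> (x, t) + R (x, t)]) \<bullet> perp_gradient \<psi> x) =
           (LINT x|lebesgue_on unit_square. (v (x, t) + vector [0, \<rho> (x, t)]) \<bullet> perp_gradient \<psi> x)
           + (LINT x|lebesgue_on unit_square. (V (x, t) + vector [0, R (x, t)]) \<bullet> perp_gradient \<psi> x)"
        proof -
          have "(v (x, t) + V (x, t) + vector [0, \<rho> (x, t) + R (x, t)]) \<bullet> perp_gradient \<psi> x =
            (v (x, t) + vector [0, \<rho> (x, t)]) \<bullet> perp_gradient \<psi> x + (V (x, t) + vector [0, R (x, t)]) \<bullet> perp_gradient \<psi> x" for x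
            by (simp add: inner_real2 algebra_simps)
          then show ?thesis
            by (simp only:) (intro Bochner_Integration.integral_add integrable_inner_continuous vt Vt bounded_unit_square perp_gradient_continuous s)
        qed
        ultimately show "(LINT x|lebesgue_on unit_square. (v (x, t) + V (x, t) + vector [0, \<rho> (x, t) + R (x, t)]) \<bullet> perp_gradient \<psi> x) = 0"
          using elim(2) t by simp
      qed
    qed
  qed
qed

section \<open>Decreasing the deficit\<close>

lemma abs_one_square: "\<bar>x :: real\<bar> = 1 \<Longrightarrow> x\<^sup>2 = 1"
  by (metis power2_abs power_one)

text \<open>Representatives of the elements of \<open>X\<^sub>0\<close>: the constructions are
  pointwise, and classes are formed only at the end.\<close>

definition strict_subsolution where
  "strict_subsolution T \<rho>\<^sub>0 \<rho>' v' m' U \<rho> v m \<longleftrightarrow>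
     ess_bounded (slab T) (\<lambda>z. (\<rho> z, v z, m z)) \<and> linear_system unit_square T \<rho>\<^sub>0 \<rho> v m \<and>
     (AE z in lebesgue_on (slab T - U). (\<rho> z, v z, m z) = (\<rho>' z, v' z, m' z)) \<and> strict_on U \<rho> v m"

definition pairing where
  "pairing T g \<rho> v m = (LINT z|lebesgue_on (slab T). (\<rho> z :: real, v z :: real^2, m z :: real^2) \<bullet> g z)"

lemma square_integrable_triple:
  "square_integrable S (\<lambda>z. (\<rho> z :: real, v z :: real^2, m z :: real^2)) \<longleftrightarrow>
     square_integrable S \<rho> \<and> square_integrable S v \<and> square_integrable S m"
proof -
  have n: "(norm (a, b, c))\<^sup>2 = (norm a)\<^sup>2 + ((norm b)\<^sup>2 + (norm c)\<^sup>2)" for a :: real and b c :: "real^2"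
    by (simp add: norm_Pair)
  show ?thesis
  proof
    assume a: "square_integrable S (\<lambda>z. (\<rho> z, v z, m z))"
    then have mm: "\<rho> \<in> borel_measurable (lebesgue_on S)" "v \<in> borel_measurable (lebesgue_on S)" "m \<in> borel_measurable (lebesgue_on S)"
      and i: "integrable (lebesgue_on S) (\<lambda>z. (norm (\<rho> z))\<^sup>2 + ((norm (v z))\<^sup>2 + (norm (m z))\<^sup>2))"
      unfolding square_integrable_def measurable_Pair_triple n by auto
    have "integrable (lebesgue_on S) (\<lambda>z. (norm (\<rho> z))\<^sup>2)" "integrable (lebesgue_on S) (\<lambda>z. (norm (v z))\<^sup>2)" "integrable (lebesgue_on S) (\<lambda>z. (norm (m z))\<^sup>2)"
      by (rule Bochner_Integration.integrable_bound[OF i]; use mm in auto)+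
    with mm show "square_integrable S \<rho> \<and> square_integrable S v \<and> square_integrable S m"
      by (simp add: square_integrable_def)
  next
    assume "square_integrable S \<rho> \<and> square_integrable S v \<and> square_integrable S m"
    then show "square_integrable S (\<lambda>z. (\<rho> z, v z, m z))"
      unfolding square_integrable_def measurable_Pair_triple n by auto
  qed
qed

lemma square_integrable_component: "square_integrable S v \<Longrightarrow> square_integrable S (\<lambda>z. (v z :: real^2) $ i)"
proof -
  assume v: "square_integrable S v"
  then have m: "(\<lambda>z. v z $ i) \<in> borel_measurable (lebesgue_on S)"
    by (simp add: square_integrable_def vec_component_measurable)
  have "integrable (lebesgue_on S) (\<lambda>z. (norm (v z $ i))\<^sup>2)"
  proof (rule Bochner_Integration.integrable_bound)
    show "integrable (lebesgue_on S) (\<lambda>z. (norm (v z))\<^sup>2)" using v by (simp add: square_integrable_def)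
    show "AE z in lebesgue_on S. norm ((norm (v z $ i))\<^sup>2) \<le> norm ((norm (v z))\<^sup>2)"
      using component_le_norm_cart by (intro AE_I2) (auto simp: abs_le_square_iff[symmetric])
  qed (use m in auto)
  with m show ?thesis by (simp add: square_integrable_def)
qed

text \<open>In U the strict inequality forces 1 - \<rho>^2 to exceed twice a norm; outside U the
  density agrees almost everywhere with that of the given subsolution, which has modulus 1
  there.\<close>

lemma strict_subsolution_bound:
  assumes s: "strict_subsolution T \<rho>\<^sub>0 \<rho>' v' m' U \<rho> v m" and mz: "mixing_zone unit_square T \<rho>' v' m' U"
  shows "AE z in lebesgue_on (slab T). \<bar>\<rho> z\<bar> \<le> 1" "AE z in lebesgue_on (slab T). z \<notin> U \<longrightarrow> \<bar>\<rho> z\<bar> = 1"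
    "z \<in> U \<Longrightarrow> (\<rho> z)\<^sup>2 < 1"
proof -
  have U: "open U" "U \<subseteq> slab T" using mz by (simp_all add: mixing_zone_def)
  have D: "slab T - U \<in> sets lebesgue" using slab_props(4) U(1) by auto
  have "AE z in lebesgue_on (slab T - U). \<bar>\<rho>' z\<bar> = 1" using mz by (simp add: mixing_zone_def)
  moreover have "AE z in lebesgue_on (slab T - U). (\<rho> z, v z, m z) = (\<rho>' z, v' z, m' z)" using s by (simp add: strict_subsolution_def)
  ultimately have "AE z in lebesgue_on (slab T - U). \<bar>\<rho> z\<bar> = 1" by eventually_elim simp
  then have "AE z in lborel. z \<in> slab T - U \<longrightarrow> \<bar>\<rho> z\<bar> = 1" by (simp only: AE_lebesgue_on_iff[OF D])
  then have "AE z in lborel. z \<in> slab T \<longrightarrow> (z \<notin> U \<longrightarrow> \<bar>\<rho> z\<bar> = 1)" by eventually_elim auto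
  then show 2: "AE z in lebesgue_on (slab T). z \<notin> U \<longrightarrow> \<bar>\<rho> z\<bar> = 1" by (simp only: AE_lebesgue_on_iff[OF slab_props(4)])
  have 3: "(\<rho> z)\<^sup>2 < 1" if "z \<in> U" for z
  proof -
    have "hull_gap (\<rho> z) (v z) (m z) < (1 - (\<rho> z)\<^sup>2) / 2" using s that by (auto simp: strict_subsolution_def strict_on_def)
    moreover have "0 \<le> hull_gap (\<rho> z) (v z) (m z)" by (simp add: hull_gap_def)
    ultimately show ?thesis by simp
  qed
  then show "z \<in> U \<Longrightarrow> (\<rho> z)\<^sup>2 < 1" .
  show "AE z in lebesgue_on (slab T). \<bar>\<rho> z\<bar> \<le> 1"
    using 2
  proof eventually_elim
    case (elim z)
    then show ?case using 3[of z] by (cases "z \<in> U") (auto simp: abs_square_less_1 less_imp_le)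
  qed
qed

text \<open>One member of the wave family, of high enough frequency, is added. In the integral of
  (\<rho> + R)^2 the cross term is small by weak convergence, while the square of R contributes its
  full gain.\<close>

lemma cball_step:
  assumes s: "strict_subsolution T \<rho>\<^sub>0 \<rho>' v' m' U \<rho> v m" and U: "open U" "U \<subseteq> slab T"
    and sub: "cball z0 r \<subseteq> U"
    and p: "\<And>n::nat. perturbation (cball z0 r) (R n) (V n) (M n)"
    and hull: "\<forall>\<^sub>F n in sequentially. \<forall>z\<in>cball z0 r. hull_gap (\<rho> z + R n z) (v z + V n z) (m z + M n z) < (1 - (\<rho> z + R n z)\<^sup>2) / 2"
    and weak: "\<And>S G. S \<in> lmeasurable \<Longrightarrow> cball z0 r \<subseteq> S \<Longrightarrow> integrable (lebesgue_on S) G \<Longrightarrow>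
         (\<lambda>n. LINT z|lebesgue_on S. G z * R n z) \<longlonglongrightarrow> 0 \<and>
         (\<forall>i. (\<lambda>n. LINT z|lebesgue_on S. G z * V n z $ i) \<longlonglongrightarrow> 0) \<and>
         (\<forall>i. (\<lambda>n. LINT z|lebesgue_on S. G z * M n z $ i) \<longlonglongrightarrow> 0)"
    and gain: "\<forall>\<^sub>F n in sequentially. (LINT z|lborel. (R n z)\<^sup>2) > I"
    and gs: "finite gs" "\<And>g. g \<in> gs \<Longrightarrow> square_integrable (slab T) g" and e: "e > 0"
  shows "\<exists>\<rho>2 v2 m2. strict_subsolution T \<rho>\<^sub>0 \<rho>' v' m' U \<rho>2 v2 m2 \<and>
     (\<forall>g\<in>gs. \<bar>pairing T g \<rho>2 v2 m2 - pairing T g \<rho> v m\<bar> < e) \<and>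
     (\<forall>z. z \<notin> cball z0 r \<longrightarrow> (\<rho>2 z, v2 z, m2 z) = (\<rho> z, v z, m z)) \<and>
     (LINT z|lebesgue_on (slab T). (\<rho>2 z)\<^sup>2) \<ge> (LINT z|lebesgue_on (slab T). (\<rho> z)\<^sup>2) + I - e"
proof -
  note pd = perturbationD[OF p]
  have K: "compact (cball z0 r)" "cball z0 r \<subseteq> slab T" using sub U by auto
  have eb: "ess_bounded (slab T) \<rho>" "ess_bounded (slab T) v" "ess_bounded (slab T) m"
    using s by (simp_all add: strict_subsolution_def ess_bounded_triple)
  have ebp: "ess_bounded (slab T) (R n)" "ess_bounded (slab T) (V n)" "ess_bounded (slab T) (M n)" for n
    using continuous_compact_support_ess_bounded[OF pd(1) K(1) pd(4)]
      continuous_compact_support_ess_bounded[OF pd(2) K(1) pd(5)]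
      continuous_compact_support_ess_bounded[OF pd(3) K(1) pd(6)] by blast+
  note si = ess_bounded_imp_square_integrable[OF _ slab_props(3)]
  have pair_diff: "pairing T g (\<lambda>z. \<rho> z + R n z) (\<lambda>z. v z + V n z) (\<lambda>z. m z + M n z) - pairing T g \<rho> v m = pairing T g (R n) (V n) (M n)"
    if "square_integrable (slab T) g" for g n
  proof -
    have "integrable (lebesgue_on (slab T)) (\<lambda>z. (\<rho> z, v z, m z) \<bullet> g z)"
      "integrable (lebesgue_on (slab T)) (\<lambda>z. (R n z, V n z, M n z) \<bullet> g z)"
      by (intro square_integrable_inner that; simp add: square_integrable_triple si eb ebp)+
    moreover have "(\<rho> z + R n z, v z + V n z, m z + M n z) \<bullet> g z = (\<rho> z, v z, m z) \<bullet> g z + (R n z, V n z, M n z) \<bullet> g z" for z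
      by (simp add: inner_add_left[symmetric])
    ultimately show ?thesis unfolding pairing_def by simp
  qed
  have pair_lim: "(\<lambda>n. pairing T g (R n) (V n) (M n)) \<longlonglongrightarrow> 0" if g: "square_integrable (slab T) g" for g
  proof -
    define g1 g2 g3 where "g1 z = fst (g z)" and "g2 z = fst (snd (g z))" and "g3 z = snd (snd (g z))" for z
    have "square_integrable (slab T) (\<lambda>z. (g1 z, g2 z, g3 z))" using g by (simp add: g1_def g2_def g3_def)
    then have sg: "square_integrable (slab T) g1" "square_integrable (slab T) g2" "square_integrable (slab T) g3"
      by (simp_all add: square_integrable_triple)
    note sg' = sg(1) square_integrable_component[OF sg(2)] square_integrable_component[OF sg(3)]
    note ig = sg'[THEN square_integrable_imp_integrable, OF slab_props(3)]
    note w1 = weak[OF slab_props(3) K(2) ig(1)] and w2 = weak[OF slab_props(3) K(2) ig(2)] and w3 = weak[OF slab_props(3) K(2) ig(3)]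
    have i: "integrable (lebesgue_on (slab T)) (\<lambda>z. g1 z * R n z)" "integrable (lebesgue_on (slab T)) (\<lambda>z. g2 z $ i * V n z $ i)"
      "integrable (lebesgue_on (slab T)) (\<lambda>z. g3 z $ i * M n z $ i)" for n i
      using square_integrable_inner[OF sg'(1) si[OF ebp(1)]] square_integrable_inner[OF sg'(2) si[OF ess_bounded_component[OF ebp(2)]]]
        square_integrable_inner[OF sg'(3) si[OF ess_bounded_component[OF ebp(3)]]] by simp_all
    have "(R n z, V n z, M n z) \<bullet> g z = g1 z * R n z + (g2 z $ 1 * V n z $ 1 + g2 z $ 2 * V n z $ 2 + (g3 z $ 1 * M n z $ 1 + g3 z $ 2 * M n z $ 2))" for n z
      by (cases "g z") (simp add: g1_def g2_def g3_def inner_real2 inner_prod_def mult.commute)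
    then have "pairing T g (R n) (V n) (M n) = (LINT z|lebesgue_on (slab T). g1 z * R n z) +
        ((LINT z|lebesgue_on (slab T). g2 z $ 1 * V n z $ 1) + (LINT z|lebesgue_on (slab T). g2 z $ 2 * V n z $ 2) +
        ((LINT z|lebesgue_on (slab T). g3 z $ 1 * M n z $ 1) + (LINT z|lebesgue_on (slab T). g3 z $ 2 * M n z $ 2)))" for n
      unfolding pairing_def using i by simp
    moreover have "(\<lambda>n. (LINT z|lebesgue_on (slab T). g1 z * R n z) +
        ((LINT z|lebesgue_on (slab T). g2 z $ 1 * V n z $ 1) + (LINT z|lebesgue_on (slab T). g2 z $ 2 * V n z $ 2) +
        ((LINT z|lebesgue_on (slab T). g3 z $ 1 * M n z $ 1) + (LINT z|lebesgue_on (slab T). g3 z $ 2 * M n z $ 2)))) \<longlonglongrightarrow> 0 + (0 + 0 + (0 + 0))"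
      by (intro tendsto_add w1[THEN conjunct1] w2[THEN conjunct2, THEN conjunct1, THEN spec] w3[THEN conjunct2, THEN conjunct2, THEN spec])
    ultimately show ?thesis by simp
  qed
  have ev1: "\<forall>\<^sub>F n in sequentially. \<forall>g\<in>gs. \<bar>pairing T g (R n) (V n) (M n)\<bar> < e"
    using gs(1)
  proof (rule eventually_ball_finite)
    show "\<forall>g\<in>gs. \<forall>\<^sub>F n in sequentially. \<bar>pairing T g (R n) (V n) (M n)\<bar> < e"
      using tendstoD[OF pair_lim[OF gs(2)] e] by (simp add: dist_real_def)
  qed
  have lim\<rho>: "(\<lambda>n. LINT z|lebesgue_on (slab T). \<rho> z * R n z) \<longlonglongrightarrow> 0"
    using weak[OF slab_props(3) K(2) ess_bounded_integrable[OF eb(1) slab_props(3)]] by blast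
  \<comment> \<open>Half of e, because the cross term appears with the factor 2.\<close>
  have ev2: "\<forall>\<^sub>F n in sequentially. \<bar>LINT z|lebesgue_on (slab T). \<rho> z * R n z\<bar> < e / 2"
    using tendstoD[OF lim\<rho>, of "e / 2"] e by (simp add: dist_real_def)
  from ev1 ev2 hull gain have "\<forall>\<^sub>F n in sequentially. (\<forall>g\<in>gs. \<bar>pairing T g (R n) (V n) (M n)\<bar> < e) \<and>
     \<bar>LINT z|lebesgue_on (slab T). \<rho> z * R n z\<bar> < e / 2 \<and>
     (\<forall>z\<in>cball z0 r. hull_gap (\<rho> z + R n z) (v z + V n z) (m z + M n z) < (1 - (\<rho> z + R n z)\<^sup>2) / 2) \<and> (LINT z|lborel. (R n z)\<^sup>2) > I"
    by (intro eventually_conj)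
  then obtain n where n: "\<forall>g\<in>gs. \<bar>pairing T g (R n) (V n) (M n)\<bar> < e" "\<bar>LINT z|lebesgue_on (slab T). \<rho> z * R n z\<bar> < e / 2"
     "\<forall>z\<in>cball z0 r. hull_gap (\<rho> z + R n z) (v z + V n z) (m z + M n z) < (1 - (\<rho> z + R n z)\<^sup>2) / 2" "(LINT z|lborel. (R n z)\<^sup>2) > I"
    unfolding eventually_sequentially by blast
  show ?thesis
  proof (intro exI conjI ballI allI impI)
    show "strict_subsolution T \<rho>\<^sub>0 \<rho>' v' m' U (\<lambda>z. \<rho> z + R n z) (\<lambda>z. v z + V n z) (\<lambda>z. m z + M n z)"
      unfolding strict_subsolution_def
    proof (intro conjI)
      show "ess_bounded (slab T) (\<lambda>z. (\<rho> z + R n z, v z + V n z, m z + M n z))"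
        unfolding ess_bounded_triple by (intro conjI ess_bounded_add eb ebp)
      show "linear_system unit_square T \<rho>\<^sub>0 (\<lambda>z. \<rho> z + R n z) (\<lambda>z. v z + V n z) (\<lambda>z. m z + M n z)"
        using s by (intro linear_system_perturb[OF _ _ p K]) (simp_all add: strict_subsolution_def)
      have "AE z in lebesgue_on (slab T - U). (\<rho> z, v z, m z) = (\<rho>' z, v' z, m' z)" using s by (simp add: strict_subsolution_def)
      moreover have "AE z in lebesgue_on (slab T - U). z \<notin> cball z0 r"
        using sub by (intro AE_I2) (auto simp: space_restrict_space)
      ultimately show "AE z in lebesgue_on (slab T - U). (\<rho> z + R n z, v z + V n z, m z + M n z) = (\<rho>' z, v' z, m' z)"
      proof eventually_elim
        case (elim z) then show ?case using pd(4-6)[of z n] by simp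
      qed
      have st: "continuous_on U (\<lambda>z. (\<rho> z, v z, m z))" "\<And>z. z \<in> U \<Longrightarrow> hull_gap (\<rho> z) (v z) (m z) < (1 - (\<rho> z)\<^sup>2) / 2"
        using s by (auto simp: strict_subsolution_def strict_on_def)
      have c: "continuous_on U (\<lambda>z. (R n z, V n z, M n z))"
        by (intro continuous_on_Pair continuous_on_subset[OF pd(1)] continuous_on_subset[OF pd(2)] continuous_on_subset[OF pd(3)]) auto
      show "strict_on U (\<lambda>z. \<rho> z + R n z) (\<lambda>z. v z + V n z) (\<lambda>z. m z + M n z)"
        unfolding strict_on_def
      proof (intro conjI ballI)
        show "continuous_on U (\<lambda>z. (\<rho> z + R n z, v z + V n z, m z + M n z))"
          using continuous_on_add[OF st(1) c] by simp
        fix z assume z: "z \<in> U"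
        show "hull_gap (\<rho> z + R n z) (v z + V n z) (m z + M n z) < (1 - (\<rho> z + R n z)\<^sup>2) / 2"
          using n(3) st(2)[OF z] pd(4-6)[of z n] by (cases "z \<in> cball z0 r") auto
      qed
    qed
    fix g assume g: "g \<in> gs"
    show "\<bar>pairing T g (\<lambda>z. \<rho> z + R n z) (\<lambda>z. v z + V n z) (\<lambda>z. m z + M n z) - pairing T g \<rho> v m\<bar> < e"
      unfolding pair_diff[OF gs(2)[OF g]] using n(1) g by blast
  next
    fix z assume "z \<notin> cball z0 r"
    then show "(\<rho> z + R n z, v z + V n z, m z + M n z) = (\<rho> z, v z, m z)" using pd(4-6)[of z n] by simp
  next
    have i: "integrable (lebesgue_on (slab T)) (\<lambda>z. \<rho> z * \<rho> z)" "integrable (lebesgue_on (slab T)) (\<lambda>z. \<rho> z * R n z)" "integrable (lebesgue_on (slab T)) (\<lambda>z. R n z * R n z)"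
      using square_integrable_inner[OF si[OF eb(1)] si[OF eb(1)]] square_integrable_inner[OF si[OF eb(1)] si[OF ebp(1)]]
        square_integrable_inner[OF si[OF ebp(1)] si[OF ebp(1)]] by simp_all
    have "(LINT z|lebesgue_on (slab T). R n z * R n z) = (LINT z|lborel. R n z * R n z)"
    proof (intro lebesgue_on_integral_eq_lborel slab_props borel_measurable_continuous_onI continuous_intros pd(1))
      fix z assume "z \<notin> slab T"
      then have "R n z = 0" using pd(4)[of z n] K(2) by blast
      then show "R n z * R n z = 0" by simp
    qed
    moreover have "(\<rho> z + R n z)\<^sup>2 = \<rho> z * \<rho> z + 2 * (\<rho> z * R n z) + R n z * R n z" for z
      by (simp add: power2_eq_square algebra_simps)
    ultimately have "(LINT z|lebesgue_on (slab T). (\<rho> z + R n z)\<^sup>2) =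
      (LINT z|lebesgue_on (slab T). (\<rho> z)\<^sup>2) + 2 * (LINT z|lebesgue_on (slab T). \<rho> z * R n z) + (LINT z|lborel. (R n z)\<^sup>2)"
      using i by (simp add: power2_eq_square)
    then show "(LINT z|lebesgue_on (slab T). (\<rho> z)\<^sup>2) + I - e \<le> (LINT z|lebesgue_on (slab T). (\<rho> z + R n z)\<^sup>2)"
      using n(2,4) by linarith
  qed
qed

text \<open>The increase of the integral of \<rho>^2 that a wave on B guarantees. It is quadratic in
  the local deficit because the amplitude is proportional to it; the constant comes from
  \<open>local_perturbation\<close>.\<close>

definition gain_on where
  "gain_on \<rho> B = (1 / 30000) * (LINT z|lebesgue_on B. (1 - (\<rho> z :: real)\<^sup>2)\<^sup>2)"

text \<open>The conclusion of \<open>local_perturbation\<close> as one predicate. It involves the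
  triple only through its values on the ball.\<close>

definition wave_family where
  "wave_family \<rho> v m z0 r R V M \<longleftrightarrow>
      (\<forall>n::nat. perturbation (cball z0 r) (R n) (V n) (M n)) \<and>
      (\<forall>\<^sub>F n in sequentially. \<forall>z\<in>cball z0 r. hull_gap (\<rho> z + R n z) (v z + V n z) (m z + M n z) < (1 - (\<rho> z + R n z)\<^sup>2) / 2) \<and>
      (\<forall>S G. S \<in> lmeasurable \<longrightarrow> cball z0 r \<subseteq> S \<longrightarrow> integrable (lebesgue_on S) G \<longrightarrow>
         (\<lambda>n. LINT z|lebesgue_on S. G z * R n z) \<longlonglongrightarrow> 0 \<and>
         (\<forall>i. (\<lambda>n. LINT z|lebesgue_on S. G z * V n z $ i) \<longlonglongrightarrow> 0) \<and>
         (\<forall>i. (\<lambda>n. LINT z|lebesgue_on S. G z * M n z $ i) \<longlonglongrightarrow> 0)) \<and>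
      (\<forall>\<^sub>F n in sequentially. (LINT z|lborel. (R n z)\<^sup>2) > gain_on \<rho> (cball z0 r))"

definition admissible_cball where
  "admissible_cball U \<rho> v m z0 r \<longleftrightarrow> cball z0 r \<subseteq> U \<and> (\<exists>R V M. wave_family \<rho> v m z0 r R V M)"

text \<open>Modifying the triple on one ball leaves it unchanged on the others, since the balls are
  disjoint. Hence every wave family prepared for the original triple is still valid when its turn
  comes, and the gains add up; the tolerance is halved at each step.\<close>

lemma finite_family_step:
  fixes F :: "((((real^2) \<times> real)) \<times> real) set"
  assumes s: "strict_subsolution T \<rho>\<^sub>0 \<rho>' v' m' U \<rho> v m" and U: "open U" "U \<subseteq> slab T"
    and F: "finite F" "\<And>i. i \<in> F \<Longrightarrow> admissible_cball U \<rho> v m (fst i) (snd i)"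
      "pairwise (\<lambda>i j. disjnt (cball (fst i) (snd i)) (cball (fst j) (snd j))) F"
    and gs: "finite gs" "\<And>g. g \<in> gs \<Longrightarrow> square_integrable (slab T) g" and e: "e > 0"
  shows "\<exists>\<rho>2 v2 m2. strict_subsolution T \<rho>\<^sub>0 \<rho>' v' m' U \<rho>2 v2 m2 \<and>
     (\<forall>g\<in>gs. \<bar>pairing T g \<rho>2 v2 m2 - pairing T g \<rho> v m\<bar> < e) \<and>
     (\<forall>z. (\<forall>i\<in>F. z \<notin> cball (fst i) (snd i)) \<longrightarrow> (\<rho>2 z, v2 z, m2 z) = (\<rho> z, v z, m z)) \<and>
     (LINT z|lebesgue_on (slab T). (\<rho>2 z)\<^sup>2) \<ge> (LINT z|lebesgue_on (slab T). (\<rho> z)\<^sup>2) + (\<Sum>i\<in>F. gain_on \<rho> (cball (fst i) (snd i))) - e"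
  using F e
proof (induction F arbitrary: e rule: finite_induct)
  case empty
  then show ?case using s by (intro exI[of _ \<rho>] exI[of _ v] exI[of _ m]) auto
next
  case (insert i F)
  have F: "\<And>j. j \<in> F \<Longrightarrow> admissible_cball U \<rho> v m (fst j) (snd j)"
    "pairwise (\<lambda>i j. disjnt (cball (fst i) (snd i)) (cball (fst j) (snd j))) F"
    using insert.prems(1,2) by (auto simp: pairwise_insert)
  have e2: "e / 2 > 0" using insert.prems(3) by simp
  from insert.IH[OF F e2] obtain \<rho>1 v1 m1 where q1: "strict_subsolution T \<rho>\<^sub>0 \<rho>' v' m' U \<rho>1 v1 m1"
     "\<forall>g\<in>gs. \<bar>pairing T g \<rho>1 v1 m1 - pairing T g \<rho> v m\<bar> < e / 2"
     "\<forall>z. (\<forall>i\<in>F. z \<notin> cball (fst i) (snd i)) \<longrightarrow> (\<rho>1 z, v1 z, m1 z) = (\<rho> z, v z, m z)"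
     "(LINT z|lebesgue_on (slab T). (\<rho>1 z)\<^sup>2) \<ge> (LINT z|lebesgue_on (slab T). (\<rho> z)\<^sup>2) + (\<Sum>i\<in>F. gain_on \<rho> (cball (fst i) (snd i))) - e / 2"
    by blast
  define z0 r where "z0 = fst i" and "r = snd i"
  have "admissible_cball U \<rho> v m z0 r" using insert.prems(1)[of i] by (simp add: z0_def r_def)
  then obtain R V M where sub: "cball z0 r \<subseteq> U" and wf: "wave_family \<rho> v m z0 r R V M"
    unfolding admissible_cball_def by blast
  note wf' = wf[unfolded wave_family_def]
  note p = wf'[THEN conjunct1, THEN spec]
  note hull = wf'[THEN conjunct2, THEN conjunct1]
  note weak = wf'[THEN conjunct2, THEN conjunct2, THEN conjunct1, THEN spec, THEN spec, THEN mp, THEN mp, THEN mp]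
  note gain = wf'[THEN conjunct2, THEN conjunct2, THEN conjunct2]
  \<comment> \<open>On the new ball the triple of the induction hypothesis is still the original
    one.\<close>
  have same: "\<rho>1 z = \<rho> z" "v1 z = v z" "m1 z = m z" if z: "z \<in> cball z0 r" for z
  proof -
    have "\<forall>j\<in>F. z \<notin> cball (fst j) (snd j)"
    proof
      fix j assume j: "j \<in> F"
      then have "i \<noteq> j" using insert.hyps(2) by blast
      then have "disjnt (cball (fst i) (snd i)) (cball (fst j) (snd j))"
        using pairwiseD[OF insert.prems(2), of i j] j by blast
      then show "z \<notin> cball (fst j) (snd j)" using z unfolding z0_def r_def disjnt_iff by blast
    qed
    then have "(\<rho>1 z, v1 z, m1 z) = (\<rho> z, v z, m z)" by (rule q1(3)[THEN spec, THEN mp])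
    then show "\<rho>1 z = \<rho> z" "v1 z = v z" "m1 z = m z" by simp_all
  qed
  have hull1: "\<forall>\<^sub>F n in sequentially. \<forall>z\<in>cball z0 r. hull_gap (\<rho>1 z + R n z) (v1 z + V n z) (m1 z + M n z) < (1 - (\<rho>1 z + R n z)\<^sup>2) / 2"
    using hull
  proof eventually_elim
    case (elim n)
    show ?case
    proof
      fix z assume z: "z \<in> cball z0 r"
      show "hull_gap (\<rho>1 z + R n z) (v1 z + V n z) (m1 z + M n z) < (1 - (\<rho>1 z + R n z)\<^sup>2) / 2"
        unfolding same[OF z] using elim z by blast
    qed
  qed
  from cball_step[OF q1(1) U sub p hull1 weak gain gs e2]
  obtain \<rho>2 v2 m2 where q2: "strict_subsolution T \<rho>\<^sub>0 \<rho>' v' m' U \<rho>2 v2 m2"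
     "\<forall>g\<in>gs. \<bar>pairing T g \<rho>2 v2 m2 - pairing T g \<rho>1 v1 m1\<bar> < e / 2"
     "\<forall>z. z \<notin> cball z0 r \<longrightarrow> (\<rho>2 z, v2 z, m2 z) = (\<rho>1 z, v1 z, m1 z)"
     "(LINT z|lebesgue_on (slab T). (\<rho>2 z)\<^sup>2) \<ge> (LINT z|lebesgue_on (slab T). (\<rho>1 z)\<^sup>2) + gain_on \<rho> (cball z0 r) - e / 2"
    by blast
  show ?case
  proof (intro exI conjI ballI allI impI)
    show "strict_subsolution T \<rho>\<^sub>0 \<rho>' v' m' U \<rho>2 v2 m2" by (rule q2(1))
    fix g assume "g \<in> gs"
    then have "\<bar>pairing T g \<rho>2 v2 m2 - pairing T g \<rho>1 v1 m1\<bar> < e / 2" "\<bar>pairing T g \<rho>1 v1 m1 - pairing T g \<rho> v m\<bar> < e / 2"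
      using q1(2) q2(2) by blast+
    then show "\<bar>pairing T g \<rho>2 v2 m2 - pairing T g \<rho> v m\<bar> < e" by linarith
  next
    fix z assume "\<forall>j\<in>insert i F. z \<notin> cball (fst j) (snd j)"
    then have "z \<notin> cball z0 r" "\<forall>j\<in>F. z \<notin> cball (fst j) (snd j)" by (simp_all add: z0_def r_def)
    then show "(\<rho>2 z, v2 z, m2 z) = (\<rho> z, v z, m z)"
      using q2(3)[THEN spec, THEN mp, of z] q1(3)[THEN spec, THEN mp, of z] by (metis (no_types))
  next
    have "(\<Sum>j\<in>insert i F. gain_on \<rho> (cball (fst j) (snd j))) = gain_on \<rho> (cball z0 r) + (\<Sum>j\<in>F. gain_on \<rho> (cball (fst j) (snd j)))"
      using insert.hyps by (simp add: z0_def r_def)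
    then show "(LINT z|lebesgue_on (slab T). (\<rho> z)\<^sup>2) + (\<Sum>j\<in>insert i F. gain_on \<rho> (cball (fst j) (snd j))) - e \<le> (LINT z|lebesgue_on (slab T). (\<rho>2 z)\<^sup>2)"
      using q1(4) q2(4) by linarith
  qed
qed

text \<open>All small balls around points of U are admissible and form a Vitali cover, so countably
  many disjoint ones exhaust U up to a null set. Outside U the integrand of the gain vanishes, and
  by dominated convergence finitely many balls collect almost everything.\<close>

lemma Vitali_finite_subfamily:
  assumes s: "strict_subsolution T \<rho>\<^sub>0 \<rho>' v' m' U \<rho> v m" and mz: "mixing_zone unit_square T \<rho>' v' m' U" and d: "d > 0"
  obtains F where "finite F" "\<And>i. i \<in> F \<Longrightarrow> admissible_cball U \<rho> v m (fst i) (snd i)"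
      "pairwise (\<lambda>i j. disjnt (cball (fst i) (snd i)) (cball (fst j) (snd j))) F"
      "(\<Sum>i\<in>F. gain_on \<rho> (cball (fst i) (snd i))) \<ge> gain_on \<rho> (slab T) - d"
proof -
  have U: "open U" "U \<subseteq> slab T" using mz by (simp_all add: mixing_zone_def)
  have st: "strict_on U \<rho> v m" using s by (simp add: strict_subsolution_def)
  have "\<forall>z0\<in>U. \<exists>r0>0. \<forall>r. 0 < r \<longrightarrow> r \<le> r0 \<longrightarrow> admissible_cball U \<rho> v m z0 r"
  proof
    fix z0 assume z0: "z0 \<in> U"
    obtain r0 where "r0 > 0" "\<And>r. 0 < r \<Longrightarrow> r \<le> r0 \<Longrightarrow> admissible_cball U \<rho> v m z0 r"
      using local_perturbation[OF st U(1) z0, folded gain_on_def, folded wave_family_def, folded admissible_cball_def] by metis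
    then show "\<exists>r0>0. \<forall>r. 0 < r \<longrightarrow> r \<le> r0 \<longrightarrow> admissible_cball U \<rho> v m z0 r" by blast
  qed
  then obtain r0 where r0: "\<And>z0. z0 \<in> U \<Longrightarrow> r0 z0 > 0" "\<And>z0 r. z0 \<in> U \<Longrightarrow> 0 < r \<Longrightarrow> r \<le> r0 z0 \<Longrightarrow> admissible_cball U \<rho> v m z0 r"
    by metis
  define K where "K = {i. fst i \<in> U \<and> 0 < snd i \<and> snd i \<le> r0 (fst i)}"
  obtain C where C: "countable C" "C \<subseteq> K" "pairwise (\<lambda>i j. disjnt (cball (fst i) (snd i)) (cball (fst j) (snd j))) C"
     "negligible (U - (\<Union>i\<in>C. cball (fst i) (snd i)))"
  proof (rule Vitali_covering_theorem_cballs[of K snd U fst])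
    fix x d assume x: "x \<in> U" and d: "(0::real) < d"
    \<comment> \<open>The ball is centred at x itself; d/2 makes its radius strictly smaller than
      d.\<close>
    show "\<exists>i. i \<in> K \<and> x \<in> cball (fst i) (snd i) \<and> snd i < d"
      using x d r0(1)[OF x] by (intro exI[of _ "(x, min (r0 x) (d / 2))"]) (auto simp: K_def)
  qed (auto simp: K_def)
  have adm: "admissible_cball U \<rho> v m (fst i) (snd i)" if "i \<in> C" for i
  proof -
    have "i \<in> K" using that C(2) by blast
    then have "fst i \<in> U" "0 < snd i" "snd i \<le> r0 (fst i)" by (simp_all add: K_def)
    then show ?thesis by (rule r0(2))
  qed
  have sub: "cball (fst i) (snd i) \<subseteq> slab T" if "i \<in> C" for i
    using adm[OF that] U(2) by (auto simp: admissible_cball_def)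
  define f where "f z = (1 - (\<rho> z)\<^sup>2)\<^sup>2" for z
  have \<rho>m: "\<rho> \<in> borel_measurable (lebesgue_on (slab T))"
    using s by (simp add: strict_subsolution_def ess_bounded_triple ess_bounded_def)
  have fm: "f \<in> borel_measurable (lebesgue_on (slab T))" unfolding f_def using \<rho>m by auto
  note bd = strict_subsolution_bound[OF s mz]
  have fb: "AE z in lebesgue_on (slab T). norm (f z) \<le> 1"
    using bd(1)
  proof eventually_elim
    case (elim z)
    then have "(\<rho> z)\<^sup>2 \<le> 1" by (simp add: abs_square_le_1)
    then have "\<bar>1 - (\<rho> z)\<^sup>2\<bar> \<le> 1" using zero_le_power2[of "\<rho> z"] by linarith
    then show ?case by (simp add: f_def abs_square_le_1)
  qed
  have fi: "integrable (lebesgue_on (slab T)) f" by (rule integrable_bounded_lebesgue_on[OF fm slab_props(3) fb])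
  have gain_ball: "(LINT z|lebesgue_on B. f z) = (LINT z|lebesgue_on (slab T). indicator B z * f z)" if B: "B \<in> sets lebesgue" "B \<subseteq> slab T" for B
  proof -
    have "(LINT z|lebesgue_on (slab T). indicator B z * f z) = (LINT z|lebesgue. indicator (slab T) z *\<^sub>R (indicator B z * f z))"
      using slab_props(4) by (intro integral_restrict_space) auto
    also have "\<dots> = (LINT z|lebesgue. indicator B z *\<^sub>R f z)"
      by (intro Bochner_Integration.integral_cong) (use B(2) in \<open>auto simp: indicator_def\<close>)
    also have "\<dots> = (LINT z|lebesgue_on B. f z)" using B(1) by (intro integral_restrict_space[symmetric]) auto
    finally show ?thesis by simp
  qed
  show ?thesis
  proof (cases "C = {}")
    case True
    \<comment> \<open>Without any ball U is negligible, so |\<rho>| = 1 almost everywhere and there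
      is nothing to gain. The enumeration in the other case presupposes a nonempty family.\<close>
    have "AE z in lebesgue_on (slab T). f z = 0"
    proof -
      have "negligible U" using C(4) True by simp
      then have "U \<in> null_sets lebesgue" by (simp add: negligible_iff_null_sets)
      then have "AE z in lebesgue. z \<notin> U" by (rule AE_not_in)
      then have "AE z in lebesgue_on (slab T). z \<notin> U"
        using slab_props(4) by (subst AE_restrict_space_iff) (auto elim: eventually_mono)
      then show ?thesis using bd(2)
      proof eventually_elim
        case (elim z) then have "(\<rho> z)\<^sup>2 = 1" using abs_one_square by blast
        then show ?case by (simp add: f_def)
      qed
    qed
    then have "(LINT z|lebesgue_on (slab T). f z) = (LINT z|lebesgue_on (slab T). 0)"
      using fm by (intro integral_cong_AE) auto
    then have "gain_on \<rho> (slab T) = 0" by (simp add: gain_on_def f_def)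
    then show ?thesis using d by (intro that[of "{}"]) auto
  next
    case False
    \<comment> \<open>The enumeration repeats balls when C is finite; therefore unions and sums
      below run over image sets and not over indices.\<close>
    define c where "c = from_nat_into C"
    have cC: "range c = C" unfolding c_def using False C(1) by (simp add: range_from_nat_into)
    define B where "B i = cball (fst i) (snd i)" for i :: "((real^2) \<times> real) \<times> real"
    define A where "A n = (\<Union>i\<in>c ` {..n}. B i)" for n
    have Bl: "B i \<in> sets lebesgue" for i unfolding B_def by auto
    have Al: "A n \<in> sets lebesgue" for n unfolding A_def using Bl by (intro sets.finite_UN) auto
    have "(\<lambda>n. LINT z|lebesgue_on (slab T). indicator (A n) z * f z) \<longlonglongrightarrow> (LINT z|lebesgue_on (slab T). f z)"
    proof (rule integral_dominated_convergence[where w="\<lambda>z. \<bar>f z\<bar>"])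
      show "AE z in lebesgue_on (slab T). (\<lambda>n. indicator (A n) z * f z) \<longlonglongrightarrow> f z"
      proof -
        have "U - (\<Union>i\<in>C. B i) \<in> null_sets lebesgue" using C(4) by (simp add: negligible_iff_null_sets B_def)
        then have "AE z in lebesgue. z \<notin> U - (\<Union>i\<in>C. B i)" by (rule AE_not_in)
        then have "AE z in lebesgue_on (slab T). z \<notin> U - (\<Union>i\<in>C. B i)"
          using slab_props(4) by (subst AE_restrict_space_iff) (auto elim: eventually_mono)
        then show ?thesis using bd(2)
        proof eventually_elim
          case (elim z)
          show ?case
          proof (cases "z \<in> (\<Union>i\<in>C. B i)")
            case True
            then obtain i where "i \<in> C" "z \<in> B i" by blast
            then obtain N where N: "z \<in> B (c N)" using cC by (metis rangeE)
            have "indicator (A n) z * f z = f z" if "n \<ge> N" for n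
              using N that by (auto simp: A_def indicator_def)
            then show ?thesis by (intro tendsto_eventually) (auto simp: eventually_sequentially)
          next
            case False
            then have "(\<rho> z)\<^sup>2 = 1" using elim abs_one_square by blast
            then show ?thesis by (simp add: f_def)
          qed
        qed
      qed
      show "(\<lambda>z. indicator (A n) z * f z) \<in> borel_measurable (lebesgue_on (slab T))" for n
        by (rule borel_measurable_times[OF measurable_restrict_space1[OF borel_measurable_indicator[OF Al]] fm])
      show "AE z in lebesgue_on (slab T). norm (indicator (A n) z * f z) \<le> \<bar>f z\<bar>" for n
        by (intro AE_I2) (auto simp: indicator_def)
    qed (use fi fm in auto)
    then have "\<forall>\<^sub>F n in sequentially. (LINT z|lebesgue_on (slab T). indicator (A n) z * f z) > (LINT z|lebesgue_on (slab T). f z) - d"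
      using d by (intro order_tendstoD(1)) auto
    then obtain n where n: "(LINT z|lebesgue_on (slab T). indicator (A n) z * f z) > (LINT z|lebesgue_on (slab T). f z) - d"
      by (auto simp: eventually_sequentially)
    define F where "F = c ` {..n}"
    have F: "finite F" "F \<subseteq> C" using cC by (auto simp: F_def)
    have ind: "indicator (A n) z = (\<Sum>i\<in>F. indicator (B i) z :: real)" for z
    proof -
      have "disjoint_family_on B F"
        using pairwise_subset[OF C(3) F(2)] by (auto simp: disjoint_family_on_def pairwise_def disjnt_def B_def)
      then show ?thesis unfolding A_def F_def[symmetric] using F(1) by (intro indicator_UN_disjoint) auto
    qed
    have Bi: "integrable (lebesgue_on (slab T)) (\<lambda>z. indicator (B i) z * f z)" for i
    proof (rule Bochner_Integration.integrable_bound[OF fi])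
      show "(\<lambda>z. indicator (B i) z * f z) \<in> borel_measurable (lebesgue_on (slab T))"
        by (rule borel_measurable_times[OF measurable_restrict_space1[OF borel_measurable_indicator[OF Bl]] fm])
    qed (auto simp: indicator_def)
    have "(LINT z|lebesgue_on (slab T). indicator (A n) z * f z) = (\<Sum>i\<in>F. LINT z|lebesgue_on (slab T). indicator (B i) z * f z)"
      unfolding ind sum_distrib_right using Bi by (intro Bochner_Integration.integral_sum) auto
    also have "\<dots> = (\<Sum>i\<in>F. LINT z|lebesgue_on (B i). f z)"
      using gain_ball[OF Bl] sub F(2) by (intro sum.cong) (auto simp: B_def)
    finally have e: "(\<Sum>i\<in>F. LINT z|lebesgue_on (B i). f z) > (LINT z|lebesgue_on (slab T). f z) - d" using n by simp
    have "gain_on \<rho> (slab T) - d \<le> (1 / 30000) * ((LINT z|lebesgue_on (slab T). f z) - d)"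
      using d by (simp add: gain_on_def f_def)
    also have "\<dots> \<le> (1 / 30000) * (\<Sum>i\<in>F. LINT z|lebesgue_on (B i). f z)" using e by simp
    also have "\<dots> = (\<Sum>i\<in>F. gain_on \<rho> (B i))" by (simp add: gain_on_def f_def sum_distrib_left)
    finally have "gain_on \<rho> (slab T) - d \<le> (\<Sum>i\<in>F. gain_on \<rho> (cball (fst i) (snd i)))" by (simp add: B_def)
    then show ?thesis using F adm pairwise_subset[OF C(3) F(2)] by (intro that[of F]) auto
  qed
qed

definition deficit where
  "deficit T \<rho> = (LINT z|lebesgue_on (slab T). 1 - (\<rho> z :: real)\<^sup>2)"

text \<open>The common margin lets a further small perturbation stay in the same weak
  neighbourhood.\<close>

lemma finite_uniform_slack:
  fixes a :: "'a \<Rightarrow> real"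
  assumes "finite gs" "\<forall>g\<in>gs. a g < e"
  obtains d where "d > 0" "\<forall>g\<in>gs. a g + d \<le> e"
proof -
  from assms have "\<exists>d>0. \<forall>g\<in>gs. a g + d \<le> e"
  proof (induction gs rule: finite_induct)
    case empty show ?case by (intro exI[of _ 1]) auto
  next
    case (insert x F)
    then obtain d where "d > 0" "\<forall>g\<in>F. a g + d \<le> e" by auto
    then show ?case using insert.prems by (intro exI[of _ "min d (e - a x)"]) auto
  qed
  then show ?thesis using that by blast
qed

text \<open>A subsolution whose deficit is at least \<open>\<epsilon>\<close> can be perturbed so that the deficit drops by a
  fixed amount; hence the infimum of the deficit over a weak neighbourhood is zero.\<close>

lemma small_deficit_dense:
  assumes s: "strict_subsolution T \<rho>\<^sub>0 \<rho>' v' m' U \<rho> v m" and mz: "mixing_zone unit_square T \<rho>' v' m' U"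
    and gs: "finite gs" "\<And>g. g \<in> gs \<Longrightarrow> square_integrable (slab T) g" and e: "e > 0" and \<epsilon>: "\<epsilon> > 0"
  shows "\<exists>\<rho>2 v2 m2. strict_subsolution T \<rho>\<^sub>0 \<rho>' v' m' U \<rho>2 v2 m2 \<and>
     (\<forall>g\<in>gs. \<bar>pairing T g \<rho>2 v2 m2 - pairing T g \<rho> v m\<bar> < e) \<and> deficit T \<rho>2 < \<epsilon>"
proof (rule ccontr)
  assume contra: "\<not> ?thesis"
  have U: "open U" "U \<subseteq> slab T" using mz by (simp_all add: mixing_zone_def)
  define P where "P \<rho>2 v2 m2 \<longleftrightarrow> strict_subsolution T \<rho>\<^sub>0 \<rho>' v' m' U \<rho>2 v2 m2 \<and> (\<forall>g\<in>gs. \<bar>pairing T g \<rho>2 v2 m2 - pairing T g \<rho> v m\<bar> < e)" for \<rho>2 v2 m2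
  have big: "deficit T \<rho>2 \<ge> \<epsilon>" if "P \<rho>2 v2 m2" for \<rho>2 v2 m2
    using contra that unfolding P_def by (meson not_le)
  \<comment> \<open>The infimum over the neighbourhood need not be attained; a near-minimiser is
    enough for the contradiction.\<close>
  define J where "J = {deficit T \<rho>2 | \<rho>2 v2 m2. P \<rho>2 v2 m2}"
  have "P \<rho> v m" using s e by (simp add: P_def)
  then have Jne: "J \<noteq> {}" by (auto simp: J_def)
  have Jbd: "bdd_below J" using big by (intro bdd_belowI[of _ \<epsilon>]) (auto simp: J_def)
  define L where "L = measure lebesgue (slab T)"
  interpret fm: finite_measure "lebesgue_on (slab T)" by (rule finite_measure_lebesgue_on[OF slab_props(3)])
  have mL: "measure (lebesgue_on (slab T)) (slab T) = L"
    using slab_props(4) by (simp add: L_def measure_restrict_space)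
  have L: "(LINT z|lebesgue_on (slab T). c) = c * L" for c :: real
    by (simp add: mL)
  have deficit_facts: "integrable (lebesgue_on (slab T)) (\<lambda>z. 1 - (\<rho>2 z)\<^sup>2)" "integrable (lebesgue_on (slab T)) (\<lambda>z. (\<rho>2 z)\<^sup>2)"
      "deficit T \<rho>2 = L - (LINT z|lebesgue_on (slab T). (\<rho>2 z)\<^sup>2)" "gain_on \<rho>2 (slab T) * L \<ge> (1 / 30000) * (deficit T \<rho>2)\<^sup>2"
      "deficit T \<rho>2 \<le> L"
    if s2: "strict_subsolution T \<rho>\<^sub>0 \<rho>' v' m' U \<rho>2 v2 m2" for \<rho>2 v2 m2
  proof -
    have eb: "ess_bounded (slab T) \<rho>2" using s2 by (simp add: strict_subsolution_def ess_bounded_triple)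
    note si = ess_bounded_imp_square_integrable[OF eb slab_props(3)]
    show i: "integrable (lebesgue_on (slab T)) (\<lambda>z. (\<rho>2 z)\<^sup>2)" using si by (simp add: square_integrable_def)
    then show i1: "integrable (lebesgue_on (slab T)) (\<lambda>z. 1 - (\<rho>2 z)\<^sup>2)" by simp
    show de: "deficit T \<rho>2 = L - (LINT z|lebesgue_on (slab T). (\<rho>2 z)\<^sup>2)" unfolding deficit_def using i L[of 1] by simp
    then show "deficit T \<rho>2 \<le> L" by simp
    define x where "x z = 1 - (\<rho>2 z)\<^sup>2" for z
    have xm: "x \<in> borel_measurable (lebesgue_on (slab T))" unfolding x_def using i1 by blast
    have "AE z in lebesgue_on (slab T). norm (x z) \<le> 1"
      using strict_subsolution_bound(1)[OF s2 mz]
    proof eventually_elim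
      case (elim z)
      then have "(\<rho>2 z)\<^sup>2 \<le> 1" by (simp add: abs_square_le_1)
      then show ?case unfolding x_def using zero_le_power2[of "\<rho>2 z"] by simp
    qed
    then have "square_integrable (slab T) x" by (rule square_integrable_bounded[OF xm slab_props(3)])
    then have ix2: "integrable (lebesgue_on (slab T)) (\<lambda>z. (x z)\<^sup>2)" by (simp add: square_integrable_def)
    have ix: "integrable (lebesgue_on (slab T)) x" using i1 by (simp add: x_def[abs_def])
    define I1 I2 where "I1 = (LINT z|lebesgue_on (slab T). x z)" and "I2 = (LINT z|lebesgue_on (slab T). (x z)\<^sup>2)"
    \<comment> \<open>Cauchy-Schwarz against the constant 1, in the form of a variance: it bounds
      the quadratic gain from below by the squared deficit. Dividing by L leaves the case L = 0
      apart.\<close>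
    have "0 \<le> (LINT z|lebesgue_on (slab T). (L * x z - I1)\<^sup>2)" by simp
    also have "(\<lambda>z. (L * x z - I1)\<^sup>2) = (\<lambda>z. L\<^sup>2 * (x z)\<^sup>2 - 2 * L * I1 * x z + I1\<^sup>2)"
      by (rule ext) (simp add: power2_eq_square algebra_simps)
    also have "(LINT z|lebesgue_on (slab T). L\<^sup>2 * (x z)\<^sup>2 - 2 * L * I1 * x z + I1\<^sup>2) = L\<^sup>2 * I2 - 2 * L * I1 * I1 + I1\<^sup>2 * L"
      using ix ix2 by (simp add: I1_def I2_def mL)
    finally have "0 \<le> L * (L * I2 - I1\<^sup>2)" by (simp add: power2_eq_square algebra_simps)
    moreover have "L \<ge> 0" by (simp add: L_def)
    moreover have "L = 0 \<Longrightarrow> I1 = 0"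
    proof -
      assume "L = 0"
      then have "emeasure lebesgue (slab T) = 0"
        using slab_props(3) by (simp add: L_def emeasure_eq_measure2 fmeasurableD2)
      then have "slab T \<in> null_sets lebesgue" using slab_props(4) by auto
      then have "AE z in lebesgue. z \<notin> slab T" by (rule AE_not_in)
      then have "AE z in lebesgue_on (slab T). x z = 0"
        using slab_props(4) by (subst AE_restrict_space_iff) (auto elim: eventually_mono)
      then have "(LINT z|lebesgue_on (slab T). x z) = (LINT z|lebesgue_on (slab T). 0)" using xm by (intro integral_cong_AE) auto
      then show ?thesis by (simp add: I1_def)
    qed
    ultimately have "I1\<^sup>2 \<le> L * I2" by (cases "L = 0") (auto simp: zero_le_mult_iff)
    then show "gain_on \<rho>2 (slab T) * L \<ge> (1 / 30000) * (deficit T \<rho>2)\<^sup>2"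
      by (simp add: gain_on_def deficit_def I1_def I2_def x_def mult_ac)
  qed
  have Lpos: "L > 0" using big[OF \<open>P \<rho> v m\<close>] \<epsilon> deficit_facts(5)[OF s] by linarith
  \<comment> \<open>Chosen so that 4 \<delta> L = \<epsilon>^2 / 30000. The gain is then at least 4
    \<delta>; the covering and the tolerance cost at most \<delta> each, and the remaining 2
    \<delta> exceed the distance \<delta> of the near-minimiser from the infimum.\<close>
  define \<delta> where "\<delta> = \<epsilon>\<^sup>2 / (120000 * L)"
  have \<delta>: "\<delta> > 0" using \<epsilon> Lpos by (simp add: \<delta>_def)
  have "Inf J < Inf J + \<delta>" using \<delta> by simp
  then obtain j where j: "j \<in> J" "j < Inf J + \<delta>" using cInf_lessD[OF Jne] by blast
  then obtain \<rho>1 v1 m1 where q1: "P \<rho>1 v1 m1" "deficit T \<rho>1 < Inf J + \<delta>" by (auto simp: J_def)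
  have s1: "strict_subsolution T \<rho>\<^sub>0 \<rho>' v' m' U \<rho>1 v1 m1" using q1(1) by (simp add: P_def)
  obtain d where d: "d > 0" "\<forall>g\<in>gs. \<bar>pairing T g \<rho>1 v1 m1 - pairing T g \<rho> v m\<bar> + d \<le> e"
    using finite_uniform_slack[OF gs(1), of "\<lambda>g. \<bar>pairing T g \<rho>1 v1 m1 - pairing T g \<rho> v m\<bar>" e] q1(1) by (auto simp: P_def)
  define e' where "e' = min d \<delta>"
  have e': "e' > 0" using d(1) \<delta> by (simp add: e'_def)
  obtain F where F: "finite F" "\<And>i. i \<in> F \<Longrightarrow> admissible_cball U \<rho>1 v1 m1 (fst i) (snd i)"
      "pairwise (\<lambda>i j. disjnt (cball (fst i) (snd i)) (cball (fst j) (snd j))) F"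
      "(\<Sum>i\<in>F. gain_on \<rho>1 (cball (fst i) (snd i))) \<ge> gain_on \<rho>1 (slab T) - \<delta>"
    by (rule Vitali_finite_subfamily[OF s1 mz \<delta>]) (rule that; assumption)
  from finite_family_step[OF s1 U F(1-3) gs e']
  obtain \<rho>2 v2 m2 where q2: "strict_subsolution T \<rho>\<^sub>0 \<rho>' v' m' U \<rho>2 v2 m2"
     "\<forall>g\<in>gs. \<bar>pairing T g \<rho>2 v2 m2 - pairing T g \<rho>1 v1 m1\<bar> < e'"
     "(LINT z|lebesgue_on (slab T). (\<rho>2 z)\<^sup>2) \<ge> (LINT z|lebesgue_on (slab T). (\<rho>1 z)\<^sup>2) + (\<Sum>i\<in>F. gain_on \<rho>1 (cball (fst i) (snd i))) - e'"
    by blast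
  have "P \<rho>2 v2 m2"
    unfolding P_def
  proof (intro conjI ballI)
    fix g assume g: "g \<in> gs"
    have "\<bar>pairing T g \<rho>2 v2 m2 - pairing T g \<rho>1 v1 m1\<bar> < d" using q2(2) g by (auto simp: e'_def)
    moreover have "\<bar>pairing T g \<rho>1 v1 m1 - pairing T g \<rho> v m\<bar> + d \<le> e" using d(2) g by blast
    ultimately show "\<bar>pairing T g \<rho>2 v2 m2 - pairing T g \<rho> v m\<bar> < e" by linarith
  qed (rule q2(1))
  then have low: "Inf J \<le> deficit T \<rho>2" using Jbd by (intro cInf_lower) (auto simp: J_def)
  have "4 * \<delta> * L = (1 / 30000) * \<epsilon>\<^sup>2" using Lpos by (simp add: \<delta>_def)
  also have "\<dots> \<le> (1 / 30000) * (deficit T \<rho>1)\<^sup>2" using big[OF q1(1)] \<epsilon> by (intro mult_left_mono power_mono) auto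
  also have "\<dots> \<le> gain_on \<rho>1 (slab T) * L" by (rule deficit_facts(4)[OF s1])
  finally have "4 * \<delta> \<le> gain_on \<rho>1 (slab T)" using Lpos by simp
  moreover have "e' \<le> \<delta>" by (simp add: e'_def)
  ultimately have "deficit T \<rho>2 \<le> deficit T \<rho>1 - 2 * \<delta>"
    using q2(3) F(4) deficit_facts(3)[OF s1] deficit_facts(3)[OF q2(1)] by linarith
  then show False using low q1(2) \<delta> by linarith
qed

section \<open>The weak topology\<close>

lemma L2_class_mem: "h \<in> L2_class S f \<longleftrightarrow> square_integrable S f \<and> square_integrable S h \<and> (AE z in lebesgue_on S. f z = h z)"
  by (auto simp: L2_class_def L2_eq_def)

lemma L2_class_eqD:
  assumes "L2_class S f = L2_class S h" "square_integrable S h"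
  shows "square_integrable S f" "AE z in lebesgue_on S. f z = h z"
proof -
  have "h \<in> L2_class S h" using assms(2) by (simp add: L2_class_mem)
  then have "h \<in> L2_class S f" using assms(1) by simp
  then show "square_integrable S f" "AE z in lebesgue_on S. f z = h z" by (simp_all add: L2_class_mem)
qed

lemma L2_class_eqI:
  assumes "square_integrable S f" "square_integrable S h" "AE z in lebesgue_on S. f z = h z"
  shows "L2_class S f = L2_class S h"
proof -
  have "k \<in> L2_class S f \<longleftrightarrow> k \<in> L2_class S h" for k
  proof
    assume "k \<in> L2_class S f"
    then have k: "square_integrable S k" "AE z in lebesgue_on S. f z = k z" by (simp_all add: L2_class_mem)
    have "AE z in lebesgue_on S. h z = k z" using k(2) assms(3) by eventually_elim simp
    then show "k \<in> L2_class S h" using assms k by (simp add: L2_class_mem)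
  next
    assume "k \<in> L2_class S h"
    then have k: "square_integrable S k" "AE z in lebesgue_on S. h z = k z" by (simp_all add: L2_class_mem)
    have "AE z in lebesgue_on S. f z = k z" using k(2) assms(3) by eventually_elim simp
    then show "k \<in> L2_class S f" using assms k by (simp add: L2_class_mem)
  qed
  then show ?thesis by blast
qed

lemma inner_integral_cong:
  assumes "square_integrable S f" "square_integrable S h" "AE z in lebesgue_on S. f z = h z" "square_integrable S g"
  shows "(LINT z|lebesgue_on S. f z \<bullet> g z) = (LINT z|lebesgue_on S. h z \<bullet> g z)"
proof (rule integral_cong_AE)
  show "(\<lambda>z. f z \<bullet> g z) \<in> borel_measurable (lebesgue_on S)" "(\<lambda>z. h z \<bullet> g z) \<in> borel_measurable (lebesgue_on S)"
    using square_integrable_inner[OF assms(1,4)] square_integrable_inner[OF assms(2,4)] by blast+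
  show "AE z in lebesgue_on S. f z \<bullet> g z = h z \<bullet> g z" using assms(3) by eventually_elim simp
qed

text \<open>The subbasic open sets of \<open>weak_L2\<close>.\<close>

definition weak_cylinder where
  "weak_cylinder S g W = L2_class S ` {f. square_integrable S f \<and> (LINT z|lebesgue_on S. f z \<bullet> g z) \<in> W}"

lemma openin_weak_cylinder: "square_integrable S g \<Longrightarrow> open W \<Longrightarrow> openin (weak_L2 S) (weak_cylinder S g W)"
  unfolding weak_L2_def weak_cylinder_def by (rule topology_generated_by_Basis) blast

lemma weak_cylinder_mem:
  assumes f: "square_integrable S f" and g: "square_integrable S g"
  shows "L2_class S f \<in> weak_cylinder S g W \<longleftrightarrow> (LINT z|lebesgue_on S. f z \<bullet> g z) \<in> W"
proof
  assume "L2_class S f \<in> weak_cylinder S g W"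
  then obtain h where h: "square_integrable S h" "(LINT z|lebesgue_on S. h z \<bullet> g z) \<in> W" "L2_class S h = L2_class S f"
    by (auto simp: weak_cylinder_def)
  then show "(LINT z|lebesgue_on S. f z \<bullet> g z) \<in> W"
    using inner_integral_cong[OF h(1) f L2_class_eqD(2)[OF h(3) f] g] by simp
qed (use f in \<open>auto simp: weak_cylinder_def\<close>)

lemma topspace_weak_L2:
  "topspace (weak_L2 S :: ('a::euclidean_space \<Rightarrow> 'b::euclidean_space) set topology) = L2_class S ` {f. square_integrable S f}"
proof
  show "topspace (weak_L2 S :: ('a \<Rightarrow> 'b) set topology) \<subseteq> L2_class S ` {f. square_integrable S f}"
    unfolding weak_L2_def topology_generated_by_topspace by auto
  have "square_integrable S (\<lambda>z :: 'a. 0 :: 'b)" by (simp add: square_integrable_def)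
  from openin_subset[OF openin_weak_cylinder[OF this open_UNIV]]
  show "L2_class S ` {f. square_integrable S f} \<subseteq> topspace (weak_L2 S :: ('a \<Rightarrow> 'b) set topology)" by (simp add: weak_cylinder_def)
qed

text \<open>Induction over the generated topology: finite intersections merge the lists of test
  fields and take the smaller tolerance, unions need only one member. Density can thus be checked
  with finitely many pairings.\<close>

lemma weak_L2_neighbourhood:
  fixes f :: "'a::euclidean_space \<Rightarrow> 'b::euclidean_space"
  assumes W: "openin (weak_L2 S) W" and f: "square_integrable S f" and fW: "L2_class S f \<in> W"
  shows "\<exists>gs e. finite gs \<and> (\<forall>g\<in>gs. square_integrable S g) \<and> e > 0 \<and>
    (\<forall>h. square_integrable S h \<longrightarrow> (\<forall>g\<in>gs. \<bar>(LINT z|lebesgue_on S. h z \<bullet> g z) - (LINT z|lebesgue_on S. f z \<bullet> g z)\<bar> < e) \<longrightarrow> L2_class S h \<in> W)"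
proof -
  have "generate_topology_on {L2_class S ` {f. square_integrable S f \<and> (LINT z|lebesgue_on S. f z \<bullet> g z) \<in> W} | g W.
        square_integrable S g \<and> open W} W"
    using W unfolding weak_L2_def openin_topology_generated_by_iff .
  then show ?thesis
    using fW
  proof (induction rule: generate_topology_on.induct)
    case Empty
    then show ?case by simp
  next
    case (Int A B)
    then obtain gs e gs' e' where 1: "finite gs" "\<forall>g\<in>gs. square_integrable S g" "e > 0"
      "\<forall>h. square_integrable S h \<longrightarrow> (\<forall>g\<in>gs. \<bar>(LINT z|lebesgue_on S. h z \<bullet> g z) - (LINT z|lebesgue_on S. f z \<bullet> g z)\<bar> < e) \<longrightarrow> L2_class S h \<in> A"
      and 2: "finite gs'" "\<forall>g\<in>gs'. square_integrable S g" "e' > 0"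
      "\<forall>h. square_integrable S h \<longrightarrow> (\<forall>g\<in>gs'. \<bar>(LINT z|lebesgue_on S. h z \<bullet> g z) - (LINT z|lebesgue_on S. f z \<bullet> g z)\<bar> < e') \<longrightarrow> L2_class S h \<in> B"
      by auto
    show ?case
      by (intro exI[of _ "gs \<union> gs'"] exI[of _ "min e e'"]) (use 1 2 in auto)
  next
    case (UN K)
    then obtain k where k: "k \<in> K" "L2_class S f \<in> k" by blast
    show ?case using UN.IH[OF k] k(1) by blast
  next
    case (Basis s)
    then obtain g V where g: "square_integrable S g" "open V" "s = weak_cylinder S g V"
      unfolding weak_cylinder_def by blast
    have "(LINT z|lebesgue_on S. f z \<bullet> g z) \<in> V" using Basis.prems unfolding g(3) weak_cylinder_mem[OF f g(1)] .
    then obtain e where e: "e > 0" "ball (LINT z|lebesgue_on S. f z \<bullet> g z) e \<subseteq> V" using g(2) open_contains_ball by blast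
    show ?case
    proof (intro exI[of _ "{g}"] exI[of _ e] conjI allI impI)
      fix h assume h: "square_integrable S h" and
        "\<forall>g\<in>{g}. \<bar>(LINT z|lebesgue_on S. h z \<bullet> g z) - (LINT z|lebesgue_on S. f z \<bullet> g z)\<bar> < e"
      then have "(LINT z|lebesgue_on S. h z \<bullet> g z) \<in> ball (LINT z|lebesgue_on S. f z \<bullet> g z) e"
        by (simp add: dist_real_def abs_minus_commute)
      then show "L2_class S h \<in> s" unfolding g(3) weak_cylinder_mem[OF h g(1)] using e(2) by blast
    qed (use g e in auto)
  qed
qed

text \<open>Finitely many cylinders around the class of f intersect in an open set, which must meet
  X.\<close>

lemma weak_closure_approx:
  fixes f :: "'a::euclidean_space \<Rightarrow> 'b::euclidean_space"
  assumes q: "L2_class S f \<in> weak_L2 S closure_of X" and f: "square_integrable S f"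
    and X: "X \<subseteq> L2_class S ` Y" "\<And>h. h \<in> Y \<Longrightarrow> square_integrable S h"
    and gs: "finite gs" "\<And>g. g \<in> gs \<Longrightarrow> square_integrable S g" and e: "e > 0"
  shows "\<exists>h\<in>Y. \<forall>g\<in>gs. \<bar>(LINT z|lebesgue_on S. h z \<bullet> g z) - (LINT z|lebesgue_on S. f z \<bullet> g z)\<bar> < e"
proof -
  \<comment> \<open>The factor \<open>topspace\<close> gives the correct set for an empty list of
    test fields.\<close>
  define V where "V = topspace (weak_L2 S) \<inter> (\<Inter>g\<in>gs. weak_cylinder S g (ball (LINT z|lebesgue_on S. f z \<bullet> g z) e))"
  have "openin (weak_L2 S) V"
  proof (cases "gs = {}")
    case False
    then show ?thesis unfolding V_def
      by (intro openin_Int openin_topspace openin_INT2 gs(1) False openin_weak_cylinder gs(2) open_ball)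
  qed (simp add: V_def)
  moreover have "L2_class S f \<in> V"
    unfolding V_def
  proof (intro IntI INT_I)
    show "L2_class S f \<in> topspace (weak_L2 S)" using f by (simp add: topspace_weak_L2)
    fix g assume g: "g \<in> gs"
    show "L2_class S f \<in> weak_cylinder S g (ball (LINT z|lebesgue_on S. f z \<bullet> g z) e)"
      unfolding weak_cylinder_mem[OF f gs(2)[OF g]] using e by simp
  qed
  ultimately obtain y where y: "y \<in> X" "y \<in> V" using q by (auto simp: in_closure_of)
  then obtain h where h: "h \<in> Y" "y = L2_class S h" using X(1) by blast
  show ?thesis
  proof (rule bexI[OF _ h(1)], intro ballI)
    fix g assume g: "g \<in> gs"
    then have "L2_class S h \<in> weak_cylinder S g (ball (LINT z|lebesgue_on S. f z \<bullet> g z) e)" using y(2) h(2) by (simp add: V_def)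
    then show "\<bar>(LINT z|lebesgue_on S. h z \<bullet> g z) - (LINT z|lebesgue_on S. f z \<bullet> g z)\<bar> < e"
      using weak_cylinder_mem[OF X(2)[OF h(1)] gs(2)[OF g]] by (simp add: dist_real_def abs_minus_commute)
  qed
qed

lemma subsolution_space_0_eq:
  "subsolution_space_0 unit_square T \<rho>\<^sub>0 \<rho>' v' m' U =
     L2_class (slab T) ` {h. \<exists>\<rho> v m. h = (\<lambda>z. (\<rho> z, v z, m z)) \<and> strict_subsolution T \<rho>\<^sub>0 \<rho>' v' m' U \<rho> v m}"
  unfolding subsolution_space_0_def strict_subsolution_def by blast

lemma strict_subsolution_square_integrable:
  "strict_subsolution T \<rho>\<^sub>0 \<rho>' v' m' U \<rho> v m \<Longrightarrow> square_integrable (slab T) (\<lambda>z. (\<rho> z, v z, m z))"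
  unfolding strict_subsolution_def by (rule ess_bounded_imp_square_integrable[OF _ slab_props(3)]) blast

lemma subsolution_space_approx:
  assumes q: "L2_class (slab T) (\<lambda>z. (\<rho> z, v z, m z)) \<in> topspace (subsolution_space unit_square T \<rho>\<^sub>0 \<rho>' v' m' U)"
    and f: "square_integrable (slab T) (\<lambda>z. (\<rho> z, v z, m z))"
    and gs: "finite gs" "\<And>g. g \<in> gs \<Longrightarrow> square_integrable (slab T) g" and e: "e > 0"
  obtains r w n where "strict_subsolution T \<rho>\<^sub>0 \<rho>' v' m' U r w n"
    "\<And>g. g \<in> gs \<Longrightarrow> \<bar>pairing T g r w n - pairing T g \<rho> v m\<bar> < e"
proof -
  have "L2_class (slab T) (\<lambda>z. (\<rho> z, v z, m z)) \<in> weak_L2 (slab T) closure_of subsolution_space_0 unit_square T \<rho>\<^sub>0 \<rho>' v' m' U"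
    using q by (simp add: subsolution_space_def topspace_subtopology)
  from weak_closure_approx[OF this f equalityD1[OF subsolution_space_0_eq] _ gs e]
  obtain h where h: "h \<in> {h. \<exists>\<rho> v m. h = (\<lambda>z. (\<rho> z, v z, m z)) \<and> strict_subsolution T \<rho>\<^sub>0 \<rho>' v' m' U \<rho> v m}"
    "\<forall>g\<in>gs. \<bar>(LINT z|lebesgue_on (slab T). h z \<bullet> g z) - (LINT z|lebesgue_on (slab T). (\<rho> z, v z, m z) \<bullet> g z)\<bar> < e"
    using strict_subsolution_square_integrable by blast
  then obtain r w n where hn: "h = (\<lambda>z. (r z, w z, n z))" "strict_subsolution T \<rho>\<^sub>0 \<rho>' v' m' U r w n" by blast
  show ?thesis
    by (rule that[OF hn(2)]) (use h(2) in \<open>simp add: pairing_def hn(1)\<close>)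
qed

text \<open>Lower semicontinuity of a convex functional: expanding the square of h - f bounds the
  integral of h^2 from below by twice that of h f minus that of f^2, which is weakly continuous in h
  and exact at h = f.\<close>

lemma openin_large_density:
  "openin (weak_L2 (slab T)) (L2_class (slab T) ` {f :: _ \<Rightarrow> real \<times> (real^2) \<times> (real^2). square_integrable (slab T) f \<and> (LINT z|lebesgue_on (slab T). (fst (f z))\<^sup>2) > c})"
  (is "openin _ (L2_class _ ` ?A)")
proof (subst openin_subopen, intro ballI)
  fix q assume "q \<in> L2_class (slab T) ` ?A"
  then obtain f where q: "q = L2_class (slab T) f" and f: "square_integrable (slab T) f" and c: "(LINT z|lebesgue_on (slab T). (fst (f z))\<^sup>2) > c"
    by blast
  have fst_si: "square_integrable (slab T) (\<lambda>z. fst (h z))" if "square_integrable (slab T) h" for h :: "_ \<Rightarrow> real \<times> (real^2) \<times> (real^2)"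
    using that square_integrable_triple[of "slab T" "\<lambda>z. fst (h z)" "\<lambda>z. fst (snd (h z))" "\<lambda>z. snd (snd (h z))"] by simp
  define g where "g z = (fst (f z), 0 :: real^2, 0 :: real^2)" for z
  have g: "square_integrable (slab T) g"
    unfolding g_def square_integrable_triple using fst_si[OF f] by (simp add: square_integrable_def)
  define c0 where "c0 = (LINT z|lebesgue_on (slab T). (fst (f z))\<^sup>2)"
  have hg: "h z \<bullet> g z = fst (h z) * fst (f z)" for h :: "_ \<Rightarrow> real \<times> (real^2) \<times> (real^2)" and z
    by (cases "h z") (simp add: g_def inner_prod_def)
  \<comment> \<open>The midpoint threshold satisfies 2 (c + c0)/2 - c0 = c.\<close>
  have "L2_class (slab T) f \<in> weak_cylinder (slab T) g {(c + c0) / 2<..}"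
    unfolding weak_cylinder_mem[OF f g] hg using c by (simp add: c0_def power2_eq_square)
  moreover have "weak_cylinder (slab T) g {(c + c0) / 2<..} \<subseteq> L2_class (slab T) ` ?A"
  proof
    fix p assume "p \<in> weak_cylinder (slab T) g {(c + c0) / 2<..}"
    then obtain h where p: "p = L2_class (slab T) h" and h: "square_integrable (slab T) h" and "(LINT z|lebesgue_on (slab T). h z \<bullet> g z) > (c + c0) / 2"
      by (auto simp: weak_cylinder_def)
    then have big: "(LINT z|lebesgue_on (slab T). fst (h z) * fst (f z)) > (c + c0) / 2" by (simp add: hg)
    have i: "integrable (lebesgue_on (slab T)) (\<lambda>z. fst (h z) * fst (h z))" "integrable (lebesgue_on (slab T)) (\<lambda>z. fst (h z) * fst (f z))"
      "integrable (lebesgue_on (slab T)) (\<lambda>z. fst (f z) * fst (f z))"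
      using square_integrable_inner[OF fst_si[OF h] fst_si[OF h]] square_integrable_inner[OF fst_si[OF h] fst_si[OF f]]
        square_integrable_inner[OF fst_si[OF f] fst_si[OF f]] by simp_all
    have "0 \<le> (LINT z|lebesgue_on (slab T). (fst (h z) - fst (f z))\<^sup>2)" by simp
    also have "(\<lambda>z. (fst (h z) - fst (f z))\<^sup>2) = (\<lambda>z. fst (h z) * fst (h z) - 2 * (fst (h z) * fst (f z)) + fst (f z) * fst (f z))"
      by (rule ext) (simp add: power2_eq_square algebra_simps)
    also have "(LINT z|lebesgue_on (slab T). fst (h z) * fst (h z) - 2 * (fst (h z) * fst (f z)) + fst (f z) * fst (f z)) =
       (LINT z|lebesgue_on (slab T). fst (h z) * fst (h z)) - 2 * (LINT z|lebesgue_on (slab T). fst (h z) * fst (f z)) + c0"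
      using i by (simp add: c0_def power2_eq_square)
    finally have "c < (LINT z|lebesgue_on (slab T). (fst (h z))\<^sup>2)" using big by (simp add: power2_eq_square)
    then show "p \<in> L2_class (slab T) ` ?A" using p h by blast
  qed
  ultimately show "\<exists>W. openin (weak_L2 (slab T)) W \<and> q \<in> W \<and> W \<subseteq> L2_class (slab T) ` ?A"
    unfolding q using openin_weak_cylinder[OF g open_greaterThan] by blast
qed

text \<open>Continuous functions on a compact set are separable in the uniform norm, and so is every
  subfamily, with a dense sequence taken from the family itself. It is applied to perpendicular
  gradients of test functions, whose approximants must again be test functions.\<close>

lemma countable_uniformly_dense:
  fixes f :: "'i \<Rightarrow> 'a::euclidean_space \<Rightarrow> 'b::euclidean_space"
  assumes K: "compact K" and f: "\<And>i. i \<in> I \<Longrightarrow> continuous_on K (f i)"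
  obtains C where "countable C" "C \<subseteq> I" "\<And>i e. i \<in> I \<Longrightarrow> e > 0 \<Longrightarrow> \<exists>j\<in>C. \<forall>x\<in>K. norm (f i x - f j x) < e"
proof -
  obtain D :: "'b set" where D: "countable D" "\<And>X. open X \<Longrightarrow> X \<noteq> {} \<Longrightarrow> \<exists>d\<in>D. d \<in> X"
    using countable_dense_setE by metis
  have "\<forall>m::nat. \<exists>k. finite k \<and> k \<subseteq> K \<and> K \<subseteq> (\<Union>x\<in>k. ball x (1 / real (Suc m)))"
  proof
    fix m :: nat
    have "0 < 1 / real (Suc m)" by simp
    then show "\<exists>k. finite k \<and> k \<subseteq> K \<and> K \<subseteq> (\<Union>x\<in>k. ball x (1 / real (Suc m)))"
      using seq_compact_imp_totally_bounded[OF compact_imp_seq_compact[OF K]] by blast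
  qed
  then obtain net where net: "\<And>m. finite (net m)" "\<And>m. net m \<subseteq> K" "\<And>m. K \<subseteq> (\<Union>x\<in>net m. ball x (1 / real (Suc m)))"
    by metis
  \<comment> \<open>The code (n, m, p) records a modulus of continuity of \<open>f i\<close> at
    accuracy 1/(n+1) and its values on a finite net, rounded to the countable set D. There are
    countably many codes, functions with a common code are uniformly close, and one index is chosen
    per code.\<close>
  define good where "good n m p i \<longleftrightarrow> i \<in> I \<and> (\<forall>x\<in>K. \<forall>y\<in>K. dist x y < 1 / real (Suc m) \<longrightarrow> dist (f i x) (f i y) < 1 / real (Suc n)) \<and>
     (\<forall>y\<in>net m. dist (f i y) (p y) < 1 / real (Suc n))" for n m :: nat and p and i
  define ch where "ch = (\<lambda>(n, m, p). SOME i. good n m p i)"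
  define Q where "Q = {(n, m, p) | n m p. p \<in> PiE (net m) (\<lambda>_. D) \<and> (\<exists>i. good n m p i)}"
  have "Q \<subseteq> (\<Union>n. \<Union>m. (\<lambda>p. (n, m, p)) ` PiE (net m) (\<lambda>_. D))" by (auto simp: Q_def)
  moreover have "countable (\<Union>n. \<Union>m. (\<lambda>p. (n :: nat, m, p)) ` PiE (net m) (\<lambda>_. D))"
    using net(1) D(1) by (intro countable_UN countable_image countable_PiE) auto
  ultimately have cQ: "countable Q" using countable_subset by blast
  have chg: "good n m p (ch (n, m, p))" if "(n, m, p) \<in> Q" for n m p
  proof -
    have "\<exists>i. good n m p i" using that by (auto simp: Q_def)
    then show ?thesis unfolding ch_def by (simp add: someI_ex)
  qed
  show ?thesis
  proof (rule that[of "ch ` Q"])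
    show "countable (ch ` Q)" using cQ by simp
    show "ch ` Q \<subseteq> I"
    proof
      fix j assume "j \<in> ch ` Q"
      then obtain n m p where "(n, m, p) \<in> Q" "j = ch (n, m, p)" by auto
      then show "j \<in> I" using chg by (simp add: good_def)
    qed
    fix i and e :: real assume i: "i \<in> I" and e: "e > 0"
    \<comment> \<open>A quarter of e: the final triangle inequality has four terms.\<close>
    obtain n where n: "1 / real (Suc n) < e / 4" using e nat_approx_posE[of "e / 4"] by auto
    have np: "0 < 1 / real (Suc n)" by simp
    have "uniformly_continuous_on K (f i)" by (rule compact_uniformly_continuous[OF f[OF i] K])
    then obtain d where d: "d > 0" "\<And>x y. x \<in> K \<Longrightarrow> y \<in> K \<Longrightarrow> dist x y < d \<Longrightarrow> dist (f i x) (f i y) < 1 / real (Suc n)"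
      unfolding uniformly_continuous_on_def using np by (metis dist_commute)
    obtain m where m: "1 / real (Suc m) < d" using d(1) nat_approx_posE by blast
    have "\<forall>y. \<exists>b\<in>D. dist (f i y) b < 1 / real (Suc n)"
    proof
      fix y
      have "ball (f i y) (1 / real (Suc n)) \<noteq> {}" using np by simp
      from D(2)[OF open_ball this] show "\<exists>b\<in>D. dist (f i y) b < 1 / real (Suc n)" by simp
    qed
    then obtain p0 where p0: "\<And>y. p0 y \<in> D" "\<And>y. dist (f i y) (p0 y) < 1 / real (Suc n)" by metis
    define p where "p = restrict p0 (net m)"
    have "good n m p i"
      unfolding good_def using i d(2) m p0(2) by (auto simp: p_def)
    moreover have "p \<in> PiE (net m) (\<lambda>_. D)" using p0(1) by (auto simp: p_def)
    ultimately have Q: "(n, m, p) \<in> Q" by (auto simp: Q_def)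
    define j where "j = ch (n, m, p)"
    have gj: "good n m p j" unfolding j_def by (rule chg[OF Q])
    have gi: "good n m p i" by fact
    show "\<exists>j\<in>ch ` Q. \<forall>x\<in>K. norm (f i x - f j x) < e"
    proof (rule bexI[of _ j], intro ballI)
      fix x assume x: "x \<in> K"
      then obtain y where y: "y \<in> net m" "dist x y < 1 / real (Suc m)" using net(3)[of m] by (auto simp: dist_commute)
      have yK: "y \<in> K" using y(1) net(2) by blast
      have "dist (f i x) (f i y) < 1 / real (Suc n)" "dist (f j x) (f j y) < 1 / real (Suc n)"
        "dist (f i y) (p y) < 1 / real (Suc n)" "dist (f j y) (p y) < 1 / real (Suc n)"
        using gi gj x yK y unfolding good_def by blast+
      moreover have "dist (f i x) (f j x) \<le> dist (f i x) (f i y) + dist (f i y) (p y) + dist (f j y) (p y) + dist (f j x) (f j y)"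
        using dist_triangle[of "f i x" "f j x" "f i y"] dist_triangle[of "f i y" "f j x" "p y"] dist_triangle[of "p y" "f j x" "f j y"]
        by (simp add: dist_commute)
      ultimately have "dist (f i x) (f j x) < e" using n by linarith
      then show "norm (f i x - f j x) < e" by (simp add: dist_norm)
    qed (use Q in \<open>auto simp: j_def\<close>)
  qed
qed

section \<open>Limits with maximal density\<close>

lemma real2_measurableI:
  "(\<lambda>x. (v x :: real^2) $ 1) \<in> borel_measurable M \<Longrightarrow> (\<lambda>x. v x $ 2) \<in> borel_measurable M \<Longrightarrow> v \<in> borel_measurable M"
proof -
  assume a: "(\<lambda>x. v x $ 1) \<in> borel_measurable M" "(\<lambda>x. v x $ 2) \<in> borel_measurable M"
  have "v = (\<lambda>x. v x $ 1 *\<^sub>R axis 1 1 + v x $ 2 *\<^sub>R axis 2 1)"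
    by (simp add: fun_eq_iff vec_eq_iff forall_2 axis_def)
  also have "\<dots> \<in> borel_measurable M" using a by (intro borel_measurable_add borel_measurable_scaleR) auto
  finally show ?thesis .
qed

lemma indicator_snd_measurable:
  assumes "I \<in> sets borel"
  shows "(\<lambda>z :: (real^2) \<times> real. indicator I (snd z) :: real) \<in> borel_measurable (lebesgue_on S)"
proof (rule borel_measurable_lebesgue_on_borel)
  have "(snd :: (real^2) \<times> real \<Rightarrow> real) \<in> borel_measurable borel"
    by (intro borel_measurable_continuous_onI continuous_intros)
  from measurable_compose[OF this borel_measurable_indicator[OF assms]]
  show "(\<lambda>z :: (real^2) \<times> real. indicator I (snd z) :: real) \<in> borel_measurable borel" .
qed

text \<open>\<open>velocity_bound\<close> at almost every time, integrated over the times in I. The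
  freedom in I keeps the estimate local in time while it can still be tested by pairings.\<close>

lemma slab_velocity_bound:
  assumes eb: "ess_bounded (slab T) (\<lambda>z. (\<rho> z, v z, m z))" and ls: "linear_system unit_square T \<rho>\<^sub>0 \<rho> v m"
    and I: "I \<in> sets borel"
  shows "(LINT z|lebesgue_on (slab T). indicator I (snd z) * (norm (v z))\<^sup>2) \<le> (LINT z|lebesgue_on (slab T). indicator I (snd z) * (\<rho> z)\<^sup>2)"
proof -
  have eb': "ess_bounded (slab T) \<rho>" "ess_bounded (slab T) v" using eb by (simp_all add: ess_bounded_triple)
  then obtain C D where C: "AE z in lebesgue_on (slab T). norm (v z) \<le> C" and D: "AE z in lebesgue_on (slab T). norm (\<rho> z) \<le> D"
    by (auto simp: ess_bounded_def)
  define M where "M = max C D"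
  have vm: "v \<in> borel_measurable (lebesgue_on (slab T))" and \<rho>m: "\<rho> \<in> borel_measurable (lebesgue_on (slab T))"
    using eb' by (simp_all add: ess_bounded_def)
  have ib: "integrable (lebesgue_on (slab T)) (\<lambda>z. indicator I (snd z) * h z)" if h: "integrable (lebesgue_on (slab T)) h" for h :: "_ \<Rightarrow> real"
  proof (rule Bochner_Integration.integrable_bound[OF h])
    show "(\<lambda>z. indicator I (snd z) * h z) \<in> borel_measurable (lebesgue_on (slab T))"
      using indicator_snd_measurable[OF I] borel_measurable_integrable[OF h] by (rule borel_measurable_times)
  qed (auto simp: indicator_def)
  have iv: "integrable (lebesgue_on (slab T)) (\<lambda>z. (norm (v z))\<^sup>2)" and i\<rho>: "integrable (lebesgue_on (slab T)) (\<lambda>z. (\<rho> z)\<^sup>2)"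
    using ess_bounded_imp_square_integrable[OF eb'(2) slab_props(3)] ess_bounded_imp_square_integrable[OF eb'(1) slab_props(3)]
    by (simp_all add: square_integrable_def)
  have B: "{0<..<T} \<in> sets borel" by simp
  note sl = slab_props(6) B
  note fv = fubini_lebesgue_on[OF ib[OF iv] sl] and f\<rho> = fubini_lebesgue_on[OF ib[OF i\<rho>] sl]
  have "AE t in lebesgue_on {0<..<T}. (LINT x|lebesgue_on unit_square. indicator I (snd (x, t)) * (norm (v (x, t)))\<^sup>2)
      \<le> (LINT x|lebesgue_on unit_square. indicator I (snd (x, t)) * (\<rho> (x, t))\<^sup>2)"
  proof -
    have ls2: "AE t in lebesgue_on {0<..<T}. \<forall>\<psi>. smooth \<psi> \<longrightarrow> (LINT x|lebesgue_on unit_square. v (x, t) \<bullet> gradient \<psi> x) = 0"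
      and ls3: "AE t in lebesgue_on {0<..<T}. \<forall>\<psi>\<in>test_functions unit_square.
        (LINT x|lebesgue_on unit_square. (v (x, t) + vector [0, \<rho> (x, t)]) \<bullet> perp_gradient \<psi> x) = 0"
      using ls unfolding linear_system_def by blast+
    show ?thesis
      using ls2 ls3 measurable_lebesgue_on_slice[OF vec_component_measurable[OF vm, of 1] sl]
        measurable_lebesgue_on_slice[OF vec_component_measurable[OF vm, of 2] sl]
        measurable_lebesgue_on_slice[OF \<rho>m sl] AE_lebesgue_on_slice[OF C sl] AE_lebesgue_on_slice[OF D sl]
    proof eventually_elim
      case (elim t)
      have "AE x in lebesgue_on unit_square. norm (v (x, t)) \<le> M" using elim(6) by eventually_elim (simp add: M_def)
      moreover have "AE x in lebesgue_on unit_square. \<bar>\<rho> (x, t)\<bar> \<le> M" using elim(7) by eventually_elim (simp add: M_def)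
      ultimately have "(LINT x|lebesgue_on unit_square. (norm (v (x, t)))\<^sup>2) \<le> (LINT x|lebesgue_on unit_square. (\<rho> (x, t))\<^sup>2)"
        using elim(1,2) real2_measurableI[OF elim(3,4)] elim(5) by (intro velocity_bound[of "\<lambda>x. v (x, t)" M "\<lambda>x. \<rho> (x, t)"]) blast+
      then show ?case by (cases "t \<in> I") simp_all
    qed
  qed
  from integral_mono_AE[OF fv(2) f\<rho>(2) this] show ?thesis unfolding fv(3) f\<rho>(3) .
qed

text \<open>The vector (0, 1 - \<rho>^2)/2 in the hull condition has norm (1 - \<rho>^2)/2, as large
  as the right-hand side; removing it by the triangle inequality doubles the bound.\<close>

lemma strict_subsolution_flux_bound:
  assumes s: "strict_subsolution T \<rho>\<^sub>0 \<rho>' v' m' U \<rho> v m" and mz: "mixing_zone unit_square T \<rho>' v' m' U"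
    and hull: "AE z in lebesgue_on (slab T). hull_gap (\<rho>' z) (v' z) (m' z) \<le> (1 - (\<rho>' z)\<^sup>2) / 2"
  shows "AE z in lebesgue_on (slab T). norm (m z - \<rho> z *\<^sub>R v z) \<le> 1 - (\<rho> z)\<^sup>2"
proof -
  have U: "open U" "U \<subseteq> slab T" using mz by (simp_all add: mixing_zone_def)
  have D: "slab T - U \<in> sets lebesgue" using slab_props(4) U(1) by auto
  have "AE z in lebesgue_on (slab T - U). (\<rho> z, v z, m z) = (\<rho>' z, v' z, m' z)" using s by (simp add: strict_subsolution_def)
  then have "AE z in lborel. z \<in> slab T - U \<longrightarrow> (\<rho> z, v z, m z) = (\<rho>' z, v' z, m' z)" unfolding AE_lebesgue_on_iff[OF D] .
  moreover have "AE z in lborel. z \<in> slab T \<longrightarrow> hull_gap (\<rho>' z) (v' z) (m' z) \<le> (1 - (\<rho>' z)\<^sup>2) / 2"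
    using hull unfolding AE_lebesgue_on_iff[OF slab_props(4)] .
  ultimately have "AE z in lborel. z \<in> slab T \<longrightarrow> norm (m z - \<rho> z *\<^sub>R v z) \<le> 1 - (\<rho> z)\<^sup>2"
  proof eventually_elim
    case (elim z)
    show ?case
    proof
      assume z: "z \<in> slab T"
      have g: "hull_gap (\<rho> z) (v z) (m z) \<le> (1 - (\<rho> z)\<^sup>2) / 2"
      proof (cases "z \<in> U")
        case True
        then have "hull_gap (\<rho> z) (v z) (m z) < (1 - (\<rho> z)\<^sup>2) / 2" using s unfolding strict_subsolution_def strict_on_def by blast
        then show ?thesis by simp
      next
        case False
        then have "\<rho> z = \<rho>' z" "v z = v' z" "m z = m' z" using elim(1) z by blast+
        then show ?thesis using elim(2) z by simp
      qed
      have "0 \<le> hull_gap (\<rho> z) (v z) (m z)" by (simp add: hull_gap_def)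
      then have "0 \<le> (1 - (\<rho> z)\<^sup>2) / 2" using g by (rule order_trans)
      then have y: "0 \<le> 1 - (\<rho> z)\<^sup>2" by (rule iffD1[OF zero_le_divide_iff, THEN disjE]) auto
      define k where "k = (1/2) *\<^sub>R (vector [0, 1 - (\<rho> z)\<^sup>2] :: real^2)"
      have "(vector [0, 1 - (\<rho> z)\<^sup>2] :: real^2) = (1 - (\<rho> z)\<^sup>2) *\<^sub>R axis 2 1" by (simp add: vector_real2_eq)
      then have k: "norm k = (1 - (\<rho> z)\<^sup>2) / 2" using y by (simp add: k_def norm_axis_1)
      have "norm (m z - \<rho> z *\<^sub>R v z) = norm ((m z - \<rho> z *\<^sub>R v z + k) - k)" by simp
      also have "\<dots> \<le> norm (m z - \<rho> z *\<^sub>R v z + k) + norm k" by (rule norm_triangle_ineq4)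
      also have "norm (m z - \<rho> z *\<^sub>R v z + k) = hull_gap (\<rho> z) (v z) (m z)" by (simp add: hull_gap_def k_def)
      also have "hull_gap (\<rho> z) (v z) (m z) + norm k \<le> (1 - (\<rho> z)\<^sup>2) / 2 + (1 - (\<rho> z)\<^sup>2) / 2"
        by (rule add_mono[OF g eq_refl[OF k]])
      also have "\<dots> = 1 - (\<rho> z)\<^sup>2" by (rule field_sum_of_halves)
      finally show "norm (m z - \<rho> z *\<^sub>R v z) \<le> 1 - (\<rho> z)\<^sup>2" .
    qed
  qed
  then show ?thesis unfolding AE_lebesgue_on_iff[OF slab_props(4)] .
qed

lemma square_integrable_continuous_slab:
  fixes h :: "(real^2) \<times> real \<Rightarrow> 'b::euclidean_space"
  assumes "continuous_on UNIV h"
  shows "square_integrable (slab T) h"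
proof -
  have "bounded (h ` closure (slab T))"
    using assms slab_props(2) by (intro compact_imp_bounded compact_continuous_image) (auto intro: continuous_on_subset)
  then obtain C where C: "\<forall>z\<in>closure (slab T). norm (h z) \<le> C" by (auto simp: bounded_iff)
  show ?thesis
  proof (rule square_integrable_bounded[OF _ slab_props(3)])
    show "h \<in> borel_measurable (lebesgue_on (slab T))"
      by (intro borel_measurable_lebesgue_on_borel borel_measurable_continuous_onI assms)
    show "AE z in lebesgue_on (slab T). norm (h z) \<le> C"
    proof (rule AE_I2)
      fix z assume "z \<in> space (lebesgue_on (slab T))"
      then have "z \<in> slab T" by (simp add: space_restrict_space)
      then have "z \<in> closure (slab T)" by (rule subsetD[OF closure_subset])
      then show "norm (h z) \<le> C" using C by blast
    qed
  qed
qed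

lemma square_integrable_0: "square_integrable S (\<lambda>z. 0)"
  by (simp add: square_integrable_def)

lemma square_integrable_mult_bounded:
  assumes b: "b \<in> borel_measurable (lebesgue_on S)" "AE z in lebesgue_on S. \<bar>b z\<bar> \<le> 1" and h: "square_integrable S h"
  shows "square_integrable S (\<lambda>z. b z *\<^sub>R h z)"
proof -
  have m: "(\<lambda>z. b z *\<^sub>R h z) \<in> borel_measurable (lebesgue_on S)" using b h by (auto simp: square_integrable_def)
  have "integrable (lebesgue_on S) (\<lambda>z. (norm (b z *\<^sub>R h z))\<^sup>2)"
  proof (rule Bochner_Integration.integrable_bound)
    show "integrable (lebesgue_on S) (\<lambda>z. (norm (h z))\<^sup>2)" using h by (simp add: square_integrable_def)
    show "AE z in lebesgue_on S. norm ((norm (b z *\<^sub>R h z))\<^sup>2) \<le> norm ((norm (h z))\<^sup>2)"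
      using b(2)
    proof eventually_elim
      case (elim z)
      then have "norm (b z *\<^sub>R h z) \<le> norm (h z)" by (simp add: mult_left_le_one_le)
      then have "(norm (b z *\<^sub>R h z))\<^sup>2 \<le> (norm (h z))\<^sup>2" by (intro power_mono) auto
      then show ?case by simp
    qed
    show "(\<lambda>z. (norm (b z *\<^sub>R h z))\<^sup>2) \<in> borel_measurable (lebesgue_on S)"
      by (rule borel_measurable_power[OF measurable_compose[OF m borel_measurable_norm]])
  qed
  with m show ?thesis by (simp only: square_integrable_def)
qed

lemma square_integrable_diff:
  assumes "square_integrable S f" "square_integrable S g"
  shows "square_integrable S (\<lambda>z. f z - g z)"
proof -
  have m: "(\<lambda>z. f z - g z) \<in> borel_measurable (lebesgue_on S)" using assms by (auto simp: square_integrable_def)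
  have "(norm (f z - g z))\<^sup>2 = (norm (f z))\<^sup>2 - 2 * (f z \<bullet> g z) + (norm (g z))\<^sup>2" for z
    by (simp add: power2_norm_eq_inner inner_diff inner_commute)
  then have "integrable (lebesgue_on S) (\<lambda>z. (norm (f z - g z))\<^sup>2)"
    using assms square_integrable_inner[OF assms] by (simp add: square_integrable_def)
  with m show ?thesis by (simp add: square_integrable_def)
qed

text \<open>An element of X in the residual set through an arbitrary representative. Only square
  integrability is assumed of the triple; \<open>full\<close> is all that the residual set
  contributes.\<close>

locale limit_subsolution =
  fixes T :: real and \<rho>\<^sub>0 \<rho>' v' m' U \<rho> v m
  assumes mz: "mixing_zone unit_square T \<rho>' v' m' U"
    and hull: "AE z in lebesgue_on (slab T). hull_gap (\<rho>' z) (v' z) (m' z) \<le> (1 - (\<rho>' z)\<^sup>2) / 2"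
    and sq: "square_integrable (slab T) (\<lambda>z. (\<rho> z, v z, m z))"
    and lim: "L2_class (slab T) (\<lambda>z. (\<rho> z, v z, m z)) \<in> topspace (subsolution_space unit_square T \<rho>\<^sub>0 \<rho>' v' m' U)"
    and full: "(LINT z|lebesgue_on (slab T). (\<rho> z)\<^sup>2) \<ge> measure lebesgue (slab T)"
begin

abbreviation "D \<equiv> lebesgue_on (slab T)"
abbreviation "near r w n \<equiv> strict_subsolution T \<rho>\<^sub>0 \<rho>' v' m' U r w n"

definition "L = measure lebesgue (slab T)"

lemma sq': "square_integrable (slab T) \<rho>" "square_integrable (slab T) v" "square_integrable (slab T) m"
  using sq by (simp_all add: square_integrable_triple)

lemma near_sq:
  assumes "near r w n"
  shows "square_integrable (slab T) r" "square_integrable (slab T) w" "square_integrable (slab T) n"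
  using strict_subsolution_square_integrable[OF assms] by (simp_all add: square_integrable_triple)

text \<open>Affine upper bounds that hold on \<open>X\<^sub>0\<close> survive on its weak
  closure.\<close>

lemma pairing_le:
  assumes g: "square_integrable (slab T) g" and le: "\<And>r w n. near r w n \<Longrightarrow> pairing T g r w n \<le> c"
  shows "pairing T g \<rho> v m \<le> c"
proof (rule field_le_epsilon)
  fix e :: real assume e: "e > 0"
  obtain r w n where q: "near r w n" "\<And>h. h \<in> {g} \<Longrightarrow> \<bar>pairing T h r w n - pairing T h \<rho> v m\<bar> < e"
    by (rule subsolution_space_approx[OF lim sq, of "{g}" e]) (use g e in auto)
  show "pairing T g \<rho> v m \<le> c + e" using q(2)[of g] le[OF q(1)] by auto
qed

lemma pairing_eq:
  assumes g: "square_integrable (slab T) g" and eq: "\<And>r w n. near r w n \<Longrightarrow> pairing T g r w n = c"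
  shows "pairing T g \<rho> v m = c"
proof (rule antisym)
  show "pairing T g \<rho> v m \<le> c" using pairing_le[OF g, of c] eq by simp
  have neg: "pairing T (\<lambda>z. - g z) r w n = - pairing T g r w n" for r w n by (simp add: pairing_def)
  have "square_integrable (slab T) (\<lambda>z. - g z)" using g by (simp add: square_integrable_def)
  from pairing_le[OF this, of "- c"] show "c \<le> pairing T g \<rho> v m" using eq by (simp add: neg)
qed

lemma pairing_density: "pairing T (\<lambda>z. (h z, 0, 0)) r w n = (LINT z|D. r z * h z)"
  by (simp add: pairing_def inner_prod_def)

lemma pairing_velocity: "pairing T (\<lambda>z. (0, h z, 0)) r w n = (LINT z|D. w z \<bullet> h z)"
  by (simp add: pairing_def inner_prod_def)

lemma pairing_flux: "pairing T (\<lambda>z. (0, 0, h z)) r w n = (LINT z|D. n z \<bullet> h z)"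
  by (simp add: pairing_def inner_prod_def)

text \<open>Testing with s times the indicator of the set where s \<rho> > 1 compares the integral
  of s \<rho> over this set with its measure. The bound inherited from \<open>X\<^sub>0\<close>
  leaves only a null set.\<close>

lemma one_sided_bound:
  assumes s: "\<bar>s\<bar> = 1"
  shows "AE z in D. s * \<rho> z \<le> 1"
proof -
  \<comment> \<open>The test field depends on the limit density itself, which is legitimate because
    the limit is fixed before approximants are chosen.\<close>
  define E where "E z = (if s * \<rho> z > 1 then 1 else 0 :: real)" for z
  have \<rho>m: "\<rho> \<in> borel_measurable D" using sq'(1) by (simp add: square_integrable_def)
  have Em: "E \<in> borel_measurable D" unfolding E_def using \<rho>m by measurable
  have E1: "AE z in D. \<bar>E z\<bar> \<le> 1" by (intro AE_I2) (simp add: E_def)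
  have Es: "square_integrable (slab T) E"
    by (rule square_integrable_bounded[OF Em slab_props(3)]) (use E1 in simp)
  have sEs: "square_integrable (slab T) (\<lambda>z. s * E z)"
  proof (rule square_integrable_bounded[OF _ slab_props(3)])
    show "(\<lambda>z. s * E z) \<in> borel_measurable D" by (rule borel_measurable_times[OF borel_measurable_const Em])
    show "AE z in D. norm (s * E z) \<le> 1" using E1 by eventually_elim (simp add: abs_mult s)
  qed
  have g: "square_integrable (slab T) (\<lambda>z. (s * E z, 0 :: real^2, 0 :: real^2))"
    using sEs by (simp add: square_integrable_triple square_integrable_0)
  have iE: "integrable D E" by (rule square_integrable_imp_integrable[OF Es slab_props(3)])
  have "pairing T (\<lambda>z. (s * E z, 0, 0)) \<rho> v m \<le> (LINT z|D. E z)"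
  proof (rule pairing_le[OF g])
    fix r w n assume q: "near r w n"
    have "(LINT z|D. r z * (s * E z)) \<le> (LINT z|D. E z)"
    proof (rule integral_mono_AE)
      show "integrable D (\<lambda>z. r z * (s * E z))" using square_integrable_inner[OF near_sq(1)[OF q] sEs] by simp
      show "integrable D E" by (rule iE)
      show "AE z in D. r z * (s * E z) \<le> E z"
        using strict_subsolution_bound(1)[OF q mz]
      proof eventually_elim
        case (elim z)
        have "\<bar>r z * s\<bar> \<le> 1" using elim s by (simp add: abs_mult)
        then show ?case by (auto simp: E_def)
      qed
    qed
    then show "pairing T (\<lambda>z. (s * E z, 0, 0)) r w n \<le> (LINT z|D. E z)" unfolding pairing_density .
  qed
  then have le: "(LINT z|D. \<rho> z * (s * E z)) \<le> (LINT z|D. E z)" unfolding pairing_density .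
  have i: "integrable D (\<lambda>z. \<rho> z * (s * E z))" using square_integrable_inner[OF sq'(1) sEs] by simp
  have nn: "0 \<le> \<rho> z * (s * E z) - E z" for z by (auto simp: E_def mult.commute)
  have "(LINT z|D. \<rho> z * (s * E z) - E z) = (LINT z|D. \<rho> z * (s * E z)) - (LINT z|D. E z)"
    by (rule Bochner_Integration.integral_diff[OF i iE])
  moreover have "(LINT z|D. \<rho> z * (s * E z) - E z) \<ge> 0" using nn by simp
  ultimately have "(LINT z|D. \<rho> z * (s * E z) - E z) = 0" using le by linarith
  then have "AE z in D. \<rho> z * (s * E z) - E z = 0"
    using integral_nonneg_eq_0_iff_AE[OF Bochner_Integration.integrable_diff[OF i iE]] nn by simp
  then show ?thesis
  proof eventually_elim
    case (elim z)
    then show ?case by (auto simp: E_def mult.commute split: if_splits)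
  qed
qed

lemma abs_density: "AE z in D. \<bar>\<rho> z\<bar> = 1"
proof -
  have b: "AE z in D. (\<rho> z)\<^sup>2 \<le> 1"
  proof -
    have "AE z in D. 1 * \<rho> z \<le> 1" by (rule one_sided_bound) simp
    moreover have "AE z in D. (- 1) * \<rho> z \<le> 1" by (rule one_sided_bound) simp
    ultimately show ?thesis
    proof eventually_elim
      case (elim z)
      then have "\<bar>\<rho> z\<bar> \<le> 1" by linarith
      then show ?case by (simp add: abs_square_le_1)
    qed
  qed
  interpret finite_measure D by (rule finite_measure_lebesgue_on[OF slab_props(3)])
  have i: "integrable D (\<lambda>z. 1 - (\<rho> z)\<^sup>2)" using sq'(1) by (simp add: square_integrable_def)
  have "(LINT z|D. 1 - (\<rho> z)\<^sup>2) = (LINT z|D. 1) - (LINT z|D. (\<rho> z)\<^sup>2)"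
    using sq'(1) by (intro Bochner_Integration.integral_diff) (simp_all add: square_integrable_def)
  moreover have "(LINT z|D. 1) = measure lebesgue (slab T)" using slab_props(4) by (simp add: measure_restrict_space)
  ultimately have "(LINT z|D. 1 - (\<rho> z)\<^sup>2) \<le> 0" using full by linarith
  moreover have nn: "AE z in D. 0 \<le> 1 - (\<rho> z)\<^sup>2" using b by eventually_elim simp
  ultimately have "(LINT z|D. 1 - (\<rho> z)\<^sup>2) = 0" using integral_nonneg_AE[OF nn] by linarith
  then have "AE z in D. 1 - (\<rho> z)\<^sup>2 = 0" using integral_nonneg_eq_0_iff_AE[OF i nn] by blast
  then show ?thesis
  proof eventually_elim
    case (elim z)
    then have "(\<rho> z)\<^sup>2 = 1" by simp
    then show ?case by (simp add: power2_eq_1_iff) auto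
  qed
qed

lemma density_square_integral: "(LINT z|D. (\<rho> z)\<^sup>2) = L" "(LINT z|D. c) = c * L"
proof -
  show c: "(LINT z|D. c) = c * L" for c :: real using slab_props(4) by (simp add: measure_restrict_space L_def)
  have "(LINT z|D. (\<rho> z)\<^sup>2) = (LINT z|D. 1)"
  proof (rule integral_cong_AE)
    show "AE z in D. (\<rho> z)\<^sup>2 = 1" using abs_density by eventually_elim (rule abs_one_square)
  qed (use sq'(1) in \<open>auto simp: square_integrable_def\<close>)
  then show "(LINT z|D. (\<rho> z)\<^sup>2) = L" using c[of 1] by simp
qed

text \<open>The product \<rho> v is not weakly continuous, but with the limit density as a fixed
  factor it becomes a linear pairing: m - \<rho> v is tested with its own direction g, and the
  approximating pair (n, w) is compared with n - \<rho> w. Fullness makes the approximating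
  densities r converge strongly.\<close>

lemma flux_eq: "AE z in D. m z = \<rho> z *\<^sub>R v z"
proof -
  have \<rho>m: "\<rho> \<in> borel_measurable D" using sq'(1) by (simp add: square_integrable_def)
  have \<rho>1: "AE z in D. \<bar>\<rho> z\<bar> \<le> 1" using abs_density by eventually_elim simp
  define d where "d z = m z - \<rho> z *\<^sub>R v z" for z
  have ds: "square_integrable (slab T) d"
    unfolding d_def by (intro square_integrable_diff sq' square_integrable_mult_bounded \<rho>m \<rho>1)
  \<comment> \<open>Where d = 0 the convention \<open>inverse 0 = 0\<close> gives g = 0.\<close>
  define g where "g z = inverse (norm (d z)) *\<^sub>R d z" for z
  have g1: "norm (g z) \<le> 1" for z by (cases "norm (d z) = 0") (simp_all add: g_def)
  have dm: "d \<in> borel_measurable D" using ds by (simp add: square_integrable_def)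
  have gm: "g \<in> borel_measurable D" unfolding g_def using dm by measurable
  have gs: "square_integrable (slab T) g" using g1 by (intro square_integrable_bounded[OF gm slab_props(3), where C=1]) simp
  have \<rho>gs: "square_integrable (slab T) (\<lambda>z. \<rho> z *\<^sub>R g z)" by (rule square_integrable_mult_bounded[OF \<rho>m \<rho>1 gs])
  have dg: "m z \<bullet> g z - v z \<bullet> (\<rho> z *\<^sub>R g z) = norm (d z)" for z
  proof -
    have "m z \<bullet> g z - v z \<bullet> (\<rho> z *\<^sub>R g z) = d z \<bullet> g z" by (simp add: d_def inner_diff_left)
    also have "\<dots> = inverse (norm (d z)) * (norm (d z) * norm (d z))" by (simp add: g_def power2_norm_eq_inner[symmetric] power2_eq_square)
    also have "\<dots> = norm (d z)" by (cases "norm (d z) = 0") auto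
    finally show ?thesis .
  qed
  have in1: "integrable D (\<lambda>z. m z \<bullet> g z)" "integrable D (\<lambda>z. v z \<bullet> (\<rho> z *\<^sub>R g z))"
    by (intro square_integrable_inner sq' gs \<rho>gs)+
  have nd: "(LINT z|D. norm (d z)) = (LINT z|D. m z \<bullet> g z) - (LINT z|D. v z \<bullet> (\<rho> z *\<^sub>R g z))"
    unfolding dg[symmetric] by (rule Bochner_Integration.integral_diff[OF in1])
  have L0: "L \<ge> 0" by (simp add: L_def)
  have small: "(LINT z|D. norm (d z)) \<le> 0 + \<eta>" if \<eta>: "\<eta> > 0" for \<eta>
  proof -
    \<comment> \<open>The weight s makes L/(4s) at most \<eta>/4, and the tolerance e below makes 2
      (2 + s) e equal to \<eta>/2.\<close>
    define s where "s = (L + 1) / \<eta>"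
    have s: "s > 0" using L0 \<eta> by (simp add: s_def)
    define e where "e = \<eta> / (4 * (2 + s))"
    have e: "e > 0" using s \<eta> by (simp add: e_def)
    \<comment> \<open>Three pairings suffice: the flux with g, the velocity with \<rho> g, and the
      density with \<rho>, the last of which yields strong convergence.\<close>
    define G where "G = {(\<lambda>z. (0 :: real, 0 :: real^2, g z)), (\<lambda>z. (0, \<rho> z *\<^sub>R g z, 0)), (\<lambda>z. (\<rho> z, 0, 0))}"
    have Gs: "h \<in> G \<Longrightarrow> square_integrable (slab T) h" for h
      unfolding G_def using gs \<rho>gs sq'(1) by (auto simp: square_integrable_triple square_integrable_0)
    obtain r w n where q: "near r w n" and ap: "\<And>h. h \<in> G \<Longrightarrow> \<bar>pairing T h r w n - pairing T h \<rho> v m\<bar> < e"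
    proof (rule subsolution_space_approx[OF lim sq])
      show "finite G" by (simp add: G_def)
      show "e > 0" by (rule e)
      show "square_integrable (slab T) h" if "h \<in> G" for h using that by (rule Gs)
    qed (rule that; assumption)
    have a1: "\<bar>(LINT z|D. n z \<bullet> g z) - (LINT z|D. m z \<bullet> g z)\<bar> < e"
      using ap[of "\<lambda>z. (0, 0, g z)"] unfolding pairing_flux by (simp add: G_def)
    have a2: "\<bar>(LINT z|D. w z \<bullet> (\<rho> z *\<^sub>R g z)) - (LINT z|D. v z \<bullet> (\<rho> z *\<^sub>R g z))\<bar> < e"
      using ap[of "\<lambda>z. (0, \<rho> z *\<^sub>R g z, 0)"] unfolding pairing_velocity by (simp add: G_def)
    have a3: "\<bar>(LINT z|D. r z * \<rho> z) - L\<bar> < e"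
      using ap[of "\<lambda>z. (\<rho> z, 0, 0)"] density_square_integral(1) unfolding pairing_density by (simp add: G_def power2_eq_square)
    note qs = near_sq[OF q]
    have i: "integrable D (\<lambda>z. n z \<bullet> g z)" "integrable D (\<lambda>z. w z \<bullet> (\<rho> z *\<^sub>R g z))" "integrable D (\<lambda>z. (r z)\<^sup>2)" "integrable D (\<lambda>z. (\<rho> z)\<^sup>2)"
      "integrable D (\<lambda>z. (norm (w z))\<^sup>2)" "integrable D (\<lambda>z. r z * \<rho> z)" "integrable D (\<lambda>z. 1 - (r z)\<^sup>2)"
    proof -
      interpret finite_measure D by (rule finite_measure_lebesgue_on[OF slab_props(3)])
      show "integrable D (\<lambda>z. n z \<bullet> g z)" "integrable D (\<lambda>z. w z \<bullet> (\<rho> z *\<^sub>R g z))" by (intro square_integrable_inner qs gs \<rho>gs)+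
      show "integrable D (\<lambda>z. (r z)\<^sup>2)" "integrable D (\<lambda>z. (\<rho> z)\<^sup>2)" "integrable D (\<lambda>z. (norm (w z))\<^sup>2)"
        using qs sq' by (simp_all add: square_integrable_def)
      then show "integrable D (\<lambda>z. 1 - (r z)\<^sup>2)" by simp
      show "integrable D (\<lambda>z. r z * \<rho> z)" using square_integrable_inner[OF qs(1) sq'(1)] by simp
    qed
    have rd: "(r z - \<rho> z)\<^sup>2 = (r z)\<^sup>2 - 2 * (r z * \<rho> z) + (\<rho> z)\<^sup>2" for z by (simp add: power2_eq_square algebra_simps)
    have ird: "integrable D (\<lambda>z. (r z - \<rho> z)\<^sup>2)" unfolding rd using i by simp
    have Ird: "(LINT z|D. (r z - \<rho> z)\<^sup>2) = (LINT z|D. (r z)\<^sup>2) - 2 * (LINT z|D. r z * \<rho> z) + L"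
      unfolding rd using i density_square_integral(1) by simp
    have I1r: "(LINT z|D. 1 - (r z)\<^sup>2) = L - (LINT z|D. (r z)\<^sup>2)"
    proof -
      interpret finite_measure D by (rule finite_measure_lebesgue_on[OF slab_props(3)])
      have "(LINT z|D. 1 - (r z)\<^sup>2) = (LINT z|D. 1) - (LINT z|D. (r z)\<^sup>2)"
        using i by (intro Bochner_Integration.integral_diff) simp_all
      then show ?thesis using density_square_integral(2)[of 1] by simp
    qed
    have r1: "AE z in D. (r z)\<^sup>2 \<le> 1" using strict_subsolution_bound(1)[OF q mz] by eventually_elim (simp add: abs_square_le_1)
    have "0 \<le> (LINT z|D. 1 - (r z)\<^sup>2)" by (rule integral_nonneg_AE) (use r1 in eventually_elim, simp)
    then have R1: "(LINT z|D. (r z)\<^sup>2) \<le> L" using I1r by linarith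
    have R0: "0 \<le> (LINT z|D. (r z - \<rho> z)\<^sup>2)" by simp
    have W: "(LINT z|D. (norm (w z))\<^sup>2) \<le> L"
      using slab_velocity_bound[of T r w n \<rho>\<^sub>0 UNIV] q R1 unfolding strict_subsolution_def by simp
    have fb: "AE z in D. norm (n z - r z *\<^sub>R w z) \<le> 1 - (r z)\<^sup>2" by (rule strict_subsolution_flux_bound[OF q mz hull])
    \<comment> \<open>Split n - \<rho> w into (n - r w) + (r - \<rho>) w. The hull condition bounds
      the first part by 1 - r^2. For the second, w has no uniform pointwise bound, so Young's
      inequality with weight s separates the small factor r - \<rho> from w.\<close>
    have "(LINT z|D. n z \<bullet> g z - w z \<bullet> (\<rho> z *\<^sub>R g z)) \<le> (LINT z|D. (1 - (r z)\<^sup>2) + (s * (r z - \<rho> z)\<^sup>2 + (1 / (4 * s)) * (norm (w z))\<^sup>2))"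
    proof (rule integral_mono_AE)
      show "integrable D (\<lambda>z. n z \<bullet> g z - w z \<bullet> (\<rho> z *\<^sub>R g z))" using i(1,2) by simp
      show "integrable D (\<lambda>z. (1 - (r z)\<^sup>2) + (s * (r z - \<rho> z)\<^sup>2 + (1 / (4 * s)) * (norm (w z))\<^sup>2))"
        using i(5,7) ird by simp
      show "AE z in D. n z \<bullet> g z - w z \<bullet> (\<rho> z *\<^sub>R g z) \<le> (1 - (r z)\<^sup>2) + (s * (r z - \<rho> z)\<^sup>2 + (1 / (4 * s)) * (norm (w z))\<^sup>2)"
        using fb
      proof eventually_elim
        case (elim z)
        have "n z \<bullet> g z - w z \<bullet> (\<rho> z *\<^sub>R g z) = (n z - r z *\<^sub>R w z) \<bullet> g z + (r z - \<rho> z) * (w z \<bullet> g z)"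
          by (simp add: inner_diff_left algebra_simps)
        moreover have "(n z - r z *\<^sub>R w z) \<bullet> g z \<le> 1 - (r z)\<^sup>2"
        proof -
          have "(n z - r z *\<^sub>R w z) \<bullet> g z \<le> norm (n z - r z *\<^sub>R w z) * norm (g z)" by (rule norm_cauchy_schwarz)
          also have "\<dots> \<le> norm (n z - r z *\<^sub>R w z) * 1" using g1 by (intro mult_left_mono) auto
          finally show ?thesis using elim by simp
        qed
        moreover have "(r z - \<rho> z) * (w z \<bullet> g z) \<le> s * (r z - \<rho> z)\<^sup>2 + (1 / (4 * s)) * (norm (w z))\<^sup>2"
        proof -
          define x y where "x = r z - \<rho> z" and "y = w z \<bullet> g z"
          have "\<bar>y\<bar> \<le> norm (w z) * norm (g z)" unfolding y_def by (rule Cauchy_Schwarz_ineq2)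
          also have "\<dots> \<le> norm (w z) * 1" using g1 by (intro mult_left_mono) auto
          finally have "y\<^sup>2 \<le> (norm (w z))\<^sup>2" by (intro iffD1[OF abs_le_square_iff]) simp
          then have "(1 / (4 * s)) * y\<^sup>2 \<le> (1 / (4 * s)) * (norm (w z))\<^sup>2" using s by (intro mult_left_mono) auto
          moreover have "s * x\<^sup>2 + (1 / (4 * s)) * y\<^sup>2 - x * y = s * (x - y / (2 * s))\<^sup>2"
            using s by (simp add: power2_eq_square field_simps)
          moreover have "0 \<le> s * (x - y / (2 * s))\<^sup>2" using s by simp
          ultimately show ?thesis unfolding x_def[symmetric] y_def[symmetric] by linarith
        qed
        ultimately show ?case by linarith
      qed
    qed
    also have "\<dots> = (L - (LINT z|D. (r z)\<^sup>2)) + (s * (LINT z|D. (r z - \<rho> z)\<^sup>2) + (1 / (4 * s)) * (LINT z|D. (norm (w z))\<^sup>2))"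
      using i(5,7) ird I1r by simp
    also have "\<dots> \<le> 2 * e + (s * (2 * e) + (1 / (4 * s)) * L)"
    proof (intro add_mono mult_left_mono)
      \<comment> \<open>Both estimates come from expanding the integral of (r - \<rho>)^2, with the
        mixed integral larger than L - e.\<close>
      show "L - (LINT z|D. (r z)\<^sup>2) \<le> 2 * e" using R0 Ird a3 by linarith
      show "(LINT z|D. (r z - \<rho> z)\<^sup>2) \<le> 2 * e" using R1 Ird a3 by linarith
    qed (use s W in auto)
    finally have "(LINT z|D. norm (d z)) \<le> 2 * e + (s * (2 * e) + (1 / (4 * s)) * L) + 2 * e"
      using a1 a2 i(1,2) unfolding nd by simp
    also have "\<dots> = 2 * ((2 + s) * e) + (1 / (4 * s)) * L" by (simp add: algebra_simps)
    also have "2 * ((2 + s) * e) = \<eta> / 2"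
    proof -
      have "(2 + s) * (\<eta> / (4 * (2 + s))) = \<eta> * (2 + s) / (4 * (2 + s))" by (simp only: times_divide_eq_right mult.commute)
      also have "\<dots> = \<eta> / 4" using s by (intro nonzero_mult_divide_mult_cancel_right) simp
      finally have "(2 + s) * e = \<eta> / 4" unfolding e_def .
      then show ?thesis by simp
    qed
    also have "(1 / (4 * s)) * L \<le> \<eta> / 4"
    proof -
      have "L / (L + 1) \<le> 1" using L0 by simp
      then have "\<eta> / 4 * (L / (L + 1)) \<le> \<eta> / 4 * 1" using \<eta> by (intro mult_left_mono) auto
      then show ?thesis by (simp add: s_def)
    qed
    finally show ?thesis using \<eta> by simp
  qed
  then have "(LINT z|D. norm (d z)) \<le> 0" by (rule field_le_epsilon)
  moreover have "0 \<le> (LINT z|D. norm (d z))" by simp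
  ultimately have "(LINT z|D. norm (d z)) = 0" by linarith
  then have "AE z in D. norm (d z) = 0"
    using square_integrable_imp_integrable[OF ds slab_props(3)] by (subst (asm) integral_nonneg_eq_0_iff_AE) auto
  then show ?thesis by eventually_elim (simp add: d_def)
qed

section \<open>The equations for the limit\<close>

lemma test_functions_imp_rel:
  fixes \<phi> :: "(real^2) \<times> real \<Rightarrow> real"
  assumes "\<phi> \<in> test_functions (UNIV \<times> {..<T})"
  shows "\<phi> \<in> test_functions_rel (closure unit_square \<times> {0..<T})"
proof -
  define K where "K = closure {z. \<phi> z \<noteq> 0}"
  have K: "smooth \<phi>" "compact K" "K \<subseteq> UNIV \<times> {..<T}" using assms by (simp_all add: test_functions_def K_def)
  \<comment> \<open>Cutting K at time 0 leaves a compact set, and K ends before T. The relative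
    support therefore stays in the half-open cylinder; it may touch t = 0 and the lateral
    boundary.\<close>
  have sub: "closure {z \<in> closure unit_square \<times> {0..<T}. \<phi> z \<noteq> 0} \<subseteq> K \<inter> (closure unit_square \<times> {0..})"
  proof (rule closure_minimal)
    show "{z \<in> closure unit_square \<times> {0..<T}. \<phi> z \<noteq> 0} \<subseteq> K \<inter> (closure unit_square \<times> {0..})"
      using closure_subset[of "{z. \<phi> z \<noteq> 0}"] by (auto simp: K_def)
    show "closed (K \<inter> (closure unit_square \<times> {0..}))"
      by (intro closed_Int closed_Times) (auto simp: K_def)
  qed
  have "compact (closure {z \<in> closure unit_square \<times> {0..<T}. \<phi> z \<noteq> 0})"
    unfolding compact_closure using closure_subset sub compact_imp_bounded[OF K(2)] by (meson bounded_subset le_inf_iff order_trans)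
  moreover have "K \<inter> (closure unit_square \<times> {0..}) \<subseteq> closure unit_square \<times> {0..<T}" using K(3) by auto
  ultimately show ?thesis using K(1) sub unfolding test_functions_rel_def by blast
qed

lemma gradient_triple_square_integrable:
  assumes "smooth \<phi>"
  shows "square_integrable (slab T) (time_deriv \<phi>)" "square_integrable (slab T) (space_gradient \<phi>)"
proof -
  show "square_integrable (slab T) (time_deriv \<phi>)"
    by (rule square_integrable_continuous_slab[OF smooth_time_deriv_continuous[OF assms]])
  have "continuous_on UNIV (\<lambda>z. \<chi> i. space_gradient \<phi> z $ i)"
    by (intro continuous_on_vec_lambda smooth_space_gradient_continuous assms)
  then show "square_integrable (slab T) (space_gradient \<phi>)"
    by (intro square_integrable_continuous_slab) simp
qed

text \<open>The equation with flux m is a linear pairing with fixed value on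
  \<open>X\<^sub>0\<close> and passes to the limit; only then is m replaced by \<rho> v.\<close>

lemma transport_equation:
  fixes \<phi> :: "(real^2) \<times> real \<Rightarrow> real"
  assumes \<phi>: "\<phi> \<in> test_functions (UNIV \<times> {..<T})"
  shows "(LINT z|D. \<rho> z * (time_deriv \<phi> z + v z \<bullet> space_gradient \<phi> z)) + (LINT x|lebesgue_on unit_square. \<rho>\<^sub>0 x * \<phi> (x, 0)) = 0"
proof -
  have s: "smooth \<phi>" using \<phi> by (simp add: test_functions_def)
  note gs = gradient_triple_square_integrable[OF s]
  define g where "g z = (time_deriv \<phi> z, 0 :: real^2, space_gradient \<phi> z)" for z
  have g: "square_integrable (slab T) g" unfolding g_def square_integrable_triple using gs by (simp add: square_integrable_0)
  have pg: "pairing T g r w n = (LINT z|D. r z * time_deriv \<phi> z + n z \<bullet> space_gradient \<phi> z)" for r w n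
    by (simp add: pairing_def g_def inner_prod_def)
  have "pairing T g \<rho> v m = - (LINT x|lebesgue_on unit_square. \<phi> (x, 0) * \<rho>\<^sub>0 x)"
  proof (rule pairing_eq[OF g])
    fix r w n assume "near r w n"
    then have "linear_system unit_square T \<rho>\<^sub>0 r w n" by (simp add: strict_subsolution_def)
    then have "(LINT z|D. r z * time_deriv \<phi> z + n z \<bullet> space_gradient \<phi> z) + (LINT x|lebesgue_on unit_square. \<phi> (x, 0) * \<rho>\<^sub>0 x) = 0"
      using test_functions_imp_rel[OF \<phi>] unfolding linear_system_def by blast
    then show "pairing T g r w n = - (LINT x|lebesgue_on unit_square. \<phi> (x, 0) * \<rho>\<^sub>0 x)" unfolding pg by linarith
  qed
  moreover have "(LINT z|D. \<rho> z * (time_deriv \<phi> z + v z \<bullet> space_gradient \<phi> z)) = (LINT z|D. \<rho> z * time_deriv \<phi> z + m z \<bullet> space_gradient \<phi> z)"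
  proof (rule integral_cong_AE)
    have "(\<lambda>z. v z \<bullet> space_gradient \<phi> z) \<in> borel_measurable D"
      using square_integrable_inner[OF sq'(2) gs(2)] by blast
    then show "(\<lambda>z. \<rho> z * (time_deriv \<phi> z + v z \<bullet> space_gradient \<phi> z)) \<in> borel_measurable D"
      using sq'(1) gs(1) by (auto simp: square_integrable_def)
    have "(\<lambda>z. m z \<bullet> space_gradient \<phi> z) \<in> borel_measurable D"
      using square_integrable_inner[OF sq'(3) gs(2)] by blast
    then show "(\<lambda>z. \<rho> z * time_deriv \<phi> z + m z \<bullet> space_gradient \<phi> z) \<in> borel_measurable D"
      using sq'(1) gs(1) by (auto simp: square_integrable_def)
    show "AE z in D. \<rho> z * (time_deriv \<phi> z + v z \<bullet> space_gradient \<phi> z) = \<rho> z * time_deriv \<phi> z + m z \<bullet> space_gradient \<phi> z"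
      using flux_eq by eventually_elim (simp add: distrib_left)
  qed
  ultimately show ?thesis by (simp add: pg mult.commute)
qed

text \<open>For approximants the condition at almost every time is integrated over time, which turns
  it into a single pairing.\<close>

lemma divergence_equation:
  assumes \<phi>: "smooth \<phi>"
  shows "(LINT z|D. v z \<bullet> space_gradient \<phi> z) = 0"
proof -
  note gs = gradient_triple_square_integrable[OF \<phi>]
  have g: "square_integrable (slab T) (\<lambda>z. (0 :: real, space_gradient \<phi> z, 0 :: real^2))"
    unfolding square_integrable_triple using gs by (simp add: square_integrable_0)
  have "pairing T (\<lambda>z. (0, space_gradient \<phi> z, 0)) \<rho> v m = 0"
  proof (rule pairing_eq[OF g])
    fix r w n assume q: "near r w n"
    then have ae: "AE t in lebesgue_on {0<..<T}. \<forall>\<psi>. smooth \<psi> \<longrightarrow> (LINT x|lebesgue_on unit_square. w (x, t) \<bullet> gradient \<psi> x) = 0"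
      unfolding strict_subsolution_def linear_system_def by blast
    have i: "integrable D (\<lambda>z. w z \<bullet> space_gradient \<phi> z)" by (rule square_integrable_inner[OF near_sq(2)[OF q] gs(2)])
    have B: "{0<..<T} \<in> sets borel" by simp
    have "(LINT z|D. w z \<bullet> space_gradient \<phi> z) = (LINT t|lebesgue_on {0<..<T}. LINT x|lebesgue_on unit_square. w (x, t) \<bullet> space_gradient \<phi> (x, t))"
      by (rule fubini_lebesgue_on(3)[OF i slab_props(6) B, symmetric])
    also have "\<dots> = (LINT t|lebesgue_on {0<..<T}. 0)"
    proof (rule integral_cong_AE)
      show "(\<lambda>t. LINT x|lebesgue_on unit_square. w (x, t) \<bullet> space_gradient \<phi> (x, t)) \<in> borel_measurable (lebesgue_on {0<..<T})"
        using fubini_lebesgue_on(2)[OF i slab_props(6) B] by blast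
      show "AE t in lebesgue_on {0<..<T}. (LINT x|lebesgue_on unit_square. w (x, t) \<bullet> space_gradient \<phi> (x, t)) = 0"
        using ae by eventually_elim (simp add: space_gradient_def smooth_slice[OF \<phi>])
    qed simp
    finally show "pairing T (\<lambda>z. (0, space_gradient \<phi> z, 0)) r w n = 0" unfolding pairing_velocity by simp
  qed
  then show ?thesis unfolding pairing_velocity .
qed

text \<open>The exceptional set of times must not depend on the test function. For one \<psi> the
  equation at almost every time follows by localising the space-time pairing to Borel sets of times.
  A countable family of \<psi> shares one null set, and uniform approximation of the perpendicular
  gradients reaches all others.\<close>

lemma curl_equation:
  "AE t in lebesgue_on {0<..<T}. \<forall>\<psi>\<in>test_functions unit_square.
     (LINT x|lebesgue_on unit_square. (v (x, t) + vector [0, \<rho> (x, t)]) \<bullet> perp_gradient \<psi> x) = 0"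
proof -
  have B: "{0<..<T} \<in> sets borel" by simp
  note sl = slab_props(6) B
  define F where "F r w \<psi> t = (LINT x|lebesgue_on unit_square. (w (x, t) + vector [0, r (x, t)]) \<bullet> perp_gradient \<psi> x)"
    for r and w :: "_ \<Rightarrow> real^2" and \<psi> and t :: real
  have pgc: "continuous_on UNIV (\<lambda>z :: (real^2) \<times> real. perp_gradient \<psi> (fst z))" if s: "smooth \<psi>" for \<psi>
  proof -
    have "continuous_on UNIV (\<lambda>z :: (real^2) \<times> real. \<chi> i. perp_gradient \<psi> (fst z) $ i)"
      by (intro continuous_on_vec_lambda continuous_on_compose2[OF perp_gradient_continuous[OF s]] continuous_intros) auto
    then show ?thesis by simp
  qed
  have wr: "square_integrable (slab T) (\<lambda>z. w z + vector [0, r z] :: real^2)" if "square_integrable (slab T) r" "square_integrable (slab T) w" for r w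
  proof -
    have "square_integrable (slab T) (\<lambda>z. - (r z *\<^sub>R axis 2 1 :: real^2))"
      using that(1) by (auto simp: square_integrable_def power_mult_distrib norm_axis_1)
    from square_integrable_diff[OF that(2) this] show ?thesis by (simp add: vector_real2_eq)
  qed
  have i: "integrable D (\<lambda>z. (w z + vector [0, r z]) \<bullet> perp_gradient \<psi> (fst z))"
    if "smooth \<psi>" "square_integrable (slab T) r" "square_integrable (slab T) w" for \<psi> r w
    by (rule square_integrable_inner[OF wr[OF that(2,3)] square_integrable_continuous_slab[OF pgc[OF that(1)]]])
  have each: "AE t in lebesgue_on {0<..<T}. F \<rho> v \<psi> t = 0" if \<psi>: "\<psi> \<in> test_functions unit_square" for \<psi>
  proof -
    have s: "smooth \<psi>" using \<psi> by (simp add: test_functions_def)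
    have iF: "integrable (lebesgue_on {0<..<T}) (F \<rho> v \<psi>)"
      using fubini_lebesgue_on(2)[OF i[OF s sq'(1,2)] sl] by (simp add: F_def[abs_def])
    \<comment> \<open>The space-time pairing of the limit, restricted to the times in I, vanishes
      because it vanishes for every approximant.\<close>
    have zero: "(LINT t|lebesgue_on {0<..<T}. indicator I t * F \<rho> v \<psi> t) = 0" if I: "I \<in> sets borel" for I
    proof -
      define p where "p z = indicator I (snd z) *\<^sub>R perp_gradient \<psi> (fst z)" for z :: "(real^2) \<times> real"
      have ps: "square_integrable (slab T) p"
        unfolding p_def
        by (intro square_integrable_mult_bounded indicator_snd_measurable I square_integrable_continuous_slab pgc s) (auto simp: indicator_def)
      \<comment> \<open>The inner product of (0, \<rho>) with p is \<rho> times the second component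
        of p; this component therefore becomes the density slot.\<close>
      define g where "g z = (p z $ 2, p z, 0 :: real^2)" for z
      have g: "square_integrable (slab T) g"
        unfolding g_def square_integrable_triple using ps square_integrable_component[OF ps] by (simp add: square_integrable_0)
      have pg: "pairing T g r w n = (LINT t|lebesgue_on {0<..<T}. indicator I t * F r w \<psi> t)"
        if rw: "square_integrable (slab T) r" "square_integrable (slab T) w" for r w n
      proof -
        have ip: "integrable D (\<lambda>z. (w z + vector [0, r z]) \<bullet> p z)" by (rule square_integrable_inner[OF wr[OF rw] ps])
        have "pairing T g r w n = (LINT z|D. (w z + vector [0, r z]) \<bullet> p z)"
          unfolding pairing_def g_def by (intro Bochner_Integration.integral_cong) (simp_all add: inner_prod_def inner_add_left inner_real2 algebra_simps)
        also have "\<dots> = (LINT t|lebesgue_on {0<..<T}. LINT x|lebesgue_on unit_square. (w (x, t) + vector [0, r (x, t)]) \<bullet> p (x, t))"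
          by (rule fubini_lebesgue_on(3)[OF ip sl, symmetric])
        also have "\<dots> = (LINT t|lebesgue_on {0<..<T}. indicator I t * F r w \<psi> t)"
          by (simp add: p_def F_def)
        finally show ?thesis .
      qed
      have "pairing T g \<rho> v m = 0"
      proof (rule pairing_eq[OF g])
        fix r w n assume q: "near r w n"
        then have "AE t in lebesgue_on {0<..<T}. F r w \<psi> t = 0"
          using \<psi> unfolding strict_subsolution_def linear_system_def F_def by (auto elim: eventually_mono)
        then have ae: "AE t in lebesgue_on {0<..<T}. indicator I t * F r w \<psi> t = 0" by eventually_elim simp
        show "pairing T g r w n = 0" unfolding pg[OF near_sq(1,2)[OF q]] by (rule integral_eq_zero_AE[OF ae])
      qed
      then show ?thesis unfolding pg[OF sq'(1,2)] .
    qed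
    \<comment> \<open>A Borel representative, because the sign sets used for localisation have to be
      Borel.\<close>
    obtain h where h: "h \<in> borel_measurable borel" "AE t in lborel. indicator {0<..<T} t *\<^sub>R F \<rho> v \<psi> t = h t"
      using lebesgue_on_ex_borel[OF borel_measurable_integrable[OF iF]] by auto
    have "AE t in lborel. t \<in> {0<..<T} \<longrightarrow> F \<rho> v \<psi> t = h t" using h(2) by eventually_elim (auto simp: indicator_def)
    moreover have "{0<..<T} \<in> sets lebesgue" by simp
    ultimately have hF: "AE t in lebesgue_on {0<..<T}. F \<rho> v \<psi> t = h t" using AE_lebesgue_on_iff by blast
    \<comment> \<open>With c = 1 and c = -1 the positive and the negative part of
      \<open>F \<rho> v \<psi>\<close> are eliminated separately.\<close>
    have sgn: "AE t in lebesgue_on {0<..<T}. indicator {t. c * h t > 0} t * (c * F \<rho> v \<psi> t) = 0" for c :: real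
    proof -
      have I: "{t. c * h t > 0} \<in> sets borel" using h(1) by measurable
      have ii: "integrable (lebesgue_on {0<..<T}) (\<lambda>t. indicator {t. c * h t > 0} t * (c * F \<rho> v \<psi> t))"
      proof (rule Bochner_Integration.integrable_bound)
        show "integrable (lebesgue_on {0<..<T}) (\<lambda>t. c * F \<rho> v \<psi> t)" using iF by simp
        have "(indicator {t. c * h t > 0} :: real \<Rightarrow> real) \<in> borel_measurable (lebesgue_on {0<..<T})"
          by (rule borel_measurable_lebesgue_on_borel[OF borel_measurable_indicator[OF I]])
        then show "(\<lambda>t. indicator {t. c * h t > 0} t * (c * F \<rho> v \<psi> t)) \<in> borel_measurable (lebesgue_on {0<..<T})"
          using borel_measurable_integrable[OF iF] by auto
      qed (auto simp: indicator_def)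
      have "(LINT t|lebesgue_on {0<..<T}. indicator {t. c * h t > 0} t * (c * F \<rho> v \<psi> t)) = 0"
        using zero[OF I] by (simp add: mult.left_commute[where a=c])
      moreover have "AE t in lebesgue_on {0<..<T}. 0 \<le> indicator {t. c * h t > 0} t * (c * F \<rho> v \<psi> t)"
        using hF by eventually_elim (auto simp: indicator_def)
      ultimately show ?thesis using integral_nonneg_eq_0_iff_AE[OF ii] by blast
    qed
    show ?thesis using sgn[of 1] sgn[of "-1"] hF
      by eventually_elim (auto simp: indicator_def split: if_splits)
  qed
  define I where "I = test_functions unit_square"
  have Ic: "\<psi> \<in> I \<Longrightarrow> continuous_on (closure unit_square) (perp_gradient \<psi>)" for \<psi>
  proof -
    assume "\<psi> \<in> I"
    then have s: "smooth \<psi>" by (simp add: I_def test_functions_def)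
    have "continuous_on UNIV (\<lambda>z. \<chi> i. perp_gradient \<psi> z $ i)"
      by (intro continuous_on_vec_lambda perp_gradient_continuous s)
    then show "continuous_on (closure unit_square) (perp_gradient \<psi>)" by (auto intro: continuous_on_subset)
  qed
  have Kc: "compact (closure unit_square)" using bounded_unit_square by simp
  \<comment> \<open>Closeness on the closed square suffices, as the integrals run over the
    square.\<close>
  obtain C where C: "countable C" "C \<subseteq> I"
    "\<And>i e. i \<in> I \<Longrightarrow> e > 0 \<Longrightarrow> \<exists>j\<in>C. \<forall>x\<in>closure unit_square. norm (perp_gradient i x - perp_gradient j x) < e"
    by (rule countable_uniformly_dense[OF Kc Ic]) blast+
  have "AE t in lebesgue_on {0<..<T}. \<forall>\<psi>\<in>C. F \<rho> v \<psi> t = 0"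
    using each C(1,2) by (subst AE_ball_countable) (auto simp: I_def)
  moreover have "AE t in lebesgue_on {0<..<T}. integrable (lebesgue_on unit_square) (\<lambda>x. v (x, t) $ 1) \<and>
      integrable (lebesgue_on unit_square) (\<lambda>x. v (x, t) $ 2) \<and> integrable (lebesgue_on unit_square) (\<lambda>x. \<rho> (x, t))"
    using ess_bounded_slices_integrable[OF square_integrable_imp_integrable[OF square_integrable_component[OF sq'(2)] slab_props(3)], of 1]
      ess_bounded_slices_integrable[OF square_integrable_imp_integrable[OF square_integrable_component[OF sq'(2)] slab_props(3)], of 2]
      ess_bounded_slices_integrable[OF square_integrable_imp_integrable[OF sq'(1) slab_props(3)]]
    by eventually_elim auto
  ultimately show ?thesis
  proof eventually_elim
    case (elim t)
    define W where "W x = v (x, t) + vector [0, \<rho> (x, t)]" for x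
    have W: "integrable (lebesgue_on unit_square) (\<lambda>x. W x $ i)" for i
    proof -
      have "\<forall>i. integrable (lebesgue_on unit_square) (\<lambda>x. W x $ i)"
        unfolding forall_2 W_def vector_add_component vector_sel using elim(2) by auto
      then show ?thesis by blast
    qed
    have Wm: "W \<in> borel_measurable (lebesgue_on unit_square)"
      using W borel_measurable_integrable by (intro real2_measurableI) blast+
    have nW: "integrable (lebesgue_on unit_square) (\<lambda>x. norm (W x))"
    proof (rule Bochner_Integration.integrable_bound)
      show "integrable (lebesgue_on unit_square) (\<lambda>x. \<bar>W x $ 1\<bar> + \<bar>W x $ 2\<bar>)" using W by auto
      show "AE x in lebesgue_on unit_square. norm (norm (W x)) \<le> norm (\<bar>W x $ 1\<bar> + \<bar>W x $ 2\<bar>)"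
      proof (rule AE_I2)
        fix x
        show "norm (norm (W x)) \<le> norm (\<bar>W x $ 1\<bar> + \<bar>W x $ 2\<bar>)" using norm_le_l1_cart[of "W x"] by (simp add: sum_2)
      qed
    qed (use Wm in auto)
    show ?case
    proof
      fix \<psi> :: "real^2 \<Rightarrow> real" assume "\<psi> \<in> test_functions unit_square"
      then have \<psi>: "\<psi> \<in> I" by (simp add: I_def)
      define N where "N = (LINT x|lebesgue_on unit_square. norm (W x))"
      have N0: "N \<ge> 0" by (simp add: N_def)
      have iW: "integrable (lebesgue_on unit_square) (\<lambda>x. W x \<bullet> perp_gradient \<theta> x)" if "\<theta> \<in> I" for \<theta>
        using that by (intro integrable_inner_continuous W bounded_unit_square perp_gradient_continuous) (simp add: I_def test_functions_def)
      have "\<bar>LINT x|lebesgue_on unit_square. W x \<bullet> perp_gradient \<psi> x\<bar> \<le> 0 + e" if e: "e > 0" for e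
      proof -
        \<comment> \<open>N is the L1 norm of the slice W, so a uniform error e/(N + 1) changes the
          integral by at most e.\<close>
        have e': "e / (N + 1) > 0" using e N0 by simp
        obtain \<theta> where \<theta>: "\<theta> \<in> C" "\<forall>x\<in>closure unit_square. norm (perp_gradient \<psi> x - perp_gradient \<theta> x) < e / (N + 1)"
          using C(3)[OF \<psi> e'] by blast
        have \<theta>I: "\<theta> \<in> I" using \<theta>(1) C(2) by blast
        have "(LINT x|lebesgue_on unit_square. W x \<bullet> perp_gradient \<theta> x) = 0" using elim(1) \<theta>(1) by (simp add: F_def W_def)
        then have "(LINT x|lebesgue_on unit_square. W x \<bullet> perp_gradient \<psi> x) = (LINT x|lebesgue_on unit_square. W x \<bullet> (perp_gradient \<psi> x - perp_gradient \<theta> x))"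
          using iW[OF \<psi>] iW[OF \<theta>I] by (simp add: inner_diff_right)
        also have "\<bar>\<dots>\<bar> \<le> (LINT x|lebesgue_on unit_square. norm (W x) * (e / (N + 1)))"
        proof (rule order_trans[OF integral_abs_bound], rule integral_mono)
          show "integrable (lebesgue_on unit_square) (\<lambda>x. \<bar>W x \<bullet> (perp_gradient \<psi> x - perp_gradient \<theta> x)\<bar>)"
            using iW[OF \<psi>] iW[OF \<theta>I] by (simp add: inner_diff_right)
          show "integrable (lebesgue_on unit_square) (\<lambda>x. norm (W x) * (e / (N + 1)))" using nW by (rule integrable_mult_left)
          fix x assume "x \<in> space (lebesgue_on unit_square)"
          then have "x \<in> closure unit_square" using closure_subset by (auto simp: space_restrict_space)
          then have "norm (perp_gradient \<psi> x - perp_gradient \<theta> x) \<le> e / (N + 1)" using \<theta>(2) less_imp_le by blast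
          then show "\<bar>W x \<bullet> (perp_gradient \<psi> x - perp_gradient \<theta> x)\<bar> \<le> norm (W x) * (e / (N + 1))"
            by (intro order_trans[OF Cauchy_Schwarz_ineq2] mult_left_mono) auto
        qed
        also have "\<dots> = N * (e / (N + 1))" unfolding N_def by (rule integral_mult_left_zero)
        also have "\<dots> = e * (N / (N + 1))" by simp
        also have "\<dots> \<le> e * 1" using e N0 by (intro mult_left_mono) auto
        finally show ?thesis by simp
      qed
      then have "\<bar>LINT x|lebesgue_on unit_square. W x \<bullet> perp_gradient \<psi> x\<bar> \<le> 0" by (rule field_le_epsilon)
      then show "(LINT x|lebesgue_on unit_square. (v (x, t) + vector [0, \<rho> (x, t)]) \<bullet> perp_gradient \<psi> x) = 0"
        unfolding W_def by simp
    qed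
  qed
qed

text \<open>The norm is quadratic, so the uniform bound for the approximants is passed on by testing
  with v itself, restricted to a set I of times: w \<bullet> v is at most half of |w|^2 + |v|^2, and
  half of the limit norm is absorbed on the left.\<close>

lemma velocity_Linf_L2: "Linf_L2 unit_square T v"
proof -
  have B: "{0<..<T} \<in> sets borel" by simp
  note sl = slab_props(6) B
  have vm: "v \<in> borel_measurable D" using sq'(2) by (simp add: square_integrable_def)
  have iv: "integrable D (\<lambda>z. (norm (v z))\<^sup>2)" using sq'(2) by (simp add: square_integrable_def)
  define A where "A t = (LINT x|lebesgue_on unit_square. (norm (v (x, t)))\<^sup>2)" for t
  have iA: "integrable (lebesgue_on {0<..<T}) A" using fubini_lebesgue_on(2)[OF iv sl] by (simp add: A_def[abs_def])
  \<comment> \<open>The area of the square bounds the squared norm at almost every time, since |r|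
    \<le> 1.\<close>
  define K where "K = measure lebesgue unit_square"
  have bound: "(LINT t|lebesgue_on {0<..<T}. indicator I t * (A t - K)) \<le> 0" if I: "I \<in> sets borel" for I
  proof -
    have Im: "(\<lambda>z :: (real^2) \<times> real. indicator I (snd z) :: real) \<in> borel_measurable D" by (rule indicator_snd_measurable[OF I])
    have gs: "square_integrable (slab T) (\<lambda>z. indicator I (snd z) *\<^sub>R v z)"
      by (intro square_integrable_mult_bounded Im sq'(2)) (auto simp: indicator_def)
    have g: "square_integrable (slab T) (\<lambda>z. (0 :: real, indicator I (snd z) *\<^sub>R v z, 0 :: real^2))"
      unfolding square_integrable_triple using gs by (simp add: square_integrable_0)
    have ib: "integrable D (\<lambda>z. indicator I (snd z) * h z)" if h: "integrable D h" for h :: "_ \<Rightarrow> real"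
    proof (rule Bochner_Integration.integrable_bound[OF h])
      show "(\<lambda>z. indicator I (snd z) * h z) \<in> borel_measurable D"
        using Im borel_measurable_integrable[OF h] by (rule borel_measurable_times)
    qed (auto simp: indicator_def)
    define X where "X = (LINT z|D. indicator I (snd z) * (norm (v z))\<^sup>2)"
    define J where "J = (LINT z|D. indicator I (snd z) :: real)"
    have i1: "integrable D (\<lambda>z. indicator I (snd z) :: real)"
    proof -
      interpret finite_measure D by (rule finite_measure_lebesgue_on[OF slab_props(3)])
      show ?thesis using ib[of "\<lambda>_. 1"] by simp
    qed
    have "pairing T (\<lambda>z. (0, indicator I (snd z) *\<^sub>R v z, 0)) \<rho> v m \<le> J / 2 + X / 2"
    proof (rule pairing_le[OF g])
      fix r w n assume q: "near r w n"
      have iw: "integrable D (\<lambda>z. (norm (w z))\<^sup>2)" and ir: "integrable D (\<lambda>z. (r z)\<^sup>2)" using near_sq(1,2)[OF q] by (simp_all add: square_integrable_def)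
      have "(LINT z|D. w z \<bullet> (indicator I (snd z) *\<^sub>R v z)) \<le> (LINT z|D. (indicator I (snd z) * (norm (w z))\<^sup>2) / 2 + (indicator I (snd z) * (norm (v z))\<^sup>2) / 2)"
      proof (rule integral_mono)
        show "integrable D (\<lambda>z. w z \<bullet> (indicator I (snd z) *\<^sub>R v z))" by (rule square_integrable_inner[OF near_sq(2)[OF q] gs])
        show "integrable D (\<lambda>z. (indicator I (snd z) * (norm (w z))\<^sup>2) / 2 + (indicator I (snd z) * (norm (v z))\<^sup>2) / 2)"
          using ib[OF iw] ib[OF iv] by simp
        fix z
        have "w z \<bullet> v z \<le> norm (w z) * norm (v z)" by (rule norm_cauchy_schwarz)
        also have "\<dots> \<le> ((norm (w z))\<^sup>2 + (norm (v z))\<^sup>2) / 2" using sum_squares_bound[of "norm (w z)" "norm (v z)"] by simp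
        finally show "w z \<bullet> (indicator I (snd z) *\<^sub>R v z) \<le> (indicator I (snd z) * (norm (w z))\<^sup>2) / 2 + (indicator I (snd z) * (norm (v z))\<^sup>2) / 2"
          by (cases "snd z \<in> I") (simp_all add: add_divide_distrib)
      qed
      also have "\<dots> = (LINT z|D. indicator I (snd z) * (norm (w z))\<^sup>2) / 2 + X / 2"
        using ib[OF iw] ib[OF iv] by (simp add: X_def)
      also have "(LINT z|D. indicator I (snd z) * (norm (w z))\<^sup>2) \<le> (LINT z|D. indicator I (snd z) * (r z)\<^sup>2)"
        using slab_velocity_bound[of T r w n \<rho>\<^sub>0 I] q I unfolding strict_subsolution_def by blast
      also have "\<dots> \<le> J"
        unfolding J_def
      proof (rule integral_mono_AE[OF ib[OF ir] i1])
        show "AE z in D. indicator I (snd z) * (r z)\<^sup>2 \<le> (indicator I (snd z) :: real)"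
          using strict_subsolution_bound(1)[OF q mz] by eventually_elim (auto simp: indicator_def abs_square_le_1)
      qed
      finally show "pairing T (\<lambda>z. (0, indicator I (snd z) *\<^sub>R v z, 0)) r w n \<le> J / 2 + X / 2" unfolding pairing_velocity by simp
    qed
    moreover have "pairing T (\<lambda>z. (0, indicator I (snd z) *\<^sub>R v z, 0)) \<rho> v m = X"
      unfolding pairing_velocity X_def by (simp add: power2_norm_eq_inner)
    \<comment> \<open>From X \<le> J/2 + X/2.\<close>
    ultimately have XJ: "X \<le> J" by linarith
    have X: "X = (LINT t|lebesgue_on {0<..<T}. indicator I t * A t)"
      unfolding X_def using fubini_lebesgue_on(3)[OF ib[OF iv] sl] by (simp add: A_def)
    have J: "J = (LINT t|lebesgue_on {0<..<T}. indicator I t * K)"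
      unfolding J_def using fubini_lebesgue_on(3)[OF i1 sl] slab_props(7) by (simp add: K_def measure_restrict_space mult.commute)
    have ibt: "integrable (lebesgue_on {0<..<T}) (\<lambda>t. indicator I t * h t)" if h: "integrable (lebesgue_on {0<..<T}) h" for h :: "real \<Rightarrow> real"
    proof (rule Bochner_Integration.integrable_bound[OF h])
      show "(\<lambda>t. indicator I t * h t) \<in> borel_measurable (lebesgue_on {0<..<T})"
        using borel_measurable_lebesgue_on_borel[OF borel_measurable_indicator[OF I]] borel_measurable_integrable[OF h]
        by (rule borel_measurable_times)
    qed (auto simp: indicator_def)
    interpret finite_measure "lebesgue_on {0<..<T}" by (rule finite_measure_lebesgue_on[OF slab_props(8)])
    have "(LINT t|lebesgue_on {0<..<T}. indicator I t * (A t - K)) = (LINT t|lebesgue_on {0<..<T}. indicator I t * A t) - (LINT t|lebesgue_on {0<..<T}. indicator I t * K)"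
      unfolding right_diff_distrib by (intro Bochner_Integration.integral_diff ibt iA) simp
    then show ?thesis using XJ X J by linarith
  qed
  obtain h where h: "h \<in> borel_measurable borel" "AE t in lborel. indicator {0<..<T} t *\<^sub>R A t = h t"
    using lebesgue_on_ex_borel[OF borel_measurable_integrable[OF iA]] by auto
  have "AE t in lborel. t \<in> {0<..<T} \<longrightarrow> A t = h t" using h(2) by eventually_elim (auto simp: indicator_def)
  moreover have "{0<..<T} \<in> sets lebesgue" by simp
  ultimately have hA: "AE t in lebesgue_on {0<..<T}. A t = h t" using AE_lebesgue_on_iff by blast
  \<comment> \<open>On the set of times where the bound would fail the integrand is nonnegative,
    while its integral is at most 0.\<close>
  have I: "{t. h t > K} \<in> sets borel" using h(1) by measurable
  interpret ft: finite_measure "lebesgue_on {0<..<T}" by (rule finite_measure_lebesgue_on[OF slab_props(8)])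
  have ii: "integrable (lebesgue_on {0<..<T}) (\<lambda>t. indicator {t. h t > K} t * (A t - K))"
  proof (rule Bochner_Integration.integrable_bound)
    show i0: "integrable (lebesgue_on {0<..<T}) (\<lambda>t. A t - K)" using iA by simp
    show "(\<lambda>t. indicator {t. h t > K} t * (A t - K)) \<in> borel_measurable (lebesgue_on {0<..<T})"
      using borel_measurable_lebesgue_on_borel[OF borel_measurable_indicator[OF I]] borel_measurable_integrable[OF i0]
      by (rule borel_measurable_times)
  qed (auto simp: indicator_def)
  have nn: "AE t in lebesgue_on {0<..<T}. 0 \<le> indicator {t. h t > K} t * (A t - K)"
    using hA by eventually_elim (auto simp: indicator_def)
  have "(LINT t|lebesgue_on {0<..<T}. indicator {t. h t > K} t * (A t - K)) = 0"
    using bound[OF I] integral_nonneg_AE[OF nn] by linarith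
  then have "AE t in lebesgue_on {0<..<T}. indicator {t. h t > K} t * (A t - K) = 0"
    using integral_nonneg_eq_0_iff_AE[OF ii nn] by blast
  then have AK: "AE t in lebesgue_on {0<..<T}. A t \<le> K"
    using hA by eventually_elim (auto simp: indicator_def split: if_splits)
  have sqi: "AE t in lebesgue_on {0<..<T}. square_integrable unit_square (\<lambda>x. v (x, t))"
    using fubini_lebesgue_on(1)[OF iv sl] measurable_lebesgue_on_slice[OF vec_component_measurable[OF vm, of 1] sl]
      measurable_lebesgue_on_slice[OF vec_component_measurable[OF vm, of 2] sl]
  proof eventually_elim
    case (elim t)
    then show ?case using real2_measurableI[OF elim(2,3)] by (simp add: square_integrable_def)
  qed
  have "AE t in lebesgue_on {0<..<T}. square_integrable unit_square (\<lambda>x. v (x, t)) \<and> (LINT x|lebesgue_on unit_square. (norm (v (x, t)))\<^sup>2) \<le> K"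
    using AK sqi by eventually_elim (simp add: A_def)
  then show ?thesis unfolding Linf_L2_def using vm by blast
qed

lemma weak_solution: "weak_solution unit_square T \<rho>\<^sub>0 \<rho> v"
  unfolding weak_solution_def
proof (intro conjI ballI)
  have "AE z in D. norm (\<rho> z) \<le> 1" using abs_density by eventually_elim simp
  then show "ess_bounded (slab T) \<rho>" using sq'(1) unfolding ess_bounded_def square_integrable_def by blast
  show "Linf_L2 unit_square T v" by (rule velocity_Linf_L2)
  fix \<phi> :: "(real^2) \<times> real \<Rightarrow> real" assume \<phi>: "\<phi> \<in> test_functions (UNIV \<times> {..<T})"
  show "(LINT z|D. \<rho> z * (time_deriv \<phi> z + v z \<bullet> space_gradient \<phi> z)) + (LINT x|lebesgue_on unit_square. \<rho>\<^sub>0 x * \<phi> (x, 0)) = 0"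
    by (rule transport_equation[OF \<phi>])
  show "(LINT z|D. v z \<bullet> space_gradient \<phi> z) = 0"
    by (rule divergence_equation) (use \<phi> in \<open>simp add: test_functions_def\<close>)
qed (rule curl_equation)

end

section \<open>The residual set\<close>

theorem theorem4p2:
  fixes \<Omega> :: "(real^2) set" and T :: real and \<rho>\<^sub>0 :: "real^2 \<Rightarrow> real"
    and \<rho>' :: "(real^2) \<times> real \<Rightarrow> real" and v' m' :: "(real^2) \<times> real \<Rightarrow> real^2"
    and U :: "((real^2) \<times> real) set"
  assumes "\<Omega> = {x. -1 < x $ 1 \<and> x $ 1 < 1 \<and> -1 < x $ 2 \<and> x $ 2 < 1}"
    and "T > 0"
    and "\<And>x. x \<in> \<Omega> \<Longrightarrow> x $ 2 > 0 \<Longrightarrow> \<rho>\<^sub>0 x = 1"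
    and "\<And>x. x \<in> \<Omega> \<Longrightarrow> x $ 2 < 0 \<Longrightarrow> \<rho>\<^sub>0 x = -1"
    and "admissible_subsolution \<Omega> T \<rho>\<^sub>0 \<rho>' v' m'"
    and "mixing_zone \<Omega> T \<rho>' v' m' U"
  shows "\<exists>R. residual_in (subsolution_space \<Omega> T \<rho>\<^sub>0 \<rho>' v' m' U) R \<and>
    (\<forall>q\<in>R. \<forall>\<rho> v m. (\<lambda>z. (\<rho> z, v z, m z)) \<in> q \<longrightarrow>
       weak_solution \<Omega> T \<rho>\<^sub>0 \<rho> v \<and>
       (AE z in lebesgue_on (\<Omega> \<times> {0<..<T}). \<bar>\<rho> z\<bar> = 1))"
proof -
  have \<Omega>: "\<Omega> = unit_square" using assms(1) by (simp add: unit_square_def)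
  have mz: "mixing_zone unit_square T \<rho>' v' m' U" using assms(6) \<Omega> by simp
  have hull: "AE z in lebesgue_on (slab T). hull_gap (\<rho>' z) (v' z) (m' z) \<le> (1 - (\<rho>' z)\<^sup>2) / 2"
    using assms(5) \<Omega> by (simp add: admissible_subsolution_def)
  define X where "X = subsolution_space unit_square T \<rho>\<^sub>0 \<rho>' v' m' U"
  define X0 where "X0 = subsolution_space_0 unit_square T \<rho>\<^sub>0 \<rho>' v' m' U"
  define L where "L = measure lebesgue (slab T)"
  have Xeq: "X = subtopology (weak_L2 (slab T)) (weak_L2 (slab T) closure_of X0)" by (simp add: X_def X0_def subsolution_space_def)
  have topX: "topspace X = weak_L2 (slab T) closure_of X0"
    unfolding Xeq by (simp add: closure_of_subset_topspace inf.absorb2)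
  have X0top: "X0 \<subseteq> topspace (weak_L2 (slab T))"
    unfolding X0_def subsolution_space_0_eq topspace_weak_L2 using strict_subsolution_square_integrable by blast
  \<comment> \<open>Strict lower bounds on a convex functional cut out weakly open sets; together
    they force the integral of \<rho>^2 up to L.\<close>
  define G where "G k = topspace X \<inter> L2_class (slab T) ` {f :: _ \<Rightarrow> real \<times> (real^2) \<times> (real^2). square_integrable (slab T) f \<and>
      (LINT z|lebesgue_on (slab T). (fst (f z))\<^sup>2) > L - 1 / real (Suc k)}" for k
  have Gopen: "openin X (G k)" for k
  proof -
    have "openin X (L2_class (slab T) ` {f :: _ \<Rightarrow> real \<times> (real^2) \<times> (real^2). square_integrable (slab T) f \<and>
      (LINT z|lebesgue_on (slab T). (fst (f z))\<^sup>2) > L - 1 / real (Suc k)} \<inter> weak_L2 (slab T) closure_of X0)"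
      unfolding Xeq using openin_large_density by (rule openin_subtopology_Int)
    then show ?thesis unfolding G_def topX by (simp add: Int_commute)
  qed
  have Gdense: "X closure_of (G k) = topspace X" for k
    unfolding dense_intersects_open
  proof (intro allI impI)
    fix V assume V: "openin X V \<and> V \<noteq> {}"
    then obtain W where W: "openin (weak_L2 (slab T)) W" "V = W \<inter> weak_L2 (slab T) closure_of X0"
      unfolding Xeq openin_subtopology by blast
    \<comment> \<open>An open set that meets the closure meets \<open>X0\<close> itself, where an
      actual subsolution can be perturbed.\<close>
    obtain y where "y \<in> W" "y \<in> weak_L2 (slab T) closure_of X0" using V W(2) by blast
    then obtain p where p: "p \<in> X0" "p \<in> W" using W(1) unfolding in_closure_of by blast
    then obtain r w n where q: "strict_subsolution T \<rho>\<^sub>0 \<rho>' v' m' U r w n" "p = L2_class (slab T) (\<lambda>z. (r z, w z, n z))"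
      unfolding X0_def subsolution_space_0_eq by blast
    note qs = strict_subsolution_square_integrable[OF q(1)]
    obtain gs e where gs: "finite gs" "\<forall>g\<in>gs. square_integrable (slab T) g" "e > 0" and
      nb: "\<forall>h. square_integrable (slab T) h \<longrightarrow> (\<forall>g\<in>gs. \<bar>(LINT z|lebesgue_on (slab T). h z \<bullet> g z) - (LINT z|lebesgue_on (slab T). (r z, w z, n z) \<bullet> g z)\<bar> < e)
         \<longrightarrow> L2_class (slab T) h \<in> W"
      using weak_L2_neighbourhood[OF W(1) qs] p(2) q(2) by blast
    obtain r2 w2 n2 where q2: "strict_subsolution T \<rho>\<^sub>0 \<rho>' v' m' U r2 w2 n2"
      "\<forall>g\<in>gs. \<bar>pairing T g r2 w2 n2 - pairing T g r w n\<bar> < e" "deficit T r2 < 1 / real (Suc k)"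
      using small_deficit_dense[OF q(1) mz gs(1) _ gs(3), of "1 / real (Suc k)"] gs(2) by auto
    note qs2 = strict_subsolution_square_integrable[OF q2(1)]
    define p2 where "p2 = L2_class (slab T) (\<lambda>z. (r2 z, w2 z, n2 z))"
    have "p2 \<in> W" unfolding p2_def using nb qs2 q2(2) unfolding pairing_def by blast
    moreover have "p2 \<in> X0" unfolding p2_def X0_def subsolution_space_0_eq using q2(1) by blast
    then have clo: "p2 \<in> weak_L2 (slab T) closure_of X0" using closure_of_subset[OF X0top] by blast
    moreover have "p2 \<in> G k"
    proof -
      have i: "integrable (lebesgue_on (slab T)) (\<lambda>z. (r2 z)\<^sup>2)" using qs2 by (simp add: square_integrable_triple square_integrable_def)
      interpret finite_measure "lebesgue_on (slab T)" by (rule finite_measure_lebesgue_on[OF slab_props(3)])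
      have "deficit T r2 = (LINT z|lebesgue_on (slab T). 1) - (LINT z|lebesgue_on (slab T). (r2 z)\<^sup>2)"
        unfolding deficit_def using i by (intro Bochner_Integration.integral_diff) simp_all
      then have "(LINT z|lebesgue_on (slab T). (r2 z)\<^sup>2) > L - 1 / real (Suc k)"
        using q2(3) slab_props(4) by (simp add: L_def measure_restrict_space)
      then have "(\<lambda>z. (r2 z, w2 z, n2 z)) \<in> {f. square_integrable (slab T) f \<and> (LINT z|lebesgue_on (slab T). (fst (f z))\<^sup>2) > L - 1 / real (Suc k)}"
        using qs2 by simp
      then show ?thesis unfolding G_def topX p2_def[symmetric] using clo unfolding p2_def by blast
    qed
    ultimately show "G k \<inter> V \<noteq> {}" using W(2) by blast
  qed
  define R where "R = topspace X \<inter> \<Inter> (range G)"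
  have "residual_in X R"
    unfolding residual_in_def
  proof (intro conjI exI[of _ "range G"] ballI)
    fix H assume "H \<in> range G"
    then show "openin X H" "X closure_of H = topspace X" using Gopen Gdense by auto
  qed (auto simp: R_def)
  moreover have "weak_solution unit_square T \<rho>\<^sub>0 \<rho> v \<and> (AE z in lebesgue_on (slab T). \<bar>\<rho> z\<bar> = 1)"
    if q: "q \<in> R" and mem: "(\<lambda>z. (\<rho> z, v z, m z)) \<in> q" for q \<rho> v m
  proof -
    have qX: "q \<in> topspace X" using q by (simp add: R_def)
    from subsetD[OF closure_of_subset_topspace this[unfolded topX]] have "q \<in> topspace (weak_L2 (slab T))" .
    then obtain f where f: "square_integrable (slab T) f" "q = L2_class (slab T) f" unfolding topspace_weak_L2 by blast
    have t: "square_integrable (slab T) (\<lambda>z. (\<rho> z, v z, m z))" "AE z in lebesgue_on (slab T). f z = (\<rho> z, v z, m z)"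
      using mem unfolding f(2) L2_class_mem by simp_all
    have qeq: "q = L2_class (slab T) (\<lambda>z. (\<rho> z, v z, m z))" unfolding f(2) by (rule L2_class_eqI[OF f(1) t])
    have t1: "square_integrable (slab T) \<rho>" using t(1) by (simp add: square_integrable_triple)
    \<comment> \<open>The representative that witnesses membership in \<open>G k\<close> may differ
      from the given triple; the integral of the squared density does not.\<close>
    have big: "(LINT z|lebesgue_on (slab T). (\<rho> z)\<^sup>2) > L - 1 / real (Suc k)" for k
    proof -
      have "q \<in> G k" using q by (simp add: R_def)
      then obtain h :: "_ \<Rightarrow> real \<times> (real^2) \<times> (real^2)" where h: "square_integrable (slab T) h" "L2_class (slab T) h = q"
        "(LINT z|lebesgue_on (slab T). (fst (h z))\<^sup>2) > L - 1 / real (Suc k)"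
        unfolding G_def by blast
      have "AE z in lebesgue_on (slab T). h z = (\<rho> z, v z, m z)" by (rule L2_class_eqD(2)[OF _ t(1)]) (use h(2) qeq in simp)
      moreover have "square_integrable (slab T) (\<lambda>z. fst (h z))"
        using h(1) square_integrable_triple[of "slab T" "\<lambda>z. fst (h z)" "\<lambda>z. fst (snd (h z))" "\<lambda>z. snd (snd (h z))"] by simp
      ultimately have "(LINT z|lebesgue_on (slab T). (fst (h z))\<^sup>2) = (LINT z|lebesgue_on (slab T). (\<rho> z)\<^sup>2)"
        using t1 by (intro integral_cong_AE) (auto simp: square_integrable_def elim: eventually_mono)
      then show ?thesis using h(3) by simp
    qed
    have "L \<le> (LINT z|lebesgue_on (slab T). (\<rho> z)\<^sup>2)"
    proof (rule field_le_epsilon)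
      fix e :: real assume "e > 0"
      then obtain k where "1 / real (Suc k) < e" using nat_approx_posE by blast
      then show "L \<le> (LINT z|lebesgue_on (slab T). (\<rho> z)\<^sup>2) + e" using big[of k] by linarith
    qed
    then interpret limit_subsolution T \<rho>\<^sub>0 \<rho>' v' m' U \<rho> v m
      using mz hull t(1) qX qeq by unfold_locales (simp_all add: X_def L_def)
    show ?thesis using weak_solution abs_density by blast
  qed
  ultimately show ?thesis unfolding \<Omega> X_def by blast
qed

end
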